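(* Let $\Omega\subset\mathbf{R}^d$ be open. For all $i,j\in\{1,\ldots,d\}$ let $a_{ij}\in L_\infty(\Omega)$ (complex valued). Let $\theta\in[0,\frac\pi2)$ and suppose $\sum_{i,j=1}^d a_{ij}(x)\,\xi_i\,\overline{\xi_j}\in\Sigma_\theta$ for all $\xi\in\mathbf{C}^d$ and a.e. $x\in\Omega$. Define the form $a$ with form domain $D(a)=H^1(\Omega)$ by $$a(u,v)=\sum_{i,j=1}^d\int_{\Omega}(\partial_iu)\,a_{ij}\,\overline{\partial_jv}.$$ Then: (a) $\overline{a_r}(u,v)=0$ for all $u,v\in D(\overline{a_r})$ with compact support such that $v$ is constant on a neighbourhood of the support of $u$. (b) If $S$ is the semigroup associated with $a$, then $(S_tu,\mathbf 1)=(u,\mathbf 1)$ for all $t>0$ and $u\in L_{2,c}(\Omega)$.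
   Context: $\Sigma_\theta=\{re^{i\alpha}:r\ge0,\ |\alpha|\le\theta\}$. $L_{2,c}(\Omega)=\{u\in L_2(\Omega):\operatorname{supp}u\text{ is compact}\}$; $\mathbf 1$ is the constant function one and $(w,\mathbf 1)=\int_\Omega w$ for $w\in L_1(\Omega)$ (for $u\in L_{2,c}(\Omega)$ the function $S_tu$ belongs to $L_1(\Omega)$). The form $a$ is densely defined and sectorial in $L_2(\Omega)$ with vertex $0$ (possibly not closable). The operator $A$ associated with $a$ is the well-defined $m$-sectorial operator in $L_2(\Omega)$ such that $x\in D(A)$ and $Ax=f$ if and only if there exist $u_1,u_2,\ldots\in D(a)$ with $(\operatorname{Re}a(u_n,u_n))_n$ bounded, $u_n\to x$ in $L_2(\Omega)$ and $a(u_n,v)\to(f,v)_{L_2(\Omega)}$ for all $v\in D(a)$. The semigroup $S$ associated with $a$ is the (holomorphic) $C_0$-semigroup generated by $-A$. The relaxed form $\overline{a_r}$ of $a$ is the closed sectorial form in $L_2(\Omega)$ classically (in Kato's sense) associated with $A$; it is the closure of the regular part $a_r$, the unique closable sectorial form with domain $D(a)$ such that $A$ is associated with its closure. *)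

theory Defs
  imports "HOL-Analysis.Analysis"
begin

text \<open>
  Elements of \<open>L\<^sub>2(M)\<close> are represented by square-integrable functions; equality in
  \<open>L\<^sub>2(M)\<close> is equality almost everywhere. Domains of forms, graphs of operators and
  semigroups are therefore required to be compatible with equality almost everywhere.
  For \<open>M = lebesgue_on \<Omega>\<close> the values of a representative outside \<open>\<Omega>\<close> are irrelevant.
\<close>

definition L2 :: "'a measure \<Rightarrow> ('a \<Rightarrow> complex) set" where
  "L2 M = {u. u \<in> borel_measurable M \<and> integrable M (\<lambda>x. (cmod (u x))\<^sup>2)}"

definition l2_inner :: "'a measure \<Rightarrow> ('a \<Rightarrow> complex) \<Rightarrow> ('a \<Rightarrow> complex) \<Rightarrow> complex" where
  "l2_inner M u v = (LINT x|M. u x * cnj (v x))"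

definition l2_norm :: "'a measure \<Rightarrow> ('a \<Rightarrow> complex) \<Rightarrow> real" where
  "l2_norm M u = sqrt (LINT x|M. (cmod (u x))\<^sup>2)"

definition l2_tendsto ::
  "'a measure \<Rightarrow> ('b \<Rightarrow> 'a \<Rightarrow> complex) \<Rightarrow> ('a \<Rightarrow> complex) \<Rightarrow> 'b filter \<Rightarrow> bool" where
  "l2_tendsto M u x F \<longleftrightarrow> ((\<lambda>n. l2_norm M (\<lambda>\<omega>. u n \<omega> - x \<omega>)) \<longlongrightarrow> 0) F"

definition sector :: "real \<Rightarrow> complex set" where
  "sector \<theta> = {complex_of_real r * cis \<alpha> |r \<alpha>. r \<ge> 0 \<and> \<bar>\<alpha>\<bar> \<le> \<theta>}"


subsection \<open>Sesquilinear forms in \<open>L\<^sub>2\<close>\<close>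

type_synonym 'a form = "('a \<Rightarrow> complex) \<Rightarrow> ('a \<Rightarrow> complex) \<Rightarrow> complex"

definition sesquilinear_form :: "'a measure \<Rightarrow> ('a \<Rightarrow> complex) set \<Rightarrow> 'a form \<Rightarrow> bool" where
  "sesquilinear_form M D b \<longleftrightarrow>
     D \<subseteq> L2 M \<and> (\<lambda>x. 0) \<in> D \<and>
     (\<forall>u\<in>D. \<forall>v\<in>D. \<forall>\<alpha> \<beta>. (\<lambda>x. \<alpha> * u x + \<beta> * v x) \<in> D) \<and>
     (\<forall>u\<in>D. \<forall>v\<in>D. \<forall>w\<in>D. \<forall>\<alpha> \<beta>.
        b (\<lambda>x. \<alpha> * u x + \<beta> * v x) w = \<alpha> * b u w + \<beta> * b v w \<and>
        b w (\<lambda>x. \<alpha> * u x + \<beta> * v x) = cnj \<alpha> * b w u + cnj \<beta> * b w v) \<and>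
     (\<forall>u\<in>D. \<forall>v\<in>L2 M. (AE x in M. u x = v x) \<longrightarrow>
        v \<in> D \<and> (\<forall>w\<in>D. b u w = b v w \<and> b w u = b w v))"

definition densely_defined :: "'a measure \<Rightarrow> ('a \<Rightarrow> complex) set \<Rightarrow> bool" where
  "densely_defined M D \<longleftrightarrow>
     (\<forall>u\<in>L2 M. \<forall>\<epsilon>>0. \<exists>v\<in>D. l2_norm M (\<lambda>x. u x - v x) < \<epsilon>)"

definition sectorial_form :: "'a measure \<Rightarrow> ('a \<Rightarrow> complex) set \<Rightarrow> 'a form \<Rightarrow> bool" where
  "sectorial_form M D b \<longleftrightarrow>
     sesquilinear_form M D b \<and>
     (\<exists>\<gamma> \<theta>. 0 \<le> \<theta> \<and> \<theta> < pi / 2 \<and>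
        (\<forall>u\<in>D. b u u - complex_of_real (\<gamma> * (l2_norm M u)\<^sup>2) \<in> sector \<theta>))"

text \<open>Closedness in Kato's sense; the condition does not depend on the vertex.\<close>

definition closed_form :: "'a measure \<Rightarrow> ('a \<Rightarrow> complex) set \<Rightarrow> 'a form \<Rightarrow> bool" where
  "closed_form M D b \<longleftrightarrow>
     (\<forall>u. \<forall>x\<in>L2 M.
        (\<forall>n::nat. u n \<in> D) \<and> l2_tendsto M u x sequentially \<and>
        ((\<lambda>(n, m). b (\<lambda>\<omega>. u n \<omega> - u m \<omega>) (\<lambda>\<omega>. u n \<omega> - u m \<omega>)) \<longlongrightarrow> 0)
          (sequentially \<times>\<^sub>F sequentially)
        \<longrightarrow> x \<in> D \<and> (\<lambda>n. b (\<lambda>\<omega>. u n \<omega> - x \<omega>) (\<lambda>\<omega>. u n \<omega> - x \<omega>)) \<longlonglongrightarrow> 0)"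


subsection \<open>Associated operators, the relaxed form and the associated semigroup\<close>

text \<open>Operators are given by their graphs. The first one is the operator associated with a
  densely defined sectorial form of vertex \<open>0\<close> which need not be closable, the second one
  is the operator classically associated with a closed sectorial form.\<close>

definition form_operator ::
  "'a measure \<Rightarrow> ('a \<Rightarrow> complex) set \<Rightarrow> 'a form \<Rightarrow> (('a \<Rightarrow> complex) \<times> ('a \<Rightarrow> complex)) set" where
  "form_operator M D a =
     {(x, f). x \<in> L2 M \<and> f \<in> L2 M \<and>
        (\<exists>u. (\<forall>n::nat. u n \<in> D) \<and> bounded (range (\<lambda>n. Re (a (u n) (u n)))) \<and>
             l2_tendsto M u x sequentially \<and>
             (\<forall>v\<in>D. (\<lambda>n. a (u n) v) \<longlonglongrightarrow> l2_inner M f v))}"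

definition closed_form_operator ::
  "'a measure \<Rightarrow> ('a \<Rightarrow> complex) set \<Rightarrow> 'a form \<Rightarrow> (('a \<Rightarrow> complex) \<times> ('a \<Rightarrow> complex)) set" where
  "closed_form_operator M D b =
     {(x, f). x \<in> D \<and> f \<in> L2 M \<and> (\<forall>v\<in>D. b x v = l2_inner M f v)}"

text \<open>\<open>b\<close> with domain \<open>Db\<close> is the relaxed form of \<open>a\<close> with domain \<open>D\<close>. By Kato's representation
  theorems an m-sectorial operator determines such a form uniquely.\<close>

definition relaxed_form ::
  "'a measure \<Rightarrow> ('a \<Rightarrow> complex) set \<Rightarrow> 'a form \<Rightarrow> ('a \<Rightarrow> complex) set \<Rightarrow> 'a form \<Rightarrow> bool" where
  "relaxed_form M D a Db b \<longleftrightarrow>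
     sectorial_form M Db b \<and> densely_defined M Db \<and> closed_form M Db b \<and>
     closed_form_operator M Db b = form_operator M D a"

definition C0_semigroup ::
  "'a measure \<Rightarrow> (real \<Rightarrow> ('a \<Rightarrow> complex) \<Rightarrow> ('a \<Rightarrow> complex)) \<Rightarrow> bool" where
  "C0_semigroup M S \<longleftrightarrow>
     (\<forall>t\<ge>0. \<forall>u\<in>L2 M. S t u \<in> L2 M) \<and>
     (\<forall>t\<ge>0. \<forall>u\<in>L2 M. \<forall>v\<in>L2 M. (AE x in M. u x = v x) \<longrightarrow> (AE x in M. S t u x = S t v x)) \<and>
     (\<forall>t\<ge>0. \<forall>u\<in>L2 M. \<forall>v\<in>L2 M. \<forall>\<alpha> \<beta>.
        AE x in M. S t (\<lambda>y. \<alpha> * u y + \<beta> * v y) x = \<alpha> * S t u x + \<beta> * S t v x) \<and>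
     (\<forall>t\<ge>0. \<exists>C. \<forall>u\<in>L2 M. l2_norm M (S t u) \<le> C * l2_norm M u) \<and>
     (\<forall>u\<in>L2 M. AE x in M. S 0 u x = u x) \<and>
     (\<forall>s\<ge>0. \<forall>t\<ge>0. \<forall>u\<in>L2 M. AE x in M. S (s + t) u x = S s (S t u) x) \<and>
     (\<forall>u\<in>L2 M. l2_tendsto M (\<lambda>t. S t u) u (at_right 0))"

definition semigroup_generator ::
  "'a measure \<Rightarrow> (real \<Rightarrow> ('a \<Rightarrow> complex) \<Rightarrow> ('a \<Rightarrow> complex)) \<Rightarrow>
     (('a \<Rightarrow> complex) \<times> ('a \<Rightarrow> complex)) set" where
  "semigroup_generator M S =
     {(u, f). u \<in> L2 M \<and> f \<in> L2 M \<and>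
        l2_tendsto M (\<lambda>h x. (S h u x - u x) / complex_of_real h) f (at_right 0)}"

definition associated_semigroup ::
  "'a measure \<Rightarrow> ('a \<Rightarrow> complex) set \<Rightarrow> 'a form \<Rightarrow>
     (real \<Rightarrow> ('a \<Rightarrow> complex) \<Rightarrow> ('a \<Rightarrow> complex)) \<Rightarrow> bool" where
  "associated_semigroup M D a S \<longleftrightarrow>
     C0_semigroup M S \<and>
     semigroup_generator M S = {(x, \<lambda>\<omega>. - f \<omega>) |x f. (x, f) \<in> form_operator M D a}"


subsection \<open>Sobolev space and the elliptic form\<close>

definition partial_deriv ::
  "'d::finite \<Rightarrow> (real^'d \<Rightarrow> complex) \<Rightarrow> real^'d \<Rightarrow> complex" where
  "partial_deriv i f x = frechet_derivative f (at x) (axis i 1)"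

primrec C_times :: "nat \<Rightarrow> (real^'d::finite \<Rightarrow> complex) \<Rightarrow> bool" where
  "C_times 0 f \<longleftrightarrow> continuous_on UNIV f"
| "C_times (Suc k) f \<longleftrightarrow> (\<forall>x. f differentiable (at x)) \<and> (\<forall>i. C_times k (partial_deriv i f))"

definition test_functions :: "(real^'d::finite) set \<Rightarrow> (real^'d \<Rightarrow> complex) set" where
  "test_functions \<Omega> =
     {\<phi>. (\<forall>k. C_times k \<phi>) \<and> compact (closure {x. \<phi> x \<noteq> 0}) \<and> closure {x. \<phi> x \<noteq> 0} \<subseteq> \<Omega>}"

definition is_weak_partial ::
  "(real^'d::finite) set \<Rightarrow> 'd \<Rightarrow> (real^'d \<Rightarrow> complex) \<Rightarrow> (real^'d \<Rightarrow> complex) \<Rightarrow> bool" where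
  "is_weak_partial \<Omega> i u g \<longleftrightarrow>
     (\<forall>\<phi>\<in>test_functions \<Omega>.
        (LINT x|lebesgue_on \<Omega>. u x * partial_deriv i \<phi> x) =
        - (LINT x|lebesgue_on \<Omega>. g x * \<phi> x))"

definition H1 :: "(real^'d::finite) set \<Rightarrow> (real^'d \<Rightarrow> complex) set" where
  "H1 \<Omega> =
     {u \<in> L2 (lebesgue_on \<Omega>). \<forall>i. \<exists>g\<in>L2 (lebesgue_on \<Omega>). is_weak_partial \<Omega> i u g}"

text \<open>The weak derivative is unique up to equality almost everywhere, so the choice of the
  representative does not affect the integrals in \<open>elliptic_form\<close>.\<close>

definition weak_partial ::
  "(real^'d::finite) set \<Rightarrow> 'd \<Rightarrow> (real^'d \<Rightarrow> complex) \<Rightarrow> real^'d \<Rightarrow> complex" where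
  "weak_partial \<Omega> i u = (SOME g. g \<in> L2 (lebesgue_on \<Omega>) \<and> is_weak_partial \<Omega> i u g)"

definition L_infty :: "'a measure \<Rightarrow> ('a \<Rightarrow> complex) set" where
  "L_infty M = {f. f \<in> borel_measurable M \<and> (\<exists>C. AE x in M. cmod (f x) \<le> C)}"

definition elliptic_form ::
  "(real^'d::finite) set \<Rightarrow> ('d \<Rightarrow> 'd \<Rightarrow> real^'d \<Rightarrow> complex) \<Rightarrow> (real^'d) form" where
  "elliptic_form \<Omega> a u v =
     (\<Sum>i\<in>UNIV. \<Sum>j\<in>UNIV.
        LINT x|lebesgue_on \<Omega>. weak_partial \<Omega> i u x * a i j x * cnj (weak_partial \<Omega> j v x))"


subsection \<open>Supports\<close>

text \<open>The support of an element of \<open>L\<^sub>2(\<Omega>)\<close> is taken relative to \<open>\<Omega>\<close>: it is the complement in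
  \<open>\<Omega>\<close> of the largest open subset of \<open>\<Omega>\<close> on which the function vanishes almost everywhere.\<close>

definition ess_support :: "(real^'d::finite) set \<Rightarrow> (real^'d \<Rightarrow> complex) \<Rightarrow> (real^'d) set" where
  "ess_support \<Omega> u =
     {x \<in> \<Omega>. \<forall>U. open U \<and> x \<in> U \<longrightarrow> \<not> (AE y in lebesgue_on (\<Omega> \<inter> U). u y = 0)}"

definition L2c :: "(real^'d::finite) set \<Rightarrow> (real^'d \<Rightarrow> complex) set" where
  "L2c \<Omega> = {u \<in> L2 (lebesgue_on \<Omega>). compact (ess_support \<Omega> u)}"

definition constant_near ::
  "(real^'d::finite) set \<Rightarrow> (real^'d \<Rightarrow> complex) \<Rightarrow> (real^'d) set \<Rightarrow> bool" where
  "constant_near \<Omega> v K \<longleftrightarrow>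
     (\<exists>U c. open U \<and> K \<subseteq> U \<and> (AE x in lebesgue_on (\<Omega> \<inter> U). v x = c))"

end

theory Submission
  imports Defs "HOL-Analysis.Analysis" "HOL-Computational_Algebra.Polynomial"
begin

text \<open>
  Everything is read off from the approximating sequences in \<open>H\<^sup>1(\<Omega>)\<close>, since the coefficients may
  degenerate and \<open>a\<close> need not be closable. Approximate solutions of the resolvent equation exist by a
  Lax--Milgram argument in the incomplete form domain, and they represent the relaxed form as
  \<open>b(u, v) = lim a(u\<^sub>n, v\<^sub>n)\<close>.

  For (a), multiplication by a smooth cutoff is bounded in the form seminorm up to an \<open>L\<^sub>2\<close> term.
  Hence \<open>v\<^sub>n\<close> may be replaced by functions which are constant near the support of \<open>u\<close>, while a
  Caccioppoli type estimate shows that the energy of \<open>u\<^sub>n\<close> away from this support tends to \<open>0\<close>.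

  For (b), put \<open>\<phi>(x) = (1 + \<delta>\<^sup>2 \<bar>x\<bar>\<^sup>2)\<^sup>-\<^sup>d\<close>. The total mass changes at the rate \<open>a(S\<^sub>t u, \<phi>)\<close> when tested
  against \<open>\<phi>\<close>, and \<open>\<bar>\<nabla>\<phi>\<bar> \<le> d \<delta> \<phi>\<close>. A polynomially weighted energy estimate for \<open>S\<^sub>t u\<close>, uniform in
  \<open>\<delta>\<close> because \<open>u\<close> has compact support, bounds the change by a multiple of \<open>\<delta>\<close>; now let \<open>\<delta> \<rightarrow> 0\<close>.
\<close>

section \<open>Square integrable functions\<close>

text \<open>An element of \<open>Db\<close> need not have a weak gradient, so no energy estimate can
  be stated for it directly. Estimates are made for H1 functions and passed to the limit, and the
  residuals of approximate solutions are measured in the dual of the form norm: such residuals are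
  small uniformly on test sequences of bounded energy, which may therefore vary with n. In (b) the
  constant 1 need not be square integrable, hence the decaying family \<phi>. Its exponent comes
  from the factorisation \<phi> = sqrt \<sigma> * \<omega> with \<omega> = (1 + |x|^2)^(-d), which
  is square integrable, and \<sigma> = ((1 + |x|^2) / (1 + \<delta>^2 |x|^2))^(2d). For \<delta> > 0
  the weight \<sigma> is bounded, so multiplication by it preserves H1; and |D_i \<sigma>| \<le> 4 d
  \<sigma> for every \<delta> \<le> 1, which keeps the Caccioppoli and Gronwall constants
  independent of \<delta>. The semigroup is known only through the C0 axioms. A uniform bound for
  small times has to be proved by a Banach-Steinhaus argument, and all time derivatives are
  one-sided.\<close>

lemma L2_measurable: "u \<in> L2 M \<Longrightarrow> u \<in> borel_measurable M"
  by (simp add: L2_def)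

lemma L2_square_integrable: "u \<in> L2 M \<Longrightarrow> integrable M (\<lambda>x. (cmod (u x))\<^sup>2)"
  by (simp add: L2_def)

lemma cmod_mult_le_squares: "cmod (z * w) \<le> (cmod z)\<^sup>2 + (cmod w)\<^sup>2"
proof -
  have "2 * (cmod z * cmod w) \<le> (cmod z)\<^sup>2 + (cmod w)\<^sup>2"
    using sum_squares_bound[of "cmod z" "cmod w"] by (simp add: mult.assoc)
  moreover have "0 \<le> cmod z * cmod w" by simp
  ultimately show ?thesis by (simp only: norm_mult)
qed

lemma L2_mult_integrable:
  assumes "u \<in> L2 M" "v \<in> L2 M"
  shows "integrable M (\<lambda>x. u x * v x)"
proof (rule Bochner_Integration.integrable_bound)
  show "integrable M (\<lambda>x. (cmod (u x))\<^sup>2 + (cmod (v x))\<^sup>2)"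
    using assms by (simp add: L2_def)
  show "(\<lambda>x. u x * v x) \<in> borel_measurable M"
    using assms by (intro borel_measurable_times L2_measurable)
  show "AE x in M. norm (u x * v x) \<le> norm ((cmod (u x))\<^sup>2 + (cmod (v x))\<^sup>2)"
    using cmod_mult_le_squares[of "u _" "v _"] by (intro AE_I2) auto
qed

lemma borel_measurable_cnj [measurable (raw)]:
  "f \<in> borel_measurable M \<Longrightarrow> (\<lambda>x. cnj (f x)) \<in> borel_measurable M"
  by (rule borel_measurable_continuous_on[OF _]) (auto intro!: continuous_intros)

lemma L2_cnj: "u \<in> L2 M \<Longrightarrow> (\<lambda>x. cnj (u x)) \<in> L2 M"
  by (simp add: L2_def borel_measurable_cnj)

lemma L2_inner_integrable:
  "u \<in> L2 M \<Longrightarrow> v \<in> L2 M \<Longrightarrow> integrable M (\<lambda>x. u x * cnj (v x))"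
  by (rule L2_mult_integrable[OF _ L2_cnj])

lemma L2_mult_bounded:
  assumes "u \<in> L2 M" "f \<in> borel_measurable M" "AE x in M. cmod (f x) \<le> B"
  shows "(\<lambda>x. f x * u x) \<in> L2 M"
  unfolding L2_def
proof (intro CollectI conjI)
  show "(\<lambda>x. f x * u x) \<in> borel_measurable M"
    using assms by (intro borel_measurable_times) (auto simp: L2_def)
  show "integrable M (\<lambda>x. (cmod (f x * u x))\<^sup>2)"
  proof (rule Bochner_Integration.integrable_bound)
    show "integrable M (\<lambda>x. B\<^sup>2 * (cmod (u x))\<^sup>2)"
      using assms by (simp add: L2_def)
    show "(\<lambda>x. (cmod (f x * u x))\<^sup>2) \<in> borel_measurable M"
      using assms by (auto simp: L2_def)
    show "AE x in M. norm ((cmod (f x * u x))\<^sup>2) \<le> norm (B\<^sup>2 * (cmod (u x))\<^sup>2)"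
      using assms(3) by eventually_elim
        (auto simp: norm_mult power_mult_distrib intro!: mult_right_mono power_mono)
  qed
qed

lemma L2_zero: "(\<lambda>x. 0) \<in> L2 M"
  by (simp add: L2_def)

lemma L2_cmult: "u \<in> L2 M \<Longrightarrow> (\<lambda>x. c * u x) \<in> L2 M"
  by (rule L2_mult_bounded[where B="cmod c"]) auto

lemma cmod_add_sq: "(cmod (z + w))\<^sup>2 \<le> 2 * (cmod z)\<^sup>2 + 2 * (cmod w)\<^sup>2"
proof -
  have "(cmod (z + w))\<^sup>2 \<le> (cmod z + cmod w)\<^sup>2"
    by (intro power_mono norm_triangle_ineq) auto
  also have "\<dots> \<le> 2 * (cmod z)\<^sup>2 + 2 * (cmod w)\<^sup>2"
    using sum_squares_bound[of "cmod z" "cmod w"] by (simp add: power2_sum)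
  finally show ?thesis .
qed

lemma L2_add:
  assumes "u \<in> L2 M" "v \<in> L2 M"
  shows "(\<lambda>x. u x + v x) \<in> L2 M"
  unfolding L2_def
proof (intro CollectI conjI)
  show "(\<lambda>x. u x + v x) \<in> borel_measurable M"
    using assms by (intro borel_measurable_add L2_measurable)
  show "integrable M (\<lambda>x. (cmod (u x + v x))\<^sup>2)"
  proof (rule Bochner_Integration.integrable_bound)
    show "integrable M (\<lambda>x. 2 * (cmod (u x))\<^sup>2 + 2 * (cmod (v x))\<^sup>2)"
      using assms by (simp add: L2_def)
    show "(\<lambda>x. (cmod (u x + v x))\<^sup>2) \<in> borel_measurable M"
      using assms by (auto simp: L2_def)
    show "AE x in M. norm ((cmod (u x + v x))\<^sup>2) \<le> norm (2 * (cmod (u x))\<^sup>2 + 2 * (cmod (v x))\<^sup>2)"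
      using cmod_add_sq[of "u _" "v _"] by (intro AE_I2) auto
  qed
qed

lemma L2_comb:
  "u \<in> L2 M \<Longrightarrow> v \<in> L2 M \<Longrightarrow> (\<lambda>x. \<alpha> * u x + \<beta> * v x) \<in> L2 M"
  by (intro L2_add L2_cmult)

lemma L2_diff: "u \<in> L2 M \<Longrightarrow> v \<in> L2 M \<Longrightarrow> (\<lambda>x. u x - v x) \<in> L2 M"
  using L2_comb[of u M v 1 "-1"] by simp

lemma l2_norm_nonneg [simp]: "0 \<le> l2_norm M u"
  by (simp add: l2_norm_def)

lemma l2_norm_sq: "(l2_norm M u)\<^sup>2 = (LINT x|M. (cmod (u x))\<^sup>2)"
  by (simp add: l2_norm_def)

lemma l2_inner_self: "l2_inner M u u = complex_of_real ((l2_norm M u)\<^sup>2)"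
  unfolding l2_norm_sq l2_inner_def
  by (subst integral_complex_of_real[symmetric], intro Bochner_Integration.integral_cong)
     (auto simp: complex_norm_square[symmetric] simp del: of_real_power)

lemma l2_inner_cnj: "cnj (l2_inner M u v) = l2_inner M v u"
  unfolding l2_inner_def
  by (subst Bochner_Integration.integral_cnj[symmetric]) (simp add: mult.commute)

lemma l2_inner_comb_left:
  assumes "u \<in> L2 M" "v \<in> L2 M" "w \<in> L2 M"
  shows "l2_inner M (\<lambda>x. \<alpha> * u x + \<beta> * v x) w = \<alpha> * l2_inner M u w + \<beta> * l2_inner M v w"
  unfolding l2_inner_def
  using L2_inner_integrable[OF assms(1,3)] L2_inner_integrable[OF assms(2,3)]
  by (simp add: distrib_right mult.assoc)

lemma l2_inner_comb_right:
  assumes "u \<in> L2 M" "v \<in> L2 M" "w \<in> L2 M"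
  shows "l2_inner M w (\<lambda>x. \<alpha> * u x + \<beta> * v x) = cnj \<alpha> * l2_inner M w u + cnj \<beta> * l2_inner M w v"
  using arg_cong[OF l2_inner_comb_left[OF assms], of cnj] by (simp add: l2_inner_cnj)

lemma l2_inner_diff_left:
  assumes "u \<in> L2 M" "v \<in> L2 M" "w \<in> L2 M"
  shows "l2_inner M (\<lambda>x. u x - v x) w = l2_inner M u w - l2_inner M v w"
  using l2_inner_comb_left[OF assms, of 1 "-1"] by simp

lemma l2_inner_diff_right:
  assumes "u \<in> L2 M" "v \<in> L2 M" "w \<in> L2 M"
  shows "l2_inner M w (\<lambda>x. u x - v x) = l2_inner M w u - l2_inner M w v"
  using l2_inner_comb_right[OF assms, of 1 "-1"] by simp

text \<open>Minimising over the scaling parameter turns a family of Young inequalities into a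
  Cauchy-Schwarz inequality. It serves the inner product, sectorial forms, the residual in
  \<open>approx_Riesz\<close> and the energy splitting in part (a).\<close>

lemma am_gm_optimise:
  fixes X A B :: real
  assumes "0 \<le> A" "0 \<le> B" "\<And>s. 0 < s \<Longrightarrow> X \<le> s * A + B / s"
  shows "X \<le> 2 * (sqrt A * sqrt B)"
proof (rule field_le_epsilon)
  fix e :: real assume e: "0 < e"
  define a where "a = sqrt A"
  define b where "b = sqrt B"
  have ab: "0 \<le> a" "0 \<le> b" "A = a\<^sup>2" "B = b\<^sup>2"
    using assms by (auto simp: a_def b_def)
  show "X \<le> 2 * (sqrt A * sqrt B) + e"
  proof (cases "a = 0")
    case True
    \<comment> \<open>With \<open>A = 0\<close> the infimum is approached for large s; this s makes
      \<open>B / s\<close> smaller than e even if \<open>b = 0\<close>.\<close>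
    have "X \<le> ((b\<^sup>2 + 1) / e) * A + B / ((b\<^sup>2 + 1) / e)"
      by (rule assms(3)) (use e in \<open>auto intro!: divide_pos_pos add_nonneg_pos\<close>)
    also have "\<dots> = b\<^sup>2 / (b\<^sup>2 + 1) * e" using True ab by simp
    also have "\<dots> \<le> 1 * e"
      by (intro mult_right_mono) (use e in \<open>auto simp: divide_le_eq add_nonneg_pos\<close>)
    finally show ?thesis using True by (simp add: a_def)
  next
    case False
    then have a: "0 < a" using ab by simp
    \<comment> \<open>The minimiser is \<open>b / a\<close>, which vanishes for
      \<open>b = 0\<close>; the shift by \<open>e / (2 * a)\<close> keeps s positive and costs only
      \<open>e / 2\<close>.\<close>
    define s where "s = (b + e / (2 * a)) / a"
    have s: "0 < s" unfolding s_def using a e ab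
      by (intro divide_pos_pos add_nonneg_pos) auto
    have "X \<le> s * a\<^sup>2 + b\<^sup>2 / s" using assms(3)[OF s] ab by simp
    also have "s * a\<^sup>2 = a * b + e / 2" using a by (simp add: s_def power2_eq_square field_simps)
    also have "b\<^sup>2 / s \<le> a * b"
    proof -
      have "b \<le> a * s" using a e by (simp add: s_def)
      then have "b * b \<le> b * (a * s)" using ab by (intro mult_left_mono) auto
      then show ?thesis using s by (simp add: divide_le_eq power2_eq_square mult_ac)
    qed
    finally show ?thesis using e by (simp add: a_def b_def)
  qed
qed

text \<open>Integrating \<open>(s * |u| - |v|)^2 / s >= 0\<close> gives Young's inequality for every
  s, and optimising s gives Cauchy-Schwarz.\<close>

lemma l2_inner_bound:
  assumes "u \<in> L2 M" "v \<in> L2 M"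
  shows "cmod (l2_inner M u v) \<le> l2_norm M u * l2_norm M v"
proof -
  have iu: "integrable M (\<lambda>x. (cmod (u x))\<^sup>2)" and iv: "integrable M (\<lambda>x. (cmod (v x))\<^sup>2)"
    using assms by (auto simp: L2_def)
  have "2 * cmod (l2_inner M u v) \<le> s * (l2_norm M u)\<^sup>2 + (l2_norm M v)\<^sup>2 / s" if s: "0 < s" for s
  proof -
    have "2 * cmod (l2_inner M u v) \<le> 2 * (LINT x|M. cmod (u x * cnj (v x)))"
      unfolding l2_inner_def by (intro mult_left_mono integral_norm_bound) auto
    also have "\<dots> = (LINT x|M. 2 * cmod (u x * cnj (v x)))" by simp
    also have "\<dots> \<le> (LINT x|M. s * (cmod (u x))\<^sup>2 + (cmod (v x))\<^sup>2 / s)"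
    proof (rule integral_mono)
      show "integrable M (\<lambda>x. 2 * cmod (u x * cnj (v x)))"
        using L2_inner_integrable[OF assms] by (intro integrable_mult_right integrable_norm)
      show "integrable M (\<lambda>x. s * (cmod (u x))\<^sup>2 + (cmod (v x))\<^sup>2 / s)" using iu iv by simp
      fix x
      have "0 \<le> (s * cmod (u x) - cmod (v x))\<^sup>2 / s" using s by simp
      also have "\<dots> = s * (cmod (u x))\<^sup>2 + (cmod (v x))\<^sup>2 / s - 2 * cmod (u x * cnj (v x))"
        using s by (simp add: power2_diff norm_mult field_simps power2_eq_square)
      finally show "2 * cmod (u x * cnj (v x)) \<le> s * (cmod (u x))\<^sup>2 + (cmod (v x))\<^sup>2 / s" by simp
    qed
    also have "\<dots> = s * (l2_norm M u)\<^sup>2 + (l2_norm M v)\<^sup>2 / s"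
      using iu iv by (simp add: l2_norm_sq)
    finally show ?thesis .
  qed
  from am_gm_optimise[OF _ _ this] show ?thesis by simp
qed

lemma l2_norm_cmult: "l2_norm M (\<lambda>x. c * u x) = cmod c * l2_norm M u"
  unfolding l2_norm_def by (simp add: norm_mult power_mult_distrib real_sqrt_mult)

lemma l2_norm_minus_commute: "l2_norm M (\<lambda>x. u x - v x) = l2_norm M (\<lambda>x. v x - u x)"
  unfolding l2_norm_def by (simp add: norm_minus_commute)

lemma l2_norm_triangle:
  assumes "u \<in> L2 M" "v \<in> L2 M"
  shows "l2_norm M (\<lambda>x. u x + v x) \<le> l2_norm M u + l2_norm M v"
proof (rule power2_le_imp_le)
  let ?w = "\<lambda>x. u x + v x"
  have w: "?w \<in> L2 M" by (rule L2_add[OF assms])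
  have "complex_of_real ((l2_norm M ?w)\<^sup>2)
      = l2_inner M u u + l2_inner M u v + (l2_inner M v u + l2_inner M v v)"
    unfolding l2_inner_self[symmetric]
    using l2_inner_comb_left[OF assms w, of 1 1] l2_inner_comb_right[OF assms assms(1), of 1 1]
      l2_inner_comb_right[OF assms assms(2), of 1 1] by simp
  then have "(l2_norm M ?w)\<^sup>2 = Re (l2_inner M u u + l2_inner M u v + (l2_inner M v u + l2_inner M v v))"
    by (metis Re_complex_of_real)
  also have "\<dots> = (l2_norm M u)\<^sup>2 + Re (l2_inner M u v) + Re (l2_inner M v u) + (l2_norm M v)\<^sup>2"
    by (simp add: l2_inner_self)
  also have "\<dots> \<le> (l2_norm M u)\<^sup>2 + l2_norm M u * l2_norm M v + l2_norm M v * l2_norm M u + (l2_norm M v)\<^sup>2"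
    using complex_Re_le_cmod[of "l2_inner M u v"] complex_Re_le_cmod[of "l2_inner M v u"]
      l2_inner_bound[OF assms] l2_inner_bound[OF assms(2,1)] by linarith
  also have "\<dots> = (l2_norm M u + l2_norm M v)\<^sup>2" by (simp add: power2_sum)
  finally show "(l2_norm M ?w)\<^sup>2 \<le> (l2_norm M u + l2_norm M v)\<^sup>2" .
qed (simp)

lemma l2_norm_diff_triangle:
  assumes "u \<in> L2 M" "v \<in> L2 M" "w \<in> L2 M"
  shows "l2_norm M (\<lambda>x. u x - w x) \<le> l2_norm M (\<lambda>x. u x - v x) + l2_norm M (\<lambda>x. v x - w x)"
  using l2_norm_triangle[OF L2_diff[OF assms(1,2)] L2_diff[OF assms(2,3)]] by simp

lemma l2_norm_cong_AE:
  assumes "u \<in> borel_measurable M" "v \<in> borel_measurable M" "AE x in M. u x = v x"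
  shows "l2_norm M u = l2_norm M v"
  unfolding l2_norm_def
  by (intro arg_cong[where f=sqrt] integral_cong_AE)
     (use assms in \<open>auto elim!: eventually_mono\<close>)

lemma l2_norm_eq_0_iff:
  assumes "u \<in> L2 M"
  shows "l2_norm M u = 0 \<longleftrightarrow> (AE x in M. u x = 0)"
  unfolding l2_norm_def
  using integral_nonneg_eq_0_iff_AE[OF L2_square_integrable[OF assms]] by simp

lemma l2_norm_zero [simp]: "l2_norm M (\<lambda>x. 0) = 0"
  by (simp add: l2_norm_def)

lemma l2_tendsto_inner:
  assumes "l2_tendsto M u x F" "\<And>n. u n \<in> L2 M" "x \<in> L2 M" "g \<in> L2 M"
  shows "((\<lambda>n. l2_inner M g (u n)) \<longlongrightarrow> l2_inner M g x) F"
    and "((\<lambda>n. l2_inner M (u n) g) \<longlongrightarrow> l2_inner M x g) F"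
proof -
  show A: "((\<lambda>n. l2_inner M g (u n)) \<longlongrightarrow> l2_inner M g x) F"
  proof (subst tendsto_dist_iff, rule tendsto_sandwich)
    show "((\<lambda>n. 0) \<longlongrightarrow> (0::real)) F" by simp
    show "((\<lambda>n. l2_norm M g * l2_norm M (\<lambda>\<omega>. u n \<omega> - x \<omega>)) \<longlongrightarrow> 0) F"
      using assms(1) unfolding l2_tendsto_def by (rule tendsto_mult_right_zero)
    show "\<forall>\<^sub>F n in F. dist (l2_inner M g (u n)) (l2_inner M g x)
            \<le> l2_norm M g * l2_norm M (\<lambda>\<omega>. u n \<omega> - x \<omega>)"
      using l2_inner_bound[OF assms(4) L2_diff[OF assms(2,3)]]
      by (intro always_eventually) (simp add: dist_norm l2_inner_diff_right assms)
  qed simp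
  from tendsto_cnj[OF this] show "((\<lambda>n. l2_inner M (u n) g) \<longlongrightarrow> l2_inner M x g) F"
    by (simp add: l2_inner_cnj)
qed

lemma l2_norm_diff_abs:
  assumes "u \<in> L2 M" "v \<in> L2 M"
  shows "\<bar>l2_norm M u - l2_norm M v\<bar> \<le> l2_norm M (\<lambda>x. u x - v x)"
  using l2_norm_diff_triangle[OF assms L2_zero] l2_norm_diff_triangle[OF assms(2,1) L2_zero]
  by (simp add: l2_norm_minus_commute[of M u v])

lemma l2_tendsto_norm:
  assumes "l2_tendsto M u x F" "\<And>n. u n \<in> L2 M" "x \<in> L2 M"
  shows "((\<lambda>n. l2_norm M (u n)) \<longlongrightarrow> l2_norm M x) F"
proof (subst tendsto_dist_iff, rule tendsto_sandwich)
  show "((\<lambda>n. 0) \<longlongrightarrow> (0::real)) F" by simp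
  show "((\<lambda>n. l2_norm M (\<lambda>\<omega>. u n \<omega> - x \<omega>)) \<longlongrightarrow> 0) F"
    using assms(1) unfolding l2_tendsto_def .
  show "\<forall>\<^sub>F n in F. dist (l2_norm M (u n)) (l2_norm M x) \<le> l2_norm M (\<lambda>\<omega>. u n \<omega> - x \<omega>)"
    using l2_norm_diff_abs[OF assms(2,3)] by (intro always_eventually) (simp add: dist_real_def)
qed simp

lemma l2_norm_mult_bounded:
  assumes "u \<in> L2 M" "f \<in> borel_measurable M" "AE x in M. cmod (f x) \<le> B" "0 \<le> B"
  shows "l2_norm M (\<lambda>x. f x * u x) \<le> B * l2_norm M u"
proof -
  have "(l2_norm M (\<lambda>x. f x * u x))\<^sup>2 \<le> (LINT x|M. B\<^sup>2 * (cmod (u x))\<^sup>2)"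
    unfolding l2_norm_sq
  proof (rule integral_mono_AE)
    show "integrable M (\<lambda>x. (cmod (f x * u x))\<^sup>2)"
      using L2_square_integrable[OF L2_mult_bounded[OF assms(1-3)]] .
    show "AE x in M. (cmod (f x * u x))\<^sup>2 \<le> B\<^sup>2 * (cmod (u x))\<^sup>2"
      using assms(3) by eventually_elim
        (auto simp: norm_mult power_mult_distrib intro!: mult_right_mono power_mono)
  qed (use assms in \<open>simp add: L2_def\<close>)
  also have "\<dots> = (B * l2_norm M u)\<^sup>2" by (simp add: power_mult_distrib l2_norm_sq)
  finally show ?thesis by (rule power2_le_imp_le) (simp add: assms)
qed

lemma l2_tendsto_mult_bounded:
  assumes "l2_tendsto M u x F" "\<And>n. u n \<in> L2 M" "x \<in> L2 M"
    and "f \<in> borel_measurable M" "AE x in M. cmod (f x) \<le> B"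
  shows "l2_tendsto M (\<lambda>n y. f y * u n y) (\<lambda>y. f y * x y) F"
  unfolding l2_tendsto_def
proof (rule tendsto_sandwich)
  let ?B = "\<bar>B\<bar>"
  show "((\<lambda>n. 0) \<longlongrightarrow> (0::real)) F" by simp
  show "((\<lambda>n. ?B * l2_norm M (\<lambda>\<omega>. u n \<omega> - x \<omega>)) \<longlongrightarrow> 0) F"
    using assms(1) unfolding l2_tendsto_def by (rule tendsto_mult_right_zero)
  have B: "AE x in M. cmod (f x) \<le> ?B" using assms(5) by eventually_elim auto
  show "\<forall>\<^sub>F n in F. l2_norm M (\<lambda>y. f y * u n y - f y * x y) \<le> ?B * l2_norm M (\<lambda>\<omega>. u n \<omega> - x \<omega>)"
    using l2_norm_mult_bounded[OF L2_diff[OF assms(2,3)] assms(4) B]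
    by (intro always_eventually) (simp add: right_diff_distrib)
qed simp

lemma l2_tendsto_comb:
  assumes "l2_tendsto M u x F" "\<And>n. u n \<in> L2 M" "x \<in> L2 M"
    and "l2_tendsto M v y F" "\<And>n. v n \<in> L2 M" "y \<in> L2 M"
  shows "l2_tendsto M (\<lambda>n \<omega>. \<alpha> * u n \<omega> + \<beta> * v n \<omega>) (\<lambda>\<omega>. \<alpha> * x \<omega> + \<beta> * y \<omega>) F"
  unfolding l2_tendsto_def
proof (rule tendsto_sandwich)
  show "((\<lambda>n. 0) \<longlongrightarrow> (0::real)) F" by simp
  have "((\<lambda>n. cmod \<alpha> * l2_norm M (\<lambda>\<omega>. u n \<omega> - x \<omega>) + cmod \<beta> * l2_norm M (\<lambda>\<omega>. v n \<omega> - y \<omega>))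
      \<longlongrightarrow> cmod \<alpha> * 0 + cmod \<beta> * 0) F"
    using assms(1,4) unfolding l2_tendsto_def by (intro tendsto_intros)
  then show "((\<lambda>n. cmod \<alpha> * l2_norm M (\<lambda>\<omega>. u n \<omega> - x \<omega>) + cmod \<beta> * l2_norm M (\<lambda>\<omega>. v n \<omega> - y \<omega>))
      \<longlongrightarrow> 0) F" by simp
  have "l2_norm M (\<lambda>\<omega>. \<alpha> * u n \<omega> + \<beta> * v n \<omega> - (\<alpha> * x \<omega> + \<beta> * y \<omega>))
     \<le> cmod \<alpha> * l2_norm M (\<lambda>\<omega>. u n \<omega> - x \<omega>) + cmod \<beta> * l2_norm M (\<lambda>\<omega>. v n \<omega> - y \<omega>)" for n
  proof -
    have "(\<lambda>\<omega>. \<alpha> * u n \<omega> + \<beta> * v n \<omega> - (\<alpha> * x \<omega> + \<beta> * y \<omega>))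
        = (\<lambda>\<omega>. \<alpha> * (u n \<omega> - x \<omega>) + \<beta> * (v n \<omega> - y \<omega>))"
      by (simp add: algebra_simps)
    with l2_norm_triangle[OF L2_cmult[OF L2_diff[OF assms(2)[of n] assms(3)], of \<alpha>]
        L2_cmult[OF L2_diff[OF assms(5)[of n] assms(6)], of \<beta>]]
    show ?thesis by (simp only: l2_norm_cmult)
  qed
  then show "\<forall>\<^sub>F n in F. l2_norm M (\<lambda>\<omega>. \<alpha> * u n \<omega> + \<beta> * v n \<omega> - (\<alpha> * x \<omega> + \<beta> * y \<omega>))
     \<le> cmod \<alpha> * l2_norm M (\<lambda>\<omega>. u n \<omega> - x \<omega>) + cmod \<beta> * l2_norm M (\<lambda>\<omega>. v n \<omega> - y \<omega>)"
    by simp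
qed simp

section \<open>Sectorial sesquilinear forms on function spaces\<close>

text \<open>The carrier is a set of functions on an arbitrary type, so that one theory covers three
  uses: forms on function spaces over a domain, relaxed forms, and the coefficient matrix at a
  single point (functions of the index, \<open>D = UNIV\<close>). \<open>T\<close> plays the role of
  the tangent of the semi-angle, the vertex being 0.\<close>

locale sect_form =
  fixes D :: "('a \<Rightarrow> complex) set" and q :: "'a form" and T :: real
  assumes T_nonneg: "0 \<le> T"
    and zero_mem: "(\<lambda>x. 0) \<in> D"
    and comb_mem: "\<And>u v \<alpha> \<beta>. u \<in> D \<Longrightarrow> v \<in> D \<Longrightarrow> (\<lambda>x. \<alpha> * u x + \<beta> * v x) \<in> D"
    and comb_left: "\<And>u v w \<alpha> \<beta>. u \<in> D \<Longrightarrow> v \<in> D \<Longrightarrow> w \<in> D \<Longrightarrow>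
       q (\<lambda>x. \<alpha> * u x + \<beta> * v x) w = \<alpha> * q u w + \<beta> * q v w"
    and comb_right: "\<And>u v w \<alpha> \<beta>. u \<in> D \<Longrightarrow> v \<in> D \<Longrightarrow> w \<in> D \<Longrightarrow>
       q w (\<lambda>x. \<alpha> * u x + \<beta> * v x) = cnj \<alpha> * q w u + cnj \<beta> * q w v"
    and p_nonneg: "\<And>u. u \<in> D \<Longrightarrow> 0 \<le> Re (q u u)"
    and sector: "\<And>u. u \<in> D \<Longrightarrow> \<bar>Im (q u u)\<bar> \<le> T * Re (q u u)"
begin

abbreviation p :: "('a \<Rightarrow> complex) \<Rightarrow> real" where "p u \<equiv> Re (q u u)"

abbreviation L :: real where "L \<equiv> 2 * (1 + T)"

lemma diff_mem: "u \<in> D \<Longrightarrow> v \<in> D \<Longrightarrow> (\<lambda>x. u x - v x) \<in> D"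
  using comb_mem[of u v 1 "-1"] by simp

lemma add_mem: "u \<in> D \<Longrightarrow> v \<in> D \<Longrightarrow> (\<lambda>x. u x + v x) \<in> D"
  using comb_mem[of u v 1 1] by simp

lemma scale_mem: "u \<in> D \<Longrightarrow> (\<lambda>x. c * u x) \<in> D"
  using comb_mem[of u u c 0] by simp

lemma diff_left: "u \<in> D \<Longrightarrow> v \<in> D \<Longrightarrow> w \<in> D \<Longrightarrow> q (\<lambda>x. u x - v x) w = q u w - q v w"
  using comb_left[of u v w 1 "-1"] by simp

lemma add_left: "u \<in> D \<Longrightarrow> v \<in> D \<Longrightarrow> w \<in> D \<Longrightarrow> q (\<lambda>x. u x + v x) w = q u w + q v w"
  using comb_left[of u v w 1 1] by simp

lemma scale_left: "u \<in> D \<Longrightarrow> w \<in> D \<Longrightarrow> q (\<lambda>x. c * u x) w = c * q u w"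
  using comb_left[of u u w c 0] by simp

lemma scale_right: "u \<in> D \<Longrightarrow> w \<in> D \<Longrightarrow> q w (\<lambda>x. c * u x) = cnj c * q w u"
  using comb_right[of u u w c 0] by simp

lemma zero_left: "w \<in> D \<Longrightarrow> q (\<lambda>x. 0) w = 0"
  using scale_left[of "\<lambda>x. 0" w 0] zero_mem by simp

lemma cmod_self_le: "u \<in> D \<Longrightarrow> cmod (q u u) \<le> (1 + T) * p u"
  using cmod_le[of "q u u"] sector[of u] p_nonneg[of u] by (simp add: algebra_simps)

lemma expand:
  assumes "u \<in> D" "v \<in> D"
  shows "q (\<lambda>x. \<alpha> * u x + \<beta> * v x) (\<lambda>x. \<alpha> * u x + \<beta> * v x)
    = \<alpha> * cnj \<alpha> * q u u + \<alpha> * cnj \<beta> * q u v + \<beta> * cnj \<alpha> * q v u + \<beta> * cnj \<beta> * q v v"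
  unfolding comb_left[OF assms comb_mem[OF assms]] comb_right[OF assms assms(1)] comb_right[OF assms assms(2)]
  by (simp only: distrib_left add.assoc mult.assoc)

lemma p_scale: "u \<in> D \<Longrightarrow> p (\<lambda>x. c * u x) = (cmod c)\<^sup>2 * p u"
proof -
  assume "u \<in> D"
  then have "q (\<lambda>x. c * u x) (\<lambda>x. c * u x) = complex_of_real ((cmod c)\<^sup>2) * q u u"
    using expand[of u u c 0] by (simp only: complex_norm_square) simp
  then show ?thesis by (simp del: of_real_power)
qed

text \<open>The cross terms cancel over the four fourth roots of unity, the same four arguments that
  occur in the polarisation identity.\<close>

lemma p_sum_four_roots:
  assumes "u \<in> D" "v \<in> D"
  shows "p (\<lambda>x. 1 * u x + 1 * v x) + p (\<lambda>x. 1 * u x + (-1) * v x)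
       + p (\<lambda>x. 1 * u x + \<i> * v x) + p (\<lambda>x. 1 * u x + (-\<i>) * v x) = 4 * (p u + p v)"
  unfolding expand[OF assms] by simp

lemma polarisation:
  assumes "u \<in> D" "v \<in> D"
  shows "4 * q u v = q (\<lambda>x. 1 * u x + 1 * v x) (\<lambda>x. 1 * u x + 1 * v x)
       - q (\<lambda>x. 1 * u x + (-1) * v x) (\<lambda>x. 1 * u x + (-1) * v x)
       + \<i> * q (\<lambda>x. 1 * u x + \<i> * v x) (\<lambda>x. 1 * u x + \<i> * v x)
       - \<i> * q (\<lambda>x. 1 * u x + (-\<i>) * v x) (\<lambda>x. 1 * u x + (-\<i>) * v x)"
  unfolding expand[OF assms] by (simp add: algebra_simps)

lemma bound_sum:
  assumes "u \<in> D" "v \<in> D"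
  shows "cmod (q u v) \<le> (1 + T) * (p u + p v)"
proof -
  have "cmod (4 * q u v) \<le> cmod (q (\<lambda>x. 1 * u x + 1 * v x) (\<lambda>x. 1 * u x + 1 * v x))
       + cmod (q (\<lambda>x. 1 * u x + (-1) * v x) (\<lambda>x. 1 * u x + (-1) * v x))
       + cmod (q (\<lambda>x. 1 * u x + \<i> * v x) (\<lambda>x. 1 * u x + \<i> * v x))
       + cmod (q (\<lambda>x. 1 * u x + (-\<i>) * v x) (\<lambda>x. 1 * u x + (-\<i>) * v x))"
    unfolding polarisation[OF assms]
    by (intro order_trans[OF norm_triangle_ineq4] order_trans[OF norm_triangle_ineq] add_mono)
       (simp_all add: norm_mult)
  also have "\<dots> \<le> (1 + T) * p (\<lambda>x. 1 * u x + 1 * v x) + (1 + T) * p (\<lambda>x. 1 * u x + (-1) * v x)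
       + (1 + T) * p (\<lambda>x. 1 * u x + \<i> * v x) + (1 + T) * p (\<lambda>x. 1 * u x + (-\<i>) * v x)"
    by (intro add_mono cmod_self_le comb_mem assms)
  also have "\<dots> = (1 + T) * (4 * (p u + p v))"
    unfolding p_sum_four_roots[OF assms, symmetric] by (simp only: distrib_left)
  finally have "4 * cmod (q u v) \<le> 4 * ((1 + T) * (p u + p v))"
    by (simp only: norm_mult mult_ac) simp
  then show ?thesis by linarith
qed

text \<open>Replacing u by r u and v by v / r with \<open>r = sqrt s\<close> does not change q u v
  but redistributes the two energies.\<close>

lemma bound_scaled:
  assumes "u \<in> D" "v \<in> D" "0 < s"
  shows "cmod (q u v) \<le> (1 + T) * (s * p u + p v / s)"
proof -
  define r where "r = sqrt s"
  have r: "0 < r" "r\<^sup>2 = s" using assms by (auto simp: r_def)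
  have "q (\<lambda>x. complex_of_real r * u x) (\<lambda>x. complex_of_real (1 / r) * v x) 
      = complex_of_real r * (cnj (complex_of_real (1 / r)) * q u v)"
    by (simp only: scale_left scale_right scale_mem assms)
  also have "\<dots> = q u v" using r by simp
  finally have "q (\<lambda>x. complex_of_real r * u x) (\<lambda>x. complex_of_real (1 / r) * v x) = q u v" .
  then have "cmod (q u v) \<le> (1 + T) * (p (\<lambda>x. complex_of_real r * u x) + p (\<lambda>x. complex_of_real (1 / r) * v x))"
    using bound_sum[OF scale_mem[OF assms(1)] scale_mem[OF assms(2)], of "complex_of_real r" "complex_of_real (1 / r)"]
    by simp
  also have "\<dots> = (1 + T) * (s * p u + p v / s)"
    unfolding p_scale[OF assms(1)] p_scale[OF assms(2)] using r
    by (simp add: power_divide norm_divide)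
  finally show ?thesis .
qed

text \<open>Optimising the scaling yields Cauchy-Schwarz for the sectorial form; the factor 2 in
  \<open>L\<close> comes from this optimisation.\<close>

lemma bound:
  assumes "u \<in> D" "v \<in> D"
  shows "cmod (q u v) \<le> L * (sqrt (p u) * sqrt (p v))"
proof -
  have "cmod (q u v) \<le> 2 * (sqrt ((1 + T) * p u) * sqrt ((1 + T) * p v))"
    by (rule am_gm_optimise)
       (use bound_scaled[OF assms] p_nonneg assms T_nonneg in \<open>auto simp: algebra_simps add_divide_distrib\<close>)
  also have "\<dots> = 2 * ((sqrt (1 + T) * sqrt (1 + T)) * (sqrt (p u) * sqrt (p v)))"
    by (simp only: real_sqrt_mult mult_ac)
  also have "\<dots> = L * (sqrt (p u) * sqrt (p v))"
    using T_nonneg by simp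
  finally show ?thesis .
qed

lemma parallelogram:
  assumes "u \<in> D" "v \<in> D"
  shows "p (\<lambda>x. u x + v x) + p (\<lambda>x. u x - v x) = 2 * p u + 2 * p v"
  using expand[OF assms, of 1 1] expand[OF assms, of 1 "-1"] by simp

lemma p_add_le:
  assumes "u \<in> D" "v \<in> D"
  shows "p (\<lambda>x. u x + v x) \<le> 2 * p u + 2 * p v"
  using parallelogram[OF assms] p_nonneg[OF diff_mem[OF assms]] by linarith

lemma p_diff_le:
  assumes "u \<in> D" "v \<in> D"
  shows "p (\<lambda>x. u x - v x) \<le> 2 * p u + 2 * p v"
  using parallelogram[OF assms] p_nonneg[OF add_mem[OF assms]] by linarith

lemma p_triangle:
  assumes "u \<in> D" "v \<in> D" "w \<in> D"
  shows "p (\<lambda>x. u x - w x) \<le> 2 * p (\<lambda>x. u x - v x) + 2 * p (\<lambda>x. v x - w x)"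
  using p_add_le[OF diff_mem[OF assms(1,2)] diff_mem[OF assms(2,3)]] by simp

lemma p_minus_commute:
  assumes "u \<in> D" "v \<in> D"
  shows "p (\<lambda>x. u x - v x) = p (\<lambda>x. v x - u x)"
  using p_scale[OF diff_mem[OF assms], of "-1"] by simp

text \<open>The hypothesis is divided by \<open>sqrt (p u)\<close>. If the energy vanishes this is
  impossible and C may even be negative, hence the second alternative.\<close>

lemma sqrt_p_bound_of_functional:
  assumes u: "u \<in> D" and C: "cmod (q u u) \<le> C * sqrt (p u)"
  shows "sqrt (p u) \<le> C \<or> p u = 0"
proof (cases "p u = 0")
  case False
  then have pos: "0 < sqrt (p u)" using p_nonneg[OF u] by simp
  have "sqrt (p u) * sqrt (p u) = p u" using p_nonneg[OF u] by simp
  also have "\<dots> \<le> cmod (q u u)" by (rule complex_Re_le_cmod)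
  finally have "sqrt (p u) * sqrt (p u) \<le> C * sqrt (p u)" using C by linarith
  then have "sqrt (p u) \<le> C" using pos by (rule mult_right_le_imp_le)
  then show ?thesis ..
qed simp

lemma p_le_of_functional:
  assumes u: "u \<in> D" and C: "cmod (q u u) \<le> C * sqrt (p u)" "0 \<le> C"
  shows "p u \<le> C\<^sup>2"
  using sqrt_p_bound_of_functional[OF u C(1)]
proof
  assume "sqrt (p u) \<le> C"
  then have "(sqrt (p u))\<^sup>2 \<le> C\<^sup>2" using p_nonneg[OF u] by (intro power_mono) auto
  then show ?thesis using p_nonneg[OF u] by simp
qed simp

text \<open>Minimising sequences in a decreasing family of midpoint convex sets are Cauchy. This
  replaces weak compactness.\<close>

lemma near_minimisers_Cauchy:
  fixes C :: "nat \<Rightarrow> ('a \<Rightarrow> complex) set"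
  assumes sub: "\<And>n. C n \<subseteq> D" and dec: "\<And>n. C (Suc n) \<subseteq> C n"
    and mid: "\<And>n u v. u \<in> C n \<Longrightarrow> v \<in> C n \<Longrightarrow> (\<lambda>x. (1/2) * u x + (1/2) * v x) \<in> C n"
    and bdd: "\<And>n. \<exists>u\<in>C n. p u \<le> B"
  obtains y where "\<And>n. y n \<in> C n" "\<And>e. 0 < e \<Longrightarrow> \<exists>N. \<forall>n\<ge>N. \<forall>m\<ge>N. p (\<lambda>x. y n x - y m x) < e"
proof -
  define d where "d n = (INF u\<in>C n. p u)" for n
  have bb: "bdd_below (p ` C n)" for n
    using sub p_nonneg by (intro bdd_belowI[of _ 0]) blast
  have ne: "C n \<noteq> {}" for n using bdd[of n] by blast
  have dle: "d n \<le> p u" if "u \<in> C n" for n u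
    unfolding d_def using that bb by (intro cINF_lower)
  have "\<exists>u\<in>C n. p u < d n + 1 / real (Suc n)" for n
    using cINF_less_iff[OF ne bb, of n "d n + 1 / real (Suc n)"] unfolding d_def by simp
  then have "\<forall>n. \<exists>u. u \<in> C n \<and> p u < d n + 1 / real (Suc n)" by blast
  from choice[OF this] obtain y where y: "\<And>n. y n \<in> C n" "\<And>n. p (y n) < d n + 1 / real (Suc n)" by blast
  have dmono: "incseq d"
    by (rule incseq_SucI) (unfold d_def, intro cINF_superset_mono ne bb dec order_refl)
  have dB: "d n \<le> B" for n
  proof -
    obtain u where "u \<in> C n" "p u \<le> B" using bdd[of n] ..
    then show ?thesis using dle[of u n] by linarith
  qed
  \<comment> \<open>Shrinking the sets raises the infima, and \<open>B\<close> bounds them all, so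
    they converge.\<close>
  have "d \<longlonglongrightarrow> (SUP n. d n)"
    by (rule LIMSEQ_incseq_SUP[OF _ dmono]) (use dB in \<open>auto intro!: bdd_aboveI2\<close>)
  then have Cauchy_d: "Cauchy d" by (rule LIMSEQ_imp_Cauchy)
  have Cdec: "C m \<subseteq> C n" if "n \<le> m" for n m by (rule lift_Suc_antimono_le[of C, OF dec that])
  define r where "r n = 4 / real (Suc n)" for n
  \<comment> \<open>The midpoint of \<open>y n\<close> and \<open>y m\<close> lies in
    \<open>C n\<close>, so its energy is at least \<open>d n\<close>; the parallelogram law turns
    this into smallness of the difference.\<close>
  have key: "p (\<lambda>x. y n x - y m x) \<le> 2 * (d m - d n) + r n" if nm: "n \<le> m" for n m
  proof -
    have m: "(\<lambda>x. (1/2) * y n x + (1/2) * y m x) \<in> C n"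
      using mid y(1) Cdec[OF nm] by blast
    have yD: "y n \<in> D" "y m \<in> D" using y(1) sub by blast+
    have "4 * d n \<le> 4 * p (\<lambda>x. (1/2) * y n x + (1/2) * y m x)" using dle[OF m] by simp
    also have "\<dots> = p (\<lambda>x. y n x + y m x)"
      using expand[OF yD, of "1/2" "1/2"] expand[OF yD, of 1 1] by simp
    also have "\<dots> = 2 * p (y n) + 2 * p (y m) - p (\<lambda>x. y n x - y m x)"
      using parallelogram[OF yD] by linarith
    finally have "p (\<lambda>x. y n x - y m x) \<le> 2 * p (y n) + 2 * p (y m) - 4 * d n" by linarith
    moreover have "p (y n) \<le> d n + 1 / real (Suc n)" "p (y m) \<le> d m + 1 / real (Suc m)"
      using y(2) less_imp_le by blast+
    moreover have "1 / real (Suc m) \<le> 1 / real (Suc n)" using nm by (intro divide_left_mono) auto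
    ultimately have "p (\<lambda>x. y n x - y m x) \<le> 2 * (d m - d n) + 4 * (1 / real (Suc n))"
      by argo
    then show ?thesis by (simp add: r_def)
  qed
  have "\<exists>N. \<forall>n\<ge>N. \<forall>m\<ge>N. p (\<lambda>x. y n x - y m x) < e" if e: "0 < e" for e
  proof -
    from Cauchy_d e obtain N1 where N1: "\<And>n m. n \<ge> N1 \<Longrightarrow> m \<ge> N1 \<Longrightarrow> dist (d n) (d m) < e / 8"
      using metric_CauchyD[of d "e / 8"] by auto
    from reals_Archimedean[of "e / 8"] e obtain N2 where "inverse (real (Suc N2)) < e / 8" by auto
    then have "4 * inverse (real (Suc N2)) < 4 * (e / 8)" by (intro mult_strict_left_mono) auto
    then have N2: "r N2 < e / 2" by (simp add: r_def inverse_eq_divide)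
    have half: "p (\<lambda>x. y n x - y m x) < e" if "n \<ge> max N1 N2" "n \<le> m" for n m
    proof -
      have "r n \<le> r N2" unfolding r_def using that by (intro divide_left_mono) auto
      then have "r n < e / 2" using N2 by linarith
      moreover have "\<bar>d n - d m\<bar> < e / 8" using N1[of n m] that by (simp add: dist_real_def)
      then have "d m - d n < e / 8" by linarith
      ultimately have "2 * (d m - d n) + r n < e" using e by argo
      with key[OF that(2)] show ?thesis by (rule order_le_less_trans)
    qed
    have "p (\<lambda>x. y n x - y m x) < e" if "n \<ge> max N1 N2" "m \<ge> max N1 N2" for n m
    proof (cases "n \<le> m")
      case False
      have "y n \<in> D" "y m \<in> D" using y(1) sub by blast+
      then show ?thesis using half[of m n] that False by (simp add: p_minus_commute[of "y n" "y m"])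
    next
      case True
      then show ?thesis using half[of n m] that(1) by simp
    qed
    then show ?thesis by blast
  qed
  with y(1) show ?thesis by (rule that)
qed

end

text \<open>Scaling the skew part leaves the real part, hence the form norm, unchanged and
  multiplies the sector constant by |s|. The value 0 gives a Hermitian form, the value 1 gives q
  back: the path for the continuity method.\<close>

lemma sect_form_hermitian_part:
  assumes "sect_form D q T"
  shows "sect_form D (\<lambda>u v. (q u v + cnj (q v u)) / 2 + complex_of_real s * ((q u v - cnj (q v u)) / 2)) (\<bar>s\<bar> * T)"
proof -
  interpret sect_form D q T by fact
  show ?thesis
  proof
    fix u assume u: "u \<in> D"
    have eq: "(q u u + cnj (q u u)) / 2 + complex_of_real s * ((q u u - cnj (q u u)) / 2)
        = Complex (p u) (s * Im (q u u))"
      by (simp add: complex_eq_iff)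
    show "0 \<le> Re ((q u u + cnj (q u u)) / 2 + complex_of_real s * ((q u u - cnj (q u u)) / 2))"
      unfolding eq using p_nonneg[OF u] by simp
    show "\<bar>Im ((q u u + cnj (q u u)) / 2 + complex_of_real s * ((q u u - cnj (q u u)) / 2))\<bar>
        \<le> \<bar>s\<bar> * T * Re ((q u u + cnj (q u u)) / 2 + complex_of_real s * ((q u u - cnj (q u u)) / 2))"
      unfolding eq using mult_left_mono[OF sector[OF u], of "\<bar>s\<bar>"] by (simp add: abs_mult mult.assoc)
  next
    fix u v w \<alpha> \<beta> assume D: "u \<in> D" "v \<in> D" "w \<in> D"
    let ?c = "\<lambda>x. \<alpha> * u x + \<beta> * v x"
    note eqs = comb_left[OF D] comb_right[OF D] complex_cnj_add complex_cnj_mult complex_cnj_cnj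
    show "(q ?c w + cnj (q w ?c)) / 2 + complex_of_real s * ((q ?c w - cnj (q w ?c)) / 2)
       = \<alpha> * ((q u w + cnj (q w u)) / 2 + complex_of_real s * ((q u w - cnj (q w u)) / 2))
       + \<beta> * ((q v w + cnj (q w v)) / 2 + complex_of_real s * ((q v w - cnj (q w v)) / 2))"
      by (simp only: eqs divide_inverse) (simp only: algebra_simps)
    show "(q w ?c + cnj (q ?c w)) / 2 + complex_of_real s * ((q w ?c - cnj (q ?c w)) / 2)
       = cnj \<alpha> * ((q w u + cnj (q u w)) / 2 + complex_of_real s * ((q w u - cnj (q u w)) / 2))
       + cnj \<beta> * ((q w v + cnj (q v w)) / 2 + complex_of_real s * ((q w v - cnj (q v w)) / 2))"
      by (simp only: eqs divide_inverse) (simp only: algebra_simps)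
  qed (use T_nonneg zero_mem comb_mem in simp_all)
qed

lemma sect_form_adjoint:
  assumes "sect_form D q T"
  shows "sect_form D (\<lambda>u v. cnj (q v u)) T"
proof -
  interpret sect_form D q T by fact
  show ?thesis
    using T_nonneg zero_mem comb_mem p_nonneg sector by unfold_locales (simp_all add: comb_left comb_right)
qed

lemma sect_form_add_inner:
  assumes "sect_form D q T" "D \<subseteq> L2 M" "0 \<le> \<mu>"
  shows "sect_form D (\<lambda>u v. q u v + complex_of_real \<mu> * l2_inner M u v) T"
proof -
  interpret sect_form D q T by fact
  have D: "u \<in> L2 M" if "u \<in> D" for u using assms that by blast
  show ?thesis
  proof
    fix u assume u: "u \<in> D"
    have "0 \<le> T * (\<mu> * (l2_norm M u)\<^sup>2)" using T_nonneg assms by simp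
    then show "\<bar>Im (q u u + complex_of_real \<mu> * l2_inner M u u)\<bar>
        \<le> T * Re (q u u + complex_of_real \<mu> * l2_inner M u u)"
      using sector[OF u] by (simp add: l2_inner_self distrib_left)
    show "0 \<le> Re (q u u + complex_of_real \<mu> * l2_inner M u u)"
      using p_nonneg[OF u] assms by (simp add: l2_inner_self)
  next
    fix u v w \<alpha> \<beta> assume uvw: "u \<in> D" "v \<in> D" "w \<in> D"
    let ?c = "\<lambda>x. \<alpha> * u x + \<beta> * v x"
    note eqs = comb_left[OF uvw] comb_right[OF uvw] l2_inner_comb_left[OF uvw[THEN D]]
      l2_inner_comb_right[OF uvw[THEN D]]
    show "q ?c w + complex_of_real \<mu> * l2_inner M ?c w
       = \<alpha> * (q u w + complex_of_real \<mu> * l2_inner M u w) + \<beta> * (q v w + complex_of_real \<mu> * l2_inner M v w)"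
      by (simp only: eqs) (simp only: algebra_simps)
    show "q w ?c + complex_of_real \<mu> * l2_inner M w ?c
       = cnj \<alpha> * (q w u + complex_of_real \<mu> * l2_inner M w u) + cnj \<beta> * (q w v + complex_of_real \<mu> * l2_inner M w v)"
      by (simp only: eqs) (simp only: algebra_simps)
  qed (use T_nonneg zero_mem comb_mem in simp_all)
qed

subsection \<open>Lax--Milgram without completeness\<close>

definition antilinear_on :: "('a \<Rightarrow> complex) set \<Rightarrow> (('a \<Rightarrow> complex) \<Rightarrow> complex) \<Rightarrow> bool" where
  "antilinear_on D \<phi> \<longleftrightarrow> (\<forall>u\<in>D. \<forall>v\<in>D. \<forall>\<alpha> \<beta>.
     \<phi> (\<lambda>x. \<alpha> * u x + \<beta> * v x) = cnj \<alpha> * \<phi> u + cnj \<beta> * \<phi> v)"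

text \<open>Variational proof: a function minimising the quadratic functional up to
  \<open>e^2\<close> satisfies the Euler equation up to e in the dual norm. No minimiser has to
  exist.\<close>

lemma approx_Riesz:
  assumes "sect_form D h 0" and herm: "\<And>u v. u \<in> D \<Longrightarrow> v \<in> D \<Longrightarrow> h v u = cnj (h u v)"
    and phi: "antilinear_on D \<phi>" and C: "\<And>v. v \<in> D \<Longrightarrow> cmod (\<phi> v) \<le> C * sqrt (Re (h v v))"
    and e: "0 < e"
  shows "\<exists>u\<in>D. \<forall>v\<in>D. cmod (h u v - \<phi> v) \<le> e * sqrt (Re (h v v))"
proof -
  interpret sect_form D h 0 by fact
  \<comment> \<open>Energy functional whose Euler equation is h u v = \<phi> v; the bound on \<phi>
    makes it bounded below by \<open>- C\<^sup>2\<close>.\<close>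
  define J where "J u = p u - 2 * Re (\<phi> u)" for u
  have Jlow: "- C\<^sup>2 \<le> J u" if u: "u \<in> D" for u
  proof -
    have "0 \<le> (sqrt (p u) - C)\<^sup>2" by simp
    also have "\<dots> = p u - 2 * (C * sqrt (p u)) + C\<^sup>2"
      using p_nonneg[OF u] by (simp add: power2_diff mult_ac)
    finally show ?thesis
      using C[OF u] complex_Re_le_cmod[of "\<phi> u"] unfolding J_def by linarith
  qed
  have bb: "bdd_below (J ` D)" using Jlow by (intro bdd_belowI2)
  have ne: "D \<noteq> {}" using zero_mem by blast
  have "\<exists>u\<in>D. J u < (INF u\<in>D. J u) + e\<^sup>2"
    using cINF_less_iff[OF ne bb, of "(INF u\<in>D. J u) + e\<^sup>2"] e by simp
  then obtain u where u: "u \<in> D" "J u < (INF u\<in>D. J u) + e\<^sup>2" by blast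
  have near: "J u \<le> J w + e\<^sup>2" if "w \<in> D" for w
    using cINF_lower[OF bb that] u(2) by linarith
  have Re_bound: "- Re (h u v - \<phi> v) \<le> e * sqrt (p v)" if v: "v \<in> D" for v
  proof -
    \<comment> \<open>Near minimality is compared with the competitor u + s v, and the result is
      divided by s; the allowance \<open>e\<^sup>2\<close> becomes
      \<open>e\<^sup>2 / s\<close>.\<close>
    have "- 2 * Re (h u v - \<phi> v) \<le> s * p v + e\<^sup>2 / s" if s: "0 < s" for s
    proof -
      let ?w = "\<lambda>x. 1 * u x + complex_of_real s * v x"
      have "J u \<le> J ?w + e\<^sup>2" by (intro near comb_mem u v)
      also have "p ?w = p u + s * (2 * Re (h u v)) + s\<^sup>2 * p v"
        unfolding expand[OF u(1) v] using herm[OF u(1) v] by (simp add: power2_eq_square)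
      then have "J ?w = J u + s * (2 * Re (h u v - \<phi> v)) + s\<^sup>2 * p v"
        using phi[unfolded antilinear_on_def, rule_format, OF u(1) v, of 1 "complex_of_real s"]
        by (simp add: J_def algebra_simps)
      finally have "s * (- 2 * Re (h u v - \<phi> v)) \<le> s * (s * p v + e\<^sup>2 / s)"
        using s by (simp add: algebra_simps power2_eq_square)
      then show ?thesis using s by (rule mult_left_le_imp_le)
    qed
    from am_gm_optimise[OF p_nonneg[OF v] zero_le_power2 this] e
    have "- 2 * Re (h u v - \<phi> v) \<le> 2 * (sqrt (p v) * e)" by simp
    then show ?thesis by (simp add: mult.commute)
  qed
  have "cmod (h u v - \<phi> v) \<le> e * sqrt (p v)" if v: "v \<in> D" for v
  proof (cases "h u v - \<phi> v = 0")
    case True then show ?thesis using e p_nonneg[OF v] by simp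
  next
    case False
    define z where "z = h u v - \<phi> v"
    \<comment> \<open>Rotating v by this unit number makes the complex residual a negative real, so
      the one-sided bound on real parts controls the modulus.\<close>
    define c where "c = - z / complex_of_real (cmod z)"
    have c: "cmod c = 1" using False unfolding c_def z_def[symmetric] by (simp add: norm_divide)
    have "h u (\<lambda>x. c * v x) - \<phi> (\<lambda>x. c * v x) = cnj c * z"
      using scale_right[OF v u(1), of c] phi[unfolded antilinear_on_def, rule_format, OF v v, of c 0]
      by (simp add: z_def algebra_simps)
    also have "\<dots> = - complex_of_real (cmod z)"
    proof -
      have "cnj (- z / complex_of_real (cmod z)) * z = - complex_of_real (cmod z)" if "z \<noteq> 0" for z
        using complex_norm_square[of z] that by (simp add: power2_eq_square mult.commute divide_eq_eq)
      then show ?thesis using False unfolding c_def z_def by blast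
    qed
    finally have "cmod z \<le> e * sqrt (p (\<lambda>x. c * v x))"
      using Re_bound[OF scale_mem[OF v, of c]] by simp
    also have "p (\<lambda>x. c * v x) = p v" using p_scale[OF v, of c] c by simp
    finally show ?thesis unfolding z_def .
  qed
  with u(1) show ?thesis by blast
qed

text \<open>Continuity method along the forms whose skew part is multiplied by a parameter growing
  from 0 to 1; all these forms have the same real part and hence the same norm.\<close>

theorem approx_Lax_Milgram:
  assumes "sect_form D q T"
    and phi: "antilinear_on D \<phi>" and C: "\<And>v. v \<in> D \<Longrightarrow> cmod (\<phi> v) \<le> C * sqrt (Re (q v v))"
    and e: "0 < e"
  shows "\<exists>u\<in>D. \<forall>v\<in>D. cmod (q u v - \<phi> v) \<le> e * sqrt (Re (q v v))"
proof -
  interpret sect_form D q T by fact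
  define hp where "hp u v = (q u v + cnj (q v u)) / 2" for u v
  define sk where "sk u v = (q u v - cnj (q v u)) / 2" for u v
  \<comment> \<open>Number of steps along the path: \<open>1 / K\<close> is at most
    \<open>1 / (2 * L)\<close>, so one step perturbs the form by at most half of its norm.\<close>
  define K where "K = nat \<lceil>2 * L\<rceil> + 1"
  have K: "2 * L \<le> real K" "0 < K" unfolding K_def using T_nonneg by linarith+
  define qq where "qq n u v = hp u v + complex_of_real (real n / real K) * sk u v" for n u v
  have qq_sect: "sect_form D (qq n) (\<bar>real n / real K\<bar> * T)" for n
    using sect_form_hermitian_part[OF assms(1), of "real n / real K"]
    unfolding qq_def hp_def sk_def by simp
  have Re_qq: "Re (qq n u u) = p u" for n u
    by (simp add: qq_def hp_def sk_def)
  have skb: "cmod (sk u v) \<le> L * (sqrt (p u) * sqrt (p v))" if "u \<in> D" "v \<in> D" for u v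
  proof -
    have "cmod (sk u v) = cmod (q u v - cnj (q v u)) / 2" by (simp add: sk_def norm_divide)
    also have "\<dots> \<le> (cmod (q u v) + cmod (q v u)) / 2"
      using norm_triangle_ineq4[of "q u v" "cnj (q v u)"] by simp
    also have "\<dots> \<le> L * (sqrt (p u) * sqrt (p v))"
      using bound[OF that] bound[OF that(2,1)] by (simp add: mult.commute[of "sqrt (p v)"])
    finally show ?thesis .
  qed
  have main: "\<And>\<phi> C e. antilinear_on D \<phi> \<Longrightarrow> (\<And>v. v \<in> D \<Longrightarrow> cmod (\<phi> v) \<le> C * sqrt (p v)) \<Longrightarrow> 0 < e
      \<Longrightarrow> \<exists>u\<in>D. \<forall>v\<in>D. cmod (qq n u v - \<phi> v) \<le> e * sqrt (p v)" for n
  proof (induction n)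
    case 0
    have "sect_form D (qq 0) 0" using qq_sect[of 0] by simp
    moreover have "qq 0 v u = cnj (qq 0 u v)" for u v by (simp add: qq_def hp_def add.commute)
    ultimately show ?case
      using approx_Riesz[of D "qq 0" \<phi> C e] 0 unfolding Re_qq by blast
  next
    case (Suc n)
    note prem = Suc.prems
    interpret S: sect_form D "qq (Suc n)" "\<bar>real (Suc n) / real K\<bar> * T" by (rule qq_sect)
    interpret N: sect_form D "qq n" "\<bar>real n / real K\<bar> * T" by (rule qq_sect)
    \<comment> \<open>A solution for parameter n is used for parameter n + 1. Its own residual is
      \<delta>/8 and the added skew part costs at most half of 9/8 \<delta>, in total 11/16
      \<delta>, below the claimed 3/4 \<delta>.\<close>
    have contr: "\<exists>u\<in>D. \<forall>v\<in>D. cmod (qq (Suc n) u v - \<psi> v) \<le> 3/4 * \<delta> * sqrt (p v)"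
      if psi: "antilinear_on D \<psi>" "\<And>v. v \<in> D \<Longrightarrow> cmod (\<psi> v) \<le> \<delta> * sqrt (p v)" "0 < \<delta>" for \<psi> \<delta>
    proof -
      from Suc.IH[OF psi(1,2), of "\<delta> / 8"] psi(3) obtain u where u: "u \<in> D"
        "\<And>v. v \<in> D \<Longrightarrow> cmod (qq n u v - \<psi> v) \<le> \<delta> / 8 * sqrt (p v)" by auto
      have "cmod (qq n u u) \<le> cmod (qq n u u - \<psi> u) + cmod (\<psi> u)"
        using norm_triangle_ineq[of "qq n u u - \<psi> u" "\<psi> u"] by simp
      also have "\<dots> \<le> (9/8 * \<delta>) * sqrt (p u)" using u(2)[OF u(1)] psi(2)[OF u(1)] by (simp add: algebra_simps)
      finally have pu: "sqrt (p u) \<le> 9/8 * \<delta>"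
        using N.sqrt_p_bound_of_functional[OF u(1), of "9/8 * \<delta>"] psi(3) unfolding Re_qq by auto
      have "cmod (qq (Suc n) u v - \<psi> v) \<le> 3/4 * \<delta> * sqrt (p v)" if v: "v \<in> D" for v
      proof -
        have "qq (Suc n) u v = qq n u v + complex_of_real (1 / real K) * sk u v"
          by (simp add: qq_def add_divide_distrib distrib_right distrib_left)
        then have "cmod (qq (Suc n) u v - \<psi> v) = cmod ((qq n u v - \<psi> v) + complex_of_real (1 / real K) * sk u v)"
          by (simp add: algebra_simps)
        also have "\<dots> \<le> cmod (qq n u v - \<psi> v) + 1 / real K * cmod (sk u v)"
          by (rule order_trans[OF norm_triangle_ineq]) (simp add: norm_mult norm_divide)
        also have "\<dots> \<le> \<delta> / 8 * sqrt (p v) + 1 / real K * (L * (sqrt (p u) * sqrt (p v)))"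
          by (intro add_mono mult_left_mono u skb v) auto
        also have "1 / real K * (L * (sqrt (p u) * sqrt (p v))) = (L / real K) * (sqrt (p u) * sqrt (p v))" by simp
        also have "\<dots> \<le> (1/2) * ((9/8 * \<delta>) * sqrt (p v))"
          using K T_nonneg pu p_nonneg[OF v] p_nonneg[OF u(1)] psi(3)
          by (intro mult_mono mult_right_mono) (auto simp: divide_le_eq)
        also have "\<delta> / 8 * sqrt (p v) + (1/2) * ((9/8 * \<delta>) * sqrt (p v)) = 11/16 * (\<delta> * sqrt (p v))" by simp
        also have "\<dots> \<le> 3/4 * (\<delta> * sqrt (p v))"
          using psi(3) p_nonneg[OF v] by (intro mult_right_mono) auto
        finally show ?thesis by simp
      qed
      with u(1) show ?thesis by blast
    qed
    define C' where "C' = \<bar>C\<bar> + 1"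
    have C': "0 < C'" "cmod (\<phi> v) \<le> C' * sqrt (p v)" if "v \<in> D" for v
    proof -
      show "cmod (\<phi> v) \<le> C' * sqrt (p v)"
        using prem(2)[OF that] mult_right_mono[of C C' "sqrt (p v)"] p_nonneg[OF that]
        unfolding C'_def by fastforce
    qed (simp add: C'_def)
    \<comment> \<open>Iterative refinement: solving for the remaining residual and adding the
      correction gains a factor 3/4 each time, so no fixed point in a complete space is
      needed.\<close>
    have iter: "\<exists>u\<in>D. \<forall>v\<in>D. cmod (qq (Suc n) u v - \<phi> v) \<le> (3/4)^k * C' * sqrt (p v)" for k
    proof (induction k)
      case 0
      show ?case using zero_mem C'(2) by (intro bexI[of _ "\<lambda>x. 0"]) (auto simp: S.zero_left)
    next
      case (Suc k)
      then obtain u where u: "u \<in> D" "\<And>v. v \<in> D \<Longrightarrow> cmod (qq (Suc n) u v - \<phi> v) \<le> (3/4)^k * C' * sqrt (p v)"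
        by blast
      have al: "antilinear_on D (\<lambda>v. \<phi> v - qq (Suc n) u v)"
        using prem(1) u(1) unfolding antilinear_on_def
        by (auto simp: S.comb_right algebra_simps)
      have "cmod (\<phi> v - qq (Suc n) u v) \<le> (3/4)^k * C' * sqrt (p v)" if "v \<in> D" for v
        using u(2)[OF that] by (simp add: norm_minus_commute)
      from contr[OF al this] C'(1)[OF zero_mem] obtain w where w: "w \<in> D"
        "\<And>v. v \<in> D \<Longrightarrow> cmod (qq (Suc n) w v - (\<phi> v - qq (Suc n) u v)) \<le> 3/4 * ((3/4)^k * C') * sqrt (p v)"
        by auto
      show ?case
      proof (intro bexI ballI)
        show "(\<lambda>x. u x + w x) \<in> D" by (intro add_mem u w)
        fix v assume v: "v \<in> D"
        show "cmod (qq (Suc n) (\<lambda>x. u x + w x) v - \<phi> v) \<le> (3/4)^Suc k * C' * sqrt (p v)"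
          using w(2)[OF v] u(1) w(1) v by (simp add: S.add_left algebra_simps)
      qed
    qed
    from e have "0 < e / C'" using C'(1)[OF zero_mem] prem(3) by simp
    obtain k where k: "(3/4::real)^k < e / C'"
      using real_arch_pow_inv[of "e / C'" "3/4"] \<open>0 < e\<close> C'(1)[OF zero_mem] prem(3) by auto
    then have ke: "(3/4)^k * C' \<le> e" using C'(1)[OF zero_mem] by (simp add: pos_less_divide_eq)
    from iter[of k] obtain u where u: "u \<in> D"
      "\<And>v. v \<in> D \<Longrightarrow> cmod (qq (Suc n) u v - \<phi> v) \<le> (3/4)^k * C' * sqrt (p v)" by blast
    show ?case
      using u mult_right_mono[OF ke] p_nonneg by (metis order_trans real_sqrt_ge_zero)
  qed
  have "qq K = q" using K by (intro ext) (simp add: qq_def hp_def sk_def field_simps)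
  with main[of \<phi> C e K] phi C e show ?thesis by simp
qed

subsection \<open>Completeness of \<open>L\<^sub>2\<close>\<close>

lemma nn_integral_cmod_square:
  assumes "u \<in> L2 M"
  shows "(\<integral>\<^sup>+x. ennreal ((cmod (u x))\<^sup>2) \<partial>M) = ennreal ((l2_norm M u)\<^sup>2)"
  unfolding l2_norm_sq by (rule nn_integral_eq_integral[OF L2_square_integrable[OF assms]]) simp

lemma L2_I_nn_integral:
  assumes "u \<in> borel_measurable M" "(\<integral>\<^sup>+x. ennreal ((cmod (u x))\<^sup>2) \<partial>M) \<le> ennreal C"
  shows "u \<in> L2 M"
proof -
  have "(\<integral>\<^sup>+x. ennreal ((cmod (u x))\<^sup>2) \<partial>M) < \<infinity>"
    by (rule le_less_trans[OF assms(2)]) simp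
  then have "integrable M (\<lambda>x. (cmod (u x))\<^sup>2)"
    by (intro integrableI_bounded) (use assms(1) in simp_all)
  with assms(1) show ?thesis by (simp add: L2_def)
qed

lemma ennreal_term_le_suminf: "f k \<le> suminf f" for f :: "nat \<Rightarrow> ennreal"
  using sum_le_suminf[of f "{k}"] by simp

text \<open>The weight \<open>2 ^ k\<close> makes |d k| decay like \<open>2 ^ (- k / 2)\<close> as
  soon as the weighted sum is finite, so squares suffice for absolute summability.\<close>

lemma summable_of_weighted_squares:
  fixes d :: "nat \<Rightarrow> complex"
  assumes "(\<Sum>k. ennreal (2 ^ k * (cmod (d k))\<^sup>2)) < \<infinity>"
  shows "summable d"
proof -
  define C where "C = enn2real (\<Sum>k. ennreal (2 ^ k * (cmod (d k))\<^sup>2))"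
  have C: "(\<Sum>k. ennreal (2 ^ k * (cmod (d k))\<^sup>2)) = ennreal C" "0 \<le> C"
    unfolding C_def using ennreal_enn2real[OF assms[unfolded infinity_ennreal_def]] by (simp_all only: enn2real_nonneg)
  have "cmod (d k) \<le> sqrt C * (sqrt (1/2)) ^ k" for k
  proof -
    have "ennreal (2 ^ k * (cmod (d k))\<^sup>2) \<le> ennreal C"
      unfolding C(1)[symmetric] by (rule ennreal_term_le_suminf)
    then have "2 ^ k * (cmod (d k))\<^sup>2 \<le> C" using C(2) by simp
    then have "(cmod (d k))\<^sup>2 \<le> C * (1/2) ^ k" by (simp add: field_simps power_one_over)
    then have "sqrt ((cmod (d k))\<^sup>2) \<le> sqrt (C * (1/2) ^ k)" by (rule real_sqrt_le_mono)
    then show ?thesis by (simp add: real_sqrt_mult real_sqrt_power)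
  qed
  then have bd: "norm (d k) \<le> sqrt C * (sqrt (1/2)) ^ k" if "k \<ge> 0" for k by simp
  have "summable (\<lambda>k. sqrt C * (sqrt (1/2)) ^ k)"
    by (intro summable_mult summable_geometric) (simp add: real_sqrt_divide)
  then show ?thesis by (rule summable_comparison_test'[OF _ bd])
qed

text \<open>Riesz-Fischer: a rapidly Cauchy subsequence converges almost everywhere, and Fatou's
  lemma carries the Cauchy estimate over to the pointwise limit.\<close>

lemma L2_complete:
  assumes mem: "\<And>n. u n \<in> L2 M"
    and Cauchy: "\<And>e. 0 < e \<Longrightarrow> \<exists>N. \<forall>n\<ge>N. \<forall>m\<ge>N. l2_norm M (\<lambda>x. u n x - u m x) < e"
  obtains x where "x \<in> L2 M" "l2_tendsto M u x sequentially"
proof -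
  have "\<forall>k. \<exists>N. \<forall>n\<ge>N. \<forall>m\<ge>N. l2_norm M (\<lambda>x. u n x - u m x) < (1/2)^k"
    using Cauchy by simp
  from choice[OF this] obtain N where N: "\<And>k n m. n \<ge> N k \<Longrightarrow> m \<ge> N k \<Longrightarrow> l2_norm M (\<lambda>x. u n x - u m x) < (1/2)^k"
    by blast
  \<comment> \<open>The sum makes the index nondecreasing and at least every \<open>N k\<close>; the
    summand k makes it tend to infinity.\<close>
  define r where "r k = (\<Sum>j\<le>k. N j) + k" for k
  have rN: "N k \<le> r k" for k unfolding r_def by (simp add: member_le_sum trans_le_add1)
  have r_mono: "r k \<le> r (Suc k)" for k by (simp add: r_def)
  have r_ge: "k \<le> r k" for k by (simp add: r_def)
  define d where "d k x = u (r (Suc k)) x - u (r k) x" for k x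
  have dL2: "d k \<in> L2 M" for k unfolding d_def by (intro L2_diff mem)
  have dsmall: "(l2_norm M (d k))\<^sup>2 \<le> (1/4)^k" for k
  proof -
    have "N k \<le> r (Suc k)" using rN[of k] r_mono[of k] by linarith
    then have "l2_norm M (d k) \<le> (1/2)^k" unfolding d_def by (rule less_imp_le[OF N[OF _ rN]])
    then have "(l2_norm M (d k))\<^sup>2 \<le> ((1/2)^k)\<^sup>2" by (intro power_mono) auto
    also have "\<dots> = (1/4)^k" by (simp add: power_mult[symmetric] mult.commute[of k]) (simp add: power_mult power2_eq_square)
    finally show ?thesis .
  qed
  have meas [measurable]: "d k \<in> borel_measurable M" for k by (rule L2_measurable[OF dL2])
  have umeas [measurable]: "u k \<in> borel_measurable M" for k by (rule L2_measurable[OF mem])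
  have "(\<integral>\<^sup>+x. (\<Sum>k. ennreal (2 ^ k * (cmod (d k x))\<^sup>2)) \<partial>M)
      = (\<Sum>k. \<integral>\<^sup>+x. ennreal (2 ^ k * (cmod (d k x))\<^sup>2) \<partial>M)"
    by (rule nn_integral_suminf) measurable
  also have "\<dots> = (\<Sum>k. ennreal (2 ^ k * (l2_norm M (d k))\<^sup>2))"
  proof (rule arg_cong[where f=suminf], rule ext)
    fix k
    have "(\<integral>\<^sup>+x. ennreal (2 ^ k * (cmod (d k x))\<^sup>2) \<partial>M) = (\<integral>\<^sup>+x. ennreal (2 ^ k) * ennreal ((cmod (d k x))\<^sup>2) \<partial>M)"
      by (simp add: ennreal_mult)
    also have "\<dots> = ennreal (2 ^ k) * ennreal ((l2_norm M (d k))\<^sup>2)"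
      by (subst nn_integral_cmult) (auto simp: nn_integral_cmod_square[OF dL2])
    finally show "(\<integral>\<^sup>+x. ennreal (2 ^ k * (cmod (d k x))\<^sup>2) \<partial>M) = ennreal (2 ^ k * (l2_norm M (d k))\<^sup>2)"
      by (simp add: ennreal_mult)
  qed
  also have "\<dots> \<le> (\<Sum>k. ennreal ((1/2)^k))"
  proof (rule suminf_le)
    fix k
    have "2 ^ k * (l2_norm M (d k))\<^sup>2 \<le> 2 ^ k * (1/4)^k" by (intro mult_left_mono dsmall) auto
    also have "\<dots> = (2 * (1/4)) ^ k" by (rule power_mult_distrib[symmetric])
    finally show "ennreal (2 ^ k * (l2_norm M (d k))\<^sup>2) \<le> ennreal ((1/2)^k)"
      by (intro ennreal_leI) simp
  qed auto
  also have "\<dots> = ennreal (\<Sum>k. (1/2)^k)"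
    by (rule suminf_ennreal2) (auto intro!: summable_geometric)
  also have "\<dots> < \<infinity>" by simp
  finally have fin: "(\<integral>\<^sup>+x. (\<Sum>k. ennreal (2 ^ k * (cmod (d k x))\<^sup>2)) \<partial>M) < \<infinity>" .
  have conv: "AE x in M. convergent (\<lambda>k. u (r k) x)"
  proof -
    have "AE x in M. (\<Sum>k. ennreal (2 ^ k * (cmod (d k x))\<^sup>2)) \<noteq> \<infinity>"
      by (rule nn_integral_noteq_infinite) (use fin in auto)
    then show ?thesis
    proof eventually_elim
      fix x assume "(\<Sum>k. ennreal (2 ^ k * (cmod (d k x))\<^sup>2)) \<noteq> \<infinity>"
      then have "summable (\<lambda>k. d k x)" by (intro summable_of_weighted_squares) (simp add: less_top)
      then have "convergent (\<lambda>n. \<Sum>k<n. d k x)" by (simp add: summable_iff_convergent)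
      moreover have "(\<Sum>k<n. d k x) = u (r n) x - u (r 0) x" for n
        unfolding d_def by (rule sum_lessThan_telescope)
      ultimately have "convergent (\<lambda>n. u (r n) x - u (r 0) x)" by simp
      then show "convergent (\<lambda>k. u (r k) x)" by (simp add: convergent_diff_const_right_iff)
    qed
  qed
  define x where "x \<omega> = lim (\<lambda>k. u (r k) \<omega>)" for \<omega>
  have xm [measurable]: "x \<in> borel_measurable M"
    unfolding x_def by (rule borel_measurable_lim_metric) measurable
  \<comment> \<open>Fatou along the subsequence. Used with e = 1 it shows that x is in L2, and with
    e/2 that the whole sequence converges.\<close>
  have key: "(\<integral>\<^sup>+\<omega>. ennreal ((cmod (u n \<omega> - x \<omega>))\<^sup>2) \<partial>M) \<le> ennreal (e\<^sup>2)"
    if e: "0 < e" and n: "\<And>m. m \<ge> K \<Longrightarrow> l2_norm M (\<lambda>\<omega>. u n \<omega> - u m \<omega>) < e" for n e K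
  proof -
    have "(\<integral>\<^sup>+\<omega>. ennreal ((cmod (u n \<omega> - x \<omega>))\<^sup>2) \<partial>M)
       = (\<integral>\<^sup>+\<omega>. liminf (\<lambda>k. ennreal ((cmod (u n \<omega> - u (r k) \<omega>))\<^sup>2)) \<partial>M)"
    proof (rule nn_integral_cong_AE)
      show "AE \<omega> in M. ennreal ((cmod (u n \<omega> - x \<omega>))\<^sup>2) = liminf (\<lambda>k. ennreal ((cmod (u n \<omega> - u (r k) \<omega>))\<^sup>2))"
        using conv
      proof eventually_elim
        fix \<omega> assume "convergent (\<lambda>k. u (r k) \<omega>)"
        then have "(\<lambda>k. u (r k) \<omega>) \<longlonglongrightarrow> x \<omega>" unfolding x_def by (simp add: convergent_LIMSEQ_iff)
        then have "(\<lambda>k. ennreal ((cmod (u n \<omega> - u (r k) \<omega>))\<^sup>2)) \<longlonglongrightarrow> ennreal ((cmod (u n \<omega> - x \<omega>))\<^sup>2)"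
          by (intro tendsto_intros)
        then show "ennreal ((cmod (u n \<omega> - x \<omega>))\<^sup>2) = liminf (\<lambda>k. ennreal ((cmod (u n \<omega> - u (r k) \<omega>))\<^sup>2))"
          by (intro lim_imp_Liminf[symmetric]) auto
      qed
    qed
    also have "\<dots> \<le> liminf (\<lambda>k. \<integral>\<^sup>+\<omega>. ennreal ((cmod (u n \<omega> - u (r k) \<omega>))\<^sup>2) \<partial>M)"
      by (rule nn_integral_liminf) measurable
    also have "\<dots> \<le> liminf (\<lambda>k. ennreal (e\<^sup>2))"
    proof (rule Liminf_mono)
      show "\<forall>\<^sub>F k in sequentially. (\<integral>\<^sup>+\<omega>. ennreal ((cmod (u n \<omega> - u (r k) \<omega>))\<^sup>2) \<partial>M) \<le> ennreal (e\<^sup>2)"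
        using eventually_ge_at_top[of K]
      proof eventually_elim
        fix k assume "K \<le> k"
        then have "l2_norm M (\<lambda>\<omega>. u n \<omega> - u (r k) \<omega>) < e" by (intro n order_trans[OF _ r_ge])
        then have "(l2_norm M (\<lambda>\<omega>. u n \<omega> - u (r k) \<omega>))\<^sup>2 \<le> e\<^sup>2" by (intro power_mono) auto
        then show "(\<integral>\<^sup>+\<omega>. ennreal ((cmod (u n \<omega> - u (r k) \<omega>))\<^sup>2) \<partial>M) \<le> ennreal (e\<^sup>2)"
          by (simp add: nn_integral_cmod_square[OF L2_diff[OF mem mem]] ennreal_leI)
      qed
    qed
    also have "\<dots> = ennreal (e\<^sup>2)" by (simp add: Liminf_const)
    finally show ?thesis .
  qed
  obtain K where K: "\<And>n m. n \<ge> K \<Longrightarrow> m \<ge> K \<Longrightarrow> l2_norm M (\<lambda>x. u n x - u m x) < 1"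
    using Cauchy[of 1] by auto
  have "(\<lambda>\<omega>. u K \<omega> - x \<omega>) \<in> L2 M"
    by (rule L2_I_nn_integral[OF _ key[of 1 K]]) (use K in auto)
  from L2_diff[OF mem[of K] this] have xL2: "x \<in> L2 M" by simp
  have "l2_tendsto M u x sequentially"
    unfolding l2_tendsto_def
  proof (rule LIMSEQ_I)
    fix e :: real assume e: "0 < e"
    then obtain K where K: "\<And>n m. n \<ge> K \<Longrightarrow> m \<ge> K \<Longrightarrow> l2_norm M (\<lambda>x. u n x - u m x) < e / 2"
      using Cauchy[of "e / 2"] by auto
    have "l2_norm M (\<lambda>\<omega>. u n \<omega> - x \<omega>) < e" if n: "n \<ge> K" for n
    proof -
      have "ennreal ((l2_norm M (\<lambda>\<omega>. u n \<omega> - x \<omega>))\<^sup>2) \<le> ennreal ((e / 2)\<^sup>2)"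
        unfolding nn_integral_cmod_square[OF L2_diff[OF mem xL2], symmetric]
        by (rule key[where K=K]) (use e K n in auto)
      then have "(l2_norm M (\<lambda>\<omega>. u n \<omega> - x \<omega>))\<^sup>2 \<le> (e / 2)\<^sup>2" by (simp add: ennreal_le_iff)
      then have "l2_norm M (\<lambda>\<omega>. u n \<omega> - x \<omega>) \<le> e / 2" by (rule power2_le_imp_le) (use e in simp)
      then show ?thesis using e by simp
    qed
    then show "\<exists>K. \<forall>n\<ge>K. norm (l2_norm M (\<lambda>\<omega>. u n \<omega> - x \<omega>) - 0) < e" by auto
  qed
  with xL2 show ?thesis by (rule that)
qed

lemma l2_tendsto_inner_both:
  assumes "l2_tendsto M u x F" "\<And>n. u n \<in> L2 M" "x \<in> L2 M"
    and "l2_tendsto M v y F" "\<And>n. v n \<in> L2 M" "y \<in> L2 M"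
  shows "((\<lambda>n. l2_inner M (u n) (v n)) \<longlongrightarrow> l2_inner M x y) F"
proof -
  have A: "((\<lambda>n. l2_inner M (\<lambda>\<omega>. u n \<omega> - x \<omega>) (v n)) \<longlongrightarrow> 0) F"
  proof (rule tendsto_norm_zero_cancel, rule tendsto_sandwich)
    show "((\<lambda>n. 0) \<longlongrightarrow> (0::real)) F" by simp
    have "((\<lambda>n. l2_norm M (\<lambda>\<omega>. u n \<omega> - x \<omega>) * l2_norm M (v n)) \<longlongrightarrow> 0 * l2_norm M y) F"
      using assms(1) l2_tendsto_norm[OF assms(4-6)] unfolding l2_tendsto_def by (intro tendsto_intros)
    then show "((\<lambda>n. l2_norm M (\<lambda>\<omega>. u n \<omega> - x \<omega>) * l2_norm M (v n)) \<longlongrightarrow> 0) F" by simp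
    show "\<forall>\<^sub>F n in F. cmod (l2_inner M (\<lambda>\<omega>. u n \<omega> - x \<omega>) (v n)) \<le> l2_norm M (\<lambda>\<omega>. u n \<omega> - x \<omega>) * l2_norm M (v n)"
      by (intro always_eventually allI l2_inner_bound L2_diff assms)
  qed simp
  have "((\<lambda>n. l2_inner M (\<lambda>\<omega>. u n \<omega> - x \<omega>) (v n) + l2_inner M x (v n)) \<longlongrightarrow> 0 + l2_inner M x y) F"
    by (intro tendsto_add A l2_tendsto_inner(1)[OF assms(4-6,3)])
  then show ?thesis using assms by (simp add: l2_inner_diff_left)
qed

section \<open>The operator associated with a sectorial form\<close>

locale l2_form = sect_form D a T for D :: "('a \<Rightarrow> complex) set" and a T +
  fixes M :: "'a measure"
  assumes D_L2: "D \<subseteq> L2 M"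
begin

definition shift :: "real \<Rightarrow> 'a form" where
  "shift \<mu> u v = a u v + complex_of_real \<mu> * l2_inner M u v"

text \<open>Approximate solution of \<open>(\<mu> + A) U = g\<close> inside the form domain: the
  residual is at most e in the norm dual to the shifted form. An exact solution usually has no
  representative in \<open>D\<close>, only an L2 limit of such U.\<close>

definition approximates :: "real \<Rightarrow> ('a \<Rightarrow> complex) \<Rightarrow> real \<Rightarrow> ('a \<Rightarrow> complex) \<Rightarrow> bool" where
  "approximates \<mu> g e U \<longleftrightarrow> U \<in> D \<and>
     (\<forall>w\<in>D. cmod (shift \<mu> U w - l2_inner M g w) \<le> e * sqrt (Re (shift \<mu> w w)))"

lemma memL2: "u \<in> D \<Longrightarrow> u \<in> L2 M"
  using D_L2 by blast

lemma approximates_mem: "approximates \<mu> g e U \<Longrightarrow> U \<in> D"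
  by (simp add: approximates_def)

lemma approximatesD:
  "approximates \<mu> g e U \<Longrightarrow> w \<in> D \<Longrightarrow> cmod (shift \<mu> U w - l2_inner M g w) \<le> e * sqrt (Re (shift \<mu> w w))"
  by (simp add: approximates_def)

lemma Re_shift: "Re (shift \<mu> u u) = p u + \<mu> * (l2_norm M u)\<^sup>2"
  by (simp add: shift_def l2_inner_self)

lemma sect_form_shift: "0 \<le> \<mu> \<Longrightarrow> sect_form D (shift \<mu>) T"
  unfolding shift_def[abs_def] using sect_form_add_inner[OF sect_form_axioms D_L2] .

lemma shift_norm_bound:
  assumes "u \<in> D" "0 < \<mu>"
  shows "l2_norm M u \<le> sqrt (Re (shift \<mu> u u)) / sqrt \<mu>"
proof -
  have "\<mu> * (l2_norm M u)\<^sup>2 \<le> Re (shift \<mu> u u)" using p_nonneg[OF assms(1)] by (simp add: Re_shift)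
  then have "sqrt (\<mu> * (l2_norm M u)\<^sup>2) \<le> sqrt (Re (shift \<mu> u u))" by simp
  then show ?thesis using assms by (simp add: real_sqrt_mult pos_le_divide_eq mult.commute)
qed

lemma antilinear_inner: "g \<in> L2 M \<Longrightarrow> antilinear_on D (l2_inner M g)"
  unfolding antilinear_on_def using memL2 by (auto intro!: l2_inner_comb_right)

lemma inner_bound_shift:
  assumes "g \<in> L2 M" "w \<in> D" "0 < \<mu>"
  shows "cmod (l2_inner M g w) \<le> (l2_norm M g / sqrt \<mu>) * sqrt (Re (shift \<mu> w w))"
proof -
  have "cmod (l2_inner M g w) \<le> l2_norm M g * l2_norm M w"
    by (intro l2_inner_bound assms memL2)
  also have "\<dots> \<le> l2_norm M g * (sqrt (Re (shift \<mu> w w)) / sqrt \<mu>)"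
    by (intro mult_left_mono shift_norm_bound assms) auto
  finally show ?thesis by simp
qed

lemma approximates_exists:
  assumes "g \<in> L2 M" "0 < \<mu>" "0 < e"
  obtains U where "approximates \<mu> g e U"
  using approx_Lax_Milgram[OF sect_form_shift antilinear_inner[OF assms(1)] inner_bound_shift[OF assms(1) _ assms(2)] assms(3)]
    assms(2) unfolding approximates_def by (metis less_imp_le)

lemma approximates_diff:
  assumes "approximates \<mu> g e U" "approximates \<mu> h e' V" "0 < \<mu>" "g \<in> L2 M" "h \<in> L2 M"
  shows "approximates \<mu> (\<lambda>x. g x - h x) (e + e') (\<lambda>x. U x - V x)"
proof -
  interpret S: sect_form D "shift \<mu>" T by (rule sect_form_shift) (use assms in simp)
  have UV: "U \<in> D" "V \<in> D" using assms by (auto simp: approximates_def)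
  show ?thesis unfolding approximates_def
  proof (intro conjI ballI)
    show "(\<lambda>x. U x - V x) \<in> D" by (intro diff_mem UV)
    fix w assume w: "w \<in> D"
    have "cmod (shift \<mu> (\<lambda>x. U x - V x) w - l2_inner M (\<lambda>x. g x - h x) w)
        = cmod ((shift \<mu> U w - l2_inner M g w) - (shift \<mu> V w - l2_inner M h w))"
      by (simp only: S.diff_left[OF UV w] l2_inner_diff_left[OF assms(4,5) memL2[OF w]] algebra_simps)
    also have "\<dots> \<le> cmod (shift \<mu> U w - l2_inner M g w) + cmod (shift \<mu> V w - l2_inner M h w)"
      by (rule norm_triangle_ineq4)
    also have "\<dots> \<le> e * sqrt (Re (shift \<mu> w w)) + e' * sqrt (Re (shift \<mu> w w))"
      by (rule add_mono[OF approximatesD[OF assms(1) w] approximatesD[OF assms(2) w]])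
    finally show "cmod (shift \<mu> (\<lambda>x. U x - V x) w - l2_inner M (\<lambda>x. g x - h x) w)
        \<le> (e + e') * sqrt (Re (shift \<mu> w w))" by (simp add: distrib_right)
  qed
qed

lemma approximates_zero_bound:
  assumes "approximates \<mu> (\<lambda>x. 0) e U" "0 < \<mu>" "0 \<le> e"
  shows "Re (shift \<mu> U U) \<le> e\<^sup>2"
proof -
  interpret S: sect_form D "shift \<mu>" T by (rule sect_form_shift) (use assms in simp)
  have U: "U \<in> D" using assms by (simp add: approximates_def)
  have "cmod (shift \<mu> U U) \<le> e * sqrt (Re (shift \<mu> U U))"
    using approximatesD[OF assms(1) U] by (simp add: l2_inner_def)
  then show ?thesis by (rule S.p_le_of_functional[OF U _ assms(3)])
qed

lemma approximates_bound:
  assumes "approximates \<mu> g e U" "0 < \<mu>" "0 \<le> e" "g \<in> L2 M"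
  shows "Re (shift \<mu> U U) \<le> (e + l2_norm M g / sqrt \<mu>)\<^sup>2"
proof -
  interpret S: sect_form D "shift \<mu>" T by (rule sect_form_shift) (use assms in simp)
  have U: "U \<in> D" using assms by (simp add: approximates_def)
  have "cmod (shift \<mu> U U) \<le> cmod (shift \<mu> U U - l2_inner M g U) + cmod (l2_inner M g U)"
    using norm_triangle_ineq[of "shift \<mu> U U - l2_inner M g U" "l2_inner M g U"] by simp
  also have "\<dots> \<le> e * sqrt (Re (shift \<mu> U U)) + (l2_norm M g / sqrt \<mu>) * sqrt (Re (shift \<mu> U U))"
    by (rule add_mono[OF approximatesD[OF assms(1) U] inner_bound_shift[OF assms(4) U assms(2)]])
  finally have "cmod (shift \<mu> U U) \<le> (e + l2_norm M g / sqrt \<mu>) * sqrt (Re (shift \<mu> U U))"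
    by (simp add: distrib_right)
  then show ?thesis by (rule S.p_le_of_functional[OF U]) (use assms in simp)
qed

text \<open>Differences approximately solve the equation with right-hand side 0, so they are small
  in the shifted form norm; the shift \<mu> > 0 transfers this to L2, the only space in which a
  limit is available.\<close>

lemma approximates_limit:
  assumes "\<And>n. approximates \<mu> g (1 / real (Suc n)) (U n)" "0 < \<mu>" "g \<in> L2 M"
  obtains x where "x \<in> L2 M" "l2_tendsto M U x sequentially"
proof (rule L2_complete)
  show "U n \<in> L2 M" for n using assms(1)[of n] memL2 by (simp add: approximates_def)
  fix e :: real assume e: "0 < e"
  obtain N where N: "inverse (real (Suc N)) < e * sqrt \<mu> / 2"
    using reals_Archimedean[of "e * sqrt \<mu> / 2"] e assms by auto
  have "l2_norm M (\<lambda>x. U n x - U m x) < e" if nm: "n \<ge> N" "m \<ge> N" for n m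
  proof -
    have A: "approximates \<mu> (\<lambda>x. 0) (1 / real (Suc n) + 1 / real (Suc m)) (\<lambda>x. U n x - U m x)"
      using approximates_diff[OF assms(1) assms(1) assms(2,3,3), of n m] by simp
    have "l2_norm M (\<lambda>x. U n x - U m x) \<le> sqrt (Re (shift \<mu> (\<lambda>x. U n x - U m x) (\<lambda>x. U n x - U m x))) / sqrt \<mu>"
      using A by (intro shift_norm_bound assms) (simp add: approximates_def)
    also have "\<dots> \<le> sqrt ((1 / real (Suc n) + 1 / real (Suc m))\<^sup>2) / sqrt \<mu>"
      by (intro divide_right_mono real_sqrt_le_mono approximates_zero_bound[OF A]) (use assms in auto)
    also have "\<dots> = (1 / real (Suc n) + 1 / real (Suc m)) / sqrt \<mu>" by simp
    also have "\<dots> \<le> (inverse (real (Suc N)) + inverse (real (Suc N))) / sqrt \<mu>"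
      unfolding inverse_eq_divide
      by (intro divide_right_mono add_mono divide_left_mono) (use nm assms in auto)
    also have "\<dots> < (e * sqrt \<mu> / 2 + e * sqrt \<mu> / 2) / sqrt \<mu>"
      by (intro divide_strict_right_mono add_strict_mono N) (use assms in auto)
    also have "\<dots> = e" using assms by simp
    finally show ?thesis .
  qed
  then show "\<exists>N. \<forall>n\<ge>N. \<forall>m\<ge>N. l2_norm M (\<lambda>x. U n x - U m x) < e" by blast
qed (rule that)

text \<open>The test functions may vary with n: bounded energy is enough, because the residual tends
  to 0 in the dual norm. This is the substitute for weak convergence in the form domain.\<close>

lemma approximates_tendsto:
  assumes U: "\<And>n. approximates \<mu> g (1 / real (Suc n)) (U n)" and mu: "0 < \<mu>" and g: "g \<in> L2 M"
    and x: "x \<in> L2 M" "l2_tendsto M U x sequentially"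
    and W: "\<And>n. W n \<in> D" "\<And>n. p (W n) \<le> B" "w \<in> L2 M" "l2_tendsto M W w sequentially"
  shows "(\<lambda>n. shift \<mu> (U n) (W n)) \<longlonglongrightarrow> l2_inner M g w"
    and "(\<lambda>n. a (U n) (W n)) \<longlonglongrightarrow> l2_inner M (\<lambda>y. g y - complex_of_real \<mu> * x y) w"
proof -
  have UD: "U n \<in> D" for n using U by (simp add: approximates_def)
  have "(\<lambda>n. l2_norm M (W n)) \<longlonglongrightarrow> l2_norm M w"
    using l2_tendsto_norm[OF W(4) memL2[OF W(1)] W(3)] .
  from convergent_imp_Bseq[OF convergentI[OF this]] obtain K where K: "\<And>n. l2_norm M (W n) \<le> K"
    unfolding Bseq_def by (auto simp: norm_ge_zero)
  have bd: "Re (shift \<mu> (W n) (W n)) \<le> B + \<mu> * K\<^sup>2" for n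
    unfolding Re_shift using K[of n] W(2)[of n] mu by (intro add_mono mult_left_mono power_mono) auto
  have A: "(\<lambda>n. shift \<mu> (U n) (W n) - l2_inner M g (W n)) \<longlonglongrightarrow> 0"
  proof (rule tendsto_norm_zero_cancel, rule tendsto_sandwich)
    show "(\<lambda>n. 0) \<longlonglongrightarrow> (0::real)" by simp
    show "(\<lambda>n. (1 / real (Suc n)) * sqrt (B + \<mu> * K\<^sup>2)) \<longlonglongrightarrow> 0"
      using LIMSEQ_inverse_real_of_nat by (intro tendsto_mult_left_zero) (simp add: inverse_eq_divide)
    show "\<forall>\<^sub>F n in sequentially. cmod (shift \<mu> (U n) (W n) - l2_inner M g (W n)) \<le> (1 / real (Suc n)) * sqrt (B + \<mu> * K\<^sup>2)"
    proof (intro always_eventually allI)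
      fix n
      have "cmod (shift \<mu> (U n) (W n) - l2_inner M g (W n)) \<le> (1 / real (Suc n)) * sqrt (Re (shift \<mu> (W n) (W n)))"
        by (rule approximatesD[OF U W(1)])
      also have "\<dots> \<le> (1 / real (Suc n)) * sqrt (B + \<mu> * K\<^sup>2)"
        by (intro mult_left_mono real_sqrt_le_mono bd) auto
      finally show "cmod (shift \<mu> (U n) (W n) - l2_inner M g (W n)) \<le> (1 / real (Suc n)) * sqrt (B + \<mu> * K\<^sup>2)" .
    qed
  qed simp
  from tendsto_add[OF A l2_tendsto_inner(1)[OF W(4) memL2[OF W(1)] W(3) g]]
  show S: "(\<lambda>n. shift \<mu> (U n) (W n)) \<longlonglongrightarrow> l2_inner M g w" by simp
  have "(\<lambda>n. shift \<mu> (U n) (W n) - complex_of_real \<mu> * l2_inner M (U n) (W n))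
      \<longlonglongrightarrow> l2_inner M g w - complex_of_real \<mu> * l2_inner M x w"
    by (intro tendsto_diff S tendsto_mult tendsto_const
        l2_tendsto_inner_both[OF x(2) memL2[OF UD] x(1) W(4) memL2[OF W(1)] W(3)])
  moreover have "l2_inner M (\<lambda>y. g y - complex_of_real \<mu> * x y) w = l2_inner M g w - complex_of_real \<mu> * l2_inner M x w"
    using l2_inner_comb_left[OF g x(1) W(3), of 1 "- complex_of_real \<mu>"] by simp
  ultimately show "(\<lambda>n. a (U n) (W n)) \<longlonglongrightarrow> l2_inner M (\<lambda>y. g y - complex_of_real \<mu> * x y) w"
    by (simp add: shift_def)
qed

lemma approximates_p_bounded:
  assumes U: "\<And>n. approximates \<mu> g (1 / real (Suc n)) (U n)" and mu: "0 < \<mu>" and g: "g \<in> L2 M"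
  shows "p (U n) \<le> (1 + l2_norm M g / sqrt \<mu>)\<^sup>2"
proof -
  have "p (U n) \<le> Re (shift \<mu> (U n) (U n))" using mu by (simp add: Re_shift)
  also have "\<dots> \<le> (1 / real (Suc n) + l2_norm M g / sqrt \<mu>)\<^sup>2"
    by (intro approximates_bound U mu g) auto
  also have "\<dots> \<le> (1 + l2_norm M g / sqrt \<mu>)\<^sup>2"
    using mu by (intro power_mono add_mono) auto
  finally show ?thesis .
qed

text \<open>Says that \<open>(\<mu> + A) x = g\<close>; since g is arbitrary,
  \<open>\<mu> + A\<close> is onto.\<close>

lemma approximates_form_operator:
  assumes U: "\<And>n. approximates \<mu> g (1 / real (Suc n)) (U n)" and mu: "0 < \<mu>" and g: "g \<in> L2 M"
    and x: "x \<in> L2 M" "l2_tendsto M U x sequentially"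
  shows "(x, \<lambda>y. g y - complex_of_real \<mu> * x y) \<in> form_operator M D a"
  unfolding form_operator_def
proof (intro CollectI case_prodI conjI exI[of _ U] allI ballI)
  show "U n \<in> D" for n using U by (simp add: approximates_def)
  show "(\<lambda>y. g y - complex_of_real \<mu> * x y) \<in> L2 M" by (intro L2_diff L2_cmult g x)
  have "0 \<le> p (U n)" for n using U by (intro p_nonneg) (simp add: approximates_def)
  then show "bounded (range (\<lambda>n. p (U n)))"
    using approximates_p_bounded[OF U mu g] by (intro boundedI[of _ "(1 + l2_norm M g / sqrt \<mu>)\<^sup>2"]) auto
  fix v assume v: "v \<in> D"
  show "(\<lambda>n. a (U n) v) \<longlonglongrightarrow> l2_inner M (\<lambda>y. g y - complex_of_real \<mu> * x y) v"
    by (rule approximates_tendsto(2)[OF U mu g x, of "\<lambda>n. v" "p v" v])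
       (use v memL2 in \<open>auto simp: l2_tendsto_def\<close>)
qed (use x in auto)

text \<open>Testing against approximate solutions of the adjoint problem shows that \<open>\<mu> + A\<close> is
  injective, so every element of the graph comes from the approximate Lax--Milgram theorem.\<close>

lemma form_operator_injective:
  assumes V: "\<And>n. V n \<in> D" "\<And>n. p (V n) \<le> B" and y: "y \<in> L2 M" "l2_tendsto M V y sequentially"
    and lim: "\<And>v. v \<in> D \<Longrightarrow> (\<lambda>n. shift \<mu> (V n) v) \<longlonglongrightarrow> 0" and mu: "0 < \<mu>"
  shows "l2_norm M y = 0"
proof -
  interpret S: sect_form D "shift \<mu>" T by (rule sect_form_shift) (use mu in simp)
  have "(\<lambda>n. l2_norm M (V n)) \<longlonglongrightarrow> l2_norm M y"
    using l2_tendsto_norm[OF y(2) memL2[OF V(1)] y(1)] .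
  from convergent_imp_Bseq[OF convergentI[OF this]] obtain K where K: "\<And>n. l2_norm M (V n) \<le> K"
    unfolding Bseq_def by (auto simp: norm_ge_zero)
  have bd: "Re (shift \<mu> (V n) (V n)) \<le> B + \<mu> * K\<^sup>2" for n
    unfolding Re_shift using K[of n] V(2)[of n] mu by (intro add_mono mult_left_mono power_mono) auto
  have le: "(l2_norm M y)\<^sup>2 \<le> e * sqrt (B + \<mu> * K\<^sup>2)" if e: "0 < e" for e
  proof -
    \<comment> \<open>v approximately solves the adjoint equation with right-hand side y, so testing
      the vanishing limit against v recovers the norm of y.\<close>
    have "\<exists>v\<in>D. \<forall>w\<in>D. cmod (cnj (shift \<mu> w v) - l2_inner M y w) \<le> e * sqrt (Re (cnj (shift \<mu> w w)))"
      by (rule approx_Lax_Milgram[OF sect_form_adjoint[OF S.sect_form_axioms] antilinear_inner[OF y(1)] _ e,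
            where C="l2_norm M y / sqrt \<mu>"]) (use inner_bound_shift[OF y(1) _ mu] in simp)
    then obtain v where v: "v \<in> D" "\<And>w. w \<in> D \<Longrightarrow> cmod (cnj (shift \<mu> w v) - l2_inner M y w) \<le> e * sqrt (Re (shift \<mu> w w))"
      by auto
    \<comment> \<open>The form term dies because \<open>shift \<mu> (V n) v\<close> tends to 0 for
      the fixed v, and what remains is the squared norm of y.\<close>
    have "(\<lambda>n. cmod (cnj (shift \<mu> (V n) v) - l2_inner M y (V n))) \<longlonglongrightarrow> cmod (cnj 0 - l2_inner M y y)"
      by (intro tendsto_intros lim v l2_tendsto_inner(1)[OF y(2) memL2[OF V(1)] y(1) y(1)])
    moreover have "cmod (cnj (shift \<mu> (V n) v) - l2_inner M y (V n)) \<le> e * sqrt (B + \<mu> * K\<^sup>2)" for n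
      using v(2)[OF V(1)] bd[of n] e by (smt (verit, best) mult_left_mono real_sqrt_le_mono)
    ultimately have "cmod (cnj 0 - l2_inner M y y) \<le> e * sqrt (B + \<mu> * K\<^sup>2)"
      by (intro LIMSEQ_le_const2) auto
    then show ?thesis by (simp add: l2_inner_self norm_power)
  qed
  have "(\<lambda>n. 1 / real (Suc n) * sqrt (B + \<mu> * K\<^sup>2)) \<longlonglongrightarrow> 0"
    using LIMSEQ_inverse_real_of_nat by (intro tendsto_mult_left_zero) (simp add: inverse_eq_divide)
  then have "(l2_norm M y)\<^sup>2 \<le> 0"
  proof (rule LIMSEQ_le_const, intro exI allI impI)
    show "(l2_norm M y)\<^sup>2 \<le> 1 / real (Suc n) * sqrt (B + \<mu> * K\<^sup>2)" for n
      by (rule le) simp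
  qed
  then show ?thesis by simp
qed

text \<open>The sequence in the definition of the operator has residuals that tend to 0 only for
  each fixed test function. It may be exchanged for one with dual-norm control, because injectivity
  of \<open>\<mu> + A\<close> forces the two L2 limits to agree.\<close>

lemma form_operator_approximable:
  assumes xf: "(x, f) \<in> form_operator M D a" and mu: "0 < \<mu>"
  obtains U where "\<And>n. approximates \<mu> (\<lambda>y. f y + complex_of_real \<mu> * x y) (1 / real (Suc n)) (U n)"
    "l2_tendsto M U x sequentially"
proof -
  interpret S: sect_form D "shift \<mu>" T by (rule sect_form_shift) (use mu in simp)
  let ?g = "\<lambda>y. f y + complex_of_real \<mu> * x y"
  from xf obtain V where x: "x \<in> L2 M" and f: "f \<in> L2 M" and V: "\<And>n. V n \<in> D"
    "bounded (range (\<lambda>n. p (V n)))" "l2_tendsto M V x sequentially"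
    "\<And>v. v \<in> D \<Longrightarrow> (\<lambda>n. a (V n) v) \<longlonglongrightarrow> l2_inner M f v"
    unfolding form_operator_def by auto
  have g: "?g \<in> L2 M" by (intro L2_add L2_cmult x f)
  have "\<forall>n. \<exists>U. approximates \<mu> ?g (1 / real (Suc n)) U"
    using approximates_exists[OF g mu] by (metis of_nat_0_less_iff zero_less_Suc zero_less_divide_1_iff)
  from choice[OF this] obtain U where U: "\<And>n. approximates \<mu> ?g (1 / real (Suc n)) (U n)" by blast
  have UD: "U n \<in> D" for n using U by (simp add: approximates_def)
  obtain x' where x': "x' \<in> L2 M" "l2_tendsto M U x' sequentially"
    using approximates_limit[OF U mu g] .
  obtain BV where BV: "\<And>n. p (V n) \<le> BV" using V(2) unfolding bounded_iff by (auto dest: abs_le_D1)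
  let ?B = "2 * (1 + l2_norm M ?g / sqrt \<mu>)\<^sup>2 + 2 * BV"
  have "l2_norm M (\<lambda>\<omega>. x' \<omega> - x \<omega>) = 0"
  proof (rule form_operator_injective[OF _ _ _ _ _ mu])
    show "(\<lambda>\<omega>. U n \<omega> - V n \<omega>) \<in> D" for n by (intro diff_mem UD V)
    show "p (\<lambda>\<omega>. U n \<omega> - V n \<omega>) \<le> ?B" for n
      using p_diff_le[OF UD[of n] V(1)[of n]] approximates_p_bounded[OF U mu g, of n] BV[of n] by argo
    show "(\<lambda>\<omega>. x' \<omega> - x \<omega>) \<in> L2 M" by (intro L2_diff x x')
    show "l2_tendsto M (\<lambda>n \<omega>. U n \<omega> - V n \<omega>) (\<lambda>\<omega>. x' \<omega> - x \<omega>) sequentially"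
      using l2_tendsto_comb[OF x'(2) memL2[OF UD] x'(1) V(3) memL2[OF V(1)] x, of 1 "-1"] by simp
    fix v assume v: "v \<in> D"
    have "(\<lambda>n. shift \<mu> (V n) v) \<longlonglongrightarrow> l2_inner M f v + complex_of_real \<mu> * l2_inner M x v"
      unfolding shift_def by (intro tendsto_intros V(4) v l2_tendsto_inner(2)[OF V(3) memL2[OF V(1)] x memL2[OF v]])
    also have "l2_inner M f v + complex_of_real \<mu> * l2_inner M x v = l2_inner M ?g v"
      using l2_inner_comb_left[OF f x memL2[OF v], of 1 "complex_of_real \<mu>"] by simp
    finally have 1: "(\<lambda>n. shift \<mu> (V n) v) \<longlonglongrightarrow> l2_inner M ?g v" .
    have 2: "(\<lambda>n. shift \<mu> (U n) v) \<longlonglongrightarrow> l2_inner M ?g v"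
      by (rule approximates_tendsto(1)[OF U mu g x', of "\<lambda>n. v" "p v" v])
         (use v memL2 in \<open>auto simp: l2_tendsto_def\<close>)
    from tendsto_diff[OF 2 1] show "(\<lambda>n. shift \<mu> (\<lambda>\<omega>. U n \<omega> - V n \<omega>) v) \<longlonglongrightarrow> 0"
      by (simp add: S.diff_left[OF UD V(1) v])
  qed
  then have zero: "l2_norm M (\<lambda>\<omega>. x' \<omega> - x \<omega>) = 0" .
  have "l2_tendsto M U x sequentially"
    unfolding l2_tendsto_def
  proof (rule tendsto_sandwich)
    show "(\<lambda>n. 0) \<longlonglongrightarrow> (0::real)" by simp
    show "(\<lambda>n. l2_norm M (\<lambda>\<omega>. U n \<omega> - x' \<omega>)) \<longlonglongrightarrow> 0" using x'(2) by (simp add: l2_tendsto_def)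
    show "\<forall>\<^sub>F n in sequentially. l2_norm M (\<lambda>\<omega>. U n \<omega> - x \<omega>) \<le> l2_norm M (\<lambda>\<omega>. U n \<omega> - x' \<omega>)"
      using l2_norm_diff_triangle[OF memL2[OF UD] x'(1) x] zero by simp
  qed simp
  with U show ?thesis by (rule that)
qed

end

section \<open>Representation of the relaxed form by sequences\<close>

lemma sector_bounds:
  assumes "z \<in> sector \<theta>" "0 \<le> \<theta>" "\<theta> < pi / 2"
  shows "0 \<le> Re z" "\<bar>Im z\<bar> \<le> tan \<theta> * Re z"
proof -
  obtain r \<alpha> where z: "z = complex_of_real r * cis \<alpha>" "0 \<le> r" "\<bar>\<alpha>\<bar> \<le> \<theta>"
    using assms(1) unfolding sector_def by blast
  have al: "- (pi / 2) < \<alpha>" "\<alpha> < pi / 2" using z assms by linarith+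
  have c: "0 < cos \<alpha>" by (rule cos_gt_zero_pi) (use al in auto)
  show "0 \<le> Re z" using z c by simp
  have up: "tan \<beta> \<le> tan \<theta>" if "- (pi / 2) < \<beta>" "\<beta> \<le> \<theta>" for \<beta>
    using tan_mono_le[OF that assms(3)] .
  have "tan \<alpha> \<le> tan \<theta>" "- tan \<alpha> \<le> tan \<theta>"
    using up[of \<alpha>] up[of "- \<alpha>"] al z by auto
  then have "\<bar>tan \<alpha>\<bar> \<le> tan \<theta>" by linarith
  then have "\<bar>sin \<alpha>\<bar> \<le> tan \<theta> * cos \<alpha>" using c by (simp add: tan_def abs_divide divide_le_eq)
  then have "r * \<bar>sin \<alpha>\<bar> \<le> r * (tan \<theta> * cos \<alpha>)" using z(2) by (intro mult_left_mono)
  then show "\<bar>Im z\<bar> \<le> tan \<theta> * Re z" using z by (simp add: abs_mult mult_ac)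
qed

context l2_form
begin

text \<open>Bounds the energy of one approximate solution by a quantity that depends on its L2 limit
  x only; for the relaxed form this quantity is the shifted energy of x. The comparison is with
  finer solutions, whose energies converge to it.\<close>

lemma form_operator_p_bound:
  assumes xf: "(x, f) \<in> form_operator M D a" and mu: "0 < \<mu>" and e: "0 \<le> e"
    and U: "approximates \<mu> (\<lambda>y. f y + complex_of_real \<mu> * x y) e U"
  shows "Re (shift \<mu> U U) \<le> 2 * e\<^sup>2 + 2 * Re (l2_inner M (\<lambda>y. f y + complex_of_real \<mu> * x y) x)"
proof -
  let ?g = "\<lambda>y. f y + complex_of_real \<mu> * x y"
  interpret S: sect_form D "shift \<mu>" T by (rule sect_form_shift) (use mu in simp)
  have x: "x \<in> L2 M" "f \<in> L2 M" using xf by (auto simp: form_operator_def)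
  have g: "?g \<in> L2 M" by (intro L2_add L2_cmult x)
  obtain W where W: "\<And>n. approximates \<mu> ?g (1 / real (Suc n)) (W n)" "l2_tendsto M W x sequentially"
    using form_operator_approximable[OF xf mu] by blast
  note WD = approximates_mem[OF W(1)] and UD = approximates_mem[OF U]
  have "Re (shift \<mu> U U) \<le> 2 * (e + 1 / real (Suc n))\<^sup>2 + 2 * Re (shift \<mu> (W n) (W n))" for n
  proof -
    have "Re (shift \<mu> (\<lambda>x. U x - W n x) (\<lambda>x. U x - W n x)) \<le> (e + 1 / real (Suc n))\<^sup>2"
      by (rule approximates_zero_bound) (use approximates_diff[OF U W(1) mu g g] mu e in auto)
    then show ?thesis
      using S.p_add_le[OF diff_mem[OF UD WD[of n]] WD[of n]] by simp
  qed
  moreover have "(\<lambda>n. 2 * (e + 1 / real (Suc n))\<^sup>2 + 2 * Re (shift \<mu> (W n) (W n)))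
      \<longlonglongrightarrow> 2 * (e + 0)\<^sup>2 + 2 * Re (l2_inner M ?g x)"
  proof (intro tendsto_intros)
    show "(\<lambda>n. 1 / real (Suc n)) \<longlonglongrightarrow> 0"
      using LIMSEQ_inverse_real_of_nat by (simp add: inverse_eq_divide)
    show "(\<lambda>n. shift \<mu> (W n) (W n)) \<longlonglongrightarrow> l2_inner M ?g x"
      by (rule approximates_tendsto(1)[OF W(1) mu g x(1) W(2) WD approximates_p_bounded[OF W(1) mu g] x(1) W(2)])
  qed
  ultimately have "Re (shift \<mu> U U) \<le> 2 * (e + 0)\<^sup>2 + 2 * Re (l2_inner M ?g x)"
    by (intro LIMSEQ_le_const) auto
  then show ?thesis by simp
qed

end

locale relaxed = l2_form D a T M for D :: "('a \<Rightarrow> complex) set" and a T M +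
  fixes Db :: "('a \<Rightarrow> complex) set" and b :: "'a form"
  assumes relaxed: "relaxed_form M D a Db b"
begin

lemma Db_L2: "Db \<subseteq> L2 M"
  and zero_Db: "(\<lambda>x. 0) \<in> Db"
  and comb_Db: "\<And>u v \<alpha> \<beta>. u \<in> Db \<Longrightarrow> v \<in> Db \<Longrightarrow> (\<lambda>x. \<alpha> * u x + \<beta> * v x) \<in> Db"
  and b_left: "\<And>u v w \<alpha> \<beta>. u \<in> Db \<Longrightarrow> v \<in> Db \<Longrightarrow> w \<in> Db \<Longrightarrow>
        b (\<lambda>x. \<alpha> * u x + \<beta> * v x) w = \<alpha> * b u w + \<beta> * b v w"
  and b_right: "\<And>u v w \<alpha> \<beta>. u \<in> Db \<Longrightarrow> v \<in> Db \<Longrightarrow> w \<in> Db \<Longrightarrow>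
        b w (\<lambda>x. \<alpha> * u x + \<beta> * v x) = cnj \<alpha> * b w u + cnj \<beta> * b w v"
  using relaxed unfolding relaxed_form_def sectorial_form_def sesquilinear_form_def by blast+

lemma operator_eq: "form_operator M D a = {(x, f). x \<in> Db \<and> f \<in> L2 M \<and> (\<forall>v\<in>Db. b x v = l2_inner M f v)}"
  using relaxed unfolding relaxed_form_def closed_form_operator_def by simp

lemma memL2b: "u \<in> Db \<Longrightarrow> u \<in> L2 M"
  using Db_L2 by blast

text \<open>The relaxed form is known to be sectorial with some vertex \<gamma> only; the shift
  \<open>\<bar>\<gamma>\<bar> + 1\<close> moves the vertex beyond 1 and makes the form norm dominate
  the L2 norm.\<close>

lemma obtain_coercive:
  obtains \<mu> K where "0 < \<mu>" "0 \<le> K"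
    "sect_form Db (\<lambda>u v. b u v + complex_of_real \<mu> * l2_inner M u v) K"
    "\<And>u. u \<in> Db \<Longrightarrow> (l2_norm M u)\<^sup>2 \<le> Re (b u u + complex_of_real \<mu> * l2_inner M u u)"
proof -
  obtain \<gamma> \<theta> where th: "0 \<le> \<theta>" "\<theta> < pi / 2"
    and sec: "\<And>u. u \<in> Db \<Longrightarrow> b u u - complex_of_real (\<gamma> * (l2_norm M u)\<^sup>2) \<in> sector \<theta>"
    using relaxed unfolding relaxed_form_def sectorial_form_def by blast
  define K where "K = tan \<theta>"
  have K: "0 \<le> K" unfolding K_def using th tan_pos_pi2_le by simp
  define \<mu> where "\<mu> = \<bar>\<gamma>\<bar> + 1"
  define \<beta> where "\<beta> u v = b u v + complex_of_real \<mu> * l2_inner M u v" for u v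
  have mu: "0 < \<mu>" "1 \<le> \<mu> + \<gamma>" by (auto simp: \<mu>_def)
  have low: "(l2_norm M u)\<^sup>2 \<le> Re (\<beta> u u)" "\<bar>Im (\<beta> u u)\<bar> \<le> K * Re (\<beta> u u)" if u: "u \<in> Db" for u
  proof -
    have 1: "\<gamma> * (l2_norm M u)\<^sup>2 \<le> Re (b u u)"
      and 2: "\<bar>Im (b u u)\<bar> \<le> K * (Re (b u u) - \<gamma> * (l2_norm M u)\<^sup>2)"
      using sector_bounds[OF sec[OF u] th] by (simp_all add: K_def)
    have 3: "1 * (l2_norm M u)\<^sup>2 \<le> (\<mu> + \<gamma>) * (l2_norm M u)\<^sup>2"
      using mu by (intro mult_right_mono) auto
    have R: "Re (\<beta> u u) = Re (b u u) + \<mu> * (l2_norm M u)\<^sup>2" "Im (\<beta> u u) = Im (b u u)"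
      by (simp_all add: \<beta>_def l2_inner_self)
    show "(l2_norm M u)\<^sup>2 \<le> Re (\<beta> u u)" using 1 3 unfolding R by (simp add: distrib_right)
    have "Re (b u u) - \<gamma> * (l2_norm M u)\<^sup>2 \<le> Re (\<beta> u u)"
      using 3 zero_le_power2[of "l2_norm M u"] unfolding R distrib_right by linarith
    then show "\<bar>Im (\<beta> u u)\<bar> \<le> K * Re (\<beta> u u)"
      using 2 K unfolding R(2) by (meson mult_left_mono order_trans)
  qed
  have "sect_form Db \<beta> K"
  proof
    fix u assume u: "u \<in> Db"
    show "0 \<le> Re (\<beta> u u)" using low(1)[OF u] zero_le_power2 order_trans by blast
    show "\<bar>Im (\<beta> u u)\<bar> \<le> K * Re (\<beta> u u)" by (rule low(2)[OF u])
  next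
    fix u v w \<alpha> \<beta>' assume D: "u \<in> Db" "v \<in> Db" "w \<in> Db"
    note eqs = b_left[OF D] b_right[OF D] l2_inner_comb_left[OF D[THEN memL2b]] l2_inner_comb_right[OF D[THEN memL2b]]
    show "\<beta> (\<lambda>x. \<alpha> * u x + \<beta>' * v x) w = \<alpha> * \<beta> u w + \<beta>' * \<beta> v w"
      unfolding \<beta>_def by (simp only: eqs) (simp only: algebra_simps)
    show "\<beta> w (\<lambda>x. \<alpha> * u x + \<beta>' * v x) = cnj \<alpha> * \<beta> w u + cnj \<beta>' * \<beta> w v"
      unfolding \<beta>_def by (simp only: eqs) (simp only: algebra_simps)
  qed (use K zero_Db comb_Db in simp_all)
  with mu(1) K show ?thesis using low(1) unfolding \<beta>_def[abs_def] by (rule that)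
qed

text \<open>\<open>v - \<nu> (\<nu> + A)\<^sup>-\<^sup>1 v\<close> stays bounded in the form norm and tends to \<open>0\<close> in \<open>L\<^sub>2\<close> as
  \<open>\<nu> \<rightarrow> \<infinity>\<close>; near minimisers upgrade this to convergence in the form norm.\<close>

lemma operator_domain_core:
  assumes mu: "0 < \<mu>" and B: "sect_form Db (\<lambda>u v. b u v + complex_of_real \<mu> * l2_inner M u v) K"
    and coer: "\<And>u. u \<in> Db \<Longrightarrow> (l2_norm M u)\<^sup>2 \<le> Re (b u u + complex_of_real \<mu> * l2_inner M u u)"
    and v: "v \<in> Db" and e: "0 < e"
  shows "\<exists>x f. (x, f) \<in> form_operator M D a \<and>
     Re (b (\<lambda>y. x y - v y) (\<lambda>y. x y - v y) + complex_of_real \<mu> * l2_inner M (\<lambda>y. x y - v y) (\<lambda>y. x y - v y)) < e"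
proof -
  define \<beta> where "\<beta> u w = b u w + complex_of_real \<mu> * l2_inner M u w" for u w
  interpret B: sect_form Db \<beta> K using B unfolding \<beta>_def[abs_def] .
  have coer': "(l2_norm M u)\<^sup>2 \<le> B.p u" if "u \<in> Db" for u using coer[OF that] by (simp add: \<beta>_def)
  have norm_le: "l2_norm M u \<le> sqrt (B.p u)" if "u \<in> Db" for u
    using coer'[OF that] by (rule real_le_rsqrt)
  \<comment> \<open>Corrections w of small L2 norm that move v into the operator domain. The sets
    are nested and midpoint convex, as \<open>near_minimisers_Cauchy\<close> requires.\<close>
  define C where "C n = {w \<in> Db. (\<exists>f. ((\<lambda>y. w y + v y), f) \<in> form_operator M D a) \<and> l2_norm M w \<le> 1 / real (Suc n)}" for n
  \<comment> \<open>Bounds the functional w \<mapsto> b v w in the form norm: \<open>B.L\<close>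
    from Cauchy-Schwarz for \<beta>, and \<mu> from removing the shift.\<close>
  define Q where "Q = (B.L + \<mu>) * sqrt (B.p v)"
  have Q: "0 \<le> Q" unfolding Q_def using B.T_nonneg mu B.p_nonneg[OF v] by (intro mult_nonneg_nonneg) auto
  have nonempty: "\<exists>w\<in>C n. B.p w \<le> Q\<^sup>2" for n
  proof -
    \<comment> \<open>Large enough that \<open>(\<nu> - \<mu>) * norm^2 \<le> Q^2\<close> forces the
      norm of w below 1/(n+1).\<close>
    define \<nu> where "\<nu> = \<mu> + (Q\<^sup>2 + 1) * (real (Suc n))\<^sup>2"
    have nu: "0 < \<nu>" unfolding \<nu>_def using mu by (intro add_pos_nonneg) auto
    let ?g = "\<lambda>y. complex_of_real \<nu> * v y"
    have g: "?g \<in> L2 M" by (intro L2_cmult memL2b v)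
    have "\<forall>m. \<exists>U. approximates \<nu> ?g (1 / real (Suc m)) U"
      using approximates_exists[OF g nu] by (metis of_nat_0_less_iff zero_less_Suc zero_less_divide_1_iff)
    from choice[OF this] obtain U where U: "\<And>m. approximates \<nu> ?g (1 / real (Suc m)) (U m)" by blast
    obtain x where x: "x \<in> L2 M" "l2_tendsto M U x sequentially" using approximates_limit[OF U nu g] .
    have xA: "(x, \<lambda>y. ?g y - complex_of_real \<nu> * x y) \<in> form_operator M D a"
      by (rule approximates_form_operator[OF U nu g x])
    then have xDb: "x \<in> Db" and bx: "\<And>w. w \<in> Db \<Longrightarrow> b x w = l2_inner M (\<lambda>y. ?g y - complex_of_real \<nu> * x y) w"
      unfolding operator_eq by auto
    define w where "w y = x y - v y" for y
    have w: "w \<in> Db" unfolding w_def using comb_Db[OF xDb v, of 1 "-1"] by simp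
    have "b w w = b x w - b v w" using b_left[OF xDb v w, of 1 "-1"] by (simp add: w_def[abs_def])
    \<comment> \<open>x solves \<open>(\<nu> + A) x = \<nu> v\<close>, so A maps x to -\<nu>
      w.\<close>
    also have "b x w = - complex_of_real \<nu> * l2_inner M w w"
    proof -
      have "(\<lambda>y. ?g y - complex_of_real \<nu> * x y) = (\<lambda>y. (- complex_of_real \<nu>) * w y + 0 * w y)"
        by (simp add: w_def algebra_simps)
      then show ?thesis using bx[OF w] l2_inner_comb_left[OF memL2b[OF w] memL2b[OF w] memL2b[OF w], of "- complex_of_real \<nu>" 0]
        by simp
    qed
    finally have bww: "b w w = - complex_of_real \<nu> * l2_inner M w w - b v w" .
    have "\<beta> w w + complex_of_real (\<nu> - \<mu>) * l2_inner M w w = - b v w"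
      unfolding \<beta>_def bww by (simp add: left_diff_distrib)
    then have "B.p w + (\<nu> - \<mu>) * (l2_norm M w)\<^sup>2 = Re (- b v w)"
      by (metis Re_complex_of_real l2_inner_self of_real_mult plus_complex.sel(1))
    also have "\<dots> \<le> cmod (b v w)" using complex_Re_le_cmod[of "- b v w"] by simp
    also have "\<dots> \<le> Q * sqrt (B.p w)"
    proof -
      have "b v w = \<beta> v w - complex_of_real \<mu> * l2_inner M v w" by (simp add: \<beta>_def)
      then have "cmod (b v w) \<le> cmod (\<beta> v w) + cmod (complex_of_real \<mu> * l2_inner M v w)"
        by (simp only: norm_triangle_ineq4)
      also have "cmod (complex_of_real \<mu> * l2_inner M v w) = \<mu> * cmod (l2_inner M v w)"
        using mu by (simp add: norm_mult)
      also have "cmod (\<beta> v w) + \<mu> * cmod (l2_inner M v w)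
          \<le> B.L * (sqrt (B.p v) * sqrt (B.p w)) + \<mu> * (sqrt (B.p v) * sqrt (B.p w))"
      proof (intro add_mono B.bound v w mult_left_mono)
        show "cmod (l2_inner M v w) \<le> sqrt (B.p v) * sqrt (B.p w)"
          using l2_inner_bound[OF memL2b[OF v] memL2b[OF w]] norm_le[OF v] norm_le[OF w]
          by (meson mult_mono l2_norm_nonneg order_trans)
      qed (use mu in simp)
      also have "\<dots> = Q * sqrt (B.p w)" by (simp add: Q_def algebra_simps)
      finally show ?thesis .
    qed
    finally have main: "B.p w + (\<nu> - \<mu>) * (l2_norm M w)\<^sup>2 \<le> Q * sqrt (B.p w)" .
    have nm: "0 \<le> (\<nu> - \<mu>) * (l2_norm M w)\<^sup>2" by (simp add: \<nu>_def)
    have sq: "sqrt (B.p w) * sqrt (B.p w) = B.p w" using B.p_nonneg[OF w] by simp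
    have sQ: "sqrt (B.p w) \<le> Q"
    proof (cases "B.p w = 0")
      case False
      then have "0 < sqrt (B.p w)" using B.p_nonneg[OF w] by simp
      moreover have "sqrt (B.p w) * sqrt (B.p w) \<le> Q * sqrt (B.p w)" using main nm sq by linarith
      ultimately show ?thesis using mult_right_le_imp_le by blast
    qed (use Q in simp)
    have pQ: "B.p w \<le> Q\<^sup>2"
      using mult_mono[OF sQ sQ Q real_sqrt_ge_zero[OF B.p_nonneg[OF w]]] sq by (simp add: power2_eq_square)
    have "(\<nu> - \<mu>) * (l2_norm M w)\<^sup>2 \<le> Q * sqrt (B.p w)" using main B.p_nonneg[OF w] by linarith
    also have "\<dots> \<le> Q * Q" by (intro mult_left_mono sQ Q)
    finally have "(Q\<^sup>2 + 1) * ((real (Suc n))\<^sup>2 * (l2_norm M w)\<^sup>2) \<le> Q\<^sup>2"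
      by (simp add: \<nu>_def power2_eq_square mult_ac)
    also have "\<dots> \<le> (Q\<^sup>2 + 1) * 1" by simp
    finally have "(real (Suc n))\<^sup>2 * (l2_norm M w)\<^sup>2 \<le> 1"
      by (rule mult_left_le_imp_le) (simp add: add_nonneg_pos)
    then have "(real (Suc n) * l2_norm M w)\<^sup>2 \<le> 1\<^sup>2" by (simp only: power_mult_distrib) simp
    then have "real (Suc n) * l2_norm M w \<le> 1" by (rule power2_le_imp_le) simp
    then have "l2_norm M w \<le> 1 / real (Suc n)" by (simp add: pos_le_divide_eq mult.commute del: of_nat_Suc)
    moreover have "(\<lambda>y. w y + v y) = x" by (simp add: w_def)
    ultimately have "w \<in> C n" unfolding C_def using w xA by auto
    with pQ show ?thesis by blast
  qed
  have opcomb: "((\<lambda>y. (1/2) * x y + (1/2) * x' y), (\<lambda>y. (1/2) * f y + (1/2) * f' y)) \<in> form_operator M D a"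
    if "(x, f) \<in> form_operator M D a" "(x', f') \<in> form_operator M D a" for x f x' f'
  proof -
    from that have 1: "x \<in> Db" "f \<in> L2 M" "x' \<in> Db" "f' \<in> L2 M"
      and 2: "\<And>v. v \<in> Db \<Longrightarrow> b x v = l2_inner M f v" "\<And>v. v \<in> Db \<Longrightarrow> b x' v = l2_inner M f' v"
      unfolding operator_eq by auto
    show ?thesis unfolding operator_eq
    proof (intro CollectI case_prodI conjI ballI)
      show "(\<lambda>y. (1/2) * x y + (1/2) * x' y) \<in> Db" by (rule comb_Db[OF 1(1,3)])
      show "(\<lambda>y. (1/2) * f y + (1/2) * f' y) \<in> L2 M" by (rule L2_comb[OF 1(2,4)])
      fix v assume v: "v \<in> Db"
      show "b (\<lambda>y. (1/2) * x y + (1/2) * x' y) v = l2_inner M (\<lambda>y. (1/2) * f y + (1/2) * f' y) v"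
        unfolding b_left[OF 1(1,3) v] l2_inner_comb_left[OF 1(2,4) memL2b[OF v]] 2[OF v] ..
    qed
  qed
  obtain y where y: "\<And>n. y n \<in> C n" "\<And>e. 0 < e \<Longrightarrow> \<exists>N. \<forall>n\<ge>N. \<forall>m\<ge>N. B.p (\<lambda>x. y n x - y m x) < e"
  proof (rule B.near_minimisers_Cauchy[of C "Q\<^sup>2"])
    show "C n \<subseteq> Db" for n by (auto simp: C_def)
    have "1 / real (Suc (Suc n)) \<le> 1 / real (Suc n)" for n by (intro divide_left_mono) auto
    then show "C (Suc n) \<subseteq> C n" for n unfolding C_def by (auto intro: order_trans)
    fix n u w assume u: "u \<in> C n" and w: "w \<in> C n"
    then obtain f g where fg: "((\<lambda>y. u y + v y), f) \<in> form_operator M D a" "((\<lambda>y. w y + v y), g) \<in> form_operator M D a"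
      unfolding C_def by blast
    have uw: "u \<in> Db" "w \<in> Db" "l2_norm M u \<le> 1 / real (Suc n)" "l2_norm M w \<le> 1 / real (Suc n)"
      using u w by (auto simp: C_def)
    have "(\<lambda>y. (1/2) * (u y + v y) + (1/2) * (w y + v y)) = (\<lambda>y. ((1/2) * u y + (1/2) * w y) + v y)"
      by (auto simp: field_simps)
    with opcomb[OF fg] have A: "\<exists>f. ((\<lambda>y. ((1/2) * u y + (1/2) * w y) + v y), f) \<in> form_operator M D a" by auto
    have "l2_norm M (\<lambda>y. (1/2) * u y + (1/2) * w y) \<le> (1/2) * l2_norm M u + (1/2) * l2_norm M w"
      using l2_norm_triangle[OF L2_cmult[OF memL2b[OF uw(1)], of "1/2"] L2_cmult[OF memL2b[OF uw(2)], of "1/2"]]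
      by (simp only: l2_norm_cmult) (simp add: norm_divide)
    also have "\<dots> \<le> 1 / real (Suc n)" using uw(3,4) by argo
    finally show "(\<lambda>y. (1/2) * u y + (1/2) * w y) \<in> C n"
      unfolding C_def using A comb_Db[OF uw(1,2), of "1/2" "1/2"] by blast
  qed (use nonempty in auto)
  have yDb: "y n \<in> Db" and ynorm: "l2_norm M (y n) \<le> 1 / real (Suc n)" for n using y(1)[of n] by (auto simp: C_def)
  have bcmod: "cmod (b u u) \<le> (1 + K + \<mu>) * B.p u" if u: "u \<in> Db" for u
  proof -
    have "b u u = \<beta> u u - complex_of_real \<mu> * l2_inner M u u" by (simp add: \<beta>_def)
    then have "cmod (b u u) \<le> cmod (\<beta> u u) + cmod (complex_of_real \<mu> * l2_inner M u u)"
      by (simp only: norm_triangle_ineq4)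
    also have "cmod (complex_of_real \<mu> * l2_inner M u u) = \<mu> * (l2_norm M u)\<^sup>2"
      using mu by (simp add: norm_mult l2_inner_self norm_power)
    also have "cmod (\<beta> u u) + \<mu> * (l2_norm M u)\<^sup>2 \<le> (1 + K) * B.p u + \<mu> * B.p u"
      by (intro add_mono B.cmod_self_le u mult_left_mono coer') (use mu in simp)
    finally show ?thesis by (simp add: algebra_simps)
  qed
  have yL2: "l2_tendsto M y (\<lambda>x. 0) sequentially"
    unfolding l2_tendsto_def
  proof (rule tendsto_sandwich)
    show "(\<lambda>n. 0) \<longlonglongrightarrow> (0::real)" by simp
    show "(\<lambda>n. 1 / real (Suc n)) \<longlonglongrightarrow> 0" using LIMSEQ_inverse_real_of_nat by (simp add: inverse_eq_divide)
  qed (use ynorm in auto)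
  have Cau: "((\<lambda>(n, m). b (\<lambda>\<omega>. y n \<omega> - y m \<omega>) (\<lambda>\<omega>. y n \<omega> - y m \<omega>)) \<longlongrightarrow> 0) (sequentially \<times>\<^sub>F sequentially)"
  proof (rule tendstoI)
    fix e :: real assume e: "0 < e"
    define Z where "Z = 1 + K + \<mu>"
    have Z: "0 < Z" using B.T_nonneg mu by (simp add: Z_def)
    obtain N where N: "\<And>n m. n \<ge> N \<Longrightarrow> m \<ge> N \<Longrightarrow> B.p (\<lambda>x. y n x - y m x) < e / Z"
      using y(2)[of "e / Z"] e Z by auto
    have "cmod (b (\<lambda>\<omega>. y n \<omega> - y m \<omega>) (\<lambda>\<omega>. y n \<omega> - y m \<omega>)) < e" if "n \<ge> N" "m \<ge> N" for n m
    proof -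
      have "cmod (b (\<lambda>\<omega>. y n \<omega> - y m \<omega>) (\<lambda>\<omega>. y n \<omega> - y m \<omega>)) \<le> Z * B.p (\<lambda>x. y n x - y m x)"
        unfolding Z_def by (rule bcmod[OF B.diff_mem[OF yDb yDb]])
      also have "\<dots> < Z * (e / Z)" by (intro mult_strict_left_mono N that Z)
      finally show ?thesis using Z by simp
    qed
    then show "\<forall>\<^sub>F x in sequentially \<times>\<^sub>F sequentially.
        dist (case x of (n, m) \<Rightarrow> b (\<lambda>\<omega>. y n \<omega> - y m \<omega>) (\<lambda>\<omega>. y n \<omega> - y m \<omega>)) 0 < e"
      unfolding eventually_prod_sequentially by (intro exI[of _ N]) auto
  qed
  \<comment> \<open>Closedness enters here: a form-Cauchy sequence with L2 limit 0 has form limit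
    0.\<close>
  have "closed_form M Db b" using relaxed by (simp add: relaxed_form_def)
  then have "(\<lambda>n. b (\<lambda>\<omega>. y n \<omega> - 0) (\<lambda>\<omega>. y n \<omega> - 0)) \<longlonglongrightarrow> 0"
    unfolding closed_form_def using L2_zero yDb yL2 Cau by blast
  then have b0: "(\<lambda>n. b (y n) (y n)) \<longlonglongrightarrow> 0" by simp
  have "(\<lambda>n. Re (b (y n) (y n)) + \<mu> * (l2_norm M (y n))\<^sup>2) \<longlonglongrightarrow> Re 0 + \<mu> * 0\<^sup>2"
    using yL2 unfolding l2_tendsto_def by (intro tendsto_intros b0) simp
  then have "(\<lambda>n. B.p (y n)) \<longlonglongrightarrow> 0" by (simp add: \<beta>_def l2_inner_self)
  then have "\<forall>\<^sub>F n in sequentially. B.p (y n) < e" using e by (rule order_tendstoD)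
  then obtain n where n: "B.p (y n) < e" by (auto simp: eventually_sequentially)
  obtain f where f: "((\<lambda>x. y n x + v x), f) \<in> form_operator M D a" using y(1)[of n] by (auto simp: C_def)
  show ?thesis
  proof (intro exI conjI)
    show "((\<lambda>x. y n x + v x), f) \<in> form_operator M D a" by (rule f)
    show "Re (b (\<lambda>x. y n x + v x - v x) (\<lambda>x. y n x + v x - v x)
        + complex_of_real \<mu> * l2_inner M (\<lambda>x. y n x + v x - v x) (\<lambda>x. y n x + v x - v x)) < e"
      using n by (simp add: \<beta>_def)
  qed
qed

lemma form_operator_diff:
  assumes "(x, f) \<in> form_operator M D a" "(x', f') \<in> form_operator M D a"
  shows "((\<lambda>y. x y - x' y), (\<lambda>y. f y - f' y)) \<in> form_operator M D a"
proof -
  from assms have 1: "x \<in> Db" "f \<in> L2 M" "x' \<in> Db" "f' \<in> L2 M"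
    and 2: "\<And>v. v \<in> Db \<Longrightarrow> b x v = l2_inner M f v" "\<And>v. v \<in> Db \<Longrightarrow> b x' v = l2_inner M f' v"
    unfolding operator_eq by auto
  show ?thesis unfolding operator_eq
  proof (intro CollectI case_prodI conjI ballI)
    show "(\<lambda>y. x y - x' y) \<in> Db" using comb_Db[OF 1(1,3), of 1 "-1"] by simp
    show "(\<lambda>y. f y - f' y) \<in> L2 M" by (rule L2_diff[OF 1(2,4)])
    fix v assume v: "v \<in> Db"
    show "b (\<lambda>y. x y - x' y) v = l2_inner M (\<lambda>y. f y - f' y) v"
      unfolding l2_inner_diff_left[OF 1(2,4) memL2b[OF v]] 2[OF v, symmetric]
      using b_left[OF 1(1,3) v, of 1 "-1"] by simp
  qed
qed

text \<open>Diagonal choice: x k in the operator domain tends to u in the form norm, and U k is an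
  approximate solution belonging to x k whose residual and L2 distance are below \<epsilon> k. The
  limit formula holds for every test sequence of bounded energy, which gives later arguments the
  freedom to modify it by cutoffs.\<close>

theorem representing_sequence:
  assumes u: "u \<in> Db"
  obtains U B where "\<And>n. U n \<in> D" "\<And>n. p (U n) \<le> B" "l2_tendsto M U u sequentially"
    "\<And>v V B'. v \<in> Db \<Longrightarrow> (\<And>n. V n \<in> D) \<Longrightarrow> (\<And>n. p (V n) \<le> B') \<Longrightarrow> l2_tendsto M V v sequentially
      \<Longrightarrow> (\<lambda>n. a (U n) (V n)) \<longlonglongrightarrow> b u v"
proof -
  obtain \<mu> K where mu: "0 < \<mu>" and "0 \<le> K"
    and B': "sect_form Db (\<lambda>u v. b u v + complex_of_real \<mu> * l2_inner M u v) K"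
    and coer: "\<And>u. u \<in> Db \<Longrightarrow> (l2_norm M u)\<^sup>2 \<le> Re (b u u + complex_of_real \<mu> * l2_inner M u u)"
    using obtain_coercive by blast
  define \<beta> where "\<beta> u w = b u w + complex_of_real \<mu> * l2_inner M u w" for u w
  interpret B: sect_form Db \<beta> K using B' unfolding \<beta>_def[abs_def] .
  interpret S: sect_form D "shift \<mu>" T by (rule sect_form_shift) (use mu in simp)
  define \<epsilon> where "\<epsilon> k = 1 / real (Suc k)" for k
  have eps: "0 < \<epsilon> k" for k by (simp add: \<epsilon>_def)
  have eps1: "\<epsilon> k \<le> 1" for k by (simp add: \<epsilon>_def)
  have eps0: "\<epsilon> \<longlonglongrightarrow> 0" unfolding \<epsilon>_def[abs_def] using LIMSEQ_inverse_real_of_nat by (simp add: inverse_eq_divide)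
  have "\<forall>k. \<exists>xf. xf \<in> form_operator M D a \<and> B.p (\<lambda>y. fst xf y - u y) < \<epsilon> k"
    using operator_domain_core[OF mu B' coer u eps] unfolding \<beta>_def[symmetric] by fastforce
  from choice[OF this] obtain xf where xf: "\<And>k. xf k \<in> form_operator M D a" "\<And>k. B.p (\<lambda>y. fst (xf k) y - u y) < \<epsilon> k"
    by blast
  define x f where "x k = fst (xf k)" and "f k = snd (xf k)" for k
  have xfA: "(x k, f k) \<in> form_operator M D a" and xp: "B.p (\<lambda>y. x k y - u y) < \<epsilon> k" for k
    using xf[of k] by (simp_all add: x_def f_def)
  have xDb: "x k \<in> Db" and f: "f k \<in> L2 M" and bx: "w \<in> Db \<Longrightarrow> b (x k) w = l2_inner M (f k) w" for k w
    using xfA[of k] unfolding operator_eq by auto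
  define g where "g k y = f k y + complex_of_real \<mu> * x k y" for k y
  have g: "g k \<in> L2 M" for k unfolding g_def by (intro L2_add L2_cmult f memL2b xDb)
  have gx: "l2_inner M (g k) w = \<beta> (x k) w" if w: "w \<in> Db" for k w
    using l2_inner_comb_left[OF f memL2b[OF xDb] memL2b[OF w], of 1 k "complex_of_real \<mu>" k] bx[OF w, of k]
    by (simp add: g_def[abs_def] \<beta>_def)
  have "\<exists>U. approximates \<mu> (g k) (\<epsilon> k) U \<and> l2_norm M (\<lambda>y. U y - x k y) < \<epsilon> k" for k
  proof -
    obtain W where W: "\<And>n. approximates \<mu> (g k) (1 / real (Suc n)) (W n)" "l2_tendsto M W (x k) sequentially"
      using form_operator_approximable[OF xfA mu] unfolding g_def[abs_def] by blast
    have "\<forall>\<^sub>F n in sequentially. l2_norm M (\<lambda>y. W n y - x k y) < \<epsilon> k"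
      using W(2) eps[of k] unfolding l2_tendsto_def by (rule order_tendstoD)
    then obtain N where N: "\<And>n. n \<ge> N \<Longrightarrow> l2_norm M (\<lambda>y. W n y - x k y) < \<epsilon> k"
      by (auto simp: eventually_sequentially)
    \<comment> \<open>The index must exceed N for the L2 distance and k for the residual, whence the
      maximum.\<close>
    have le: "1 / real (Suc (max N k)) \<le> \<epsilon> k" unfolding \<epsilon>_def by (intro divide_left_mono) auto
    have "approximates \<mu> (g k) (\<epsilon> k) (W (max N k))"
      unfolding approximates_def
    proof (intro conjI ballI)
      show "W (max N k) \<in> D" by (rule approximates_mem[OF W(1)])
      fix w assume w: "w \<in> D"
      have "cmod (shift \<mu> (W (max N k)) w - l2_inner M (g k) w) \<le> 1 / real (Suc (max N k)) * sqrt (Re (shift \<mu> w w))"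
        by (rule approximatesD[OF W(1) w])
      also have "\<dots> \<le> \<epsilon> k * sqrt (Re (shift \<mu> w w))"
        by (intro mult_right_mono le) (use S.p_nonneg[OF w] in simp)
      finally show "cmod (shift \<mu> (W (max N k)) w - l2_inner M (g k) w) \<le> \<epsilon> k * sqrt (Re (shift \<mu> w w))" .
    qed
    with N[of "max N k"] show ?thesis by auto
  qed
  then have "\<forall>k. \<exists>U. approximates \<mu> (g k) (\<epsilon> k) U \<and> l2_norm M (\<lambda>y. U y - x k y) < \<epsilon> k" by blast
  from choice[OF this] obtain U where U: "\<And>k. approximates \<mu> (g k) (\<epsilon> k) (U k)"
    and Ux: "\<And>k. l2_norm M (\<lambda>y. U k y - x k y) < \<epsilon> k" by blast
  note UD = approximates_mem[OF U]
  have xu: "l2_norm M (\<lambda>y. x k y - u y) \<le> sqrt (\<epsilon> k)" for k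
  proof (rule real_le_rsqrt)
    have "(l2_norm M (\<lambda>y. x k y - u y))\<^sup>2 \<le> B.p (\<lambda>y. x k y - u y)"
      using coer[OF B.diff_mem[OF xDb u]] by (simp add: \<beta>_def)
    then show "(l2_norm M (\<lambda>y. x k y - u y))\<^sup>2 \<le> \<epsilon> k" using xp[of k] by linarith
  qed
  have Uu: "l2_tendsto M U u sequentially"
    unfolding l2_tendsto_def
  proof (rule tendsto_sandwich)
    show "(\<lambda>n. 0) \<longlonglongrightarrow> (0::real)" by simp
    have "(\<lambda>k. \<epsilon> k + sqrt (\<epsilon> k)) \<longlonglongrightarrow> 0 + sqrt 0" by (intro tendsto_intros eps0)
    then show "(\<lambda>k. \<epsilon> k + sqrt (\<epsilon> k)) \<longlonglongrightarrow> 0" by simp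
    have "l2_norm M (\<lambda>y. U k y - u y) \<le> \<epsilon> k + sqrt (\<epsilon> k)" for k
      using l2_norm_diff_triangle[OF memL2[OF UD] memL2b[OF xDb] memL2b[OF u], of k k] Ux[of k] xu[of k] by linarith
    then show "\<forall>\<^sub>F k in sequentially. l2_norm M (\<lambda>y. U k y - u y) \<le> \<epsilon> k + sqrt (\<epsilon> k)" by simp
  qed simp
  have px: "B.p (x k) \<le> 2 + 2 * B.p u" for k
    using B.p_add_le[OF B.diff_mem[OF xDb u] u, of k] xp[of k] eps1[of k] by simp
  have Ubd: "S.p (U k) \<le> 6 + 4 * B.p u" for k
  proof -
    have "S.p (U k) \<le> 2 * (\<epsilon> k)\<^sup>2 + 2 * B.p (x k)"
      using form_operator_p_bound[OF xfA mu less_imp_le[OF eps], of k k "U k"] U[of k] gx[OF xDb, of k k]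
      by (simp add: g_def[abs_def])
    moreover have "(\<epsilon> k)\<^sup>2 \<le> 1" using eps[of k] eps1[of k] by (simp add: power_le_one)
    ultimately show ?thesis using px[of k] by linarith
  qed
  \<comment> \<open>\<open>U k - U l\<close> approximately solves the equation for
    \<open>x k - x l\<close>, so its energy is controlled by the relaxed energy of that difference,
    and both points are close to u.\<close>
  have Ucau: "S.p (\<lambda>y. U k y - U l y) \<le> 2 * (\<epsilon> k + \<epsilon> l)\<^sup>2 + 4 * \<epsilon> k + 4 * \<epsilon> l" for k l
  proof -
    have "(\<lambda>y. f k y - f l y + complex_of_real \<mu> * (x k y - x l y)) = (\<lambda>y. g k y - g l y)"
      by (simp add: g_def algebra_simps)
    then have "S.p (\<lambda>y. U k y - U l y) \<le> 2 * (\<epsilon> k + \<epsilon> l)\<^sup>2 + 2 * Re (l2_inner M (\<lambda>y. g k y - g l y) (\<lambda>y. x k y - x l y))"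
      using form_operator_p_bound[OF form_operator_diff[OF xfA xfA] mu, of "\<epsilon> k + \<epsilon> l" k l "\<lambda>y. U k y - U l y"]
        approximates_diff[OF U U mu g g, of k l] eps[of k] eps[of l] by simp
    also have "l2_inner M (\<lambda>y. g k y - g l y) (\<lambda>y. x k y - x l y) = \<beta> (\<lambda>y. x k y - x l y) (\<lambda>y. x k y - x l y)"
      using B.diff_mem[OF xDb[of k] xDb[of l]]
      by (simp add: l2_inner_diff_left g memL2b gx B.diff_left xDb)
    also have "2 * B.p (\<lambda>y. x k y - x l y) \<le> 2 * (2 * \<epsilon> k + 2 * \<epsilon> l)"
      using B.p_triangle[OF xDb u xDb, of k l] xp[of k] xp[of l] B.p_minus_commute[OF u xDb, of l] by simp
    finally show ?thesis by simp
  qed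
  \<comment> \<open>An index k is fixed first. For n beyond k, replacing U n by U k, the form by the
    functional of g k, V n by v and x k by u costs four errors; three are small by the choice of k,
    the remaining one as n grows.\<close>
  have conv: "(\<lambda>n. a (U n) (V n)) \<longlonglongrightarrow> b u v"
    if v: "v \<in> Db" and V: "\<And>n. V n \<in> D" and VB: "\<And>n. p (V n) \<le> C" and Vv: "l2_tendsto M V v sequentially" for v V C
  proof -
    have "(\<lambda>n. l2_norm M (V n)) \<longlonglongrightarrow> l2_norm M v"
      using l2_tendsto_norm[OF Vv memL2[OF V] memL2b[OF v]] .
    from convergent_imp_Bseq[OF convergentI[OF this]] obtain N0 where N0: "\<And>n. l2_norm M (V n) \<le> N0"
      unfolding Bseq_def by (auto simp: norm_ge_zero)
    define H where "H = \<bar>C + \<mu> * N0\<^sup>2\<bar>"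
    have bd: "S.p (V n) \<le> H" for n
    proof -
      have "S.p (V n) \<le> C + \<mu> * N0\<^sup>2"
        unfolding Re_shift using N0[of n] VB[of n] mu by (intro add_mono mult_left_mono power_mono) auto
      then show ?thesis unfolding H_def by linarith
    qed
    have "(\<lambda>n. shift \<mu> (U n) (V n)) \<longlonglongrightarrow> \<beta> u v"
    proof (rule LIMSEQ_I)
      fix e :: real assume e: "0 < e"
      have "(\<lambda>k. S.L * (sqrt (2 * (\<epsilon> k + \<epsilon> k)\<^sup>2 + 8 * \<epsilon> k) * sqrt H) + \<epsilon> k * sqrt H + B.L * (sqrt (\<epsilon> k) * sqrt (B.p v)))
          \<longlonglongrightarrow> S.L * (sqrt (2 * (0 + 0)\<^sup>2 + 8 * 0) * sqrt H) + 0 * sqrt H + B.L * (sqrt 0 * sqrt (B.p v))"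
        by (intro tendsto_intros eps0)
      then have "(\<lambda>k. S.L * (sqrt (2 * (\<epsilon> k + \<epsilon> k)\<^sup>2 + 8 * \<epsilon> k) * sqrt H) + \<epsilon> k * sqrt H + B.L * (sqrt (\<epsilon> k) * sqrt (B.p v)))
          \<longlonglongrightarrow> 0" by simp
      then have "\<forall>\<^sub>F k in sequentially. S.L * (sqrt (2 * (\<epsilon> k + \<epsilon> k)\<^sup>2 + 8 * \<epsilon> k) * sqrt H) + \<epsilon> k * sqrt H + B.L * (sqrt (\<epsilon> k) * sqrt (B.p v)) < e / 2"
        using e by (intro order_tendstoD) auto
      then obtain k where k: "S.L * (sqrt (2 * (\<epsilon> k + \<epsilon> k)\<^sup>2 + 8 * \<epsilon> k) * sqrt H) + \<epsilon> k * sqrt H + B.L * (sqrt (\<epsilon> k) * sqrt (B.p v)) < e / 2"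
        by (auto simp: eventually_sequentially)
      have "(\<lambda>n. l2_inner M (g k) (V n)) \<longlonglongrightarrow> l2_inner M (g k) v"
        by (rule l2_tendsto_inner(1)[OF Vv memL2[OF V] memL2b[OF v] g])
      from LIMSEQ_D[OF this, of "e / 2"] e obtain N where N: "\<And>n. n \<ge> N \<Longrightarrow> cmod (l2_inner M (g k) (V n) - l2_inner M (g k) v) < e / 2"
        by auto
      have "cmod (shift \<mu> (U n) (V n) - \<beta> u v) < e" if n: "n \<ge> max N k" for n
      proof -
        have t1: "cmod (shift \<mu> (U n) (V n) - shift \<mu> (U k) (V n)) \<le> S.L * (sqrt (2 * (\<epsilon> k + \<epsilon> k)\<^sup>2 + 8 * \<epsilon> k) * sqrt H)"
        proof -
          have en: "\<epsilon> n \<le> \<epsilon> k" unfolding \<epsilon>_def using n by (intro divide_left_mono) auto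
          have "S.p (\<lambda>y. U n y - U k y) \<le> 2 * (\<epsilon> n + \<epsilon> k)\<^sup>2 + 4 * \<epsilon> n + 4 * \<epsilon> k" by (rule Ucau)
          also have "\<dots> \<le> 2 * (\<epsilon> k + \<epsilon> k)\<^sup>2 + 4 * \<epsilon> k + 4 * \<epsilon> k"
            using en eps[of n] eps[of k] by (intro add_mono mult_left_mono power_mono) auto
          finally have le: "S.p (\<lambda>y. U n y - U k y) \<le> 2 * (\<epsilon> k + \<epsilon> k)\<^sup>2 + 8 * \<epsilon> k" by simp
          have "cmod (shift \<mu> (U n) (V n) - shift \<mu> (U k) (V n)) = cmod (shift \<mu> (\<lambda>y. U n y - U k y) (V n))"
            by (simp add: S.diff_left UD V)
          also have "\<dots> \<le> S.L * (sqrt (S.p (\<lambda>y. U n y - U k y)) * sqrt (S.p (V n)))"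
            by (intro S.bound diff_mem UD V)
          also have "\<dots> \<le> S.L * (sqrt (2 * (\<epsilon> k + \<epsilon> k)\<^sup>2 + 8 * \<epsilon> k) * sqrt H)"
            by (intro mult_left_mono mult_mono real_sqrt_le_mono le bd) (use T_nonneg eps[of k] S.p_nonneg[OF V] in auto)
          finally show ?thesis .
        qed
        have t2: "cmod (shift \<mu> (U k) (V n) - l2_inner M (g k) (V n)) \<le> \<epsilon> k * sqrt H"
        proof -
          have "cmod (shift \<mu> (U k) (V n) - l2_inner M (g k) (V n)) \<le> \<epsilon> k * sqrt (S.p (V n))"
            by (rule approximatesD[OF U V])
          also have "\<dots> \<le> \<epsilon> k * sqrt H" by (intro mult_left_mono real_sqrt_le_mono bd less_imp_le[OF eps])
          finally show ?thesis .
        qed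
        have t4: "cmod (l2_inner M (g k) v - \<beta> u v) \<le> B.L * (sqrt (\<epsilon> k) * sqrt (B.p v))"
        proof -
          have "cmod (l2_inner M (g k) v - \<beta> u v) = cmod (\<beta> (\<lambda>y. x k y - u y) v)"
            by (simp add: gx v B.diff_left xDb u)
          also have "\<dots> \<le> B.L * (sqrt (B.p (\<lambda>y. x k y - u y)) * sqrt (B.p v))"
            by (intro B.bound B.diff_mem xDb u v)
          also have "\<dots> \<le> B.L * (sqrt (\<epsilon> k) * sqrt (B.p v))"
            by (intro mult_left_mono mult_right_mono real_sqrt_le_mono less_imp_le[OF xp])
               (use B.T_nonneg B.p_nonneg[OF v] in auto)
          finally show ?thesis .
        qed
        have t3: "cmod (l2_inner M (g k) (V n) - l2_inner M (g k) v) < e / 2" using N n by simp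
        have tri: "cmod (p1 - p5) \<le> cmod (p1 - p2) + cmod (p2 - p3) + cmod (p3 - p4) + cmod (p4 - p5)" for p1 p2 p3 p4 p5 :: complex
          using norm_triangle_ineq[of "p1 - p2" "p2 - p5"] norm_triangle_ineq[of "p2 - p3" "p3 - p5"]
            norm_triangle_ineq[of "p3 - p4" "p4 - p5"] by simp
        have "cmod (shift \<mu> (U n) (V n) - \<beta> u v)
            \<le> cmod (shift \<mu> (U n) (V n) - shift \<mu> (U k) (V n)) + cmod (shift \<mu> (U k) (V n) - l2_inner M (g k) (V n))
            + cmod (l2_inner M (g k) (V n) - l2_inner M (g k) v) + cmod (l2_inner M (g k) v - \<beta> u v)"
          by (rule tri)
        also have "\<dots> < e" using t1 t2 t3 t4 k by argo
        finally show ?thesis .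
      qed
      then show "\<exists>N. \<forall>n\<ge>N. norm (shift \<mu> (U n) (V n) - \<beta> u v) < e" by blast
    qed
    from tendsto_diff[OF this tendsto_mult[OF tendsto_const[of "complex_of_real \<mu>"]
        l2_tendsto_inner_both[OF Uu memL2[OF UD] memL2b[OF u] Vv memL2[OF V] memL2b[OF v]]]]
    show ?thesis by (simp add: shift_def \<beta>_def)
  qed
  show ?thesis
  proof (rule that[of U "6 + 4 * B.p u"])
    show "p (U n) \<le> 6 + 4 * B.p u" for n
      using Ubd[of n] mu unfolding Re_shift by (smt (verit) mult_nonneg_nonneg zero_le_power2)
    show "(\<lambda>n. a (U n) (V n)) \<longlonglongrightarrow> b u v"
      if "v \<in> Db" "\<And>n. V n \<in> D" "\<And>n. p (V n) \<le> B'" "l2_tendsto M V v sequentially" for v V B'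
      by (rule conv[OF that])
  qed (use UD Uu in auto)
qed

end

section \<open>Smooth functions\<close>

lemma partial_deriv_eqI:
  "(f has_derivative f') (at x) \<Longrightarrow> partial_deriv i f x = f' (axis i 1)"
  using frechet_derivative_at[of f f' x] by (simp add: partial_deriv_def)

lemma C_times_differentiable: "C_times (Suc k) f \<Longrightarrow> f differentiable (at x)"
  by simp

lemma C_times_continuous: "C_times k f \<Longrightarrow> continuous_on UNIV f"
  by (cases k) (auto simp: continuous_on_eq_continuous_at intro: differentiable_imp_continuous_within)

lemma C_times_SucD: "C_times (Suc k) f \<Longrightarrow> C_times k f"
proof (induction k arbitrary: f)
  case 0
  then show ?case using C_times_continuous[OF 0] by simp
next
  case (Suc k)
  then show ?case by (auto simp del: C_times.simps(1))
qed

lemma partial_deriv_const: "partial_deriv i (\<lambda>x. c) = (\<lambda>x. 0)"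
  by (intro ext partial_deriv_eqI) (rule has_derivative_const)

lemma C_times_const: "C_times k (\<lambda>x. c)"
  by (induction k arbitrary: c) (auto simp: partial_deriv_const)

lemma partial_deriv_add:
  assumes "f differentiable (at x)" "g differentiable (at x)"
  shows "partial_deriv i (\<lambda>x. f x + g x) x = partial_deriv i f x + partial_deriv i g x"
proof -
  obtain f' g' where D: "(f has_derivative f') (at x)" "(g has_derivative g') (at x)"
    using assms unfolding differentiable_def by auto
  show ?thesis
    unfolding partial_deriv_eqI[OF has_derivative_add[OF D]] D[THEN partial_deriv_eqI] ..
qed

lemma C_times_add: "C_times k f \<Longrightarrow> C_times k g \<Longrightarrow> C_times k (\<lambda>x. f x + g x)"
proof (induction k arbitrary: f g)
  case 0
  then show ?case by (auto intro: continuous_on_add)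
next
  case (Suc k)
  have "partial_deriv i (\<lambda>x. f x + g x) = (\<lambda>x. partial_deriv i f x + partial_deriv i g x)" for i
    by (intro ext partial_deriv_add C_times_differentiable[OF Suc.prems(1)] C_times_differentiable[OF Suc.prems(2)])
  then show ?case using Suc by (auto intro: differentiable_add)
qed

lemma partial_deriv_mult:
  assumes "f differentiable (at x)" "g differentiable (at x)"
  shows "partial_deriv i (\<lambda>x. f x * g x) x = partial_deriv i f x * g x + f x * partial_deriv i g x"
proof -
  obtain f' g' where D: "(f has_derivative f') (at x)" "(g has_derivative g') (at x)"
    using assms unfolding differentiable_def by auto
  show ?thesis
    unfolding partial_deriv_eqI[OF has_derivative_mult[OF D]] D[THEN partial_deriv_eqI] by simp
qed

lemma C_times_mult: "C_times k f \<Longrightarrow> C_times k g \<Longrightarrow> C_times k (\<lambda>x. f x * g x)"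
proof (induction k arbitrary: f g)
  case 0
  then show ?case by (auto intro: continuous_on_mult)
next
  case (Suc k)
  have "partial_deriv i (\<lambda>x. f x * g x) = (\<lambda>x. partial_deriv i f x * g x + f x * partial_deriv i g x)" for i
    by (intro ext partial_deriv_mult C_times_differentiable[OF Suc.prems(1)] C_times_differentiable[OF Suc.prems(2)])
  moreover have "C_times k (\<lambda>x. partial_deriv i f x * g x + f x * partial_deriv i g x)" for i
    by (intro C_times_add Suc.IH Suc.prems[THEN C_times_SucD]) (use Suc.prems in auto)
  ultimately show ?case using Suc.prems by (auto intro: differentiable_mult)
qed

lemma partial_deriv_inverse:
  fixes f :: "real^'d \<Rightarrow> complex"
  assumes "f differentiable (at x)" "f x \<noteq> 0"
  shows "partial_deriv i (\<lambda>x. inverse (f x)) x = - (inverse (f x) * partial_deriv i f x * inverse (f x))"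
proof -
  obtain f' where D: "(f has_derivative f') (at x)"
    using assms unfolding differentiable_def by auto
  show ?thesis
    unfolding partial_deriv_eqI[OF Deriv.has_derivative_inverse[OF assms(2) D]] partial_deriv_eqI[OF D] ..
qed

lemma C_times_inverse: "C_times k f \<Longrightarrow> (\<And>x. f x \<noteq> 0) \<Longrightarrow> C_times k (\<lambda>x. inverse (f x))"
proof (induction k)
  case 0
  then show ?case by (auto intro: continuous_on_inverse)
next
  case (Suc k)
  have "partial_deriv i (\<lambda>x. inverse (f x)) = (\<lambda>x. (- 1) * (inverse (f x) * partial_deriv i f x * inverse (f x)))" for i
    using partial_deriv_inverse[OF C_times_differentiable[OF Suc.prems(1)] Suc.prems(2)] by auto
  moreover have "C_times k (\<lambda>x. (- 1) * (inverse (f x) * partial_deriv i f x * inverse (f x)))" for i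
    by (intro C_times_mult C_times_const Suc.IH Suc.prems C_times_SucD[OF Suc.prems(1)])
       (use Suc.prems in auto)
  ultimately show ?case using Suc.prems by (auto intro: differentiable_inverse)
qed

definition smooth :: "(real^'d::finite \<Rightarrow> complex) \<Rightarrow> bool" where
  "smooth f \<longleftrightarrow> (\<forall>k. C_times k f)"

lemma smooth_partial_deriv: "smooth f \<Longrightarrow> smooth (partial_deriv i f)"
  unfolding smooth_def by (metis C_times.simps(2))

lemma smooth_differentiable: "smooth f \<Longrightarrow> f differentiable (at x)"
  unfolding smooth_def by (metis C_times.simps(2))

lemma smooth_continuous: "smooth f \<Longrightarrow> continuous_on UNIV f"
  unfolding smooth_def using C_times_continuous by blast

lemma smooth_const: "smooth (\<lambda>x. c)"
  by (simp add: smooth_def C_times_const)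

lemma smooth_add: "smooth f \<Longrightarrow> smooth g \<Longrightarrow> smooth (\<lambda>x. f x + g x)"
  by (simp add: smooth_def C_times_add)

lemma smooth_mult: "smooth f \<Longrightarrow> smooth g \<Longrightarrow> smooth (\<lambda>x. f x * g x)"
  by (simp add: smooth_def C_times_mult)

lemma smooth_diff: "smooth f \<Longrightarrow> smooth g \<Longrightarrow> smooth (\<lambda>x. f x - g x)"
  using smooth_add[OF _ smooth_mult[OF smooth_const[of "-1"]], of f g] by simp

lemma smooth_inverse: "smooth f \<Longrightarrow> (\<And>x. f x \<noteq> 0) \<Longrightarrow> smooth (\<lambda>x. inverse (f x))"
  by (simp add: smooth_def C_times_inverse)

lemma smooth_sum: "(\<And>i. i \<in> I \<Longrightarrow> smooth (f i)) \<Longrightarrow> smooth (\<lambda>x. \<Sum>i\<in>I. f i x)"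
  by (induction I rule: infinite_finite_induct) (auto intro: smooth_add simp: smooth_const)

lemma smooth_power: "smooth f \<Longrightarrow> smooth (\<lambda>x. f x ^ n)"
  by (induction n) (auto intro: smooth_mult simp: smooth_const)

lemma has_derivative_coordinate:
  "((\<lambda>x::real^'d. complex_of_real (x $ i)) has_derivative (\<lambda>h. complex_of_real (h $ i))) (at x)"
  by (intro has_derivative_of_real bounded_linear_imp_has_derivative bounded_linear_vec_nth)

lemma smooth_coordinate: "smooth (\<lambda>x::real^'d::finite. complex_of_real (x $ i))"
  unfolding smooth_def
proof
  fix k
  have "partial_deriv j (\<lambda>x::real^'d. complex_of_real (x $ i)) = (\<lambda>x. complex_of_real (axis j 1 $ i))" for j
    by (intro ext partial_deriv_eqI[OF has_derivative_coordinate])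
  then show "C_times k (\<lambda>x::real^'d. complex_of_real (x $ i))"
    using has_derivative_coordinate
    by (cases k) (auto simp: C_times_const differentiable_def intro!: continuous_intros)
qed

lemma norm_sq_vec: "(norm (x :: real^'d::finite))\<^sup>2 = (\<Sum>i\<in>UNIV. (x $ i)\<^sup>2)"
  unfolding power2_norm_eq_inner inner_vec_def by (simp add: power2_eq_square)

lemma smooth_dist_sq: "smooth (\<lambda>x::real^'d::finite. complex_of_real ((norm (x - c))\<^sup>2))"
proof -
  have "smooth (\<lambda>x::real^'d. \<Sum>i\<in>UNIV. (complex_of_real (x $ i) - complex_of_real (c $ i)) ^ 2)"
    by (intro smooth_sum smooth_power smooth_diff smooth_coordinate smooth_const)
  then show ?thesis by (simp add: norm_sq_vec)
qed

subsection \<open>Cutoff functions\<close>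

text \<open>The functions P(1/t) exp(-1/t), extended by 0, form a family closed under
  differentiation; the polynomial parameter is what makes induction on the order of
  differentiability possible. P = 1 is the usual bump profile.\<close>

definition flat_exp :: "real poly \<Rightarrow> real \<Rightarrow> real" where
  "flat_exp p t = (if 0 < t then poly p (1 / t) * exp (- (1 / t)) else 0)"

lemma poly_times_exp_tendsto_0: "((\<lambda>s. poly p s * exp (- s)) \<longlongrightarrow> (0::real)) at_top"
proof -
  have "((\<lambda>s. \<Sum>i\<le>degree p. coeff p i * (s ^ i / exp s)) \<longlongrightarrow> (\<Sum>i\<le>degree p. coeff p i * 0)) at_top"
    by (intro tendsto_sum tendsto_mult tendsto_const tendsto_power_div_exp_0)
  moreover have "(\<lambda>s. \<Sum>i\<le>degree p. coeff p i * (s ^ i / exp s)) = (\<lambda>s. poly p s * exp (- s))"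
    by (auto simp: poly_altdef sum_distrib_right exp_minus divide_inverse mult.assoc)
  ultimately show ?thesis by simp
qed

text \<open>In the variable s = 1/t one has ds/dt = -s^2, so p(s) exp(-s) becomes s^2 (p - p')(s)
  exp(-s); \<open>[:0, 0, 1:]\<close> is s^2.\<close>

lemma flat_exp_deriv:
  "(flat_exp p has_real_derivative flat_exp ([:0, 0, 1:] * (p - pderiv p)) t) (at t)"
proof -
  let ?q = "[:0, 0, 1:] * (p - pderiv p)"
  consider "t < 0" | "t = 0" | "0 < t" by linarith
  then show ?thesis
  proof cases
    case 1
    have "\<forall>\<^sub>F x in nhds t. x \<in> {..<0}" by (rule eventually_nhds_in_open) (use 1 in auto)
    then have ev: "\<forall>\<^sub>F x in nhds t. 0 = flat_exp p x" by eventually_elim (simp add: flat_exp_def)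
    have "((\<lambda>t. 0) has_real_derivative 0) (at t)" by simp
    then have "(flat_exp p has_real_derivative 0) (at t)"
      by (rule DERIV_cong_ev[OF refl ev refl, THEN iffD1])
    then show ?thesis using 1 by (simp add: flat_exp_def)
  next
    case 2
    have "((\<lambda>h. (flat_exp p (0 + h) - flat_exp p 0) / h) \<longlongrightarrow> 0) (at 0)"
    proof (subst filterlim_at_split, intro conjI)
      show "((\<lambda>h. (flat_exp p (0 + h) - flat_exp p 0) / h) \<longlongrightarrow> 0) (at_left 0)"
        by (rule tendsto_eventually) (auto simp: flat_exp_def eventually_at_filter)
      \<comment> \<open>The difference quotient at 0 is s p(s) exp(-s) with s = 1/h, and
        \<open>[:0, 1:]\<close> is the polynomial s.\<close>
      have "((\<lambda>s. poly (p * [:0, 1:]) s * exp (- s)) \<longlongrightarrow> 0) at_top" by (rule poly_times_exp_tendsto_0)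
      then have "((\<lambda>h. poly (p * [:0, 1:]) (inverse h) * exp (- inverse h)) \<longlongrightarrow> 0) (at_right 0)"
        using filterlim_inverse_at_top_right by (rule filterlim_compose)
      then show "((\<lambda>h. (flat_exp p (0 + h) - flat_exp p 0) / h) \<longlongrightarrow> 0) (at_right 0)"
        by (rule tendsto_cong[THEN iffD1, rotated])
           (auto simp: flat_exp_def eventually_at_filter field_simps)
    qed
    then show ?thesis using 2 by (simp add: DERIV_def flat_exp_def)
  next
    case 3
    have "((\<lambda>t. poly p (1 / t) * exp (- (1 / t))) has_real_derivative flat_exp ?q t) (at t)"
      using 3 by (auto intro!: derivative_eq_intros DERIV_chain2[OF poly_DERIV]
          simp: flat_exp_def divide_simps power2_eq_square algebra_simps)
    then show ?thesis
      by (rule DERIV_cong_ev[OF refl _ refl, THEN iffD1, rotated])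
         (use 3 in \<open>auto simp: flat_exp_def eventually_nhds intro!: exI[of _ "{0<..}"]\<close>)
  qed
qed

lemma smooth_flat_exp:
  fixes \<psi> :: "real^'d::finite \<Rightarrow> real"
  assumes "smooth (\<lambda>x. complex_of_real (\<psi> x))"
  shows "smooth (\<lambda>x. complex_of_real (flat_exp p (\<psi> x)))"
proof -
  let ?F = "\<lambda>x. complex_of_real (\<psi> x)"
  have deriv: "((\<lambda>x. complex_of_real (flat_exp p (\<psi> x))) has_derivative
       (\<lambda>h. complex_of_real (flat_exp ([:0, 0, 1:] * (p - pderiv p)) (\<psi> x)) * frechet_derivative ?F (at x) h)) (at x)" for p x
  proof -
    have F: "(?F has_derivative frechet_derivative ?F (at x)) (at x)"
      using smooth_differentiable[OF assms] frechet_derivative_works by blast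
    have psi: "(\<psi> has_derivative (\<lambda>h. Re (frechet_derivative ?F (at x) h))) (at x)"
      using has_derivative_Re[OF F] by simp
    \<comment> \<open>By uniqueness the complex derivative of a real-valued function is real-valued,
      so the chain rule may be applied on the real line.\<close>
    have "(?F has_derivative (\<lambda>h. complex_of_real (Re (frechet_derivative ?F (at x) h)))) (at x)"
      by (rule has_derivative_of_real[OF psi])
    then have "frechet_derivative ?F (at x) = (\<lambda>h. complex_of_real (Re (frechet_derivative ?F (at x) h)))"
      by (rule frechet_derivative_at[symmetric])
    moreover have "((\<lambda>x. flat_exp p (\<psi> x)) has_derivative
        (\<lambda>h. flat_exp ([:0, 0, 1:] * (p - pderiv p)) (\<psi> x) * Re (frechet_derivative ?F (at x) h))) (at x)"
      using has_derivative_compose[OF psi flat_exp_deriv[unfolded has_field_derivative_def]] .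
    from has_derivative_of_real[OF this]
    have "((\<lambda>x. complex_of_real (flat_exp p (\<psi> x))) has_derivative
       (\<lambda>h. complex_of_real (flat_exp ([:0, 0, 1:] * (p - pderiv p)) (\<psi> x)) * complex_of_real (Re (frechet_derivative ?F (at x) h)))) (at x)"
      by (simp only: of_real_mult)
    ultimately show ?thesis by metis
  qed
  have "C_times k (\<lambda>x. complex_of_real (flat_exp p (\<psi> x)))" for k p
  proof (induction k arbitrary: p)
    case 0
    show ?case unfolding C_times.simps
      by (intro continuous_at_imp_continuous_on ballI has_derivative_continuous[OF deriv])
  next
    case (Suc k)
    have "partial_deriv i (\<lambda>x. complex_of_real (flat_exp p (\<psi> x)))
      = (\<lambda>x. complex_of_real (flat_exp ([:0, 0, 1:] * (p - pderiv p)) (\<psi> x)) * partial_deriv i ?F x)" for i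
      unfolding partial_deriv_eqI[OF deriv] partial_deriv_def[symmetric]
      by (intro ext) (simp only: partial_deriv_eqI[OF deriv] partial_deriv_def[symmetric])
    moreover have "C_times k (\<lambda>x. complex_of_real (flat_exp ([:0, 0, 1:] * (p - pderiv p)) (\<psi> x)) * partial_deriv i ?F x)" for i
      by (intro C_times_mult Suc.IH) (use smooth_partial_deriv[OF assms] in \<open>simp add: smooth_def\<close>)
    ultimately show ?case using deriv unfolding C_times.simps differentiable_def by metis
  qed
  then show ?thesis by (simp add: smooth_def)
qed

lemma flat_exp_1_pos: "0 < flat_exp 1 t \<longleftrightarrow> 0 < t"
  and flat_exp_1_nonneg: "0 \<le> flat_exp 1 t"
  and flat_exp_1_eq_0: "t \<le> 0 \<Longrightarrow> flat_exp 1 t = 0"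
  by (auto simp: flat_exp_def)

lemma compact_closed_subset: "compact C \<Longrightarrow> closed S \<Longrightarrow> S \<subseteq> C \<Longrightarrow> compact S"
  for S :: "'a::heine_borel set"
  using compact_Int_closed[of C S] by (simp add: Int_absorb1)

text \<open>Bumps on a finite cover of K by balls inside U add up to a function \<psi> that is
  positive on K. Composing \<psi> with a smooth step A / (A + B) makes the result equal to 1 on a
  neighbourhood of K.\<close>

lemma smooth_cutoff:
  fixes K U :: "(real^'d::finite) set"
  assumes "compact K" "open U" "K \<subseteq> U"
  obtains \<eta> :: "real^'d \<Rightarrow> real" and V where "smooth (\<lambda>x. complex_of_real (\<eta> x))"
    "\<And>x. 0 \<le> \<eta> x" "\<And>x. \<eta> x \<le> 1" "open V" "K \<subseteq> V" "\<And>x. x \<in> V \<Longrightarrow> \<eta> x = 1"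
    "compact (closure {x. \<eta> x \<noteq> 0})" "closure {x. \<eta> x \<noteq> 0} \<subseteq> U"
proof -
  have "\<forall>x\<in>K. \<exists>r>0. cball x r \<subseteq> U"
    using assms open_contains_cball_eq[of U] by blast
  then obtain r where r: "\<And>x. x \<in> K \<Longrightarrow> 0 < r x" "\<And>x. x \<in> K \<Longrightarrow> cball x (r x) \<subseteq> U" by metis
  obtain F where F: "F \<subseteq> K" "finite F" "K \<subseteq> (\<Union>x\<in>F. ball x (r x))"
    by (rule compactE_image[OF assms(1), of K "\<lambda>x. ball x (r x)"]) (use r in auto)
  define \<psi> where "\<psi> y = (\<Sum>x\<in>F. flat_exp 1 ((r x)\<^sup>2 - (norm (y - x))\<^sup>2))" for y
  have smooth_psi: "smooth (\<lambda>y. complex_of_real (\<psi> y))"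
  proof -
    have "smooth (\<lambda>y. complex_of_real (flat_exp 1 ((r x)\<^sup>2 - (norm (y - x))\<^sup>2)))" for x :: "real^'d"
      by (intro smooth_flat_exp) (use smooth_diff[OF smooth_const smooth_dist_sq] in simp)
    from smooth_sum[OF this, where I=F] show ?thesis by (simp add: \<psi>_def)
  qed
  have inball: "0 < flat_exp 1 ((r x)\<^sup>2 - (norm (y - x))\<^sup>2) \<longleftrightarrow> y \<in> ball x (r x)" if "x \<in> F" for x y
  proof -
    have "0 < r x" using r F that by blast
    then have "(norm (y - x))\<^sup>2 < (r x)\<^sup>2 \<longleftrightarrow> norm (y - x) < r x"
      by (metis less_imp_le norm_ge_zero power2_less_imp_less power_strict_mono zero_less_numeral)
    then show ?thesis by (simp add: flat_exp_1_pos dist_norm norm_minus_commute)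
  qed
  have psi_pos: "0 < \<psi> y" if "y \<in> K" for y
  proof -
    obtain x where x: "x \<in> F" "y \<in> ball x (r x)" using F(3) \<open>y \<in> K\<close> by blast
    show ?thesis unfolding \<psi>_def
      by (rule sum_pos2[OF F(2) x(1)]) (use inball x flat_exp_1_nonneg in auto)
  qed
  have psi_supp: "y \<in> (\<Union>x\<in>F. cball x (r x))" if "0 < \<psi> y" for y
  proof (rule ccontr)
    assume "\<not> ?thesis"
    then have "\<psi> y = 0" unfolding \<psi>_def using inball flat_exp_1_nonneg
      by (intro sum.neutral ballI) (metis UN_iff ball_subset_cball less_eq_real_def subsetD)
    with that show False by simp
  qed
  have cont: "continuous_on A \<psi>" for A
  proof -
    have "continuous_on UNIV (\<lambda>y. Re (complex_of_real (\<psi> y)))"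
      by (intro continuous_intros smooth_continuous[OF smooth_psi])
    then show ?thesis using continuous_on_subset by auto
  qed
  have "\<exists>\<delta>>0. \<forall>y\<in>K. \<delta> \<le> \<psi> y"
  proof (cases "K = {}")
    case False
    obtain y0 where "y0 \<in> K" "\<And>y. y \<in> K \<Longrightarrow> \<psi> y0 \<le> \<psi> y"
      using continuous_attains_inf[OF assms(1) False cont] by blast
    with psi_pos show ?thesis by blast
  qed (auto intro: exI[of _ 1])
  then obtain \<delta> where \<delta>: "0 < \<delta>" "\<And>y. y \<in> K \<Longrightarrow> \<delta> \<le> \<psi> y" by blast
  \<comment> \<open>The thresholds overlap: A vanishes for \<psi> \<le> \<delta>/4 and B for \<psi>
    \<ge> \<delta>/2, so the denominator never vanishes and the step is 1 wherever \<psi> exceeds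
    \<delta>/2.\<close>
  define A where "A y = flat_exp 1 (\<psi> y - \<delta> / 4)" for y
  define B where "B y = flat_exp 1 (\<delta> / 2 - \<psi> y)" for y
  have AB: "0 \<le> A y" "0 \<le> B y" "0 < A y + B y" for y
  proof -
    show AB': "0 \<le> A y" "0 \<le> B y" by (simp_all add: A_def B_def flat_exp_1_nonneg)
    show "0 < A y + B y"
    proof (cases "\<delta> / 4 < \<psi> y")
      case True
      then have "0 < A y" by (simp add: A_def flat_exp_1_pos)
      with AB' show ?thesis by linarith
    next
      case False
      then have "0 < B y" using \<delta>(1) by (simp add: B_def flat_exp_1_pos)
      with AB' show ?thesis by linarith
    qed
  qed
  have sA: "smooth (\<lambda>y. complex_of_real (A y))" unfolding A_def
    by (intro smooth_flat_exp) (use smooth_diff[OF smooth_psi smooth_const[of "complex_of_real (\<delta> / 4)"]] in simp)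
  have sB: "smooth (\<lambda>y. complex_of_real (B y))" unfolding B_def
    by (intro smooth_flat_exp) (use smooth_diff[OF smooth_const[of "complex_of_real (\<delta> / 2)"] smooth_psi] in simp)
  show thesis
  proof (rule that[of "\<lambda>y. A y / (A y + B y)" "{y. \<delta> / 2 < \<psi> y}"])
    have "smooth (\<lambda>y. complex_of_real (A y) * inverse (complex_of_real (A y) + complex_of_real (B y)))"
    proof (intro smooth_mult smooth_inverse smooth_add sA sB)
      show "complex_of_real (A y) + complex_of_real (B y) \<noteq> 0" for y
        using AB(3)[of y] by (metis less_irrefl of_real_add of_real_eq_0_iff)
    qed
    then show "smooth (\<lambda>y. complex_of_real (A y / (A y + B y)))" by (simp add: divide_inverse)
    show "0 \<le> A x / (A x + B x)" "A x / (A x + B x) \<le> 1" for x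
      using AB[of x] by auto
    show "open {y. \<delta> / 2 < \<psi> y}" using cont by (intro open_Collect_less continuous_intros) auto
    show "K \<subseteq> {y. \<delta> / 2 < \<psi> y}" using \<delta> by force
    show "A x / (A x + B x) = 1" if "x \<in> {y. \<delta> / 2 < \<psi> y}" for x
    proof -
      have "B x = 0" using that by (simp add: B_def flat_exp_1_eq_0)
      then show ?thesis using AB(3)[of x] by simp
    qed
    let ?C = "\<Union>x\<in>F. cball x (r x)"
    have C: "compact ?C" using F(2) by (intro compact_UN) auto
    have "{x. A x / (A x + B x) \<noteq> 0} \<subseteq> ?C"
    proof
      fix x assume "x \<in> {x. A x / (A x + B x) \<noteq> 0}"
      then have "A x \<noteq> 0" by auto
      then have "\<delta> / 4 < \<psi> x" unfolding A_def using flat_exp_1_eq_0[of "\<psi> x - \<delta> / 4"] by fastforce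
      then show "x \<in> ?C" using \<delta> by (intro psi_supp) simp
    qed
    then have sub: "closure {x. A x / (A x + B x) \<noteq> 0} \<subseteq> ?C"
      by (rule closure_minimal[OF _ compact_imp_closed[OF C]])
    show "closure {x. A x / (A x + B x) \<noteq> 0} \<subseteq> U" using sub r(2) F(1) by blast
    show "compact (closure {x. A x / (A x + B x) \<noteq> 0})"
      by (rule compact_closed_subset[OF C closed_closure sub])
  qed
qed

section \<open>Test functions and weak derivatives\<close>

lemma test_functions_iff:
  "\<phi> \<in> test_functions \<Omega> \<longleftrightarrow>
     smooth \<phi> \<and> compact (closure {x. \<phi> x \<noteq> 0}) \<and> closure {x. \<phi> x \<noteq> 0} \<subseteq> \<Omega>"
  by (simp add: test_functions_def smooth_def)

lemma test_functions_subsupport: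
  assumes "\<phi> \<in> test_functions \<Omega>" "smooth \<psi>" "{x. \<psi> x \<noteq> 0} \<subseteq> closure {x. \<phi> x \<noteq> 0}"
  shows "\<psi> \<in> test_functions \<Omega>"
proof -
  have sub: "closure {x. \<psi> x \<noteq> 0} \<subseteq> closure {x. \<phi> x \<noteq> 0}"
    by (rule closure_minimal[OF assms(3) closed_closure])
  then show ?thesis
    using assms(1,2) compact_closed_subset[OF _ closed_closure sub]
    unfolding test_functions_iff by blast
qed

lemma test_functions_mult:
  assumes "\<phi> \<in> test_functions \<Omega>" "smooth \<psi>"
  shows "(\<lambda>x. \<psi> x * \<phi> x) \<in> test_functions \<Omega>"
proof (rule test_functions_subsupport[OF assms(1)])
  show "smooth (\<lambda>x. \<psi> x * \<phi> x)" using assms by (simp add: test_functions_iff smooth_mult)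
  show "{x. \<psi> x * \<phi> x \<noteq> 0} \<subseteq> closure {x. \<phi> x \<noteq> 0}" using closure_subset by fastforce
qed

lemma partial_deriv_eq_0:
  assumes "open U" "x \<in> U" "\<And>y. y \<in> U \<Longrightarrow> f y = c"
  shows "partial_deriv i f x = 0"
proof -
  have "((\<lambda>y. c) has_derivative (\<lambda>h. 0)) (at x)" by (rule has_derivative_const)
  then have "(f has_derivative (\<lambda>h. 0)) (at x)"
    by (rule has_derivative_transform_within_open[OF _ assms(1,2)]) (use assms(3) in simp)
  from partial_deriv_eqI[OF this] show ?thesis by simp
qed

lemma partial_deriv_outside_support:
  assumes "x \<notin> closure {x. f x \<noteq> 0}"
  shows "partial_deriv i f x = 0"
proof (rule partial_deriv_eq_0[of "- closure {x. f x \<noteq> 0}" _ _ 0])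
  fix y assume "y \<in> - closure {x. f x \<noteq> 0}"
  then show "f y = 0" using closure_subset[of "{x. f x \<noteq> 0}"] by blast
qed (use assms in auto)

lemma test_functions_partial_deriv:
  assumes "\<phi> \<in> test_functions \<Omega>"
  shows "partial_deriv i \<phi> \<in> test_functions \<Omega>"
proof (rule test_functions_subsupport[OF assms])
  show "smooth (partial_deriv i \<phi>)" using assms by (simp add: test_functions_iff smooth_partial_deriv)
  show "{x. partial_deriv i \<phi> x \<noteq> 0} \<subseteq> closure {x. \<phi> x \<noteq> 0}"
    using partial_deriv_outside_support by blast
qed

lemma compact_support_bounded:
  fixes f :: "real^'d::finite \<Rightarrow> complex"
  assumes "continuous_on UNIV f" "compact (closure {x. f x \<noteq> 0})"
  obtains C where "0 \<le> C" "\<And>x. cmod (f x) \<le> C"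
proof -
  have "bounded (f ` closure {x. f x \<noteq> 0})"
    by (intro compact_imp_bounded compact_continuous_image assms(2) continuous_on_subset[OF assms(1)]) auto
  then obtain B where B: "\<And>x. x \<in> closure {x. f x \<noteq> 0} \<Longrightarrow> cmod (f x) \<le> B"
    unfolding bounded_iff by blast
  have "cmod (f x) \<le> max B 0" for x
  proof (cases "f x = 0")
    case False
    then have "x \<in> closure {x. f x \<noteq> 0}" using closure_subset[of "{x. f x \<noteq> 0}"] by blast
    then show ?thesis using B by fastforce
  qed simp
  then show ?thesis by (rule that[rotated]) simp
qed

lemma continuous_measurable_lebesgue_on:
  assumes "continuous_on UNIV f" "\<Omega> \<in> sets lebesgue"
  shows "f \<in> borel_measurable (lebesgue_on \<Omega>)"
  by (rule continuous_imp_measurable_on_sets_lebesgue[OF continuous_on_subset[OF assms(1)] assms(2)]) simp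

lemma closed_lebesgue_sets: "closed S \<Longrightarrow> S \<in> sets lebesgue"
  by (intro sets_completionI_sets) auto

lemma open_lebesgue_sets: "open S \<Longrightarrow> S \<in> sets lebesgue"
  by (intro sets_completionI_sets) auto

lemma integrable_indicator_bounded:
  assumes "\<Omega> \<in> sets lebesgue" "S \<in> sets lebesgue" "bounded S"
  shows "integrable (lebesgue_on \<Omega>) (indicator S :: real^'d::finite \<Rightarrow> real)"
proof -
  have "integrable lebesgue (indicator (\<Omega> \<inter> S) :: real^'d \<Rightarrow> real)"
    using bounded_set_imp_lmeasurable[of "\<Omega> \<inter> S"] assms
    by (intro integrable_real_indicator) (auto simp: fmeasurable_def intro: bounded_subset)
  moreover have "(\<lambda>x. indicator \<Omega> x *\<^sub>R (indicator S x :: real)) = indicator (\<Omega> \<inter> S)"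
    by (auto simp: indicator_def)
  ultimately show ?thesis using assms by (subst integrable_restrict_space) simp_all
qed

lemma L2_bounded_support:
  fixes f :: "real^'d::finite \<Rightarrow> complex"
  assumes "\<Omega> \<in> sets lebesgue" "S \<in> sets lebesgue" "bounded S"
    and "f \<in> borel_measurable (lebesgue_on \<Omega>)" "\<And>x. x \<in> \<Omega> \<Longrightarrow> cmod (f x) \<le> C * indicator S x"
  shows "f \<in> L2 (lebesgue_on \<Omega>)"
proof -
  have "integrable (lebesgue_on \<Omega>) (\<lambda>x. (cmod (f x))\<^sup>2)"
  proof (rule Bochner_Integration.integrable_bound)
    show "integrable (lebesgue_on \<Omega>) (\<lambda>x. C\<^sup>2 * indicator S x :: real)"
      by (intro integrable_mult_right integrable_indicator_bounded assms(1-3))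
    show "(\<lambda>x. (cmod (f x))\<^sup>2) \<in> borel_measurable (lebesgue_on \<Omega>)" using assms(4) by simp
    show "AE x in lebesgue_on \<Omega>. norm ((cmod (f x))\<^sup>2) \<le> norm (C\<^sup>2 * indicator S x :: real)"
    proof (rule AE_I2)
      fix x assume "x \<in> space (lebesgue_on \<Omega>)"
      then have "(cmod (f x))\<^sup>2 \<le> (C * indicator S x)\<^sup>2" by (intro power_mono assms(5)) auto
      then show "norm ((cmod (f x))\<^sup>2) \<le> norm (C\<^sup>2 * indicator S x :: real)"
        by (cases "x \<in> S") auto
    qed
  qed
  then show ?thesis using assms(4) by (simp add: L2_def)
qed

lemma compact_support_L2:
  fixes f :: "real^'d::finite \<Rightarrow> complex"
  assumes "\<Omega> \<in> sets lebesgue" "continuous_on UNIV f" "compact (closure {x. f x \<noteq> 0})"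
  shows "f \<in> L2 (lebesgue_on \<Omega>)"
proof -
  obtain C where C: "0 \<le> C" "\<And>x. cmod (f x) \<le> C" using compact_support_bounded[OF assms(2,3)] by blast
  show ?thesis
  proof (rule L2_bounded_support[OF assms(1), of "closure {x. f x \<noteq> 0}" _ C])
    show "closure {x. f x \<noteq> 0} \<in> sets lebesgue" by (rule closed_lebesgue_sets) simp
    show "bounded (closure {x. f x \<noteq> 0})" by (rule compact_imp_bounded[OF assms(3)])
    show "f \<in> borel_measurable (lebesgue_on \<Omega>)"
      by (rule continuous_measurable_lebesgue_on[OF assms(2,1)])
    fix x show "cmod (f x) \<le> C * indicator (closure {x. f x \<noteq> 0}) x"
    proof (cases "f x = 0")
      case False
      then have "x \<in> closure {x. f x \<noteq> 0}" using closure_subset[of "{x. f x \<noteq> 0}"] by blast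
      then show ?thesis using C by simp
    qed (use C in auto)
  qed
qed

lemma test_function_L2:
  "\<Omega> \<in> sets lebesgue \<Longrightarrow> \<phi> \<in> test_functions \<Omega>' \<Longrightarrow> \<phi> \<in> L2 (lebesgue_on \<Omega>)"
  unfolding test_functions_iff by (auto intro: compact_support_L2 smooth_continuous)

lemma bounded_set_ind_L2:
  fixes S :: "(real^'d::finite) set"
  assumes "\<Omega> \<in> sets lebesgue" "S \<in> sets lebesgue" "bounded S"
  shows "(\<lambda>x. complex_of_real (indicator S x)) \<in> L2 (lebesgue_on \<Omega>)"
proof (rule L2_bounded_support[OF assms, of _ 1])
  show "(\<lambda>x. complex_of_real (indicator S x)) \<in> borel_measurable (lebesgue_on \<Omega>)"
    using borel_measurable_integrable[OF integrable_indicator_bounded[OF assms]] by (intro measurable_compose[OF _ borel_measurable_of_real]) simp_all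
qed auto

lemma compact_support_integrable:
  fixes f :: "real^'d::finite \<Rightarrow> complex"
  assumes "\<Omega> \<in> sets lebesgue" "continuous_on UNIV f" "compact (closure {x. f x \<noteq> 0})"
  shows "integrable (lebesgue_on \<Omega>) f"
proof -
  let ?S = "closure {x. f x \<noteq> 0}"
  have "integrable (lebesgue_on \<Omega>) (\<lambda>x. f x * complex_of_real (indicator ?S x))"
    by (intro L2_mult_integrable compact_support_L2 bounded_set_ind_L2 assms compact_imp_bounded[OF assms(3)]
        closed_lebesgue_sets closed_closure)
  moreover have "f x * complex_of_real (indicator ?S x) = f x" for x
    using closure_subset[of "{x. f x \<noteq> 0}"] by (cases "f x = 0") (auto simp: indicator_def)
  ultimately show ?thesis by simp
qed

lemma test_function_integrable:
  "\<Omega> \<in> sets lebesgue \<Longrightarrow> \<phi> \<in> test_functions \<Omega>' \<Longrightarrow> integrable (lebesgue_on \<Omega>) \<phi>"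
  unfolding test_functions_iff by (auto intro: compact_support_integrable smooth_continuous)

subsection \<open>Integration by parts\<close>

lemma integral_translate:
  fixes f :: "real^'d::finite \<Rightarrow> complex"
  assumes "continuous_on UNIV f"
  shows "(LINT x|lebesgue. f (x + c)) = (LINT x|lebesgue. f x)"
proof -
  have m [measurable]: "f \<in> borel_measurable borel" by (rule borel_measurable_continuous_onI[OF assms])
  have "(LINT x|lebesgue. f (x + c)) = (LINT x|lborel. f (c + x))"
    by (subst integral_completion) (simp_all add: add.commute)
  also have "\<dots> = (LINT x|distr lborel borel ((+) c). f x)"
    by (rule integral_distr[symmetric]) simp_all
  also have "\<dots> = (LINT x|lborel. f x)" by (simp add: lborel_distr_plus)
  also have "\<dots> = (LINT x|lebesgue. f x)" by (rule integral_completion[symmetric]) simp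
  finally show ?thesis .
qed

lemma difference_quotient_bound:
  fixes f :: "real^'d::finite \<Rightarrow> complex"
  assumes d: "\<And>x. f differentiable (at x)" and C: "\<And>x. cmod (partial_deriv i f x) \<le> C" and h: "0 < h"
  shows "cmod (f (x + h *\<^sub>R axis i 1) - f x) \<le> C * h"
proof -
  let ?e = "axis i 1 :: real^'d"
  let ?g = "\<lambda>t. f (x + t *\<^sub>R ?e)"
  have der: "(?g has_derivative (\<lambda>s. frechet_derivative f (at (x + t *\<^sub>R ?e)) (s *\<^sub>R ?e))) (at t)" for t
  proof -
    have "((\<lambda>t. x + t *\<^sub>R ?e) has_derivative (\<lambda>s. s *\<^sub>R ?e)) (at t)"
      by (auto intro!: derivative_eq_intros)
    from has_derivative_compose[OF this, of f] show ?thesis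
      using d frechet_derivative_works by blast
  qed
  have "continuous_on {0..h} ?g" using der by (meson continuous_at_imp_continuous_on has_derivative_continuous)
  from mvt_general[OF h this der] obtain t where
    "cmod (?g h - ?g 0) \<le> cmod (frechet_derivative f (at (x + t *\<^sub>R ?e)) ((h - 0) *\<^sub>R ?e))" by blast
  also have "frechet_derivative f (at (x + t *\<^sub>R ?e)) ((h - 0) *\<^sub>R ?e) = h *\<^sub>R partial_deriv i f (x + t *\<^sub>R ?e)"
    using linear_frechet_derivative[OF d] by (simp add: linear_cmul partial_deriv_def)
  also have "cmod \<dots> = h * cmod (partial_deriv i f (x + t *\<^sub>R ?e))" using h by simp
  also have "\<dots> \<le> h * C" by (intro mult_left_mono C) (use h in simp)
  finally show ?thesis by (simp add: mult.commute)
qed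

lemma difference_quotient_tendsto:
  fixes f :: "real^'d::finite \<Rightarrow> complex"
  assumes "f differentiable (at x)"
  shows "(\<lambda>n. (f (x + (1 / real (Suc n)) *\<^sub>R axis i 1) - f x) / complex_of_real (1 / real (Suc n)))
    \<longlonglongrightarrow> partial_deriv i f x"
proof -
  let ?e = "axis i 1 :: real^'d" and ?h = "\<lambda>n. 1 / real (Suc n)"
  have D: "(f has_derivative frechet_derivative f (at x)) (at x)"
    using assms frechet_derivative_works by blast
  then have lim: "((\<lambda>h. norm (f (x + h) - f x - frechet_derivative f (at x) h) / norm h) \<longlongrightarrow> 0) (at 0)"
    by (simp add: has_derivative_at)
  have h0: "?h \<longlonglongrightarrow> 0" using LIMSEQ_inverse_real_of_nat by (simp add: inverse_eq_divide)
  have "filterlim (\<lambda>n. ?h n *\<^sub>R ?e) (at 0) sequentially"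
    unfolding filterlim_at
  proof
    have ne: "?e \<noteq> 0" by (simp add: axis_eq_0_iff)
    then show "\<forall>\<^sub>F n in sequentially. ?h n *\<^sub>R ?e \<in> UNIV \<and> ?h n *\<^sub>R ?e \<noteq> 0" by simp
    show "(\<lambda>n. ?h n *\<^sub>R ?e) \<longlonglongrightarrow> 0" using tendsto_scaleR[OF h0 tendsto_const[of ?e]] by simp
  qed
  from filterlim_compose[OF lim this]
  have "(\<lambda>n. norm (f (x + ?h n *\<^sub>R ?e) - f x - frechet_derivative f (at x) (?h n *\<^sub>R ?e)) / norm (?h n *\<^sub>R ?e)) \<longlonglongrightarrow> 0" .
  moreover have "norm (f (x + ?h n *\<^sub>R ?e) - f x - frechet_derivative f (at x) (?h n *\<^sub>R ?e)) / norm (?h n *\<^sub>R ?e)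
     = norm ((f (x + ?h n *\<^sub>R ?e) - f x) / complex_of_real (?h n) - partial_deriv i f x)" for n
  proof -
    have "frechet_derivative f (at x) (?h n *\<^sub>R ?e) = complex_of_real (?h n) * partial_deriv i f x"
      unfolding linear_cmul[OF linear_frechet_derivative[OF assms]] partial_deriv_def by (rule scaleR_conv_of_real)
    moreover have "norm (?h n *\<^sub>R ?e) = cmod (complex_of_real (?h n))"
      by (simp only: norm_scaleR norm_axis_1 norm_of_real mult_1_right)
    moreover have "cmod (z - complex_of_real c * y) / cmod (complex_of_real c) = cmod (z / complex_of_real c - y)"
      if "c \<noteq> 0" for z y c
      unfolding norm_divide[symmetric] using that by (simp add: diff_divide_distrib)
    moreover have "?h n \<noteq> 0" by simp
    ultimately show ?thesis by presburger
  qed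
  ultimately have "(\<lambda>n. norm ((f (x + ?h n *\<^sub>R ?e) - f x) / complex_of_real (?h n) - partial_deriv i f x)) \<longlonglongrightarrow> 0" by simp
  then show ?thesis by (rule LIM_zero_cancel[OF tendsto_norm_zero_cancel])
qed

text \<open>Translation invariance gives difference quotients integral 0, and dominated convergence
  passes to the derivative; Fubini is avoided.\<close>

lemma integral_partial_deriv_eq_0:
  fixes \<phi> :: "real^'d::finite \<Rightarrow> complex"
  assumes "smooth \<phi>" "compact (closure {x. \<phi> x \<noteq> 0})"
  shows "(LINT x|lebesgue. partial_deriv i \<phi> x) = 0"
proof -
  let ?e = "axis i 1 :: real^'d" and ?h = "\<lambda>n. 1 / real (Suc n)"
  let ?S = "closure {x. \<phi> x \<noteq> 0}"
  have T: "\<phi> \<in> test_functions UNIV" using assms by (simp add: test_functions_iff)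
  have T': "partial_deriv i \<phi> \<in> test_functions UNIV" by (rule test_functions_partial_deriv[OF T])
  have cont: "continuous_on UNIV \<phi>" "continuous_on UNIV (partial_deriv i \<phi>)"
    using T T' by (auto simp: test_functions_iff intro: smooth_continuous)
  obtain C where C: "0 \<le> C" "\<And>x. cmod (partial_deriv i \<phi> x) \<le> C"
    using compact_support_bounded[OF cont(2)] T' unfolding test_functions_iff by blast
  obtain R where R: "\<And>x. x \<in> ?S \<Longrightarrow> norm x \<le> R"
    using compact_imp_bounded[OF assms(2)] unfolding bounded_iff by blast
  let ?F = "\<lambda>n x. (\<phi> (x + ?h n *\<^sub>R ?e) - \<phi> x) / complex_of_real (?h n)"
  \<comment> \<open>Radius R + 1, because the quotients use steps 1/(n+1) of length at most 1 and so
    vanish outside this ball.\<close>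
  let ?B = "cball (0::real^'d) (R + 1)"
  have contF: "continuous_on UNIV (?F n)" for n
    by (intro continuous_intros continuous_on_compose2[OF cont(1)]) (auto simp del: of_nat_Suc)
  have int: "integrable lebesgue \<phi>" using test_function_integrable[OF _ T, of UNIV] by (simp add: lebesgue_on_UNIV_eq)
  have int': "integrable lebesgue (\<lambda>x. \<phi> (x + c))" for c
  proof -
    have "(\<lambda>x. \<phi> (x + c)) \<in> borel_measurable borel"
      by (intro borel_measurable_continuous_onI continuous_on_compose2[OF cont(1)] continuous_intros) auto
    moreover have "\<phi> \<in> borel_measurable borel" by (rule borel_measurable_continuous_onI[OF cont(1)])
    moreover from this int have "integrable (distr lborel borel ((+) c)) \<phi>"
      by (simp add: lborel_distr_plus integrable_completion)
    then have "integrable lborel (\<lambda>x. \<phi> (c + x))" by (rule integrable_distr[rotated]) simp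
    ultimately show ?thesis by (simp add: integrable_completion add.commute)
  qed
  have zero: "(LINT x|lebesgue. ?F n x) = 0" for n
  proof -
    have "(LINT x|lebesgue. \<phi> (x + ?h n *\<^sub>R ?e) - \<phi> x) = 0"
      by (subst Bochner_Integration.integral_diff[OF int' int], subst integral_translate[OF cont(1)]) simp
    then show ?thesis unfolding integral_divide_zero by (simp only: div_0)
  qed
  have "(\<lambda>n. LINT x|lebesgue. ?F n x) \<longlonglongrightarrow> (LINT x|lebesgue. partial_deriv i \<phi> x)"
  proof (rule integral_dominated_convergence)
    show "partial_deriv i \<phi> \<in> borel_measurable lebesgue" "?F n \<in> borel_measurable lebesgue" for n
      using continuous_measurable_lebesgue_on[OF cont(2), of UNIV] continuous_measurable_lebesgue_on[OF contF[of n], of UNIV]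
      by (simp_all only: lebesgue_on_UNIV_eq) auto
    show "integrable lebesgue (\<lambda>x. C * indicator ?B x :: real)"
      using integrable_indicator_bounded[of UNIV ?B] by (simp add: lebesgue_on_UNIV_eq)
    show "AE x in lebesgue. (\<lambda>n. ?F n x) \<longlonglongrightarrow> partial_deriv i \<phi> x"
      by (intro AE_I2 difference_quotient_tendsto smooth_differentiable assms)
    fix n
    show "AE x in lebesgue. norm (?F n x) \<le> C * indicator ?B x"
    proof (rule AE_I2)
      fix x :: "real^'d"
      show "norm (?F n x) \<le> C * indicator ?B x"
      proof (cases "x \<in> ?B")
        case True
        have "cmod (\<phi> (x + ?h n *\<^sub>R ?e) - \<phi> x) \<le> C * ?h n"
          by (intro difference_quotient_bound smooth_differentiable assms C) simp
        then have "cmod (\<phi> (x + ?h n *\<^sub>R ?e) - \<phi> x) / ?h n \<le> (C * ?h n) / ?h n"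
          by (intro divide_right_mono) auto
        moreover have "norm (?F n x) = cmod (\<phi> (x + ?h n *\<^sub>R ?e) - \<phi> x) / \<bar>?h n\<bar>"
          by (simp only: norm_divide norm_of_real)
        ultimately show ?thesis using True by simp
      next
        case False
        then have x: "R + 1 < norm x" by simp
        have "norm x \<le> norm (x + ?h n *\<^sub>R ?e) + norm (?h n *\<^sub>R ?e)"
          using norm_triangle_ineq4[of "x + ?h n *\<^sub>R ?e" "?h n *\<^sub>R ?e"] by simp
        moreover have "norm (?h n *\<^sub>R ?e) \<le> 1" by (simp add: norm_axis_1)
        ultimately have x': "R < norm (x + ?h n *\<^sub>R ?e)" using x by linarith
        have "\<phi> y = 0" if "R < norm y" for y
          using R[of y] that closure_subset[of "{x. \<phi> x \<noteq> 0}"] by force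
        then have "\<phi> x = 0" "\<phi> (x + ?h n *\<^sub>R ?e) = 0" using x x' by auto
        then show ?thesis using C(1) by simp
      qed
    qed
  qed
  then show ?thesis unfolding zero by (simp add: LIMSEQ_const_iff)
qed

lemma integral_lebesgue_on_eq:
  fixes f :: "real^'d::finite \<Rightarrow> complex"
  assumes "\<Omega> \<in> sets lebesgue" "\<And>x. x \<notin> \<Omega> \<Longrightarrow> f x = 0"
  shows "(LINT x|lebesgue_on \<Omega>. f x) = (LINT x|lebesgue. f x)"
proof -
  have "(\<lambda>x. indicator \<Omega> x *\<^sub>R f x) = f" using assms(2) by (auto simp: indicator_def)
  then show ?thesis using assms(1) by (subst integral_restrict_space) simp_all
qed

lemma integral_test_partial_deriv_eq_0:
  fixes \<phi> :: "real^'d::finite \<Rightarrow> complex"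
  assumes "\<Omega> \<in> sets lebesgue" "\<phi> \<in> test_functions \<Omega>"
  shows "(LINT x|lebesgue_on \<Omega>. partial_deriv i \<phi> x) = 0"
proof -
  have "partial_deriv i \<phi> x = 0" if "x \<notin> \<Omega>" for x
    using partial_deriv_outside_support[of x \<phi> i] assms(2) that unfolding test_functions_iff by blast
  then show ?thesis
    using integral_lebesgue_on_eq[OF assms(1)] integral_partial_deriv_eq_0[of \<phi> i] assms(2)
    unfolding test_functions_iff by simp
qed

subsection \<open>The fundamental lemma of the calculus of variations\<close>

text \<open>Cutoffs equal to 1 on the compact sets of points at distance at least 1/(n+1) from the
  complement of W, which exhaust W.\<close>

lemma test_function_approx_open:
  fixes W :: "(real^'d::finite) set"
  assumes "open W" "bounded W" "W \<subseteq> \<Omega>"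
  obtains \<phi> where "\<And>n::nat. \<phi> n \<in> test_functions \<Omega>" "\<And>n x. cmod (\<phi> n x) \<le> indicator W x"
    "\<And>x. (\<lambda>n. \<phi> n x) \<longlonglongrightarrow> indicator W x"
proof -
  \<comment> \<open>\<open>infdist\<close> to the empty set is 0 by convention, which would make
    every exhausting set empty; boundedness of W excludes this.\<close>
  have ne: "- W \<noteq> {}" using assms(2) not_bounded_UNIV by (metis double_complement Compl_empty_eq)
  define C where "C n = {x. 1 / real (Suc n) \<le> infdist x (- W)}" for n
  have sub: "C n \<subseteq> W" for n
  proof
    fix x assume "x \<in> C n"
    then have "0 < infdist x (- W)" unfolding C_def
      by (metis (mono_tags, lifting) mem_Collect_eq of_nat_0_less_iff order_less_le_trans zero_less_Suc zero_less_divide_1_iff)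
    then show "x \<in> W" using infdist_zero[of x "- W"] by fastforce
  qed
  have "compact (C n)" for n
  proof -
    have "closed (C n)" unfolding C_def by (intro closed_Collect_le continuous_intros)
    moreover have "bounded (C n)" by (rule bounded_subset[OF assms(2) sub])
    ultimately show ?thesis by (simp add: compact_eq_bounded_closed)
  qed
  note Ccomp = this
  have "\<exists>\<phi>. smooth (\<lambda>x. complex_of_real (\<phi> x)) \<and> (\<forall>x. 0 \<le> \<phi> x \<and> \<phi> x \<le> 1) \<and> (\<forall>x\<in>C n. \<phi> x = 1) \<and>
      compact (closure {x. \<phi> x \<noteq> 0}) \<and> closure {x. \<phi> x \<noteq> 0} \<subseteq> W" for n
  proof -
    obtain \<eta> V where "smooth (\<lambda>x. complex_of_real (\<eta> x))" "\<And>x. 0 \<le> \<eta> x" "\<And>x. \<eta> x \<le> 1" "open V" "C n \<subseteq> V"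
      "\<And>x. x \<in> V \<Longrightarrow> \<eta> x = 1" "compact (closure {x. \<eta> x \<noteq> 0})" "closure {x. \<eta> x \<noteq> 0} \<subseteq> W"
      using smooth_cutoff[OF Ccomp assms(1) sub] by blast
    then show ?thesis by (intro exI[of _ \<eta>]) blast
  qed
  then have "\<forall>n. \<exists>\<phi>. smooth (\<lambda>x. complex_of_real (\<phi> x)) \<and> (\<forall>x. 0 \<le> \<phi> x \<and> \<phi> x \<le> 1) \<and> (\<forall>x\<in>C n. \<phi> x = 1) \<and>
      compact (closure {x. \<phi> x \<noteq> 0}) \<and> closure {x. \<phi> x \<noteq> 0} \<subseteq> W" by blast
  from choice[OF this] obtain \<phi> where \<phi>: "\<And>n. smooth (\<lambda>x. complex_of_real (\<phi> n x))" "\<And>n x. 0 \<le> \<phi> n x \<and> \<phi> n x \<le> 1"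
    "\<And>n x. x \<in> C n \<Longrightarrow> \<phi> n x = 1" "\<And>n. compact (closure {x. \<phi> n x \<noteq> 0})" "\<And>n. closure {x. \<phi> n x \<noteq> 0} \<subseteq> W"
    by blast
  have out: "\<phi> n x = 0" if "x \<notin> W" for n x
    using \<phi>(5)[of n] closure_subset[of "{x. \<phi> n x \<noteq> 0}"] that by blast
  show ?thesis
  proof (rule that[of "\<lambda>n x. complex_of_real (\<phi> n x)"])
    show "(\<lambda>x. complex_of_real (\<phi> n x)) \<in> test_functions \<Omega>" for n
      using \<phi>(1)[of n] \<phi>(4)[of n] subset_trans[OF \<phi>(5)[of n] assms(3)] unfolding test_functions_iff by simp
    show "cmod (complex_of_real (\<phi> n x)) \<le> indicator W x" for n x
      using \<phi>(2)[of n x] out[of x n] by (cases "x \<in> W") auto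
    fix x show "(\<lambda>n. complex_of_real (\<phi> n x)) \<longlonglongrightarrow> indicator W x"
    proof (cases "x \<in> W")
      case True
      have "infdist x (- W) \<noteq> 0"
        using in_closed_iff_infdist_zero[of "- W" x] assms(1) ne True by auto
      then have "0 < infdist x (- W)" using infdist_nonneg[of x "- W"] by linarith
      then obtain N where N: "inverse (real (Suc N)) < infdist x (- W)" using reals_Archimedean by blast
      have "\<phi> n x = 1" if "n \<ge> N" for n
      proof (rule \<phi>(3))
        have "1 / real (Suc n) \<le> inverse (real (Suc N))"
          unfolding inverse_eq_divide using that by (intro divide_left_mono) auto
        then show "x \<in> C n" using N by (simp add: C_def del: of_nat_Suc)
      qed
      then show ?thesis using True by (intro tendsto_eventually) (auto simp: eventually_sequentially)
    qed (use out in simp)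
  qed
qed

locale lebesgue_domain =
  fixes \<Omega> :: "(real^'d::finite) set"
  assumes open_dom: "open \<Omega>"
begin

abbreviation M :: "(real^'d) measure" where "M \<equiv> lebesgue_on \<Omega>"

lemma dom_sets: "\<Omega> \<in> sets lebesgue"
  using open_dom by (rule open_lebesgue_sets)

lemma AE_dom: "(AE x in M. P x) \<longleftrightarrow> (AE x in lebesgue. x \<in> \<Omega> \<longrightarrow> P x)"
  using dom_sets by (intro AE_restrict_space_iff) simp

lemma integrable_indicator_mult:
  assumes "g \<in> L2 M" "S \<in> sets lebesgue" "bounded S"
  shows "integrable M (\<lambda>x. g x * complex_of_real (indicator S x))"
  by (rule L2_mult_integrable[OF assms(1) bounded_set_ind_L2[OF dom_sets assms(2,3)]])

lemma vanishing_on_open: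
  assumes g: "g \<in> L2 M" and z: "\<And>\<phi>. \<phi> \<in> test_functions \<Omega> \<Longrightarrow> (LINT x|M. g x * \<phi> x) = 0"
    and W: "open W" "bounded W"
  shows "(LINT x|M. g x * complex_of_real (indicator W x)) = 0"
proof -
  have W': "open (W \<inter> \<Omega>)" "bounded (W \<inter> \<Omega>)" "W \<inter> \<Omega> \<subseteq> \<Omega>"
    using W open_dom by (auto intro: bounded_subset)
  obtain \<phi> where \<phi>: "\<And>n::nat. \<phi> n \<in> test_functions \<Omega>" "\<And>n x. cmod (\<phi> n x) \<le> indicator (W \<inter> \<Omega>) x"
    "\<And>x. (\<lambda>n. \<phi> n x) \<longlonglongrightarrow> indicator (W \<inter> \<Omega>) x"
    using test_function_approx_open[OF W'] by metis
  have int: "integrable M (\<lambda>x. g x * complex_of_real (indicator W x))"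
    using W by (intro integrable_indicator_mult g open_lebesgue_sets)
  have "(\<lambda>n. LINT x|M. g x * \<phi> n x) \<longlonglongrightarrow> (LINT x|M. g x * complex_of_real (indicator W x))"
  proof (rule integral_dominated_convergence)
    show "(\<lambda>x. g x * complex_of_real (indicator W x)) \<in> borel_measurable M"
      by (rule borel_measurable_integrable[OF int])
    show "(\<lambda>x. g x * \<phi> n x) \<in> borel_measurable M" for n
      by (intro borel_measurable_integrable L2_mult_integrable g test_function_L2[OF dom_sets \<phi>(1)])
    show "integrable M (\<lambda>x. cmod (g x * complex_of_real (indicator W x)))" by (rule integrable_norm[OF int])
    show "AE x in M. (\<lambda>n. g x * \<phi> n x) \<longlonglongrightarrow> g x * complex_of_real (indicator W x)"
    proof (rule AE_I2)
      fix x assume "x \<in> space M"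
      then have "indicator (W \<inter> \<Omega>) x = complex_of_real (indicator W x)" by (auto simp: indicator_def)
      then show "(\<lambda>n. g x * \<phi> n x) \<longlonglongrightarrow> g x * complex_of_real (indicator W x)"
        using tendsto_mult[OF tendsto_const \<phi>(3)[of x], of "g x"] by simp
    qed
    fix n
    show "AE x in M. norm (g x * \<phi> n x) \<le> cmod (g x * complex_of_real (indicator W x))"
    proof (rule AE_I2)
      fix x
      have "cmod (\<phi> n x) \<le> indicator W x"
        using \<phi>(2)[of n x] by (rule order_trans) (auto simp: indicator_def)
      then show "norm (g x * \<phi> n x) \<le> cmod (g x * complex_of_real (indicator W x))"
        by (simp add: norm_mult mult_left_mono)
    qed
  qed
  then show ?thesis using z[OF \<phi>(1)] by (simp add: LIMSEQ_const_iff)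
qed

text \<open>Outer regularity: A is approximated from outside by open sets, for which the integrals
  vanish already.\<close>

lemma vanishing_on_measurable:
  assumes g: "g \<in> L2 M" and z: "\<And>\<phi>. \<phi> \<in> test_functions \<Omega> \<Longrightarrow> (LINT x|M. g x * \<phi> x) = 0"
    and A: "A \<in> sets lebesgue" "bounded A"
  shows "(LINT x|M. g x * complex_of_real (indicator A x)) = 0"
proof -
  have "\<forall>n. \<exists>T. open T \<and> A \<subseteq> T \<and> T - A \<in> sets lebesgue \<and> emeasure lebesgue (T - A) < ennreal (1 / real (Suc n))"
    using sets_lebesgue_outer_open[OF A(1)] by (metis fmeasurableD of_nat_0_less_iff zero_less_Suc zero_less_divide_1_iff)
  from choice[OF this] obtain T where T: "\<And>n. open (T n)" "\<And>n. A \<subseteq> T n" "\<And>n. T n - A \<in> sets lebesgue"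
    "\<And>n. emeasure lebesgue (T n - A) < ennreal (1 / real (Suc n))" by blast
  obtain R where R: "A \<subseteq> ball 0 R" using A(2) bounded_subset_ballD by blast
  \<comment> \<open>Finite intersections make the sets decreasing, so a point left once stays out,
    and the fixed ball supplies the dominating function.\<close>
  define S where "S n = (\<Inter>k\<le>n. T k) \<inter> ball 0 R" for n :: nat
  have S: "open (S n)" "bounded (S n)" "A \<subseteq> S n" for n
    unfolding S_def using T R by (auto intro!: open_INT)
  define E where "E = (\<Inter>n. T n - A)"
  have E: "E \<in> null_sets lebesgue"
  proof
    show "E \<in> sets lebesgue" unfolding E_def using T(3) by (intro sets.countable_INT) auto
    have "emeasure lebesgue E \<le> ennreal (1 / real (Suc n))" for n
    proof -
      have "emeasure lebesgue E \<le> emeasure lebesgue (T n - A)"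
        by (rule emeasure_mono[OF _ T(3)]) (auto simp: E_def)
      then show ?thesis using T(4)[of n] by (meson less_imp_le order_trans)
    qed
    moreover have "(\<lambda>n. ennreal (1 / real (Suc n))) \<longlonglongrightarrow> ennreal 0"
      using LIMSEQ_inverse_real_of_nat by (intro tendsto_ennrealI) (simp add: inverse_eq_divide)
    ultimately have "emeasure lebesgue E \<le> ennreal 0"
      by (intro LIMSEQ_le_const) auto
    then show "emeasure lebesgue E = 0" by simp
  qed
  have ptw: "(\<lambda>n. complex_of_real (indicator (S n) x)) \<longlonglongrightarrow> complex_of_real (indicator A x)" if x: "x \<notin> E" for x
  proof (cases "x \<in> A")
    case True
    then have "x \<in> S n" for n using S(3) by blast
    then show ?thesis using True by simp
  next
    case False
    then obtain N where "x \<notin> T N" using x unfolding E_def by blast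
    then have "x \<notin> S n" if "n \<ge> N" for n using that unfolding S_def by blast
    then show ?thesis using False by (intro tendsto_eventually) (auto simp: eventually_sequentially intro!: exI[of _ N])
  qed
  have int: "integrable M (\<lambda>x. g x * complex_of_real (indicator (ball 0 R) x))"
    by (intro integrable_indicator_mult g open_lebesgue_sets) auto
  have "(\<lambda>n. LINT x|M. g x * complex_of_real (indicator (S n) x)) \<longlonglongrightarrow> (LINT x|M. g x * complex_of_real (indicator A x))"
  proof (rule integral_dominated_convergence)
    show "(\<lambda>x. g x * complex_of_real (indicator A x)) \<in> borel_measurable M"
      by (rule borel_measurable_integrable[OF integrable_indicator_mult[OF g A]])
    show "(\<lambda>x. g x * complex_of_real (indicator (S n) x)) \<in> borel_measurable M" for n
      using S[of n] by (intro borel_measurable_integrable integrable_indicator_mult g open_lebesgue_sets)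
    show "integrable M (\<lambda>x. cmod (g x * complex_of_real (indicator (ball 0 R) x)))" by (rule integrable_norm[OF int])
    have "AE x in lebesgue. x \<notin> E" by (rule AE_not_in[OF E])
    then show "AE x in M. (\<lambda>n. g x * complex_of_real (indicator (S n) x)) \<longlonglongrightarrow> g x * complex_of_real (indicator A x)"
      unfolding AE_dom by eventually_elim (use ptw in \<open>auto intro: tendsto_mult\<close>)
    show "AE x in M. norm (g x * complex_of_real (indicator (S n) x)) \<le> cmod (g x * complex_of_real (indicator (ball 0 R) x))" for n
      by (intro AE_I2) (auto simp: S_def indicator_def norm_mult)
  qed
  then show ?thesis using vanishing_on_open[OF g z S(1,2)] by (simp add: LIMSEQ_const_iff)
qed

text \<open>The integral over the set where Re g is positive, cut to a ball, vanishes, so this set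
  is null; balls of integer radius exhaust the space.\<close>

lemma Re_nonpos_of_vanishing:
  assumes g: "g \<in> L2 M" and z: "\<And>\<phi>. \<phi> \<in> test_functions \<Omega> \<Longrightarrow> (LINT x|M. g x * \<phi> x) = 0"
  shows "AE x in M. Re (g x) \<le> 0"
proof -
  have "AE x in M. norm x < real n \<longrightarrow> Re (g x) \<le> 0" for n :: nat
  proof -
    define A where "A = {x \<in> \<Omega>. 0 < Re (g x)} \<inter> ball 0 (real n)"
    have "{x \<in> space M. 0 < Re (g x)} \<in> sets M"
      using L2_measurable[OF g] by measurable
    then have "{x \<in> \<Omega>. 0 < Re (g x)} \<in> sets lebesgue" using dom_sets by (simp add: sets_restrict_space_iff)
    then have A: "A \<in> sets lebesgue" "bounded A"
      unfolding A_def by (simp_all add: sets.Int open_lebesgue_sets bounded_Int)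
    have int: "integrable M (\<lambda>x. g x * complex_of_real (indicator A x))"
      by (rule integrable_indicator_mult[OF g A])
    have "(LINT x|M. Re (g x * complex_of_real (indicator A x))) = Re (LINT x|M. g x * complex_of_real (indicator A x))"
      by (rule integral_Re[OF int])
    also have "\<dots> = 0" using vanishing_on_measurable[OF g z A] by simp
    finally have "(LINT x|M. Re (g x * complex_of_real (indicator A x))) = 0" .
    then have "AE x in M. Re (g x * complex_of_real (indicator A x)) = 0"
      by (subst (asm) integral_nonneg_eq_0_iff_AE[OF integrable_Re[OF int]])
         (auto simp: A_def indicator_def)
    then have "AE x in M. x \<in> \<Omega> \<longrightarrow> norm x < real n \<longrightarrow> Re (g x) \<le> 0"
      by eventually_elim (auto simp: A_def indicator_def split: if_splits)
    then show ?thesis by (auto simp: AE_dom)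
  qed
  then have "AE x in M. \<forall>n::nat. norm x < real n \<longrightarrow> Re (g x) \<le> 0"
    unfolding AE_all_countable by blast
  then show ?thesis
  proof eventually_elim
    fix x assume "\<forall>n::nat. norm x < real n \<longrightarrow> Re (g x) \<le> 0"
    then show "Re (g x) \<le> 0" using reals_Archimedean2[of "norm x"] by blast
  qed
qed

text \<open>The one-sided result is applied to g multiplied by 1, -1, \<i> and -\<i>, which squeezes
  real and imaginary parts to 0.\<close>

lemma fundamental_lemma:
  assumes g: "g \<in> L2 M" and z: "\<And>\<phi>. \<phi> \<in> test_functions \<Omega> \<Longrightarrow> (LINT x|M. g x * \<phi> x) = 0"
  shows "AE x in M. g x = 0"
proof -
  have "AE x in M. Re (c * g x) \<le> 0" for c
    by (rule Re_nonpos_of_vanishing[OF L2_cmult[OF g]]) (simp add: z mult.assoc)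
  from this[of 1] this[of "-1"] this[of \<i>] this[of "-\<i>"] show ?thesis
    by eventually_elim (simp add: complex_eq_iff)
qed

subsection \<open>The Sobolev space\<close>

lemma weak_partial_unique:
  assumes "is_weak_partial \<Omega> i u g" "is_weak_partial \<Omega> i u h" "g \<in> L2 M" "h \<in> L2 M"
  shows "AE x in M. g x = h x"
proof -
  have "AE x in M. g x - h x = 0"
  proof (rule fundamental_lemma[OF L2_diff[OF assms(3,4)]])
    fix \<phi> assume phi: "\<phi> \<in> test_functions \<Omega>"
    have i: "integrable M (\<lambda>x. g x * \<phi> x)" "integrable M (\<lambda>x. h x * \<phi> x)"
      by (intro L2_mult_integrable assms test_function_L2[OF dom_sets phi])+
    have "(LINT x|M. (g x - h x) * \<phi> x) = (LINT x|M. g x * \<phi> x) - (LINT x|M. h x * \<phi> x)"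
      unfolding left_diff_distrib by (rule Bochner_Integration.integral_diff[OF i])
    moreover have "(LINT x|M. u x * partial_deriv i \<phi> x) = - (LINT x|M. g x * \<phi> x)"
      "(LINT x|M. u x * partial_deriv i \<phi> x) = - (LINT x|M. h x * \<phi> x)"
      using assms(1,2) phi unfolding is_weak_partial_def by blast+
    ultimately show "(LINT x|M. (g x - h x) * \<phi> x) = 0" by simp
  qed
  then show ?thesis by simp
qed

lemma weak_partial_props:
  assumes "u \<in> H1 \<Omega>"
  shows "weak_partial \<Omega> i u \<in> L2 M" "is_weak_partial \<Omega> i u (weak_partial \<Omega> i u)"
proof -
  have "\<exists>g. g \<in> L2 M \<and> is_weak_partial \<Omega> i u g" using assms unfolding H1_def by blast
  from someI_ex[OF this] show "weak_partial \<Omega> i u \<in> L2 M" "is_weak_partial \<Omega> i u (weak_partial \<Omega> i u)"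
    unfolding weak_partial_def by auto
qed

lemma H1_L2: "u \<in> H1 \<Omega> \<Longrightarrow> u \<in> L2 M"
  by (simp add: H1_def)

text \<open>Uniqueness lets the arbitrary choice in \<open>weak_partial\<close> be computed from any
  square integrable weak derivative.\<close>

lemma H1I:
  assumes "u \<in> L2 M" "\<And>i. g i \<in> L2 M" "\<And>i. is_weak_partial \<Omega> i u (g i)"
  shows "u \<in> H1 \<Omega>" "AE x in M. weak_partial \<Omega> i u x = g i x"
proof -
  show u: "u \<in> H1 \<Omega>" unfolding H1_def using assms by blast
  show "AE x in M. weak_partial \<Omega> i u x = g i x"
    by (rule weak_partial_unique[OF weak_partial_props(2)[OF u] assms(3) weak_partial_props(1)[OF u] assms(2)])
qed

lemma H1_comb:
  assumes u: "u \<in> H1 \<Omega>" and v: "v \<in> H1 \<Omega>"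
  shows "(\<lambda>x. \<alpha> * u x + \<beta> * v x) \<in> H1 \<Omega>"
    "AE x in M. weak_partial \<Omega> i (\<lambda>x. \<alpha> * u x + \<beta> * v x) x = \<alpha> * weak_partial \<Omega> i u x + \<beta> * weak_partial \<Omega> i v x"
proof -
  have weak: "is_weak_partial \<Omega> i (\<lambda>x. \<alpha> * u x + \<beta> * v x) (\<lambda>x. \<alpha> * weak_partial \<Omega> i u x + \<beta> * weak_partial \<Omega> i v x)" for i
    unfolding is_weak_partial_def
  proof
    fix \<phi> assume phi: "\<phi> \<in> test_functions \<Omega>"
    note phiL = test_function_L2[OF dom_sets phi] test_function_L2[OF dom_sets test_functions_partial_deriv[OF phi, of i]]
    have lin: "(LINT x|M. (\<alpha> * f x + \<beta> * h x) * \<psi> x) = \<alpha> * (LINT x|M. f x * \<psi> x) + \<beta> * (LINT x|M. h x * \<psi> x)"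
      if "f \<in> L2 M" "h \<in> L2 M" "\<psi> \<in> L2 M" for f h \<psi>
      using L2_mult_integrable[OF that(1,3)] L2_mult_integrable[OF that(2,3)] by (simp add: distrib_right mult.assoc)
    show "(LINT x|M. (\<alpha> * u x + \<beta> * v x) * partial_deriv i \<phi> x) =
       - (LINT x|M. (\<alpha> * weak_partial \<Omega> i u x + \<beta> * weak_partial \<Omega> i v x) * \<phi> x)"
      unfolding lin[OF H1_L2[OF u] H1_L2[OF v] phiL(2)] lin[OF weak_partial_props(1)[OF u] weak_partial_props(1)[OF v] phiL(1)]
      using weak_partial_props(2)[OF u, of i] weak_partial_props(2)[OF v, of i] phi unfolding is_weak_partial_def by simp
  qed
  note H = H1I[of "\<lambda>x. \<alpha> * u x + \<beta> * v x" "\<lambda>i x. \<alpha> * weak_partial \<Omega> i u x + \<beta> * weak_partial \<Omega> i v x",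
      OF L2_comb[OF H1_L2[OF u] H1_L2[OF v]] L2_comb[OF weak_partial_props(1)[OF u] weak_partial_props(1)[OF v]] weak]
  show "(\<lambda>x. \<alpha> * u x + \<beta> * v x) \<in> H1 \<Omega>" by (rule H(1))
  show "AE x in M. weak_partial \<Omega> i (\<lambda>x. \<alpha> * u x + \<beta> * v x) x = \<alpha> * weak_partial \<Omega> i u x + \<beta> * weak_partial \<Omega> i v x"
    by (rule H(2))
qed

lemma is_weak_partial_smooth:
  assumes "smooth f"
  shows "is_weak_partial \<Omega> i f (partial_deriv i f)"
  unfolding is_weak_partial_def
proof
  fix \<phi> assume phi: "\<phi> \<in> test_functions \<Omega>"
  have sphi: "smooth \<phi>" using phi by (simp add: test_functions_iff)
  have i: "integrable M (\<lambda>x. partial_deriv i f x * \<phi> x)" "integrable M (\<lambda>x. f x * partial_deriv i \<phi> x)"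
    by (rule test_function_integrable[OF dom_sets test_functions_mult[OF phi smooth_partial_deriv[OF assms]]],
        rule test_function_integrable[OF dom_sets test_functions_mult[OF test_functions_partial_deriv[OF phi] assms]])
  have "0 = (LINT x|M. partial_deriv i (\<lambda>x. f x * \<phi> x) x)"
    by (rule integral_test_partial_deriv_eq_0[OF dom_sets test_functions_mult[OF phi assms], symmetric])
  also have "\<dots> = (LINT x|M. partial_deriv i f x * \<phi> x + f x * partial_deriv i \<phi> x)"
    by (simp only: partial_deriv_mult[OF smooth_differentiable[OF assms] smooth_differentiable[OF sphi]])
  also have "\<dots> = (LINT x|M. partial_deriv i f x * \<phi> x) + (LINT x|M. f x * partial_deriv i \<phi> x)"
    by (rule Bochner_Integration.integral_add[OF i])
  finally show "(LINT x|M. f x * partial_deriv i \<phi> x) = - (LINT x|M. partial_deriv i f x * \<phi> x)"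
    by (simp add: eq_neg_iff_add_eq_0 add.commute)
qed

lemma H1_smooth:
  assumes "smooth f" "f \<in> L2 M" "\<And>i. partial_deriv i f \<in> L2 M"
  shows "f \<in> H1 \<Omega>" "AE x in M. weak_partial \<Omega> i f x = partial_deriv i f x"
  using H1I[of f "\<lambda>i. partial_deriv i f", OF assms(2,3) is_weak_partial_smooth[OF assms(1)]] by blast+

text \<open>The product f \<phi> is again a test function, so the weak derivative of u may be tested
  against it; the classical product rule for f \<phi> does the rest.\<close>

lemma H1_mult:
  assumes u: "u \<in> H1 \<Omega>" and f: "smooth f"
    and bd: "\<And>x. x \<in> \<Omega> \<Longrightarrow> cmod (f x) \<le> B" "\<And>i x. x \<in> \<Omega> \<Longrightarrow> cmod (partial_deriv i f x) \<le> B"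
  shows "(\<lambda>x. f x * u x) \<in> H1 \<Omega>"
    "AE x in M. weak_partial \<Omega> i (\<lambda>x. f x * u x) x = f x * weak_partial \<Omega> i u x + partial_deriv i f x * u x"
proof -
  have meas: "h \<in> borel_measurable M" if "smooth h" for h
    by (rule continuous_measurable_lebesgue_on[OF smooth_continuous[OF that] dom_sets])
  have L2f: "(\<lambda>x. f x * w x) \<in> L2 M" if "w \<in> L2 M" for w
    by (rule L2_mult_bounded[OF that meas[OF f], where B=B]) (use bd in \<open>auto intro: AE_I2\<close>)
  have L2df: "(\<lambda>x. partial_deriv i f x * w x) \<in> L2 M" if "w \<in> L2 M" for w i
    by (rule L2_mult_bounded[OF that meas[OF smooth_partial_deriv[OF f]], where B=B]) (use bd in \<open>auto intro: AE_I2\<close>)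
  have gL2: "(\<lambda>x. f x * weak_partial \<Omega> i u x + partial_deriv i f x * u x) \<in> L2 M" for i
    by (intro L2_add L2f L2df weak_partial_props(1)[OF u] H1_L2[OF u])
  have weak: "is_weak_partial \<Omega> i (\<lambda>x. f x * u x) (\<lambda>x. f x * weak_partial \<Omega> i u x + partial_deriv i f x * u x)" for i
    unfolding is_weak_partial_def
  proof
    fix \<phi> assume phi: "\<phi> \<in> test_functions \<Omega>"
    have sphi: "smooth \<phi>" using phi by (simp add: test_functions_iff)
    note fphi = test_functions_mult[OF phi f]
    have i1: "integrable M (\<lambda>x. u x * partial_deriv i (\<lambda>x. f x * \<phi> x) x)"
      by (intro L2_mult_integrable H1_L2[OF u] test_function_L2[OF dom_sets test_functions_partial_deriv[OF fphi]])
    have i2: "integrable M (\<lambda>x. u x * (partial_deriv i f x * \<phi> x))"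
      by (intro L2_mult_integrable H1_L2[OF u] test_function_L2[OF dom_sets test_functions_mult[OF phi smooth_partial_deriv[OF f]]])
    have i3: "integrable M (\<lambda>x. weak_partial \<Omega> i u x * (f x * \<phi> x))"
      by (intro L2_mult_integrable weak_partial_props(1)[OF u] test_function_L2[OF dom_sets fphi])
    have "(LINT x|M. f x * u x * partial_deriv i \<phi> x)
        = (LINT x|M. u x * partial_deriv i (\<lambda>x. f x * \<phi> x) x - u x * (partial_deriv i f x * \<phi> x))"
      by (rule arg_cong[where f="integral\<^sup>L M"])
         (simp only: partial_deriv_mult[OF smooth_differentiable[OF f] smooth_differentiable[OF sphi]],
          simp add: algebra_simps)
    also have "\<dots> = (LINT x|M. u x * partial_deriv i (\<lambda>x. f x * \<phi> x) x) - (LINT x|M. u x * (partial_deriv i f x * \<phi> x))"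
      by (rule Bochner_Integration.integral_diff[OF i1 i2])
    also have "(LINT x|M. u x * partial_deriv i (\<lambda>x. f x * \<phi> x) x) = - (LINT x|M. weak_partial \<Omega> i u x * (f x * \<phi> x))"
      using weak_partial_props(2)[OF u, of i] fphi unfolding is_weak_partial_def by blast
    also have "- (LINT x|M. weak_partial \<Omega> i u x * (f x * \<phi> x)) - (LINT x|M. u x * (partial_deriv i f x * \<phi> x))
        = - (LINT x|M. weak_partial \<Omega> i u x * (f x * \<phi> x) + u x * (partial_deriv i f x * \<phi> x))"
      unfolding Bochner_Integration.integral_add[OF i3 i2] by simp
    also have "(\<lambda>x. weak_partial \<Omega> i u x * (f x * \<phi> x) + u x * (partial_deriv i f x * \<phi> x))
        = (\<lambda>x. (f x * weak_partial \<Omega> i u x + partial_deriv i f x * u x) * \<phi> x)"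
      by (simp add: algebra_simps)
    finally show "(LINT x|M. f x * u x * partial_deriv i \<phi> x)
        = - (LINT x|M. (f x * weak_partial \<Omega> i u x + partial_deriv i f x * u x) * \<phi> x)" .
  qed
  note H = H1I[of "\<lambda>x. f x * u x" "\<lambda>i x. f x * weak_partial \<Omega> i u x + partial_deriv i f x * u x",
      OF L2f[OF H1_L2[OF u]] gL2 weak]
  show "(\<lambda>x. f x * u x) \<in> H1 \<Omega>" by (rule H(1))
  show "AE x in M. weak_partial \<Omega> i (\<lambda>x. f x * u x) x = f x * weak_partial \<Omega> i u x + partial_deriv i f x * u x"
    by (rule H(2))
qed

end

section \<open>The degenerate elliptic form\<close>

locale elliptic = lebesgue_domain \<Omega> for \<Omega> :: "(real^'d::finite) set" +
  fixes a :: "'d \<Rightarrow> 'd \<Rightarrow> real^'d \<Rightarrow> complex" and \<theta> :: real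
  assumes a_infty: "\<And>i j. a i j \<in> L_infty (lebesgue_on \<Omega>)"
    and theta: "0 \<le> \<theta>" "\<theta> < pi / 2"
    and ellipticity: "\<And>\<xi> :: complex^'d. AE x in lebesgue_on \<Omega>.
           (\<Sum>i\<in>UNIV. \<Sum>j\<in>UNIV. a i j x * \<xi> $ i * cnj (\<xi> $ j)) \<in> sector \<theta>"
begin

definition Q :: "real^'d \<Rightarrow> 'd form" where
  "Q x \<xi> \<eta> = (\<Sum>i\<in>UNIV. \<Sum>j\<in>UNIV. \<xi> i * a i j x * cnj (\<eta> j))"

definition grad :: "(real^'d \<Rightarrow> complex) \<Rightarrow> real^'d \<Rightarrow> 'd \<Rightarrow> complex" where
  "grad u x i = weak_partial \<Omega> i u x"

definition energy :: "(real^'d \<Rightarrow> complex) \<Rightarrow> real^'d \<Rightarrow> real" where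
  "energy u x = Re (Q x (grad u x) (grad u x))"

lemma AE_all_index: "(\<And>i::'d. AE x in M. P i x) \<Longrightarrow> AE x in M. \<forall>i. P i x"
  using AE_finite_allI[of "UNIV :: 'd set" "\<lambda>i x. P i x" M] by simp

lemma obtain_coefficient_bound:
  obtains A where "0 \<le> A" "AE x in M. \<forall>i j. cmod (a i j x) \<le> A"
proof -
  have "\<exists>C. AE x in M. cmod (a i j x) \<le> C" for i j using a_infty[of i j] by (simp add: L_infty_def)
  then obtain C where C: "\<And>i j. AE x in M. cmod (a i j x) \<le> C i j" by metis
  define A where "A = (\<Sum>i\<in>UNIV. \<Sum>j\<in>UNIV. \<bar>C i j\<bar>)"
  have CA: "C i j \<le> A" for i j
  proof -
    have "C i j \<le> \<bar>C i j\<bar>" by simp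
    also have "\<dots> \<le> (\<Sum>j\<in>UNIV. \<bar>C i j\<bar>)" by (rule member_le_sum) auto
    also have "\<dots> \<le> A" unfolding A_def by (rule member_le_sum[of i UNIV "\<lambda>i. \<Sum>j\<in>UNIV. \<bar>C i j\<bar>"]) (auto intro: sum_nonneg)
    finally show ?thesis .
  qed
  have "AE x in M. cmod (a i j x) \<le> A" for i j
    using C[of i j] by eventually_elim (use CA order_trans in blast)
  then have "AE x in M. \<forall>i j. cmod (a i j x) \<le> A" by (intro AE_all_index)
  moreover have "0 \<le> A" unfolding A_def by (intro sum_nonneg) auto
  ultimately show ?thesis by (rule that[rotated])
qed

definition A :: real where "A = (SOME A. 0 \<le> A \<and> (AE x in M. \<forall>i j. cmod (a i j x) \<le> A))"

lemma A: "0 \<le> A" "AE x in M. \<forall>i j. cmod (a i j x) \<le> A"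
proof -
  have "\<exists>A. 0 \<le> A \<and> (AE x in M. \<forall>i j. cmod (a i j x) \<le> A)" using obtain_coefficient_bound by blast
  from someI_ex[OF this] show "0 \<le> A" "AE x in M. \<forall>i j. cmod (a i j x) \<le> A" unfolding A_def by auto
qed

text \<open>Bound for the quadratic form of the coefficients on vectors with entries of modulus at
  most 1: d^2 terms, each at most \<open>A\<close>.\<close>

definition N :: real where "N = (real CARD('d))\<^sup>2 * A"

lemma N_nonneg: "0 \<le> N"
  using A by (simp add: N_def)

abbreviation T :: real where "T \<equiv> tan \<theta>"

lemma T_nonneg: "0 \<le> T"
  using theta tan_pos_pi2_le by simp

lemma Q_comb_left: "Q x (\<lambda>i. \<alpha> * u i + \<beta> * v i) w = \<alpha> * Q x u w + \<beta> * Q x v w"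
proof -
  have "(\<alpha> * u i + \<beta> * v i) * a i j x * cnj (w j) = \<alpha> * (u i * a i j x * cnj (w j)) + \<beta> * (v i * a i j x * cnj (w j))" for i j
    by (simp add: algebra_simps)
  then show ?thesis unfolding Q_def by (simp only: sum.distrib sum_distrib_left)
qed

lemma Q_comb_right: "Q x w (\<lambda>i. \<alpha> * u i + \<beta> * v i) = cnj \<alpha> * Q x w u + cnj \<beta> * Q x w v"
proof -
  have "w i * a i j x * cnj (\<alpha> * u j + \<beta> * v j) = cnj \<alpha> * (w i * a i j x * cnj (u j)) + cnj \<beta> * (w i * a i j x * cnj (v j))" for i j
    by (simp add: algebra_simps)
  then show ?thesis unfolding Q_def by (simp only: sum.distrib sum_distrib_left)
qed

text \<open>The hypothesis provides an exceptional null set for each vector separately. Only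
  countably many are needed for a countable dense set of vectors, and continuity in the vector
  covers the rest.\<close>

lemma AE_pointwise_sector:
  "AE x in M. \<forall>\<xi>. 0 \<le> Re (Q x \<xi> \<xi>) \<and> \<bar>Im (Q x \<xi> \<xi>)\<bar> \<le> T * Re (Q x \<xi> \<xi>)"
proof -
  define P where "P x \<xi> \<longleftrightarrow> 0 \<le> Re (Q x (vec_nth \<xi>) (vec_nth \<xi>)) \<and>
      \<bar>Im (Q x (vec_nth \<xi>) (vec_nth \<xi>))\<bar> \<le> T * Re (Q x (vec_nth \<xi>) (vec_nth \<xi>))" for x and \<xi> :: "complex^'d"
  obtain D :: "(complex^'d) set" where D: "countable D" "\<And>X. open X \<Longrightarrow> X \<noteq> {} \<Longrightarrow> \<exists>d\<in>D. d \<in> X"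
    using countable_dense_exists[where 'a="complex^'d"] by blast
  have "AE x in M. P x \<xi>" for \<xi>
    using ellipticity[of \<xi>]
  proof eventually_elim
    fix x assume "(\<Sum>i\<in>UNIV. \<Sum>j\<in>UNIV. a i j x * \<xi> $ i * cnj (\<xi> $ j)) \<in> sector \<theta>"
    then have "Q x (vec_nth \<xi>) (vec_nth \<xi>) \<in> sector \<theta>" unfolding Q_def by (simp add: mult.commute mult.left_commute)
    from sector_bounds[OF this theta] show "P x \<xi>" unfolding P_def by blast
  qed
  then have "AE x in M. \<forall>\<xi>\<in>D. P x \<xi>" using D(1) by (subst AE_ball_countable) auto
  then show ?thesis
  proof eventually_elim
    fix x assume DP: "\<forall>\<xi>\<in>D. P x \<xi>"
    have cont: "continuous_on UNIV (\<lambda>\<xi> :: complex^'d. Q x (vec_nth \<xi>) (vec_nth \<xi>))"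
      unfolding Q_def by (intro continuous_intros)
    let ?O = "{\<xi>. Re (Q x (vec_nth \<xi>) (vec_nth \<xi>)) < 0} \<union>
       {\<xi>. T * Re (Q x (vec_nth \<xi>) (vec_nth \<xi>)) < \<bar>Im (Q x (vec_nth \<xi>) (vec_nth \<xi>))\<bar>}"
    have "open ?O" by (intro open_Un open_Collect_less continuous_intros cont)
    moreover have "\<xi> \<notin> ?O" if "\<xi> \<in> D" for \<xi> using DP that unfolding P_def by fastforce
    ultimately have "?O = {}" using D(2) by blast
    then have "P x \<xi>" for \<xi> unfolding P_def by (auto simp: not_less)
    from this[of "vec_lambda _"] show "\<forall>\<xi>. 0 \<le> Re (Q x \<xi> \<xi>) \<and> \<bar>Im (Q x \<xi> \<xi>)\<bar> \<le> T * Re (Q x \<xi> \<xi>)"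
      unfolding P_def by (simp add: vec_lambda_inverse)
  qed
qed

text \<open>At almost every point the coefficient matrix is itself a sectorial form on functions of
  the index, so Cauchy-Schwarz and the parallelogram bounds apply pointwise.\<close>

definition good :: "real^'d \<Rightarrow> bool" where
  "good x \<longleftrightarrow> sect_form UNIV (Q x) T \<and> (\<forall>i j. cmod (a i j x) \<le> A)"

lemma AE_good: "AE x in M. good x"
  using AE_pointwise_sector A(2)
proof eventually_elim
  fix x assume 1: "\<forall>\<xi>. 0 \<le> Re (Q x \<xi> \<xi>) \<and> \<bar>Im (Q x \<xi> \<xi>)\<bar> \<le> T * Re (Q x \<xi> \<xi>)" and 2: "\<forall>i j. cmod (a i j x) \<le> A"
  have "sect_form UNIV (Q x) T"
    by unfold_locales (use 1 T_nonneg in \<open>auto simp: Q_comb_left Q_comb_right\<close>)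
  with 2 show "good x" by (simp add: good_def)
qed

abbreviation \<kappa> :: real where "\<kappa> \<equiv> 2 * (1 + T)"

lemma kappa_nonneg: "0 \<le> \<kappa>"
  using T_nonneg by simp

lemma Q_bound: "good x \<Longrightarrow> cmod (Q x \<xi> \<eta>) \<le> \<kappa> * (sqrt (Re (Q x \<xi> \<xi>)) * sqrt (Re (Q x \<eta> \<eta>)))"
  unfolding good_def using sect_form.bound[of UNIV "Q x" T \<xi> \<eta>] by simp

lemma Q_nonneg: "good x \<Longrightarrow> 0 \<le> Re (Q x \<xi> \<xi>)"
  unfolding good_def using sect_form.p_nonneg[of UNIV "Q x" T \<xi>] by simp

lemma Q_le:
  assumes "good x" "\<And>i. cmod (\<eta> i) \<le> m"
  shows "Re (Q x \<eta> \<eta>) \<le> N * m\<^sup>2"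
proof -
  have m: "0 \<le> m" using assms(2)[of undefined] norm_ge_zero order_trans by blast
  have "Re (Q x \<eta> \<eta>) \<le> cmod (Q x \<eta> \<eta>)" by (rule complex_Re_le_cmod)
  also have "\<dots> \<le> (\<Sum>i\<in>UNIV. \<Sum>j\<in>UNIV. cmod (\<eta> i * a i j x * cnj (\<eta> j)))"
    unfolding Q_def by (intro sum_norm_le norm_sum)
  also have "\<dots> \<le> (\<Sum>i\<in>(UNIV::'d set). \<Sum>j\<in>(UNIV::'d set). m * A * m)"
  proof (intro sum_mono)
    fix i j
    show "cmod (\<eta> i * a i j x * cnj (\<eta> j)) \<le> m * A * m"
      using assms A(1) m unfolding good_def norm_mult complex_mod_cnj by (intro mult_mono) auto
  qed
  also have "\<dots> = N * m\<^sup>2" by (simp add: N_def power2_eq_square)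
  finally show ?thesis .
qed

lemma grad_L2: "u \<in> H1 \<Omega> \<Longrightarrow> (\<lambda>x. grad u x i) \<in> L2 M"
  unfolding grad_def using weak_partial_props(1) by simp

lemma Q_term_integrable:
  assumes "f \<in> L2 M" "g \<in> L2 M"
  shows "integrable M (\<lambda>x. f x * a i j x * cnj (g x))"
proof -
  have "(\<lambda>x. a i j x * f x) \<in> L2 M"
    by (rule L2_mult_bounded[OF assms(1), of _ A]) (use a_infty A(2) in \<open>auto simp: L_infty_def elim: eventually_mono\<close>)
  from L2_inner_integrable[OF this assms(2)] show ?thesis by (simp add: mult.commute)
qed

lemma Q_integrable:
  assumes "\<And>i. (\<lambda>x. \<xi> x i) \<in> L2 M" "\<And>i. (\<lambda>x. \<eta> x i) \<in> L2 M"
  shows "integrable M (\<lambda>x. Q x (\<xi> x) (\<eta> x))"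
  unfolding Q_def by (intro Bochner_Integration.integrable_sum Q_term_integrable assms)

lemma elliptic_form_eq:
  assumes "u \<in> H1 \<Omega>" "v \<in> H1 \<Omega>"
  shows "elliptic_form \<Omega> a u v = (LINT x|M. Q x (grad u x) (grad v x))"
proof -
  note int = Q_term_integrable[OF grad_L2[OF assms(1)] grad_L2[OF assms(2)]]
  have "(LINT x|M. Q x (grad u x) (grad v x)) = (\<Sum>i\<in>UNIV. \<Sum>j\<in>UNIV. LINT x|M. grad u x i * a i j x * cnj (grad v x j))"
    unfolding Q_def
    by (subst Bochner_Integration.integral_sum, intro Bochner_Integration.integrable_sum int,
        subst Bochner_Integration.integral_sum, rule int, rule refl)
  then show ?thesis unfolding elliptic_form_def grad_def by simp
qed

lemma grad_comb:
  assumes "u \<in> H1 \<Omega>" "v \<in> H1 \<Omega>"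
  shows "AE x in M. grad (\<lambda>x. \<alpha> * u x + \<beta> * v x) x = (\<lambda>i. \<alpha> * grad u x i + \<beta> * grad v x i)"
proof -
  have "AE x in M. \<forall>i. weak_partial \<Omega> i (\<lambda>x. \<alpha> * u x + \<beta> * v x) x = \<alpha> * weak_partial \<Omega> i u x + \<beta> * weak_partial \<Omega> i v x"
    by (intro AE_all_index H1_comb(2)[OF assms])
  then show ?thesis by eventually_elim (auto simp: grad_def)
qed

lemma grad_mult:
  assumes "u \<in> H1 \<Omega>" "smooth f" "\<And>x. x \<in> \<Omega> \<Longrightarrow> cmod (f x) \<le> B" "\<And>i x. x \<in> \<Omega> \<Longrightarrow> cmod (partial_deriv i f x) \<le> B"
  shows "AE x in M. grad (\<lambda>x. f x * u x) x = (\<lambda>i. f x * grad u x i + u x * partial_deriv i f x)"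
proof -
  have "AE x in M. \<forall>i. weak_partial \<Omega> i (\<lambda>x. f x * u x) x = f x * weak_partial \<Omega> i u x + partial_deriv i f x * u x"
    by (intro AE_all_index H1_mult(2)[OF assms])
  then show ?thesis by eventually_elim (auto simp: grad_def mult.commute)
qed

lemma zero_H1: "(\<lambda>x. 0) \<in> H1 \<Omega>"
  by (rule H1_smooth(1)) (simp_all add: smooth_const L2_zero partial_deriv_const)

lemma energy_nonneg: "good x \<Longrightarrow> 0 \<le> energy u x"
  unfolding energy_def by (rule Q_nonneg)

lemma energy_integrable: "u \<in> H1 \<Omega> \<Longrightarrow> integrable M (energy u)"
  unfolding energy_def by (intro integrable_Re Q_integrable grad_L2)

lemma Re_elliptic_form: "u \<in> H1 \<Omega> \<Longrightarrow> Re (elliptic_form \<Omega> a u u) = (LINT x|M. energy u x)"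
  unfolding energy_def by (simp add: elliptic_form_eq integral_Re[OF Q_integrable[OF grad_L2 grad_L2]])

lemma sect_form_elliptic: "sect_form (H1 \<Omega>) (elliptic_form \<Omega> a) T"
proof
  show "0 \<le> T" by (rule T_nonneg)
  show "(\<lambda>x. 0) \<in> H1 \<Omega>" by (rule zero_H1)
  fix u v \<alpha> \<beta> assume u: "u \<in> H1 \<Omega>" and v: "v \<in> H1 \<Omega>"
  let ?c = "\<lambda>x. \<alpha> * u x + \<beta> * v x"
  show c: "?c \<in> H1 \<Omega>" by (rule H1_comb(1)[OF u v])
  fix w assume w: "w \<in> H1 \<Omega>"
  note int = Q_integrable[OF grad_L2 grad_L2]
  have "elliptic_form \<Omega> a ?c w = (LINT x|M. \<alpha> * Q x (grad u x) (grad w x) + \<beta> * Q x (grad v x) (grad w x))"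
    unfolding elliptic_form_eq[OF c w]
  proof (rule integral_cong_AE)
    show "AE x in M. Q x (grad ?c x) (grad w x) = \<alpha> * Q x (grad u x) (grad w x) + \<beta> * Q x (grad v x) (grad w x)"
      using grad_comb[OF u v, of \<alpha> \<beta>] by eventually_elim (simp add: Q_comb_left)
  qed (use borel_measurable_integrable[OF int] u v w c in auto)
  also have "\<dots> = \<alpha> * elliptic_form \<Omega> a u w + \<beta> * elliptic_form \<Omega> a v w"
    using int[OF u w] int[OF v w] by (simp add: elliptic_form_eq u v w)
  finally show "elliptic_form \<Omega> a ?c w = \<alpha> * elliptic_form \<Omega> a u w + \<beta> * elliptic_form \<Omega> a v w" .
  have "elliptic_form \<Omega> a w ?c = (LINT x|M. cnj \<alpha> * Q x (grad w x) (grad u x) + cnj \<beta> * Q x (grad w x) (grad v x))"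
    unfolding elliptic_form_eq[OF w c]
  proof (rule integral_cong_AE)
    show "AE x in M. Q x (grad w x) (grad ?c x) = cnj \<alpha> * Q x (grad w x) (grad u x) + cnj \<beta> * Q x (grad w x) (grad v x)"
      using grad_comb[OF u v, of \<alpha> \<beta>] by eventually_elim (simp add: Q_comb_right)
  qed (use borel_measurable_integrable[OF int] u v w c in auto)
  also have "\<dots> = cnj \<alpha> * elliptic_form \<Omega> a w u + cnj \<beta> * elliptic_form \<Omega> a w v"
    using int[OF w u] int[OF w v] by (simp add: elliptic_form_eq u v w)
  finally show "elliptic_form \<Omega> a w ?c = cnj \<alpha> * elliptic_form \<Omega> a w u + cnj \<beta> * elliptic_form \<Omega> a w v" .
next
  fix u assume u: "u \<in> H1 \<Omega>"
  note int = Q_integrable[OF grad_L2[OF u] grad_L2[OF u]]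
  show "0 \<le> Re (elliptic_form \<Omega> a u u)"
    unfolding Re_elliptic_form[OF u] using AE_good energy_nonneg by (intro integral_nonneg_AE) (auto elim: eventually_mono)
  have "\<bar>Im (elliptic_form \<Omega> a u u)\<bar> = \<bar>LINT x|M. Im (Q x (grad u x) (grad u x))\<bar>"
    by (simp add: elliptic_form_eq u integral_Im[OF int])
  also have "\<dots> \<le> (LINT x|M. \<bar>Im (Q x (grad u x) (grad u x))\<bar>)" by (rule integral_abs_bound)
  also have "\<dots> \<le> (LINT x|M. T * energy u x)"
  proof (rule integral_mono_AE)
    show "AE x in M. \<bar>Im (Q x (grad u x) (grad u x))\<bar> \<le> T * energy u x"
      using AE_good
    proof eventually_elim
      fix x assume "good x"
      then show "\<bar>Im (Q x (grad u x) (grad u x))\<bar> \<le> T * energy u x"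
        unfolding good_def energy_def using sect_form.sector[of UNIV "Q x" T "grad u x"] by simp
    qed
  qed (use integrable_Im[OF int] energy_integrable[OF u] in auto)
  also have "\<dots> = T * Re (elliptic_form \<Omega> a u u)" by (simp add: Re_elliptic_form[OF u])
  finally show "\<bar>Im (elliptic_form \<Omega> a u u)\<bar> \<le> T * Re (elliptic_form \<Omega> a u u)" .
qed

sublocale F: l2_form "H1 \<Omega>" "elliptic_form \<Omega> a" T M
proof -
  interpret E: sect_form "H1 \<Omega>" "elliptic_form \<Omega> a" T by (rule sect_form_elliptic)
  show "l2_form (H1 \<Omega>) (elliptic_form \<Omega> a) T M" by unfold_locales (use H1_L2 in blast)
qed

text \<open>Product rule and the pointwise bound for sums. It keeps sequences of bounded energy
  bounded after a cutoff, which is what test sequences in \<open>representing_sequence\<close> must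
  satisfy.\<close>

lemma mult_energy_bound:
  assumes u: "u \<in> H1 \<Omega>" and f: "smooth f" "\<And>x. x \<in> \<Omega> \<Longrightarrow> cmod (f x) \<le> B" "\<And>i x. x \<in> \<Omega> \<Longrightarrow> cmod (partial_deriv i f x) \<le> B"
  shows "F.p (\<lambda>x. f x * u x) \<le> 2 * B\<^sup>2 * F.p u + 2 * (N * B\<^sup>2) * (l2_norm M u)\<^sup>2"
proof -
  have fu: "(\<lambda>x. f x * u x) \<in> H1 \<Omega>" by (rule H1_mult(1)[OF u f])
  have "(LINT x|M. energy (\<lambda>x. f x * u x) x) \<le> (LINT x|M. 2 * B\<^sup>2 * energy u x + 2 * (N * B\<^sup>2) * (cmod (u x))\<^sup>2)"
  proof (rule integral_mono_AE)
    have "AE x in M. x \<in> \<Omega>" by (intro AE_I2) simp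
    moreover have "AE x in M. grad (\<lambda>x. f x * u x) x = (\<lambda>i. f x * grad u x i + u x * partial_deriv i f x)"
      by (rule grad_mult[OF u f])
    ultimately show "AE x in M. energy (\<lambda>x. f x * u x) x \<le> 2 * B\<^sup>2 * energy u x + 2 * (N * B\<^sup>2) * (cmod (u x))\<^sup>2"
      using AE_good
    proof eventually_elim
      fix x assume g: "grad (\<lambda>x. f x * u x) x = (\<lambda>i. f x * grad u x i + u x * partial_deriv i f x)" and good: "good x" and x: "x \<in> \<Omega>"
      interpret q: sect_form UNIV "Q x" T using good by (simp add: good_def)
      have "energy (\<lambda>x. f x * u x) x \<le> 2 * q.p (\<lambda>i. f x * grad u x i) + 2 * q.p (\<lambda>i. u x * partial_deriv i f x)"
        unfolding energy_def g by (rule q.p_add_le) auto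
      also have "\<dots> = 2 * ((cmod (f x))\<^sup>2 * energy u x) + 2 * ((cmod (u x))\<^sup>2 * q.p (\<lambda>i. partial_deriv i f x))"
        unfolding energy_def by (simp add: q.p_scale)
      also have "\<dots> \<le> 2 * (B\<^sup>2 * energy u x) + 2 * ((cmod (u x))\<^sup>2 * (N * B\<^sup>2))"
        by (intro add_mono mult_left_mono mult_right_mono Q_le good f power_mono x energy_nonneg) auto
      finally show "energy (\<lambda>x. f x * u x) x \<le> 2 * B\<^sup>2 * energy u x + 2 * (N * B\<^sup>2) * (cmod (u x))\<^sup>2" by (simp add: mult_ac)
    qed
  qed (use energy_integrable[OF u] energy_integrable[OF fu] L2_square_integrable[OF H1_L2[OF u]] in auto)
  also have "\<dots> = 2 * B\<^sup>2 * F.p u + 2 * (N * B\<^sup>2) * (l2_norm M u)\<^sup>2"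
    using energy_integrable[OF u] L2_square_integrable[OF H1_L2[OF u]]
    by (simp add: Re_elliptic_form[OF u] l2_norm_sq)
  finally show ?thesis by (simp add: Re_elliptic_form[OF fu])
qed

lemma bounded_mult_integrable:
  assumes "integrable M (f :: _ \<Rightarrow> real)" "\<sigma> \<in> borel_measurable M" "\<And>x. x \<in> \<Omega> \<Longrightarrow> \<bar>\<sigma> x\<bar> \<le> B"
  shows "integrable M (\<lambda>x. \<sigma> x * f x)"
proof (rule Bochner_Integration.integrable_bound)
  show "integrable M (\<lambda>x. B * f x)" using assms(1) by simp
  show "(\<lambda>x. \<sigma> x * f x) \<in> borel_measurable M" by (rule borel_measurable_times[OF assms(2) borel_measurable_integrable[OF assms(1)]])
  show "AE x in M. norm (\<sigma> x * f x) \<le> norm (B * f x)"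
  proof (rule AE_I2)
    fix x assume "x \<in> space M"
    then have "\<bar>\<sigma> x\<bar> \<le> \<bar>B\<bar>" using assms(3)[of x] by (auto simp: abs_le_iff)
    then show "norm (\<sigma> x * f x) \<le> norm (B * f x)" by (simp add: abs_mult mult_right_mono)
  qed
qed

lemma of_real_smooth_measurable: "smooth (\<lambda>x. complex_of_real (\<sigma> x)) \<Longrightarrow> \<sigma> \<in> borel_measurable M"
proof -
  assume "smooth (\<lambda>x. complex_of_real (\<sigma> x))"
  then have [measurable]: "(\<lambda>x. complex_of_real (\<sigma> x)) \<in> borel_measurable M"
    by (intro continuous_measurable_lebesgue_on smooth_continuous dom_sets)
  have "(\<lambda>x. Re (complex_of_real (\<sigma> x))) \<in> borel_measurable M" by measurable
  then show ?thesis by simp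
qed

text \<open>Caccioppoli type estimate; the hypothesis says \<open>\<bar>\<nabla>\<sigma>\<bar>\<^sup>2 \<le> \<sigma> s\<^sup>2\<close>, as for \<open>\<sigma> = \<eta>\<^sup>2\<close> with
  \<open>s = 2 \<bar>\<nabla>\<eta>\<bar>\<close>.\<close>

lemma weighted_energy:
  assumes u: "u \<in> H1 \<Omega>" and \<sigma>: "smooth (\<lambda>x. complex_of_real (\<sigma> x))" "\<And>x. x \<in> \<Omega> \<Longrightarrow> 0 \<le> \<sigma> x"
    and bd: "\<And>x. x \<in> \<Omega> \<Longrightarrow> cmod (complex_of_real (\<sigma> x)) \<le> B"
      "\<And>i x. x \<in> \<Omega> \<Longrightarrow> cmod (partial_deriv i (\<lambda>x. complex_of_real (\<sigma> x)) x) \<le> B"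
    and s: "s \<in> borel_measurable M" "\<And>x. x \<in> \<Omega> \<Longrightarrow> 0 \<le> s x" "\<And>x. x \<in> \<Omega> \<Longrightarrow> s x \<le> B'"
      "\<And>i x. x \<in> \<Omega> \<Longrightarrow> cmod (partial_deriv i (\<lambda>x. complex_of_real (\<sigma> x)) x) \<le> sqrt (\<sigma> x) * s x"
  shows "integrable M (\<lambda>x. \<sigma> x * energy u x)"
    "(LINT x|M. \<sigma> x * energy u x) \<le> 2 * Re (elliptic_form \<Omega> a u (\<lambda>x. complex_of_real (\<sigma> x) * u x))
      + \<kappa>\<^sup>2 * N * (l2_norm M (\<lambda>x. complex_of_real (s x) * u x))\<^sup>2"
proof -
  let ?\<sigma> = "\<lambda>x. complex_of_real (\<sigma> x)"
  have su: "(\<lambda>x. ?\<sigma> x * u x) \<in> H1 \<Omega>" by (rule H1_mult(1)[OF u \<sigma>(1) bd])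
  have sm: "\<sigma> \<in> borel_measurable M" by (rule of_real_smooth_measurable[OF \<sigma>(1)])
  have sB: "\<bar>\<sigma> x\<bar> \<le> B" if "x \<in> \<Omega>" for x using bd(1)[OF that] by simp
  show int1: "integrable M (\<lambda>x. \<sigma> x * energy u x)"
    by (rule bounded_mult_integrable[OF energy_integrable[OF u] sm sB])
  have int2: "integrable M (\<lambda>x. Q x (grad u x) (grad (\<lambda>x. ?\<sigma> x * u x) x))"
    by (intro Q_integrable grad_L2 u su)
  have sL2: "(\<lambda>x. complex_of_real (s x) * u x) \<in> L2 M"
    by (rule L2_mult_bounded[OF H1_L2[OF u], of _ B']) (use s in \<open>auto intro: AE_I2\<close>)
  have "(LINT x|M. \<sigma> x * energy u x) \<le> (LINT x|M. 2 * Re (Q x (grad u x) (grad (\<lambda>x. ?\<sigma> x * u x) x))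
       + \<kappa>\<^sup>2 * N * (cmod (complex_of_real (s x) * u x))\<^sup>2)"
  proof (rule integral_mono_AE[OF int1])
    show "integrable M (\<lambda>x. 2 * Re (Q x (grad u x) (grad (\<lambda>x. ?\<sigma> x * u x) x)) + \<kappa>\<^sup>2 * N * (cmod (complex_of_real (s x) * u x))\<^sup>2)"
      by (intro Bochner_Integration.integrable_add integrable_mult_right integrable_Re int2 L2_square_integrable[OF sL2])
    have "AE x in M. x \<in> \<Omega>" by (intro AE_I2) simp
    moreover have "AE x in M. grad (\<lambda>x. ?\<sigma> x * u x) x = (\<lambda>i. ?\<sigma> x * grad u x i + u x * partial_deriv i ?\<sigma> x)"
      by (rule grad_mult[OF u \<sigma>(1) bd])
    ultimately show "AE x in M. \<sigma> x * energy u x \<le> 2 * Re (Q x (grad u x) (grad (\<lambda>x. ?\<sigma> x * u x) x))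
       + \<kappa>\<^sup>2 * N * (cmod (complex_of_real (s x) * u x))\<^sup>2"
      using AE_good
    proof eventually_elim
      fix x assume g: "grad (\<lambda>x. ?\<sigma> x * u x) x = (\<lambda>i. ?\<sigma> x * grad u x i + u x * partial_deriv i ?\<sigma> x)"
        and good: "good x" and x: "x \<in> \<Omega>"
      let ?h = "\<lambda>i. partial_deriv i ?\<sigma> x"
      define e where "e = energy u x"
      have e: "0 \<le> e" unfolding e_def by (rule energy_nonneg[OF good])
      have s0: "0 \<le> \<sigma> x" "0 \<le> s x" using \<sigma>(2) s(2) x by auto
      \<comment> \<open>The product rule leaves the weighted energy plus one cross term containing
        the gradient of the weight.\<close>
      have eq: "Re (Q x (grad u x) (grad (\<lambda>x. ?\<sigma> x * u x) x)) = \<sigma> x * e + Re (cnj (u x) * Q x (grad u x) ?h)"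
        unfolding g Q_comb_right e_def energy_def by simp
      have "Re (Q x ?h ?h) \<le> N * (sqrt (\<sigma> x) * s x)\<^sup>2" by (rule Q_le[OF good s(4)[OF x]])
      then have "sqrt (Re (Q x ?h ?h)) \<le> sqrt (N * (sqrt (\<sigma> x) * s x)\<^sup>2)" by (rule real_sqrt_le_mono)
      also have "\<dots> = sqrt N * (sqrt (\<sigma> x) * s x)" using s0 by (simp add: real_sqrt_mult)
      finally have qh: "sqrt (Re (Q x ?h ?h)) \<le> sqrt N * (sqrt (\<sigma> x) * s x)" .
      have "- Re (cnj (u x) * Q x (grad u x) ?h) \<le> cmod (cnj (u x) * Q x (grad u x) ?h)"
        using abs_Re_le_cmod abs_ge_minus_self order_trans by blast
      also have "\<dots> = cmod (u x) * cmod (Q x (grad u x) ?h)" by (simp add: norm_mult)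
      also have "\<dots> \<le> cmod (u x) * (\<kappa> * (sqrt e * (sqrt N * (sqrt (\<sigma> x) * s x))))"
      proof (rule mult_left_mono)
        have "cmod (Q x (grad u x) ?h) \<le> \<kappa> * (sqrt e * sqrt (Re (Q x ?h ?h)))"
          unfolding e_def energy_def by (rule Q_bound[OF good])
        also have "\<dots> \<le> \<kappa> * (sqrt e * (sqrt N * (sqrt (\<sigma> x) * s x)))"
          using e kappa_nonneg by (intro mult_left_mono qh) auto
        finally show "cmod (Q x (grad u x) ?h) \<le> \<kappa> * (sqrt e * (sqrt N * (sqrt (\<sigma> x) * s x)))" .
      qed simp
      also have "\<dots> = (sqrt (\<sigma> x) * sqrt e) * (\<kappa> * sqrt N * (s x * cmod (u x)))" by (simp only: mult_ac)
      \<comment> \<open>Young's inequality absorbs half of the doubled weighted energy; the factor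
        \<open>sqrt (\<sigma> x)\<close> in the gradient hypothesis is what makes the absorbed term
        carry the full weight.\<close>
      finally have "2 * - Re (cnj (u x) * Q x (grad u x) ?h) \<le> 2 * ((sqrt (\<sigma> x) * sqrt e) * (\<kappa> * sqrt N * (s x * cmod (u x))))"
        by simp
      also have "\<dots> \<le> (sqrt (\<sigma> x) * sqrt e)\<^sup>2 + (\<kappa> * sqrt N * (s x * cmod (u x)))\<^sup>2"
        using sum_squares_bound[of "sqrt (\<sigma> x) * sqrt e" "\<kappa> * sqrt N * (s x * cmod (u x))"] by (simp only: mult.assoc)
      also have "\<dots> = \<sigma> x * e + \<kappa>\<^sup>2 * N * (s x * cmod (u x))\<^sup>2"
        using s0 e N_nonneg by (simp only: power_mult_distrib real_sqrt_pow2)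
      also have "s x * cmod (u x) = cmod (complex_of_real (s x) * u x)" using s0 by (simp add: norm_mult)
      finally show "\<sigma> x * energy u x \<le> 2 * Re (Q x (grad u x) (grad (\<lambda>x. ?\<sigma> x * u x) x))
          + \<kappa>\<^sup>2 * N * (cmod (complex_of_real (s x) * u x))\<^sup>2"
        unfolding eq e_def[symmetric] by argo
    qed
  qed
  also have "\<dots> = 2 * (LINT x|M. Re (Q x (grad u x) (grad (\<lambda>x. ?\<sigma> x * u x) x)))
       + \<kappa>\<^sup>2 * N * (LINT x|M. (cmod (complex_of_real (s x) * u x))\<^sup>2)"
    using integrable_Re[OF int2] L2_square_integrable[OF sL2] by simp
  also have "(LINT x|M. Re (Q x (grad u x) (grad (\<lambda>x. ?\<sigma> x * u x) x))) = Re (elliptic_form \<Omega> a u (\<lambda>x. ?\<sigma> x * u x))"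
    unfolding elliptic_form_eq[OF u su] by (rule integral_Re[OF int2])
  also have "(LINT x|M. (cmod (complex_of_real (s x) * u x))\<^sup>2) = (l2_norm M (\<lambda>x. complex_of_real (s x) * u x))\<^sup>2"
    by (rule l2_norm_sq[symmetric])
  finally show "(LINT x|M. \<sigma> x * energy u x) \<le> 2 * Re (elliptic_form \<Omega> a u (\<lambda>x. ?\<sigma> x * u x))
      + \<kappa>\<^sup>2 * N * (l2_norm M (\<lambda>x. complex_of_real (s x) * u x))\<^sup>2" .
qed

end

subsection \<open>Locality of the relaxed form\<close>

lemma l2_tendsto_cong_AE:
  assumes "l2_tendsto M u x F" "\<And>n. u n \<in> L2 M" "x \<in> L2 M" "y \<in> L2 M" "AE \<omega> in M. x \<omega> = y \<omega>"
  shows "l2_tendsto M u y F"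
proof -
  have "l2_norm M (\<lambda>\<omega>. u n \<omega> - x \<omega>) = l2_norm M (\<lambda>\<omega>. u n \<omega> - y \<omega>)" for n
    using assms by (intro l2_norm_cong_AE L2_measurable L2_diff) (auto elim: eventually_mono)
  then show ?thesis using assms(1) by (simp add: l2_tendsto_def)
qed

lemma smooth_compact_support_bounds:
  fixes f :: "real^'d::finite \<Rightarrow> complex"
  assumes "smooth f" "compact (closure {x. f x \<noteq> 0})"
  obtains B where "0 \<le> B" "\<And>x. cmod (f x) \<le> B" "\<And>i x. cmod (partial_deriv i f x) \<le> B"
proof -
  have T: "f \<in> test_functions UNIV" using assms by (simp add: test_functions_iff)
  have bd: "\<exists>C. 0 \<le> C \<and> (\<forall>x. cmod (g x) \<le> C)" if "g \<in> test_functions UNIV" for g :: "real^'d \<Rightarrow> complex"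
  proof -
    have g: "continuous_on UNIV g" "compact (closure {x. g x \<noteq> 0})"
      using that by (auto simp: test_functions_iff intro: smooth_continuous)
    obtain C where "0 \<le> C" "\<And>x. cmod (g x) \<le> C" using compact_support_bounded[OF g] by blast
    then show ?thesis by blast
  qed
  obtain C0 where C0: "0 \<le> C0" "\<And>x. cmod (f x) \<le> C0" using bd[OF T] by blast
  have "\<forall>i. \<exists>C. 0 \<le> C \<and> (\<forall>x. cmod (partial_deriv i f x) \<le> C)" using bd[OF test_functions_partial_deriv[OF T]] by blast
  from choice[OF this] obtain C where C: "\<And>i. 0 \<le> C i" "\<And>i x. cmod (partial_deriv i f x) \<le> C i" by blast
  define B where "B = C0 + (\<Sum>i\<in>UNIV. C i)"
  have sum0: "0 \<le> (\<Sum>i\<in>UNIV. C i)" by (intro sum_nonneg C)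
  have Ci: "C i \<le> (\<Sum>i\<in>UNIV. C i)" for i by (rule member_le_sum) (use C in auto)
  show ?thesis
  proof (rule that[of B])
    show "0 \<le> B" using sum0 C0(1) by (simp add: B_def)
    show "cmod (f x) \<le> B" for x using C0(2)[of x] sum0 by (simp add: B_def)
    show "cmod (partial_deriv i f x) \<le> B" for i x using C(2)[of i x] Ci[of i] C0(1) unfolding B_def by linarith
  qed
qed

lemma partial_deriv_one_minus:
  assumes "smooth f"
  shows "partial_deriv i (\<lambda>x. 1 - f x) = (\<lambda>x. - partial_deriv i f x)"
proof
  fix x
  obtain f' where D: "(f has_derivative f') (at x)"
    using smooth_differentiable[OF assms] unfolding differentiable_def by blast
  have "((\<lambda>x. 1 - f x) has_derivative (\<lambda>h. 0 - f' h)) (at x)"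
    by (intro has_derivative_diff has_derivative_const D)
  from partial_deriv_eqI[OF this] partial_deriv_eqI[OF D]
  show "partial_deriv i (\<lambda>x. 1 - f x) x = - partial_deriv i f x" by simp
qed

context lebesgue_domain
begin

text \<open>Off the support, u vanishes almost everywhere on some open neighbourhood of each point;
  by Lindelof countably many of these cover, so the null sets add up to a null set.\<close>

lemma AE_zero_outside_ess_support: "AE x in M. x \<notin> ess_support \<Omega> u \<longrightarrow> u x = 0"
proof -
  define F where "F = {U. open U \<and> (AE y in lebesgue_on (\<Omega> \<inter> U). u y = 0)}"
  have opF: "\<And>U. U \<in> F \<Longrightarrow> open U" by (simp add: F_def)
  then obtain F' where F': "F' \<subseteq> F" "countable F'" "\<Union>F' = \<Union>F"
    using Lindelof[of F] by metis
  have "AE y in lebesgue. y \<in> \<Omega> \<longrightarrow> y \<in> U \<longrightarrow> u y = 0" if "U \<in> F'" for U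
  proof -
    have U: "open U" "AE y in lebesgue_on (\<Omega> \<inter> U). u y = 0" using that F'(1) by (auto simp: F_def)
    have "\<Omega> \<inter> U \<in> sets lebesgue" using open_dom U by (intro open_lebesgue_sets) auto
    then have "AE y in lebesgue. y \<in> \<Omega> \<inter> U \<longrightarrow> u y = 0"
      using U(2) AE_restrict_space_iff[of "\<Omega> \<inter> U" lebesgue] by simp
    then show ?thesis by eventually_elim auto
  qed
  then have "AE y in lebesgue. \<forall>U\<in>F'. y \<in> \<Omega> \<longrightarrow> y \<in> U \<longrightarrow> u y = 0"
    using F'(2) by (subst AE_ball_countable) auto
  then show ?thesis unfolding AE_dom
  proof eventually_elim
    fix y assume *: "\<forall>U\<in>F'. y \<in> \<Omega> \<longrightarrow> y \<in> U \<longrightarrow> u y = 0"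
    show "y \<in> \<Omega> \<longrightarrow> y \<notin> ess_support \<Omega> u \<longrightarrow> u y = 0"
    proof (intro impI)
      assume y: "y \<in> \<Omega>" "y \<notin> ess_support \<Omega> u"
      then have "y \<in> \<Union>F" unfolding ess_support_def F_def by blast
      then have "y \<in> \<Union>F'" using F'(3) by simp
      then show "u y = 0" using * y by blast
    qed
  qed
qed

end

context elliptic
begin

text \<open>The value of a on the two sequences only involves the region where the modified second
  sequence may have a gradient. The first cutoff vanishes there, so the energy of U n on this region
  is dominated by a weighted energy that tends to 0.\<close>

theorem relaxed_form_local:
  assumes rel: "relaxed_form M (H1 \<Omega>) (elliptic_form \<Omega> a) Db b"
    and u: "u \<in> Db" and v: "v \<in> Db" and K: "compact (ess_support \<Omega> u)"
    and const: "constant_near \<Omega> v (ess_support \<Omega> u)"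
  shows "b u v = 0"
proof -
  interpret R: relaxed "H1 \<Omega>" "elliptic_form \<Omega> a" T M Db b
    by unfold_locales (rule rel)
  obtain U0 c where U0: "open U0" "ess_support \<Omega> u \<subseteq> U0" and vc: "AE x in lebesgue_on (\<Omega> \<inter> U0). v x = c"
    using const unfolding constant_near_def by blast
  \<comment> \<open>The support lies in \<Omega>, so the intersection still contains it; cutoffs
    below W then vanish off \<Omega> and off the set where v is the constant c.\<close>
  define W where "W = \<Omega> \<inter> U0"
  have W: "open W" "ess_support \<Omega> u \<subseteq> W"
    using U0 open_dom unfolding W_def by (auto simp: ess_support_def)
  obtain \<eta>1 V1 where \<eta>1: "smooth (\<lambda>x. complex_of_real (\<eta>1 x))" "\<And>x. 0 \<le> \<eta>1 x" "\<And>x. \<eta>1 x \<le> 1" "open V1"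
    "ess_support \<Omega> u \<subseteq> V1" "\<And>x. x \<in> V1 \<Longrightarrow> \<eta>1 x = 1" "compact (closure {x. \<eta>1 x \<noteq> 0})" "closure {x. \<eta>1 x \<noteq> 0} \<subseteq> W"
    using smooth_cutoff[OF K W] by blast
  \<comment> \<open>Nested cutoffs: the second one is 1 on a neighbourhood \<open>V2\<close> of the
    support of the first, so off \<open>V2\<close> the first one is 0.\<close>
  obtain \<eta>2 V2 where \<eta>2: "smooth (\<lambda>x. complex_of_real (\<eta>2 x))" "\<And>x. 0 \<le> \<eta>2 x" "\<And>x. \<eta>2 x \<le> 1" "open V2"
    "closure {x. \<eta>1 x \<noteq> 0} \<subseteq> V2" "\<And>x. x \<in> V2 \<Longrightarrow> \<eta>2 x = 1" "compact (closure {x. \<eta>2 x \<noteq> 0})" "closure {x. \<eta>2 x \<noteq> 0} \<subseteq> W"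
    using smooth_cutoff[OF \<eta>1(7) W(1) \<eta>1(8)] by blast
  let ?e1 = "\<lambda>x. complex_of_real (\<eta>1 x)" and ?e2 = "\<lambda>x. complex_of_real (\<eta>2 x)"
  obtain B1 where B1: "0 \<le> B1" "\<And>x. cmod (?e1 x) \<le> B1" "\<And>i x. cmod (partial_deriv i ?e1 x) \<le> B1"
  proof -
    have "compact (closure {x. ?e1 x \<noteq> 0})" using \<eta>1(7) by simp
    from smooth_compact_support_bounds[OF \<eta>1(1) this] that show thesis by blast
  qed
  obtain B2 where B2: "0 \<le> B2" "\<And>x. cmod (?e2 x) \<le> B2" "\<And>i x. cmod (partial_deriv i ?e2 x) \<le> B2"
  proof -
    have "compact (closure {x. ?e2 x \<noteq> 0})" using \<eta>2(7) by simp
    from smooth_compact_support_bounds[OF \<eta>2(1) this] that show thesis by blast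
  qed
  \<comment> \<open>The square makes the gradient carry a factor
    \<open>sqrt (\<sigma> x) = 1 - \<eta>1 x\<close>, as the Caccioppoli estimate demands.\<close>
  define \<sigma> where "\<sigma> x = (1 - \<eta>1 x)\<^sup>2" for x
  \<comment> \<open>The gradient of \<open>\<eta>1\<close> vanishes on \<open>V1\<close>, hence the
    indicator of the complement; then s vanishes near the support of u and s u is 0.\<close>
  define s where "s x = 2 * B1 * indicator (- V1) x" for x :: "real^'d"
  have one_minus1: "smooth (\<lambda>x. 1 - ?e1 x)" by (intro smooth_diff smooth_const \<eta>1)
  have \<sigma>_eq: "(\<lambda>x. complex_of_real (\<sigma> x)) = (\<lambda>x. (1 - ?e1 x) * (1 - ?e1 x))"
    by (simp add: \<sigma>_def power2_eq_square)
  have \<sigma>_smooth: "smooth (\<lambda>x. complex_of_real (\<sigma> x))" unfolding \<sigma>_eq by (intro smooth_mult one_minus1)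
  have \<sigma>_deriv: "cmod (partial_deriv i (\<lambda>x. complex_of_real (\<sigma> x)) x) = 2 * (1 - \<eta>1 x) * cmod (partial_deriv i ?e1 x)" for i x
  proof -
    have "partial_deriv i (\<lambda>x. complex_of_real (\<sigma> x)) x = - (2 * complex_of_real (1 - \<eta>1 x) * partial_deriv i ?e1 x)"
      unfolding \<sigma>_eq partial_deriv_mult[OF smooth_differentiable[OF one_minus1] smooth_differentiable[OF one_minus1]]
        partial_deriv_one_minus[OF \<eta>1(1)] by (simp add: algebra_simps)
    moreover have "cmod (complex_of_real (1 - \<eta>1 x)) = 1 - \<eta>1 x" using \<eta>1(3)[of x] by (simp only: norm_of_real)
    ultimately show ?thesis by (simp only: norm_minus_cancel norm_mult norm_numeral)
  qed
  have \<sigma>01: "0 \<le> \<sigma> x" "\<sigma> x \<le> 1" for x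
    using \<eta>1(2,3)[of x] by (auto simp: \<sigma>_def power_le_one)
  have \<sigma>B: "cmod (complex_of_real (\<sigma> x)) \<le> 1 + 2 * B1" for x using \<sigma>01[of x] B1(1) by simp
  have d\<sigma>B: "cmod (partial_deriv i (\<lambda>x. complex_of_real (\<sigma> x)) x) \<le> 1 + 2 * B1" for i x
  proof -
    have "2 * (1 - \<eta>1 x) * cmod (partial_deriv i ?e1 x) \<le> 2 * 1 * B1"
      using \<eta>1(2,3)[of x] B1 by (intro mult_mono) auto
    then show ?thesis unfolding \<sigma>_deriv by simp
  qed
  have ds: "cmod (partial_deriv i (\<lambda>x. complex_of_real (\<sigma> x)) x) \<le> sqrt (\<sigma> x) * s x" for i x
  proof -
    have sq: "sqrt (\<sigma> x) = 1 - \<eta>1 x" using \<eta>1(3)[of x] by (simp add: \<sigma>_def)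
    show ?thesis
    proof (cases "x \<in> V1")
      case True
      have "partial_deriv i ?e1 x = 0"
        by (rule partial_deriv_eq_0[OF \<eta>1(4) True, where c=1]) (simp add: \<eta>1(6))
      then show ?thesis unfolding \<sigma>_deriv sq using True by (simp add: s_def)
    next
      case False
      have "(1 - \<eta>1 x) * (2 * cmod (partial_deriv i ?e1 x)) \<le> (1 - \<eta>1 x) * (2 * B1)"
        using \<eta>1(3)[of x] B1 by (intro mult_left_mono) auto
      moreover have "2 * (1 - \<eta>1 x) * z = (1 - \<eta>1 x) * (2 * z)" for z by (simp only: mult_ac)
      moreover have "s x = 2 * B1" using False by (simp add: s_def)
      ultimately show ?thesis unfolding \<sigma>_deriv sq by presburger
    qed
  qed
  have s0: "0 \<le> s x" "s x \<le> 2 * B1" for x using B1(1) by (auto simp: s_def indicator_def)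
  have sm: "s \<in> borel_measurable M"
  proof -
    have "indicator (- V1) \<in> borel_measurable borel" using \<eta>1(4) by (intro borel_measurable_indicator) auto
    then have "(\<lambda>x. 2 * B1 * indicator (- V1) x :: real) \<in> borel_measurable borel" by (intro borel_measurable_times) auto
    then have "s \<in> borel_measurable lebesgue" unfolding s_def[abs_def] by (intro measurable_completion) simp
    then show ?thesis by (rule measurable_restrict_space1)
  qed
  have csm: "(\<lambda>x. complex_of_real (s x)) \<in> borel_measurable M" using sm by (rule measurable_compose[OF _ borel_measurable_of_real])
  obtain U BU where U: "\<And>n. U n \<in> H1 \<Omega>" "\<And>n. F.p (U n) \<le> BU" "l2_tendsto M U u sequentially"
    and Ub: "\<And>v V B'. v \<in> Db \<Longrightarrow> (\<And>n. V n \<in> H1 \<Omega>) \<Longrightarrow> (\<And>n. F.p (V n) \<le> B') \<Longrightarrow> l2_tendsto M V v sequentially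
      \<Longrightarrow> (\<lambda>n. elliptic_form \<Omega> a (U n) (V n)) \<longlonglongrightarrow> b u v"
    using R.representing_sequence[OF u] by blast
  obtain V BV where V: "\<And>n. V n \<in> H1 \<Omega>" "\<And>n. F.p (V n) \<le> BV" "l2_tendsto M V v sequentially"
    by (rule R.representing_sequence[OF v]) (rule that; assumption)
  have uL2: "u \<in> L2 M" and vL2: "v \<in> L2 M" using R.memL2b u v by auto
  have bounded_mult: "\<exists>C. \<forall>n. F.p (\<lambda>x. f x * X n x) \<le> C"
    if X: "\<And>n. X n \<in> H1 \<Omega>" "\<And>n. F.p (X n) \<le> BX" "l2_tendsto M X y sequentially" "y \<in> L2 M"
      and f: "smooth f" "\<And>x. x \<in> \<Omega> \<Longrightarrow> cmod (f x) \<le> B" "\<And>i x. x \<in> \<Omega> \<Longrightarrow> cmod (partial_deriv i f x) \<le> B" for X f B BX y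
  proof -
    have "(\<lambda>n. l2_norm M (X n)) \<longlonglongrightarrow> l2_norm M y" by (rule l2_tendsto_norm[OF X(3) H1_L2[OF X(1)] X(4)])
    from convergent_imp_Bseq[OF convergentI[OF this]] obtain N0 where N0: "\<And>n. l2_norm M (X n) \<le> N0"
      unfolding Bseq_def by auto
    have "F.p (\<lambda>x. f x * X n x) \<le> 2 * B\<^sup>2 * BX + 2 * (N * B\<^sup>2) * N0\<^sup>2" for n
    proof -
      have "F.p (\<lambda>x. f x * X n x) \<le> 2 * B\<^sup>2 * F.p (X n) + 2 * (N * B\<^sup>2) * (l2_norm M (X n))\<^sup>2"
        by (rule mult_energy_bound[OF X(1) f])
      also have "\<dots> \<le> 2 * B\<^sup>2 * BX + 2 * (N * B\<^sup>2) * N0\<^sup>2"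
        by (rule add_mono; rule mult_left_mono) (use X(2) N0 N_nonneg in \<open>auto intro: power_mono\<close>)
      finally show ?thesis .
    qed
    then show ?thesis by blast
  qed
  have AEu: "AE x in M. x \<notin> V1 \<longrightarrow> u x = 0"
    using AE_zero_outside_ess_support[of u] by eventually_elim (use \<eta>1(5) in blast)
  \<comment> \<open>Multipliers vanishing on \<open>V1\<close>, a neighbourhood of the support, kill
    the L2 limit u, although they do not kill U n.\<close>
  have zero_limit: "l2_tendsto M (\<lambda>n x. g x * U n x) (\<lambda>x. 0) sequentially"
    if g: "g \<in> borel_measurable M" "\<And>x. x \<in> \<Omega> \<Longrightarrow> cmod (g x) \<le> C" "\<And>x. x \<in> V1 \<Longrightarrow> g x = 0" for g C
  proof -
    have gB: "AE x in M. cmod (g x) \<le> C" using g(2) by (intro AE_I2) simp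
    show ?thesis
    proof (rule l2_tendsto_cong_AE)
      show "l2_tendsto M (\<lambda>n x. g x * U n x) (\<lambda>x. g x * u x) sequentially"
        by (rule l2_tendsto_mult_bounded[OF U(3) H1_L2[OF U(1)] uL2 g(1) gB])
      show "(\<lambda>x. g x * U n x) \<in> L2 M" for n by (rule L2_mult_bounded[OF H1_L2[OF U(1)] g(1) gB])
      show "(\<lambda>x. g x * u x) \<in> L2 M" by (rule L2_mult_bounded[OF uL2 g(1) gB])
      show "AE x in M. g x * u x = 0" using AEu by eventually_elim (use g(3) in auto)
    qed (rule L2_zero)
  qed
  define E where "E n = (LINT x|M. \<sigma> x * energy (U n) x)" for n
  have E_nonneg: "0 \<le> E n" for n
  proof -
    have "AE x in M. 0 \<le> \<sigma> x * energy (U n) x"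
      using AE_good by eventually_elim (simp add: \<sigma>01(1) energy_nonneg)
    then show ?thesis unfolding E_def by (rule integral_nonneg_AE)
  qed
  note WE = weighted_energy[OF U(1) \<sigma>_smooth \<sigma>01(1) \<sigma>B d\<sigma>B sm s0 ds]
  have E0: "E \<longlonglongrightarrow> 0"
  proof (rule tendsto_sandwich)
    show "(\<lambda>n. 0) \<longlonglongrightarrow> (0::real)" by simp
    show "\<forall>\<^sub>F n in sequentially. 0 \<le> E n"
      by (intro always_eventually allI E_nonneg)
    show "\<forall>\<^sub>F n in sequentially. E n \<le> 2 * Re (elliptic_form \<Omega> a (U n) (\<lambda>x. complex_of_real (\<sigma> x) * U n x))
      + \<kappa>\<^sup>2 * N * (l2_norm M (\<lambda>x. complex_of_real (s x) * U n x))\<^sup>2"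
      unfolding E_def by (intro always_eventually allI WE(2))
    \<comment> \<open>\<sigma> U n is a test sequence of bounded energy with L2 limit 0, so the
      representation of b applies with second argument 0.\<close>
    have 1: "(\<lambda>n. elliptic_form \<Omega> a (U n) (\<lambda>x. complex_of_real (\<sigma> x) * U n x)) \<longlonglongrightarrow> b u (\<lambda>x. 0)"
    proof -
      obtain C where C: "\<And>n. F.p (\<lambda>x. complex_of_real (\<sigma> x) * U n x) \<le> C"
        using bounded_mult[OF U uL2 \<sigma>_smooth \<sigma>B d\<sigma>B] by blast
      show ?thesis
      proof (rule Ub[OF R.zero_Db _ C])
        show "(\<lambda>x. complex_of_real (\<sigma> x) * U n x) \<in> H1 \<Omega>" for n by (rule H1_mult(1)[OF U(1) \<sigma>_smooth \<sigma>B d\<sigma>B])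
        show "l2_tendsto M (\<lambda>n x. complex_of_real (\<sigma> x) * U n x) (\<lambda>x. 0) sequentially"
        proof (rule zero_limit[OF _ \<sigma>B])
          show "(\<lambda>x. complex_of_real (\<sigma> x)) \<in> borel_measurable M"
            by (rule continuous_measurable_lebesgue_on[OF smooth_continuous[OF \<sigma>_smooth] dom_sets])
        qed (simp add: \<sigma>_def \<eta>1(6))
      qed
    qed
    have "b u (\<lambda>x. 0) = 0" using R.b_right[OF u u u, of 0 0] by simp
    moreover have 2: "(\<lambda>n. l2_norm M (\<lambda>x. complex_of_real (s x) * U n x)) \<longlonglongrightarrow> 0"
    proof -
      have "l2_tendsto M (\<lambda>n x. complex_of_real (s x) * U n x) (\<lambda>x. 0) sequentially"
      proof (rule zero_limit[OF csm])
        show "cmod (complex_of_real (s x)) \<le> 2 * B1" for x using s0[of x] by simp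
      qed (simp add: s_def)
      then show ?thesis by (simp add: l2_tendsto_def)
    qed
    ultimately have "(\<lambda>n. 2 * Re (elliptic_form \<Omega> a (U n) (\<lambda>x. complex_of_real (\<sigma> x) * U n x))
      + \<kappa>\<^sup>2 * N * (l2_norm M (\<lambda>x. complex_of_real (s x) * U n x))\<^sup>2) \<longlonglongrightarrow> 2 * Re 0 + \<kappa>\<^sup>2 * N * 0\<^sup>2"
      using 1 by (intro tendsto_intros) auto
    then show "(\<lambda>n. 2 * Re (elliptic_form \<Omega> a (U n) (\<lambda>x. complex_of_real (\<sigma> x) * U n x))
      + \<kappa>\<^sup>2 * N * (l2_norm M (\<lambda>x. complex_of_real (s x) * U n x))\<^sup>2) \<longlonglongrightarrow> 0" by simp
  qed
  have one_minus2: "smooth (\<lambda>x. 1 - ?e2 x)" by (intro smooth_diff smooth_const \<eta>2)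
  have f2B: "cmod (1 - ?e2 x) \<le> 1 + B2" "cmod (partial_deriv i (\<lambda>x. 1 - ?e2 x) x) \<le> 1 + B2" for i x
    using norm_triangle_ineq4[of 1 "?e2 x"] B2(2)[of x] B2(3)[of i x] unfolding partial_deriv_one_minus[OF \<eta>2(1)] by auto
  have e2H: "?e2 \<in> H1 \<Omega>" and e2g: "\<And>i. AE x in M. weak_partial \<Omega> i ?e2 x = partial_deriv i ?e2 x"
  proof -
    have T: "?e2 \<in> test_functions UNIV" using \<eta>2(1,7) by (simp add: test_functions_iff)
    note H = H1_smooth[OF \<eta>2(1) test_function_L2[OF dom_sets T] test_function_L2[OF dom_sets test_functions_partial_deriv[OF T]]]
    show "?e2 \<in> H1 \<Omega>" by (rule H(1))
    show "\<And>i. AE x in M. weak_partial \<Omega> i ?e2 x = partial_deriv i ?e2 x" by (rule H(2))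
  qed
  define f2V where "f2V n x = (1 - ?e2 x) * V n x" for n x
  have f2V: "f2V n \<in> H1 \<Omega>" for n unfolding f2V_def by (rule H1_mult(1)[OF V(1) one_minus2 f2B])
  \<comment> \<open>On W the limit v equals c and off W the second cutoff is 0, so the replacement
    still converges to v; on \<open>V2\<close> it is the constant c and has no gradient.\<close>
  define V' where "V' n x = c * ?e2 x + 1 * f2V n x" for n x
  have V': "V' n \<in> H1 \<Omega>" for n unfolding V'_def by (rule H1_comb(1)[OF e2H f2V])
  have gradV': "AE x in M. x \<in> V2 \<longrightarrow> grad (V' n) x = (\<lambda>i. 0)" for n
  proof -
    have "AE x in M. grad (f2V n) x = (\<lambda>i. (1 - ?e2 x) * grad (V n) x i + V n x * partial_deriv i (\<lambda>x. 1 - ?e2 x) x)"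
      unfolding f2V_def by (rule grad_mult[OF V(1) one_minus2 f2B])
    with grad_comb[OF e2H f2V, of c 1 n] AE_all_index[OF e2g]
    show ?thesis
    proof eventually_elim
      fix x assume 1: "grad (\<lambda>x. c * ?e2 x + 1 * f2V n x) x = (\<lambda>i. c * grad ?e2 x i + 1 * grad (f2V n) x i)"
        and 2: "\<forall>i. weak_partial \<Omega> i ?e2 x = partial_deriv i ?e2 x"
        and 3: "grad (f2V n) x = (\<lambda>i. (1 - ?e2 x) * grad (V n) x i + V n x * partial_deriv i (\<lambda>x. 1 - ?e2 x) x)"
      show "x \<in> V2 \<longrightarrow> grad (V' n) x = (\<lambda>i. 0)"
      proof
        assume x: "x \<in> V2"
        have "partial_deriv i ?e2 x = 0" for i
          by (rule partial_deriv_eq_0[OF \<eta>2(4) x, where c=1]) (simp add: \<eta>2(6))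
        then show "grad (V' n) x = (\<lambda>i. 0)"
          unfolding V'_def 1 3 partial_deriv_one_minus[OF \<eta>2(1)] using 2 \<eta>2(6)[OF x] by (simp add: grad_def)
      qed
    qed
  qed
  have V'p: "\<exists>C. \<forall>n. F.p (V' n) \<le> C"
  proof -
    obtain C where C: "\<And>n. F.p (f2V n) \<le> C"
      using bounded_mult[OF V vL2 one_minus2 f2B] unfolding f2V_def by blast
    have "F.p (V' n) \<le> 2 * F.p (\<lambda>x. c * ?e2 x) + 2 * C" for n
    proof -
      have "F.p (V' n) \<le> 2 * F.p (\<lambda>x. c * ?e2 x) + 2 * F.p (f2V n)"
        unfolding V'_def using F.p_add_le[OF F.scale_mem[OF e2H] f2V] by simp
      then show ?thesis using C[of n] by linarith
    qed
    then show ?thesis by blast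
  qed
  then obtain P where P: "\<And>n. F.p (V' n) \<le> P" by blast
  have V'lim: "l2_tendsto M V' v sequentially"
  proof -
    have f2m: "(\<lambda>x. 1 - ?e2 x) \<in> borel_measurable M"
      by (rule continuous_measurable_lebesgue_on[OF smooth_continuous[OF one_minus2] dom_sets])
    have f2AE: "AE x in M. cmod (1 - ?e2 x) \<le> 1 + B2" using f2B(1) by (intro AE_I2) simp
    have lim: "l2_tendsto M (\<lambda>n x. (1 - ?e2 x) * V n x) (\<lambda>x. (1 - ?e2 x) * v x) sequentially"
      by (rule l2_tendsto_mult_bounded[OF V(3) H1_L2[OF V(1)] vL2 f2m f2AE])
    have const_lim: "l2_tendsto M (\<lambda>n::nat. ?e2) ?e2 sequentially" by (simp add: l2_tendsto_def)
    note f2vL2 = L2_mult_bounded[OF vL2 f2m f2AE]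
    have "l2_tendsto M (\<lambda>n x. c * ?e2 x + 1 * f2V n x) (\<lambda>x. c * ?e2 x + 1 * ((1 - ?e2 x) * v x)) sequentially"
      using l2_tendsto_comb[OF const_lim H1_L2[OF e2H] H1_L2[OF e2H] lim[folded f2V_def] H1_L2[OF f2V] f2vL2, of c 1] .
    then have "l2_tendsto M V' (\<lambda>x. c * ?e2 x + 1 * ((1 - ?e2 x) * v x)) sequentially" unfolding V'_def .
    then show ?thesis
    proof (rule l2_tendsto_cong_AE[OF _ H1_L2[OF V'] L2_comb[OF H1_L2[OF e2H] f2vL2] vL2])
      have "\<Omega> \<inter> U0 \<in> sets lebesgue" using open_dom U0 by (intro open_lebesgue_sets) auto
      then have "AE x in lebesgue. x \<in> \<Omega> \<inter> U0 \<longrightarrow> v x = c"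
        using vc AE_restrict_space_iff[of "\<Omega> \<inter> U0" lebesgue] by simp
      then show "AE x in M. c * ?e2 x + 1 * ((1 - ?e2 x) * v x) = v x" unfolding AE_dom
      proof eventually_elim
        fix x assume x: "x \<in> \<Omega> \<inter> U0 \<longrightarrow> v x = c"
        have "?e2 x = 0" if "x \<notin> W" using \<eta>2(8) closure_subset[of "{x. \<eta>2 x \<noteq> 0}"] that by auto
        then show "x \<in> \<Omega> \<longrightarrow> c * ?e2 x + 1 * ((1 - ?e2 x) * v x) = v x"
          using x unfolding W_def by (cases "x \<in> U0") (auto simp: algebra_simps)
      qed
    qed
  qed
  \<comment> \<open>On \<open>V2\<close> the integrand is 0, and off \<open>V2\<close> the weight
    \<sigma> is 1, so the full energy of U n may be replaced by the weighted one.\<close>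
  have bound: "cmod (elliptic_form \<Omega> a (U n) (V' n)) \<le> 2 * (sqrt (\<kappa> * E n) * sqrt (\<kappa> * F.p (V' n)))" for n
  proof (rule am_gm_optimise)
    show "0 \<le> \<kappa> * E n" using kappa_nonneg E_nonneg by simp
    show "0 \<le> \<kappa> * F.p (V' n)" using kappa_nonneg F.p_nonneg[OF V'] by simp
    fix t :: real assume t: "0 < t"
    note int = Q_integrable[OF grad_L2[OF U(1)] grad_L2[OF V']]
    have "cmod (elliptic_form \<Omega> a (U n) (V' n)) \<le> (LINT x|M. cmod (Q x (grad (U n) x) (grad (V' n) x)))"
      unfolding elliptic_form_eq[OF U(1) V'] by (rule integral_norm_bound)
    also have "\<dots> \<le> (LINT x|M. \<kappa> * t * (\<sigma> x * energy (U n) x) + \<kappa> / t * energy (V' n) x)"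
    proof (rule integral_mono_AE)
      show "integrable M (\<lambda>x. \<kappa> * t * (\<sigma> x * energy (U n) x) + \<kappa> / t * energy (V' n) x)"
        by (intro Bochner_Integration.integrable_add integrable_mult_right WE(1) energy_integrable V')
      show "AE x in M. cmod (Q x (grad (U n) x) (grad (V' n) x)) \<le> \<kappa> * t * (\<sigma> x * energy (U n) x) + \<kappa> / t * energy (V' n) x"
        using gradV'[of n] AE_good
      proof eventually_elim
        fix x assume g: "x \<in> V2 \<longrightarrow> grad (V' n) x = (\<lambda>i. 0)" and good: "good x"
        define e e' where "e = energy (U n) x" and "e' = energy (V' n) x"
        have e: "0 \<le> e" "0 \<le> e'" unfolding e_def e'_def using energy_nonneg[OF good] by auto
        have rhs: "0 \<le> \<kappa> * t * (\<sigma> x * e) + \<kappa> / t * e'" using kappa_nonneg t e \<sigma>01(1)[of x] by simp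
        show "cmod (Q x (grad (U n) x) (grad (V' n) x)) \<le> \<kappa> * t * (\<sigma> x * energy (U n) x) + \<kappa> / t * energy (V' n) x"
        proof (cases "x \<in> V2")
          case True
          then have "Q x (grad (U n) x) (grad (V' n) x) = 0" using g by (simp add: Q_def)
          then show ?thesis using rhs unfolding e_def e'_def by simp
        next
          case False
          then have "\<eta>1 x = 0" using \<eta>2(5) closure_subset[of "{x. \<eta>1 x \<noteq> 0}"] by blast
          then have s1: "\<sigma> x = 1" by (simp add: \<sigma>_def)
          interpret q: sect_form UNIV "Q x" T using good by (simp add: good_def)
          have "cmod (Q x (grad (U n) x) (grad (V' n) x)) \<le> (1 + T) * (t * e + e' / t)"
            using q.bound_scaled[OF UNIV_I UNIV_I t] unfolding e_def e'_def energy_def .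
          also have "\<dots> \<le> \<kappa> * (t * e + e' / t)" using e t T_nonneg by (intro mult_right_mono) auto
          also have "\<dots> = \<kappa> * t * (\<sigma> x * e) + \<kappa> / t * e'" by (simp add: s1 algebra_simps add_divide_distrib)
          finally show ?thesis unfolding e_def e'_def .
        qed
      qed
    qed (use int in simp)
    also have "\<dots> = \<kappa> * t * E n + \<kappa> / t * F.p (V' n)"
      unfolding E_def Re_elliptic_form[OF V'] using WE(1)[of n] energy_integrable[OF V', of n] by simp
    finally show "cmod (elliptic_form \<Omega> a (U n) (V' n)) \<le> t * (\<kappa> * E n) + (\<kappa> * F.p (V' n)) / t"
      by (simp add: mult_ac)
  qed
  have "(\<lambda>n. elliptic_form \<Omega> a (U n) (V' n)) \<longlonglongrightarrow> 0"
  proof (rule tendsto_norm_zero_cancel, rule tendsto_sandwich)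
    show "(\<lambda>n. 0) \<longlonglongrightarrow> (0::real)" by simp
    have "(\<lambda>n. 2 * (sqrt (\<kappa> * E n) * sqrt (\<kappa> * P))) \<longlonglongrightarrow> 2 * (sqrt (\<kappa> * 0) * sqrt (\<kappa> * P))"
      by (intro tendsto_intros E0)
    then show "(\<lambda>n. 2 * (sqrt (\<kappa> * E n) * sqrt (\<kappa> * P))) \<longlonglongrightarrow> 0" by simp
    have "cmod (elliptic_form \<Omega> a (U n) (V' n)) \<le> 2 * (sqrt (\<kappa> * E n) * sqrt (\<kappa> * P))" for n
    proof -
      have "2 * (sqrt (\<kappa> * E n) * sqrt (\<kappa> * F.p (V' n))) \<le> 2 * (sqrt (\<kappa> * E n) * sqrt (\<kappa> * P))"
        using P[of n] kappa_nonneg E_nonneg[of n] by (intro mult_left_mono real_sqrt_le_mono) auto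
      with bound[of n] show ?thesis by linarith
    qed
    then show "\<forall>\<^sub>F n in sequentially. cmod (elliptic_form \<Omega> a (U n) (V' n)) \<le> 2 * (sqrt (\<kappa> * E n) * sqrt (\<kappa> * P))"
      by simp
  qed simp
  moreover have "(\<lambda>n. elliptic_form \<Omega> a (U n) (V' n)) \<longlonglongrightarrow> b u v" by (rule Ub[OF v V' P V'lim])
  ultimately show "b u v = 0" using LIMSEQ_unique by blast
qed

end

section \<open>Strongly continuous semigroups on \<open>L\<^sub>2\<close>\<close>

text \<open>Only right derivatives of orbits are available from the generator. After tilting by a
  small slope e the right derivative is strictly negative, so the last point with H \<le> 0 cannot
  lie before t.\<close>

lemma right_deriv_nonpos_imp_le:
  fixes G :: "real \<Rightarrow> real"
  assumes t: "0 \<le> t" and cont: "continuous_on {0..t} G"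
    and der: "\<And>s. 0 \<le> s \<Longrightarrow> s < t \<Longrightarrow> \<exists>D\<le>0. (G has_real_derivative D) (at_right s)"
  shows "G t \<le> G 0"
proof (rule field_le_epsilon)
  fix e0 :: real assume e0: "0 < e0"
  \<comment> \<open>Denominator t + 1 instead of t, so that t = 0 is covered as well.\<close>
  define e where "e = e0 / (t + 1)"
  have e: "0 < e" "e * t \<le> e0" using e0 t by (auto simp: e_def field_simps)
  define H where "H x = G x - G 0 - e * x" for x
  have contH: "continuous_on {0..t} H" unfolding H_def by (intro continuous_intros cont)
  have "H t \<le> 0"
  proof (rule ccontr)
    assume "\<not> H t \<le> 0"
    then have Ht: "0 < H t" by simp
    define X where "X = {0..t} \<inter> H -` {..0}"
    have "closed X" unfolding X_def by (rule continuous_closed_preimage[OF contH]) auto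
    moreover have "bounded X" unfolding X_def by (rule bounded_subset[of "{0..t}"]) auto
    ultimately have "compact X" by (simp add: compact_eq_bounded_closed)
    moreover have "0 \<in> X" using t by (simp add: X_def H_def)
    ultimately obtain s where s: "s \<in> X" "\<And>x. x \<in> X \<Longrightarrow> x \<le> s"
      using compact_attains_sup[of X] by blast
    have s1: "0 \<le> s" "s \<le> t" "H s \<le> 0" using s(1) by (auto simp: X_def)
    then have s2: "s < t" using Ht by (cases "s = t") auto
    obtain D where D: "D \<le> 0" "(G has_real_derivative D) (at_right s)" using der[OF s1(1) s2] by blast
    have "(H has_real_derivative D - e) (at_right s)"
      unfolding H_def using D(2) by (auto intro!: derivative_eq_intros)
    then have "((\<lambda>y. (H y - H s) / (y - s)) \<longlongrightarrow> D - e) (at_right s)"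
      by (simp add: has_field_derivative_iff)
    moreover have "D - e < 0" using D e by simp
    ultimately have "\<forall>\<^sub>F y in at_right s. (H y - H s) / (y - s) < 0" by (rule order_tendstoD)
    moreover have "\<forall>\<^sub>F y in at_right s. s < y \<and> y < t"
      using s2 eventually_at_right_real[OF s2] by (auto elim: eventually_mono)
    ultimately have "\<forall>\<^sub>F y in at_right s. s < y \<and> y < t \<and> H y < H s"
      by eventually_elim (auto simp: divide_less_0_iff)
    then obtain y where y: "s < y" "y < t" "H y < H s"
      using eventually_happens'[of "at_right s"] by auto
    then have "y \<in> X" using s1 by (simp add: X_def)
    with s(2) y(1) show False by fastforce
  qed
  then show "G t \<le> G 0 + e0" using e by (simp add: H_def)
qed

lemma tendsto_at_right_shift:
  fixes f :: "real \<Rightarrow> 'a::topological_space"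
  assumes "((\<lambda>h. f (s + h)) \<longlongrightarrow> l) (at_right 0)"
  shows "(f \<longlongrightarrow> l) (at_right s)"
  using assms unfolding at_right_to_0[of s] filterlim_filtermap by (simp add: add.commute)

locale l2_semigroup =
  fixes M :: "'a measure" and S :: "real \<Rightarrow> ('a \<Rightarrow> complex) \<Rightarrow> ('a \<Rightarrow> complex)"
  assumes C0: "C0_semigroup M S"
begin

lemma S_L2: "0 \<le> t \<Longrightarrow> u \<in> L2 M \<Longrightarrow> S t u \<in> L2 M"
  using C0 by (simp add: C0_semigroup_def)

lemma S_comb: "0 \<le> t \<Longrightarrow> u \<in> L2 M \<Longrightarrow> v \<in> L2 M \<Longrightarrow>
    AE x in M. S t (\<lambda>y. \<alpha> * u y + \<beta> * v y) x = \<alpha> * S t u x + \<beta> * S t v x"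
  using C0 by (simp add: C0_semigroup_def)

lemma S_bounded: "0 \<le> t \<Longrightarrow> \<exists>C. \<forall>u\<in>L2 M. l2_norm M (S t u) \<le> C * l2_norm M u"
  using C0 by (simp add: C0_semigroup_def)

lemma S_0: "u \<in> L2 M \<Longrightarrow> AE x in M. S 0 u x = u x"
  using C0 by (simp add: C0_semigroup_def)

lemma S_add: "0 \<le> s \<Longrightarrow> 0 \<le> t \<Longrightarrow> u \<in> L2 M \<Longrightarrow> AE x in M. S (s + t) u x = S s (S t u) x"
  using C0 by (simp add: C0_semigroup_def)

lemma S_cont: "u \<in> L2 M \<Longrightarrow> l2_tendsto M (\<lambda>t. S t u) u (at_right 0)"
  using C0 by (simp add: C0_semigroup_def)

lemma norm_S_comb:
  assumes "0 \<le> t" "u \<in> L2 M" "v \<in> L2 M"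
  shows "l2_norm M (S t (\<lambda>y. \<alpha> * u y + \<beta> * v y)) = l2_norm M (\<lambda>x. \<alpha> * S t u x + \<beta> * S t v x)"
  by (intro l2_norm_cong_AE L2_measurable S_L2 S_comb L2_comb assms)

lemma norm_S_diff:
  assumes "0 \<le> t" "u \<in> L2 M" "v \<in> L2 M"
  shows "l2_norm M (\<lambda>x. S t u x - S t v x) = l2_norm M (S t (\<lambda>x. u x - v x))"
  using norm_S_comb[OF assms, of 1 "-1"] by simp

text \<open>Gliding hump: a sharp dyadic bound \<open>b\<close> serves as operator norm.\<close>

lemma dyadic_norm:
  assumes t: "0 \<le> t" and R: "1 \<le> R" and u: "u \<in> L2 M" "R * l2_norm M u < l2_norm M (S t u)"
  obtains b v where "R < b" "\<And>w. w \<in> L2 M \<Longrightarrow> l2_norm M (S t w) \<le> b * l2_norm M w"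
    "v \<in> L2 M" "0 < l2_norm M v" "(b / 2) * l2_norm M v < l2_norm M (S t v)"
proof -
  define P where "P k \<longleftrightarrow> (\<forall>w\<in>L2 M. l2_norm M (S t w) \<le> 2 ^ k * l2_norm M w)" for k :: nat
  obtain C where C: "\<And>w. w \<in> L2 M \<Longrightarrow> l2_norm M (S t w) \<le> C * l2_norm M w" using S_bounded[OF t] by blast
  obtain k0 where k0: "C < 2 ^ k0" using real_arch_pow[of 2 C] by auto
  have "P k0" unfolding P_def
  proof
    fix w assume w: "w \<in> L2 M"
    have "C * l2_norm M w \<le> 2 ^ k0 * l2_norm M w" using k0 by (intro mult_right_mono) auto
    then show "l2_norm M (S t w) \<le> 2 ^ k0 * l2_norm M w" using C[OF w] by linarith
  qed
  \<comment> \<open>Least admissible power of 2: the preceding power fails for some v, which makes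
    \<open>2 ^ k\<close> sharp up to a factor 2.\<close>
  define k where "k = (LEAST k. P k)"
  have Pk: "P k" unfolding k_def by (rule LeastI[of P, OF \<open>P k0\<close>])
  have Rb: "R < 2 ^ k"
  proof (rule ccontr)
    assume "\<not> R < 2 ^ k"
    then have "2 ^ k * l2_norm M u \<le> R * l2_norm M u" by (intro mult_right_mono) auto
    moreover have "l2_norm M (S t u) \<le> 2 ^ k * l2_norm M u" using Pk u(1) unfolding P_def by blast
    ultimately show False using u(2) by linarith
  qed
  then have "k \<noteq> 0" using R by (cases "k = 0") auto
  then obtain j where j: "k = Suc j" by (cases k) auto
  then have "\<not> P j" unfolding k_def by (intro not_less_Least) simp
  then obtain v where v: "v \<in> L2 M" "2 ^ j * l2_norm M v < l2_norm M (S t v)" unfolding P_def by force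
  have "l2_norm M v \<noteq> 0"
  proof
    assume "l2_norm M v = 0"
    then have "l2_norm M (S t v) \<le> 0" using Pk v(1) unfolding P_def by fastforce
    then show False using v(2) \<open>l2_norm M v = 0\<close> by simp
  qed
  then have v0: "0 < l2_norm M v" using l2_norm_nonneg[of M v] by linarith
  show ?thesis
    by (rule that[of "2 ^ k" v]) (use Rb Pk v v0 j in \<open>auto simp: P_def\<close>)
qed

text \<open>Twice S v is the difference of S (x + v) and S (x - v), so these two images cannot both
  have norm below that of S v.\<close>

lemma norm_larger_sign:
  assumes t: "0 \<le> t" and x: "x \<in> L2 M" "v \<in> L2 M"
  shows "\<exists>c\<in>{1, -1}. l2_norm M (S t v) \<le> l2_norm M (S t (\<lambda>y. 1 * x y + c * v y))"
proof (rule ccontr)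
  assume "\<not> ?thesis"
  then have 1: "l2_norm M (\<lambda>y. 1 * S t x y + 1 * S t v y) < l2_norm M (S t v)"
    and 2: "l2_norm M (\<lambda>y. 1 * S t x y + (-1) * S t v y) < l2_norm M (S t v)"
    unfolding norm_S_comb[OF t x] by (auto simp: not_le)
  note SL = S_L2[OF t x(1)] S_L2[OF t x(2)]
  have "2 * l2_norm M (S t v) = l2_norm M (\<lambda>y. 2 * S t v y)" by (simp add: l2_norm_cmult)
  also have "(\<lambda>y. 2 * S t v y) = (\<lambda>y. (1 * S t x y + 1 * S t v y) - (1 * S t x y + (-1) * S t v y))" by auto
  also have "l2_norm M \<dots> \<le> l2_norm M (\<lambda>y. 1 * S t x y + 1 * S t v y) + l2_norm M (\<lambda>y. 1 * S t x y + (-1) * S t v y)"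
    using l2_norm_diff_triangle[OF L2_comb[OF SL, of 1 1] L2_zero L2_comb[OF SL, of 1 "-1"]]
      l2_norm_minus_commute[of M "\<lambda>y. 0" "\<lambda>y. 1 * S t x y + (-1) * S t v y"] by simp
  finally show False using 1 2 by simp
qed

text \<open>Uniform boundedness near time 0. If it failed, a vector summed from terms of norm
  \<open>4 ^ (-n)\<close>, with signs chosen one after the other, would have unbounded orbit along
  times t n tending to 0, against strong continuity.\<close>

lemma local_bound:
  obtains \<delta> K where "0 < \<delta>" "\<And>t u. 0 \<le> t \<Longrightarrow> t \<le> \<delta> \<Longrightarrow> u \<in> L2 M \<Longrightarrow> l2_norm M (S t u) \<le> K * l2_norm M u"
proof (rule ccontr)
  assume nt: "\<not> thesis"
  note obt = that
  have unb: "\<exists>t u. 0 \<le> t \<and> t \<le> \<delta> \<and> u \<in> L2 M \<and> K * l2_norm M u < l2_norm M (S t u)" if "0 < \<delta>" for \<delta> K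
  proof (rule ccontr)
    assume neg: "\<not> ?thesis"
    have "l2_norm M (S t u) \<le> K * l2_norm M u" if "0 \<le> t" "t \<le> \<delta>" "u \<in> L2 M" for t u
      using neg that by (meson not_le_imp_less)
    from obt[OF \<open>0 < \<delta>\<close> this] nt show False by blast
  qed
  \<comment> \<open>Tuned to the final estimate, where a sixth of \<open>b n / 4 ^ n\<close>
    remains: \<open>R n / (6 * 4 ^ n)\<close> is n + 1.\<close>
  define R where "R n = 6 * 4 ^ n * (real n + 1)" for n :: nat
  have R1: "1 \<le> R n" for n
  proof -
    have "1 * 1 \<le> (6 * 4 ^ n) * (real n + 1)" by (intro mult_mono) (auto intro: order_trans[OF one_le_power[of 4 n]])
    then show ?thesis by (simp add: R_def)
  qed
  have "\<exists>t b v. 0 \<le> t \<and> t \<le> 1 / real (Suc n) \<and> R n < b \<and> (\<forall>w\<in>L2 M. l2_norm M (S t w) \<le> b * l2_norm M w) \<and>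
     v \<in> L2 M \<and> 0 < l2_norm M v \<and> (b / 2) * l2_norm M v < l2_norm M (S t v)" for n
  proof -
    obtain t u where t: "0 \<le> t" "t \<le> 1 / real (Suc n)" and u: "u \<in> L2 M" "R n * l2_norm M u < l2_norm M (S t u)"
      using unb[of "1 / real (Suc n)" "R n"] by auto
    show ?thesis by (rule dyadic_norm[OF t(1) R1 u]) (use t in blast)
  qed
  then obtain t b v where t: "\<And>n. 0 \<le> t n" "\<And>n. t n \<le> 1 / real (Suc n)" and b: "\<And>n. R n < b n"
    "\<And>n w. w \<in> L2 M \<Longrightarrow> l2_norm M (S (t n) w) \<le> b n * l2_norm M w"
    and v: "\<And>n. v n \<in> L2 M" "\<And>n. 0 < l2_norm M (v n)" "\<And>n. (b n / 2) * l2_norm M (v n) < l2_norm M (S (t n) (v n))"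
    by metis
  define w where "w n x = complex_of_real ((1/4) ^ n / l2_norm M (v n)) * v n x" for n x
  have w: "w n \<in> L2 M" for n unfolding w_def by (rule L2_cmult[OF v(1)])
  have wn: "l2_norm M (w n) = (1/4) ^ n" for n
    using v(2)[of n] unfolding w_def l2_norm_cmult by (simp add: norm_divide norm_power)
  have Sw: "(b n / 2) * (1/4) ^ n \<le> l2_norm M (S (t n) (w n))" for n
  proof -
    have "l2_norm M (S (t n) (w n)) = l2_norm M (\<lambda>x. complex_of_real ((1/4) ^ n / l2_norm M (v n)) * S (t n) (v n) x)"
      using norm_S_comb[OF t(1) v(1) v(1), of n "complex_of_real ((1/4) ^ n / l2_norm M (v n))" n 0 n] by (simp add: w_def[abs_def])
    also have "\<dots> = ((1/4) ^ n / l2_norm M (v n)) * l2_norm M (S (t n) (v n))"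
      using v(2)[of n] unfolding l2_norm_cmult by (simp add: norm_divide norm_power)
    finally have eq: "l2_norm M (S (t n) (w n)) = ((1/4) ^ n / l2_norm M (v n)) * l2_norm M (S (t n) (v n))" .
    have "((1/4) ^ n / l2_norm M (v n)) * ((b n / 2) * l2_norm M (v n)) \<le> ((1/4) ^ n / l2_norm M (v n)) * l2_norm M (S (t n) (v n))"
      using v(2)[of n] v(3)[of n] by (intro mult_left_mono) auto
    moreover have "((1/4) ^ n / l2_norm M (v n)) * ((b n / 2) * l2_norm M (v n)) = (b n / 2) * (1/4) ^ n"
      using v(2)[of n] by simp
    ultimately show ?thesis unfolding eq by simp
  qed
  define sgn where "sgn n x = (SOME c. c \<in> {1, -1} \<and> l2_norm M (S (t n) (w n)) \<le> l2_norm M (S (t n) (\<lambda>y. 1 * x y + c * w n y)))" for n x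
  have sgn: "sgn n x \<in> {1, -1}" "l2_norm M (S (t n) (w n)) \<le> l2_norm M (S (t n) (\<lambda>y. 1 * x y + sgn n x * w n y))"
    if "x \<in> L2 M" for n x
  proof -
    have "\<exists>c. c \<in> {1, -1} \<and> l2_norm M (S (t n) (w n)) \<le> l2_norm M (S (t n) (\<lambda>y. 1 * x y + c * w n y))"
      using norm_larger_sign[OF t(1) that w, of n n] by blast
    from someI_ex[OF this] show "sgn n x \<in> {1, -1}" "l2_norm M (S (t n) (w n)) \<le> l2_norm M (S (t n) (\<lambda>y. 1 * x y + sgn n x * w n y))"
      unfolding sgn_def by blast+
  qed
  \<comment> \<open>Partial sums of the signed terms; the sign at stage n depends on the sum so far,
    so that adding the term does not lose its size under \<open>S (t n)\<close>.\<close>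
  define xs where "xs = rec_nat (\<lambda>x. 0) (\<lambda>n x y. 1 * x y + sgn n x * w n y)"
  have xs0: "xs 0 = (\<lambda>x. 0)" and xsS: "xs (Suc n) = (\<lambda>y. 1 * xs n y + sgn n (xs n) * w n y)" for n by (simp_all add: xs_def)
  have xsL: "xs n \<in> L2 M" for n by (induction n) (auto simp: xs0 xsS L2_zero intro!: L2_add L2_cmult w)
  have step: "l2_norm M (\<lambda>y. xs (Suc n) y - xs n y) = (1/4) ^ n" for n
  proof -
    have "(\<lambda>y. xs (Suc n) y - xs n y) = (\<lambda>y. sgn n (xs n) * w n y)" by (simp add: xsS)
    moreover have "cmod (sgn n (xs n)) = 1" using sgn(1)[OF xsL, of n n] by auto
    ultimately show ?thesis using wn by (simp add: l2_norm_cmult)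
  qed
  have tail: "l2_norm M (\<lambda>y. xs (n + k) y - xs n y) \<le> (4/3) * (1/4) ^ n" for n k
  proof -
    have "l2_norm M (\<lambda>y. xs (n + k) y - xs n y) \<le> (4/3) * ((1/4) ^ n - (1/4) ^ (n + k))"
    proof (induction k)
      case (Suc k)
      have "l2_norm M (\<lambda>y. xs (n + Suc k) y - xs n y)
          \<le> l2_norm M (\<lambda>y. xs (Suc (n + k)) y - xs (n + k) y) + l2_norm M (\<lambda>y. xs (n + k) y - xs n y)"
        using l2_norm_diff_triangle[OF xsL[of "Suc (n + k)"] xsL[of "n + k"] xsL[of n]] by simp
      also have "\<dots> \<le> (1/4) ^ (n + k) + (4/3) * ((1/4) ^ n - (1/4) ^ (n + k))"
        using Suc step[of "n + k"] by simp
      also have "\<dots> = (4/3) * ((1/4) ^ n - (1/4) ^ (n + Suc k))"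
        by (simp only: add_Suc_right power_Suc) argo
      finally show ?case .
    qed simp
    moreover have "0 \<le> (1/4::real) ^ (n + k)" by simp
    ultimately show ?thesis by argo
  qed
  have tail': "l2_norm M (\<lambda>y. xs m y - xs n y) \<le> (4/3) * (1/4) ^ n" if "n \<le> m" for n m
    using tail[of n "m - n"] that by simp
  obtain x where x: "x \<in> L2 M" "l2_tendsto M xs x sequentially"
  proof (rule L2_complete[OF xsL])
    fix e :: real assume e: "0 < e"
    obtain N where N: "(1/4::real) ^ N < e / 4" using real_arch_pow_inv[of "e / 4" "1/4"] e by auto
    have "l2_norm M (\<lambda>y. xs n y - xs m y) < e" if "n \<ge> N" "m \<ge> N" for n m
    proof -
      have "l2_norm M (\<lambda>y. xs n y - xs m y) \<le> l2_norm M (\<lambda>y. xs n y - xs N y) + l2_norm M (\<lambda>y. xs N y - xs m y)"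
        by (rule l2_norm_diff_triangle[OF xsL xsL xsL])
      also have "l2_norm M (\<lambda>y. xs N y - xs m y) = l2_norm M (\<lambda>y. xs m y - xs N y)" by (rule l2_norm_minus_commute)
      finally show ?thesis using tail'[OF that(1)] tail'[OF that(2)] N e by argo
    qed
    then show "\<exists>N. \<forall>n\<ge>N. \<forall>m\<ge>N. l2_norm M (\<lambda>y. xs n y - xs m y) < e" by blast
  qed
  have xdist: "l2_norm M (\<lambda>y. x y - xs n y) \<le> (4/3) * (1/4) ^ n" for n
  proof (rule LIMSEQ_le_const2)
    show "(\<lambda>m. l2_norm M (\<lambda>y. xs m y - xs n y)) \<longlonglongrightarrow> l2_norm M (\<lambda>y. x y - xs n y)"
    proof (rule l2_tendsto_norm)
      show "l2_tendsto M (\<lambda>m y. xs m y - xs n y) (\<lambda>y. x y - xs n y) sequentially"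
        using x(2) by (simp add: l2_tendsto_def)
    qed (intro L2_diff xsL x)+
    show "\<exists>N. \<forall>m\<ge>N. l2_norm M (\<lambda>y. xs m y - xs n y) \<le> (4/3) * (1/4) ^ n" using tail' by blast
  qed
  have big: "real n + 1 \<le> l2_norm M (S (t n) x)" for n
  proof -
    \<comment> \<open>The nth term contributes at least half of \<open>b n / 4 ^ n\<close>, and all
      later terms together at most a third of it, because 4/3 times \<open>(1/4) ^ Suc n\<close> is
      a third of \<open>(1/4) ^ n\<close>. Both bounds use that \<open>b n\<close> is sharp up to a
      factor 2.\<close>
    have "(b n / 2) * (1/4) ^ n \<le> l2_norm M (S (t n) (xs (Suc n)))"
      using Sw[of n] sgn(2)[OF xsL, of n n] unfolding xsS by linarith
    also have "\<dots> \<le> l2_norm M (S (t n) x) + l2_norm M (\<lambda>y. S (t n) x y - S (t n) (xs (Suc n)) y)"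
      using l2_norm_diff_abs[OF S_L2[OF t(1) x(1)] S_L2[OF t(1) xsL], of n n "Suc n"] by linarith
    also have "l2_norm M (\<lambda>y. S (t n) x y - S (t n) (xs (Suc n)) y) = l2_norm M (S (t n) (\<lambda>y. x y - xs (Suc n) y))"
      by (rule norm_S_diff[OF t(1) x(1) xsL])
    also have "\<dots> \<le> b n * l2_norm M (\<lambda>y. x y - xs (Suc n) y)" by (intro b L2_diff x xsL)
    also have "\<dots> \<le> b n * ((4/3) * (1/4) ^ Suc n)"
      using b(1)[of n] R1[of n] by (intro mult_left_mono xdist) auto
    also have "\<dots> = (b n / 3) * (1/4) ^ n" by simp
    finally have 1: "(b n / 2) * (1/4) ^ n - (b n / 3) * (1/4) ^ n \<le> l2_norm M (S (t n) x)" by simp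
    have "(real n + 1) = R n * ((1/4) ^ n / 6)" by (simp add: R_def power_one_over)
    also have "\<dots> \<le> b n * ((1/4) ^ n / 6)" using b(1)[of n] by (intro mult_right_mono) auto
    also have "\<dots> = (b n / 2) * (1/4) ^ n - (b n / 3) * (1/4) ^ n" by (simp add: field_simps)
    finally show ?thesis using 1 by linarith
  qed
  have "((\<lambda>h. l2_norm M (\<lambda>y. S h x y - x y)) \<longlongrightarrow> 0) (at_right 0)" using S_cont[OF x(1)] by (simp add: l2_tendsto_def)
  then have "\<forall>\<^sub>F h in at_right 0. l2_norm M (\<lambda>y. S h x y - x y) < 1" by (rule order_tendstoD) simp
  then obtain h0 where h0: "0 < h0" "\<And>h. 0 < h \<Longrightarrow> h < h0 \<Longrightarrow> l2_norm M (\<lambda>y. S h x y - x y) < 1"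
    unfolding eventually_at_right_field by blast
  have small: "l2_norm M (S h x) \<le> l2_norm M x + 1" if h: "0 \<le> h" "h < h0" for h
  proof (cases "h = 0")
    case True
    have "l2_norm M (S 0 x) = l2_norm M x" by (intro l2_norm_cong_AE L2_measurable S_L2 S_0 x) simp
    then show ?thesis using True by simp
  next
    case False
    then have "l2_norm M (\<lambda>y. S h x y - x y) < 1" using h0(2)[of h] h by simp
    then show ?thesis using l2_norm_diff_abs[OF S_L2[OF h(1) x(1)] x(1)] by linarith
  qed
  obtain n1 where n1: "inverse (real (Suc n1)) < h0" using reals_Archimedean[OF h0(1)] by blast
  obtain n2 where n2: "l2_norm M x + 1 < real n2" using reals_Archimedean2 by blast
  define n where "n = max n1 n2"
  have "t n < h0"
  proof -
    have "t n \<le> 1 / real (Suc n)" by (rule t(2))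
    also have "\<dots> \<le> inverse (real (Suc n1))" unfolding inverse_eq_divide n_def by (intro divide_left_mono) auto
    finally show ?thesis using n1 by linarith
  qed
  then have "l2_norm M (S (t n) x) \<le> l2_norm M x + 1" using t(1) small by blast
  moreover have "real n2 \<le> real n" by (simp add: n_def)
  ultimately show False using big[of n] n2 by linarith
qed

text \<open>The semigroup law splits a time into n steps of length at most \<delta>; taking K at
  least 1 makes the powers of K increase with n.\<close>

lemma bound_on_interval:
  obtains K where "\<And>t u. 0 \<le> t \<Longrightarrow> t \<le> T \<Longrightarrow> u \<in> L2 M \<Longrightarrow> l2_norm M (S t u) \<le> K * l2_norm M u"
proof -
  obtain \<delta> K0 where d: "0 < \<delta>" and K0: "\<And>t u. 0 \<le> t \<Longrightarrow> t \<le> \<delta> \<Longrightarrow> u \<in> L2 M \<Longrightarrow> l2_norm M (S t u) \<le> K0 * l2_norm M u"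
    using local_bound by blast
  define K where "K = max K0 1"
  have K: "l2_norm M (S t u) \<le> K * l2_norm M u" if "0 \<le> t" "t \<le> \<delta>" "u \<in> L2 M" for t u
  proof -
    have "K0 * l2_norm M u \<le> K * l2_norm M u" unfolding K_def by (intro mult_right_mono) auto
    then show ?thesis using K0[OF that] by linarith
  qed
  have K1: "1 \<le> K" by (simp add: K_def)
  have iter: "l2_norm M (S t u) \<le> K ^ n * l2_norm M u" if "0 \<le> t" "t \<le> real n * \<delta>" "u \<in> L2 M" for n t u
    using that
  proof (induction n arbitrary: t u)
    case 0
    then have "t = 0" by simp
    moreover have "l2_norm M (S 0 u) = l2_norm M u" by (intro l2_norm_cong_AE L2_measurable S_L2 S_0 0) simp
    ultimately show ?case by simp
  next
    case (Suc n)
    show ?case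
    proof (cases "t \<le> \<delta>")
      case True
      have "l2_norm M (S t u) \<le> K * l2_norm M u" by (rule K[OF Suc.prems(1) True Suc.prems(3)])
      also have "\<dots> \<le> K ^ Suc n * l2_norm M u"
        using K1 by (intro mult_right_mono) (auto simp: one_le_power)
      finally show ?thesis .
    next
      case False
      then have t: "0 \<le> t - \<delta>" by simp
      have "l2_norm M (S t u) = l2_norm M (S \<delta> (S (t - \<delta>) u))"
        using S_add[of \<delta> "t - \<delta>" u] d t Suc.prems by (intro l2_norm_cong_AE L2_measurable S_L2) auto
      also have "\<dots> \<le> K * l2_norm M (S (t - \<delta>) u)" using d by (intro K S_L2 t Suc.prems) auto
      also have "\<dots> \<le> K * (K ^ n * l2_norm M u)"
        using K1 Suc.prems by (intro mult_left_mono Suc.IH t) (auto simp: algebra_simps)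
      finally show ?thesis by (simp add: mult.assoc)
    qed
  qed
  obtain n where "T / \<delta> < real n" using reals_Archimedean2 by blast
  then have n: "T \<le> real n * \<delta>" using d by (simp add: field_simps)
  show ?thesis by (rule that[of "K ^ n"]) (use iter n in force)
qed

lemma S_tendsto_sequence:
  assumes "0 \<le> t" "l2_tendsto M u x F" "\<And>n. u n \<in> L2 M" "x \<in> L2 M"
  shows "l2_tendsto M (\<lambda>n. S t (u n)) (S t x) F"
proof -
  obtain C where C: "\<And>w. w \<in> L2 M \<Longrightarrow> l2_norm M (S t w) \<le> C * l2_norm M w" using S_bounded[OF assms(1)] by blast
  show ?thesis unfolding l2_tendsto_def norm_S_diff[OF assms(1) assms(3,4)]
  proof (rule tendsto_sandwich)
    show "((\<lambda>n. 0) \<longlongrightarrow> (0::real)) F" by simp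
    show "((\<lambda>n. C * l2_norm M (\<lambda>\<omega>. u n \<omega> - x \<omega>)) \<longlongrightarrow> 0) F"
      using assms(2) unfolding l2_tendsto_def by (rule tendsto_mult_right_zero)
    show "\<forall>\<^sub>F n in F. l2_norm M (S t (\<lambda>\<omega>. u n \<omega> - x \<omega>)) \<le> C * l2_norm M (\<lambda>\<omega>. u n \<omega> - x \<omega>)"
      by (intro always_eventually allI C L2_diff assms)
  qed simp
qed

text \<open>The orbit is extended to negative times by a constant so that it stays in \<open>L\<^sub>2\<close>.\<close>

definition orbit :: "('a \<Rightarrow> complex) \<Rightarrow> real \<Rightarrow> 'a \<Rightarrow> complex" where
  "orbit u t = S (max 0 t) u"

lemma orbit_L2: "u \<in> L2 M \<Longrightarrow> orbit u t \<in> L2 M"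
  unfolding orbit_def by (intro S_L2) auto

lemma orbit_increment:
  assumes u: "u \<in> L2 M" and s: "0 \<le> s" "0 \<le> h"
  shows "l2_norm M (\<lambda>x. S (s + h) u x - S s u x) = l2_norm M (S s (\<lambda>x. S h u x - u x))"
proof -
  have "AE x in M. S (s + h) u x - S s u x = S s (S h u) x - S s u x"
    using S_add[OF s u] by eventually_elim simp
  then have "l2_norm M (\<lambda>x. S (s + h) u x - S s u x) = l2_norm M (\<lambda>x. S s (S h u) x - S s u x)"
    by (intro l2_norm_cong_AE L2_measurable L2_diff S_L2 u) (use s in auto)
  then show ?thesis using norm_S_diff[OF s(1) S_L2[OF s(2) u] u] by simp
qed

text \<open>The axioms give continuity at 0 from the right only. For s < r an increment is S s
  applied to the increment over r - s; the bound on the whole interval makes this uniform and yields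
  continuity from the left too.\<close>

lemma orbit_continuous:
  assumes u: "u \<in> L2 M" and t: "t \<in> {0..T}"
  shows "l2_tendsto M (orbit u) (orbit u t) (at t within {0..T})"
proof -
  obtain K where K: "\<And>t u. 0 \<le> t \<Longrightarrow> t \<le> T \<Longrightarrow> u \<in> L2 M \<Longrightarrow> l2_norm M (S t u) \<le> K * l2_norm M u"
    using bound_on_interval[of T] by blast
  have "((\<lambda>h. \<bar>K\<bar> * l2_norm M (\<lambda>x. S h u x - u x)) \<longlongrightarrow> 0) (at_right 0)"
    using S_cont[OF u] unfolding l2_tendsto_def by (rule tendsto_mult_right_zero)
  show ?thesis unfolding l2_tendsto_def
  proof (rule tendstoI)
    fix e :: real assume e: "0 < e"
    have "\<forall>\<^sub>F h in at_right 0. \<bar>K\<bar> * l2_norm M (\<lambda>x. S h u x - u x) < e"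
      by (rule order_tendstoD(2)[OF \<open>((\<lambda>h. \<bar>K\<bar> * l2_norm M (\<lambda>x. S h u x - u x)) \<longlongrightarrow> 0) (at_right 0)\<close> e])
    then obtain d where d: "0 < d" "\<And>h. 0 < h \<Longrightarrow> h < d \<Longrightarrow> \<bar>K\<bar> * l2_norm M (\<lambda>x. S h u x - u x) < e"
      unfolding eventually_at_right_field by blast
    have inc: "l2_norm M (\<lambda>x. S r u x - S s u x) < e" if "0 \<le> s" "s < r" "r \<le> T" "r - s < d" for r s
    proof -
      have "l2_norm M (\<lambda>x. S r u x - S s u x) = l2_norm M (S s (\<lambda>x. S (r - s) u x - u x))"
        using orbit_increment[OF u that(1), of "r - s"] that by simp
      also have "\<dots> \<le> K * l2_norm M (\<lambda>x. S (r - s) u x - u x)"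
        using that by (intro K L2_diff S_L2 u) auto
      also have "\<dots> \<le> \<bar>K\<bar> * l2_norm M (\<lambda>x. S (r - s) u x - u x)" by (intro mult_right_mono) auto
      also have "\<dots> < e" using that by (intro d) auto
      finally show ?thesis .
    qed
    have "dist (l2_norm M (\<lambda>x. orbit u s x - orbit u t x)) 0 < e" if "s \<in> {0..T}" "0 < dist s t" "dist s t < d" for s
    proof (cases "s < t")
      case True
      then have "l2_norm M (\<lambda>x. S t u x - S s u x) < e" using that t by (intro inc) (auto simp: dist_real_def)
      then show ?thesis using that t by (simp add: orbit_def dist_real_def l2_norm_minus_commute[of M "S s u"])
    next
      case False
      then have "l2_norm M (\<lambda>x. S s u x - S t u x) < e" using that t by (intro inc) (auto simp: dist_real_def)
      then show ?thesis using that t by (simp add: orbit_def dist_real_def)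
    qed
    then show "\<forall>\<^sub>F s in at t within {0..T}. dist (l2_norm M (\<lambda>x. orbit u s x - orbit u t x)) 0 < e"
      unfolding eventually_at using d(1) by (intro exI[of _ d]) auto
  qed
qed

text \<open>S t is linear and bounded, so it may be applied to the difference quotients at 0; the
  semigroup law identifies the result with difference quotients at t.\<close>

lemma generator_orbit:
  assumes ug: "(u, g) \<in> semigroup_generator M S" and t: "0 \<le> t"
  shows "(S t u, S t g) \<in> semigroup_generator M S"
    and "l2_tendsto M (\<lambda>s x. (orbit u s x - orbit u t x) / complex_of_real (s - t)) (S t g) (at_right t)"
proof -
  have u: "u \<in> L2 M" and g: "g \<in> L2 M"
    and lim: "((\<lambda>h. l2_norm M (\<lambda>x. (S h u x - u x) / complex_of_real h - g x)) \<longlongrightarrow> 0) (at_right 0)"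
    using ug by (auto simp: semigroup_generator_def l2_tendsto_def)
  obtain C where C: "\<And>w. w \<in> L2 M \<Longrightarrow> l2_norm M (S t w) \<le> C * l2_norm M w" using S_bounded[OF t] by blast
  have key: "l2_norm M (\<lambda>x. (S (t + h) u x - S t u x) / complex_of_real h - S t g x)
      \<le> C * l2_norm M (\<lambda>x. (S h u x - u x) / complex_of_real h - g x)"
    and key': "l2_norm M (\<lambda>x. (S h (S t u) x - S t u x) / complex_of_real h - S t g x)
      = l2_norm M (\<lambda>x. (S (t + h) u x - S t u x) / complex_of_real h - S t g x)"
    if h: "0 < h" for h
  proof -
    define c where "c = 1 / complex_of_real h"
    let ?w = "\<lambda>x. c * (1 * S h u x + (-1) * u x) + (-1) * g x"
    have w1: "(\<lambda>x. 1 * S h u x + (-1) * u x) \<in> L2 M" using h by (intro L2_comb S_L2 u) auto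
    have w: "?w \<in> L2 M" by (rule L2_comb[OF w1 g])
    note Sh = S_L2[OF less_imp_le[OF h] u]
    have AE1: "AE x in M. S t ?w x = c * (S (t + h) u x - S t u x) - S t g x"
      using S_comb[OF t w1 g, of c "-1"] S_comb[OF t Sh u, of 1 "-1"] S_add[OF t less_imp_le[OF h] u]
      by eventually_elim simp
    have "l2_norm M (\<lambda>x. (S (t + h) u x - S t u x) / complex_of_real h - S t g x) = l2_norm M (S t ?w)"
    proof (rule l2_norm_cong_AE)
      show "AE x in M. (S (t + h) u x - S t u x) / complex_of_real h - S t g x = S t ?w x"
        using AE1 by eventually_elim (simp add: c_def)
      have "(\<lambda>x. c * (S (t + h) u x - S t u x) - S t g x) \<in> L2 M"
        using t h by (intro L2_diff L2_cmult S_L2 u g) auto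
      then show "(\<lambda>x. (S (t + h) u x - S t u x) / complex_of_real h - S t g x) \<in> borel_measurable M"
        using L2_measurable by (simp add: c_def)
    qed (rule L2_measurable[OF S_L2[OF t w]])
    also have "\<dots> \<le> C * l2_norm M ?w" by (rule C[OF w])
    also have "?w = (\<lambda>x. (S h u x - u x) / complex_of_real h - g x)" by (simp add: c_def)
    finally show "l2_norm M (\<lambda>x. (S (t + h) u x - S t u x) / complex_of_real h - S t g x)
      \<le> C * l2_norm M (\<lambda>x. (S h u x - u x) / complex_of_real h - g x)" .
    show "l2_norm M (\<lambda>x. (S h (S t u) x - S t u x) / complex_of_real h - S t g x)
      = l2_norm M (\<lambda>x. (S (t + h) u x - S t u x) / complex_of_real h - S t g x)"
    proof (rule l2_norm_cong_AE)
      show "AE x in M. (S h (S t u) x - S t u x) / complex_of_real h - S t g x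
          = (S (t + h) u x - S t u x) / complex_of_real h - S t g x"
        using S_add[OF less_imp_le[OF h] t u] by eventually_elim (simp add: add.commute)
      have "(\<lambda>x. c * (S (t + h) u x - S t u x) - S t g x) \<in> L2 M" "(\<lambda>x. c * (S h (S t u) x - S t u x) - S t g x) \<in> L2 M"
        using t h by (intro L2_diff L2_cmult S_L2 u g; simp)+
      then show "(\<lambda>x. (S (t + h) u x - S t u x) / complex_of_real h - S t g x) \<in> borel_measurable M"
        "(\<lambda>x. (S h (S t u) x - S t u x) / complex_of_real h - S t g x) \<in> borel_measurable M"
        using L2_measurable by (simp_all add: c_def)
    qed
  qed
  have ev: "\<forall>\<^sub>F h in at_right 0. 0 < (h::real)" by (simp add: eventually_at_right_less)
  have lim1: "((\<lambda>h. l2_norm M (\<lambda>x. (S (t + h) u x - S t u x) / complex_of_real h - S t g x)) \<longlongrightarrow> 0) (at_right 0)"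
  proof (rule tendsto_sandwich)
    show "((\<lambda>h. 0) \<longlongrightarrow> (0::real)) (at_right 0)" by simp
    show "((\<lambda>h. C * l2_norm M (\<lambda>x. (S h u x - u x) / complex_of_real h - g x)) \<longlongrightarrow> 0) (at_right 0)"
      using lim by (rule tendsto_mult_right_zero)
    show "\<forall>\<^sub>F h in at_right 0. l2_norm M (\<lambda>x. (S (t + h) u x - S t u x) / complex_of_real h - S t g x)
        \<le> C * l2_norm M (\<lambda>x. (S h u x - u x) / complex_of_real h - g x)"
      using ev by eventually_elim (rule key)
  qed auto
  have "((\<lambda>h. l2_norm M (\<lambda>x. (S h (S t u) x - S t u x) / complex_of_real h - S t g x)) \<longlongrightarrow> 0) (at_right 0)"
    by (rule tendsto_cong[THEN iffD1, OF _ lim1]) (use ev in eventually_elim, simp add: key')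
  then show "(S t u, S t g) \<in> semigroup_generator M S"
    using S_L2[OF t u] S_L2[OF t g] by (simp add: semigroup_generator_def l2_tendsto_def)
  have "((\<lambda>h. l2_norm M (\<lambda>x. (orbit u (t + h) x - orbit u t x) / complex_of_real (t + h - t) - S t g x)) \<longlongrightarrow> 0) (at_right 0)"
    by (rule tendsto_cong[THEN iffD1, OF _ lim1]) (use ev in eventually_elim, use t in \<open>simp add: orbit_def\<close>)
  then show "l2_tendsto M (\<lambda>s x. (orbit u s x - orbit u t x) / complex_of_real (s - t)) (S t g) (at_right t)"
    unfolding l2_tendsto_def by (rule tendsto_at_right_shift)
qed

end

section \<open>Weighted square norms along orbits\<close>

lemma
  fixes \<sigma> :: "'a \<Rightarrow> real"
  assumes "\<sigma> \<in> borel_measurable M" "\<And>x. 0 \<le> \<sigma> x \<and> \<sigma> x \<le> B"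
  shows weight_measurable: "(\<lambda>x. complex_of_real (\<sigma> x)) \<in> borel_measurable M"
    and weight_bounded: "AE x in M. cmod (complex_of_real (\<sigma> x)) \<le> B"
  using assms by (auto intro!: measurable_compose[OF assms(1) borel_measurable_of_real] AE_I2)

lemma l2_inner_real_weight:
  "l2_inner M u (\<lambda>x. complex_of_real (\<sigma> x) * v x) = cnj (l2_inner M v (\<lambda>x. complex_of_real (\<sigma> x) * u x))"
  unfolding l2_inner_cnj by (simp add: l2_inner_def mult_ac)

text \<open>Weighted square norm, written as an inner product so that the L2 limit lemmas apply to
  it; \<open>weight_sq_eq\<close> gives the integral.\<close>

definition weight_sq :: "'a measure \<Rightarrow> ('a \<Rightarrow> real) \<Rightarrow> ('a \<Rightarrow> complex) \<Rightarrow> real" where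
  "weight_sq M \<sigma> u = Re (l2_inner M u (\<lambda>x. complex_of_real (\<sigma> x) * u x))"

lemma weight_sq_eq: "weight_sq M \<sigma> u = (LINT x|M. \<sigma> x * (cmod (u x))\<^sup>2)"
proof -
  have "l2_inner M u (\<lambda>x. complex_of_real (\<sigma> x) * u x) = (LINT x|M. complex_of_real (\<sigma> x * (cmod (u x))\<^sup>2))"
    unfolding l2_inner_def of_real_mult complex_norm_square
    by (intro Bochner_Integration.integral_cong refl) (simp add: mult_ac)
  then show ?thesis unfolding weight_sq_def by (simp only: integral_complex_of_real Re_complex_of_real)
qed

lemma weight_sq_tendsto:
  assumes "\<sigma> \<in> borel_measurable M" "\<And>x. 0 \<le> \<sigma> x \<and> \<sigma> x \<le> B"
    and "l2_tendsto M u x F" "\<And>n. u n \<in> L2 M" "x \<in> L2 M"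
  shows "((\<lambda>n. weight_sq M \<sigma> (u n)) \<longlongrightarrow> weight_sq M \<sigma> x) F"
proof -
  note w = weight_measurable[OF assms(1,2)] weight_bounded[OF assms(1,2)]
  have "((\<lambda>n. l2_inner M (u n) (\<lambda>y. complex_of_real (\<sigma> y) * u n y)) \<longlongrightarrow> l2_inner M x (\<lambda>y. complex_of_real (\<sigma> y) * x y)) F"
    by (rule l2_tendsto_inner_both[OF assms(3-5) l2_tendsto_mult_bounded[OF assms(3-5) w]])
       (rule L2_mult_bounded[OF assms(4) w] L2_mult_bounded[OF assms(5) w])+
  then show ?thesis unfolding weight_sq_def by (rule tendsto_Re)
qed

context l2_semigroup
begin

lemma orbit_tendsto_right:
  assumes "u \<in> L2 M" "0 \<le> s"
  shows "l2_tendsto M (orbit u) (orbit u s) (at_right s)"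
proof -
  have "l2_tendsto M (orbit u) (orbit u s) (at s within {0..s + 1})"
    by (rule orbit_continuous[OF assms(1)]) (use assms in auto)
  moreover have "at_right s \<le> at s within {0..s + 1}"
  proof -
    have "at_right s = at s within {s..s + 1}" using at_within_Icc_at_right[of s "s + 1"] by simp
    also have "\<dots> \<le> at s within {0..s + 1}" by (rule at_le) (use assms in auto)
    finally show ?thesis .
  qed
  ultimately show ?thesis unfolding l2_tendsto_def by (rule tendsto_mono[rotated])
qed

text \<open>The factor \<zeta> allows a modulus to be recovered from real parts when it is chosen as
  a suitable unit number.\<close>

lemma inner_orbit_deriv:
  assumes ug: "(u, g) \<in> semigroup_generator M S" and s: "0 \<le> s" and phi: "\<phi> \<in> L2 M"
  shows "((\<lambda>r. Re (\<zeta> * l2_inner M (orbit u r) \<phi>)) has_real_derivative Re (\<zeta> * l2_inner M (S s g) \<phi>)) (at_right s)"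
proof -
  have u: "u \<in> L2 M" and g: "g \<in> L2 M" using ug by (auto simp: semigroup_generator_def)
  let ?D = "\<lambda>r x. (orbit u r x - orbit u s x) / complex_of_real (r - s)"
  have DL: "?D r \<in> L2 M" for r
    using L2_cmult[OF L2_diff[OF orbit_L2[OF u, of r] orbit_L2[OF u, of s]], of "1 / complex_of_real (r - s)"] by simp
  have "((\<lambda>r. Re (\<zeta> * l2_inner M (?D r) \<phi>)) \<longlongrightarrow> Re (\<zeta> * l2_inner M (S s g) \<phi>)) (at_right s)"
    by (intro tendsto_intros l2_tendsto_inner(2)[OF generator_orbit(2)[OF ug s] DL S_L2[OF s g] phi])
  moreover have "Re (\<zeta> * l2_inner M (?D r) \<phi>) = (Re (\<zeta> * l2_inner M (orbit u r) \<phi>) - Re (\<zeta> * l2_inner M (orbit u s) \<phi>)) / (r - s)" for r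
  proof -
    have "l2_inner M (?D r) \<phi> = (1 / complex_of_real (r - s)) * (l2_inner M (orbit u r) \<phi> - l2_inner M (orbit u s) \<phi>)"
      using l2_inner_comb_left[OF L2_diff[OF orbit_L2[OF u] orbit_L2[OF u]] phi phi, of "1 / complex_of_real (r - s)" r s 0]
        l2_inner_diff_left[OF orbit_L2[OF u] orbit_L2[OF u] phi, of r s] by simp
    then have "\<zeta> * l2_inner M (?D r) \<phi> = (\<zeta> * l2_inner M (orbit u r) \<phi> - \<zeta> * l2_inner M (orbit u s) \<phi>) / complex_of_real (r - s)"
      by (simp only: right_diff_distrib diff_divide_distrib times_divide_eq_left mult_1_left times_divide_eq_right)
    then show ?thesis by (simp only: Re_divide_of_real minus_complex.sel)
  qed
  ultimately show ?thesis by (simp add: has_field_derivative_iff)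
qed

lemma weight_sq_orbit_deriv:
  assumes ug: "(u, g) \<in> semigroup_generator M S" and s: "0 \<le> s"
    and \<sigma>: "\<sigma> \<in> borel_measurable M" "\<And>x. 0 \<le> \<sigma> x \<and> \<sigma> x \<le> B"
  shows "((\<lambda>r. weight_sq M \<sigma> (orbit u r)) has_real_derivative
      2 * Re (l2_inner M (S s g) (\<lambda>x. complex_of_real (\<sigma> x) * orbit u s x))) (at_right s)"
proof -
  have u: "u \<in> L2 M" and g: "g \<in> L2 M" using ug by (auto simp: semigroup_generator_def)
  note w = weight_measurable[OF \<sigma>] weight_bounded[OF \<sigma>]
  let ?\<sigma> = "\<lambda>x. complex_of_real (\<sigma> x)"
  let ?D = "\<lambda>r x. (orbit u r x - orbit u s x) / complex_of_real (r - s)"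
  have DL: "?D r \<in> L2 M" for r
    using L2_cmult[OF L2_diff[OF orbit_L2[OF u, of r] orbit_L2[OF u, of s]], of "1 / complex_of_real (r - s)"] by simp
  have oL: "(\<lambda>x. ?\<sigma> x * orbit u r x) \<in> L2 M" for r by (rule L2_mult_bounded[OF orbit_L2[OF u] w])
  note lim = generator_orbit(2)[OF ug s]
  have l1: "((\<lambda>r. l2_inner M (?D r) (\<lambda>x. ?\<sigma> x * orbit u r x)) \<longlongrightarrow> l2_inner M (S s g) (\<lambda>x. ?\<sigma> x * orbit u s x)) (at_right s)"
    by (rule l2_tendsto_inner_both[OF lim DL S_L2[OF s g]
          l2_tendsto_mult_bounded[OF orbit_tendsto_right[OF u s] orbit_L2[OF u] orbit_L2[OF u] w] oL oL])
  have l2: "((\<lambda>r. l2_inner M (?D r) (\<lambda>x. ?\<sigma> x * orbit u s x)) \<longlongrightarrow> l2_inner M (S s g) (\<lambda>x. ?\<sigma> x * orbit u s x)) (at_right s)"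
    by (rule l2_tendsto_inner(2)[OF lim DL S_L2[OF s g] oL])
  have "((\<lambda>r. Re (l2_inner M (?D r) (\<lambda>x. ?\<sigma> x * orbit u r x)) + Re (l2_inner M (?D r) (\<lambda>x. ?\<sigma> x * orbit u s x)))
      \<longlongrightarrow> Re (l2_inner M (S s g) (\<lambda>x. ?\<sigma> x * orbit u s x)) + Re (l2_inner M (S s g) (\<lambda>x. ?\<sigma> x * orbit u s x))) (at_right s)"
    by (intro tendsto_add tendsto_Re l1 l2)
  \<comment> \<open>Discrete product rule: a difference of quadratic expressions equals the
    increment tested against the sum of both endpoints, since the weight is real.\<close>
  moreover have "Re (l2_inner M (?D r) (\<lambda>x. ?\<sigma> x * orbit u r x)) + Re (l2_inner M (?D r) (\<lambda>x. ?\<sigma> x * orbit u s x))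
      = (weight_sq M \<sigma> (orbit u r) - weight_sq M \<sigma> (orbit u s)) / (r - s)" for r
  proof -
    let ?c = "1 / complex_of_real (r - s)"
    have D: "l2_inner M (?D r) v = (l2_inner M (orbit u r) v - l2_inner M (orbit u s) v) / complex_of_real (r - s)" if "v \<in> L2 M" for v
      using l2_inner_comb_left[OF L2_diff[OF orbit_L2[OF u] orbit_L2[OF u]] that that, of ?c r s 0]
        l2_inner_diff_left[OF orbit_L2[OF u] orbit_L2[OF u] that, of r s] by simp
    have sym: "Re (l2_inner M (orbit u r) (\<lambda>x. ?\<sigma> x * orbit u s x)) = Re (l2_inner M (orbit u s) (\<lambda>x. ?\<sigma> x * orbit u r x))"
      using l2_inner_real_weight[of M "orbit u r" \<sigma> "orbit u s"] by simp
    show ?thesis unfolding D[OF oL] weight_sq_def Re_divide_of_real minus_complex.sel sym by (simp add: diff_divide_distrib)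
  qed
  ultimately show ?thesis by (simp add: has_field_derivative_iff)
qed

text \<open>In the application \<sigma> is the growth weight, \<phi> the test weight and w half of
  \<open>mass_const\<close>. The bracket in \<open>test_bound\<close> dominates half the weighted
  energy plus w; it contains the term that the time derivative of the weighted square norm cancels,
  so no energy has to be integrated over time.\<close>

context
  fixes \<sigma> :: "'a \<Rightarrow> real" and \<phi> :: "'a \<Rightarrow> complex" and B c k w :: real
  assumes \<sigma>: "\<sigma> \<in> borel_measurable M" "\<And>x. 0 \<le> \<sigma> x \<and> \<sigma> x \<le> B" and phi: "\<phi> \<in> L2 M"
    and nonneg: "0 \<le> c" "0 \<le> k" "0 \<le> w"
    and dissipative: "\<And>x g. (x, g) \<in> semigroup_generator M S \<Longrightarrow>
      Re (l2_inner M g (\<lambda>y. complex_of_real (\<sigma> y) * x y)) \<le> c * weight_sq M \<sigma> x"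
    and test_bound: "\<And>x g. (x, g) \<in> semigroup_generator M S \<Longrightarrow>
      cmod (l2_inner M g \<phi>) \<le> k * (c * weight_sq M \<sigma> x + w - Re (l2_inner M g (\<lambda>y. complex_of_real (\<sigma> y) * x y)))"
begin

text \<open>The first bound is Gronwall's inequality with rate 2c. For the second, adding k/2 times
  the weighted square norm to the pairing makes the uncontrolled term in \<open>test_bound\<close>
  cancel.\<close>

lemma weighted_estimate_generator:
  assumes ug: "(u, g) \<in> semigroup_generator M S" and t: "0 \<le> t"
  shows "weight_sq M \<sigma> (S t u) \<le> exp (2 * c * t) * weight_sq M \<sigma> u"
    and "cmod (l2_inner M (S t u) \<phi> - l2_inner M u \<phi>)
      \<le> k * (weight_sq M \<sigma> u / 2 + t * (c * (exp (2 * c * t) * weight_sq M \<sigma> u) + w))"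
proof -
  have u: "u \<in> L2 M" using ug by (auto simp: semigroup_generator_def)
  let ?W = "\<lambda>r. weight_sq M \<sigma> (orbit u r)"
  let ?I = "\<lambda>s. Re (l2_inner M (S s g) (\<lambda>x. complex_of_real (\<sigma> x) * orbit u s x))"
  have orb: "orbit u s = S s u" if "0 \<le> s" for s using that by (simp add: orbit_def)
  have gen: "(orbit u s, S s g) \<in> semigroup_generator M S" if "0 \<le> s" for s
    unfolding orb[OF that] by (rule generator_orbit(1)[OF ug that])
  have W0: "weight_sq M \<sigma> (orbit u 0) = weight_sq M \<sigma> u" "l2_inner M (orbit u 0) \<phi> = l2_inner M u \<phi>"
  proof -
    have ae: "AE x in M. orbit u 0 x = u x" using S_0[OF u] by (simp add: orbit_def)
    note m = L2_measurable[OF orbit_L2[OF u]] L2_measurable[OF u] L2_measurable[OF phi] weight_measurable[OF \<sigma>]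
    show "weight_sq M \<sigma> (orbit u 0) = weight_sq M \<sigma> u" unfolding weight_sq_def l2_inner_def
      by (intro arg_cong[where f=Re] integral_cong_AE borel_measurable_times borel_measurable_cnj m)
         (use ae in eventually_elim, simp)
    show "l2_inner M (orbit u 0) \<phi> = l2_inner M u \<phi>" unfolding l2_inner_def
      by (intro integral_cong_AE borel_measurable_times borel_measurable_cnj m) (use ae in eventually_elim, simp)
  qed
  have contW: "continuous_on {0..t} ?W" for t
    unfolding continuous_on_def
    by (intro ballI weight_sq_tendsto[OF \<sigma> orbit_continuous[OF u] orbit_L2[OF u] orbit_L2[OF u]])
  have contI: "continuous_on {0..t} (\<lambda>r. Re (\<zeta> * l2_inner M (orbit u r) \<phi>))" for t \<zeta>
    unfolding continuous_on_def
    by (intro ballI tendsto_intros l2_tendsto_inner(2)[OF orbit_continuous[OF u] orbit_L2[OF u] orbit_L2[OF u] phi])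
  have decay: "?W s \<le> exp (2 * c * s) * weight_sq M \<sigma> u" if s: "0 \<le> s" for s
  proof -
    have "exp (- 2 * c * s) * ?W s \<le> exp (- 2 * c * 0) * ?W 0"
    proof (rule right_deriv_nonpos_imp_le[OF s])
      show "continuous_on {0..s} (\<lambda>s. exp (- 2 * c * s) * ?W s)" by (intro continuous_intros contW)
      fix r assume r: "0 \<le> r" "r < s"
      have "((\<lambda>s. exp (- 2 * c * s) * ?W s) has_real_derivative
          (- 2 * c * exp (- 2 * c * r)) * ?W r + (2 * ?I r) * exp (- 2 * c * r)) (at_right r)"
        by (rule DERIV_mult[OF _ weight_sq_orbit_deriv[OF ug r(1) \<sigma>]]) (auto intro!: derivative_eq_intros)
      moreover have "(- 2 * c * exp (- 2 * c * r)) * ?W r + (2 * ?I r) * exp (- 2 * c * r) \<le> 0"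
      proof -
        have "(- 2 * c * exp (- 2 * c * r)) * ?W r + (2 * ?I r) * exp (- 2 * c * r) = (2 * exp (- 2 * c * r)) * (?I r - c * ?W r)"
          by (simp add: algebra_simps)
        also have "\<dots> \<le> 0"
          using dissipative[OF gen[OF r(1)]] by (intro mult_nonneg_nonpos) auto
        finally show ?thesis .
      qed
      ultimately show "\<exists>D\<le>0. ((\<lambda>s. exp (- 2 * c * s) * ?W s) has_real_derivative D) (at_right r)" by blast
    qed
    then have "exp (2 * c * s) * (exp (- 2 * c * s) * ?W s) \<le> exp (2 * c * s) * weight_sq M \<sigma> u"
      using W0 by (intro mult_left_mono) auto
    moreover have "exp (2 * c * s) * exp (- 2 * c * s) = 1" unfolding exp_add[symmetric] by simp
    ultimately show ?thesis by (simp only: mult.assoc[symmetric] mult_1_left)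
  qed
  from decay[OF t] show "weight_sq M \<sigma> (S t u) \<le> exp (2 * c * t) * weight_sq M \<sigma> u" by (simp only: orb[OF t])
  have Wpos: "0 \<le> weight_sq M \<sigma> v" for v
    unfolding weight_sq_eq using \<sigma>(2) by (intro integral_nonneg_AE AE_I2) simp
  \<comment> \<open>Uniform bound on [0, t] for what remains of \<open>test_bound\<close> after the
    cancellation, by the growth estimate just proved.\<close>
  define H where "H = c * (exp (2 * c * t) * weight_sq M \<sigma> u) + w"
  have main: "Re (\<zeta> * (l2_inner M (S t u) \<phi> - l2_inner M u \<phi>)) \<le> k * (weight_sq M \<sigma> u / 2 + t * H)" if z: "cmod \<zeta> = 1" for \<zeta>
  proof -
    \<comment> \<open>The right derivative of the middle term is k times the real part that
      \<open>test_bound\<close> subtracts; the linear term k H s compensates the rest, so ?G is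
      nonincreasing.\<close>
    let ?G = "\<lambda>s. Re (\<zeta> * l2_inner M (orbit u s) \<phi>) + k / 2 * ?W s - k * H * s"
    have "?G t \<le> ?G 0"
    proof (rule right_deriv_nonpos_imp_le[OF t])
      show "continuous_on {0..t} ?G" by (intro continuous_intros contW contI)
      fix r assume r: "0 \<le> r" "r < t"
      have "(?G has_real_derivative Re (\<zeta> * l2_inner M (S r g) \<phi>) + k / 2 * (2 * ?I r) - k * H) (at_right r)"
        by (rule DERIV_diff[OF DERIV_add[OF inner_orbit_deriv[OF ug r(1) phi]
              DERIV_cmult[OF weight_sq_orbit_deriv[OF ug r(1) \<sigma>]]] DERIV_cmult_Id])
      moreover have "Re (\<zeta> * l2_inner M (S r g) \<phi>) + k / 2 * (2 * ?I r) - k * H \<le> 0"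
      proof -
        have "Re (\<zeta> * l2_inner M (S r g) \<phi>) \<le> cmod (\<zeta> * l2_inner M (S r g) \<phi>)" by (rule complex_Re_le_cmod)
        also have "\<dots> = cmod (l2_inner M (S r g) \<phi>)" using z by (simp add: norm_mult)
        also have "\<dots> \<le> k * (c * ?W r + w - ?I r)" by (rule test_bound[OF gen[OF r(1)]])
        also have "\<dots> \<le> k * (H - ?I r)"
        proof (rule mult_left_mono[OF _ nonneg(2)])
          have "exp (2 * c * r) * weight_sq M \<sigma> u \<le> exp (2 * c * t) * weight_sq M \<sigma> u"
            using r nonneg Wpos[of u] by (intro mult_right_mono) (auto intro: mult_left_mono)
          then have "?W r \<le> exp (2 * c * t) * weight_sq M \<sigma> u" using decay[OF r(1)] by linarith
          then have "c * ?W r \<le> c * (exp (2 * c * t) * weight_sq M \<sigma> u)" using nonneg by (intro mult_left_mono)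
          then show "c * ?W r + w - ?I r \<le> H - ?I r" by (simp add: H_def)
        qed
        finally show ?thesis by (simp add: algebra_simps)
      qed
      ultimately show "\<exists>D\<le>0. (?G has_real_derivative D) (at_right r)" by blast
    qed
    moreover have "0 \<le> k / 2 * ?W t" using nonneg Wpos[of "orbit u t"] by simp
    ultimately have "Re (\<zeta> * l2_inner M (orbit u t) \<phi>) - Re (\<zeta> * l2_inner M u \<phi>) \<le> k / 2 * weight_sq M \<sigma> u + k * H * t"
      using W0 by simp
    then show ?thesis by (simp add: orb[OF t] algebra_simps)
  qed
  let ?d = "l2_inner M (S t u) \<phi> - l2_inner M u \<phi>"
  have "cmod ?d \<le> k * (weight_sq M \<sigma> u / 2 + t * H)"
  proof (cases "?d = 0")
    case True
    have "0 \<le> H" using nonneg Wpos[of u] by (simp add: H_def)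
    then show ?thesis using True nonneg Wpos[of u] t by simp
  next
    case False
    define d where "d = ?d"
    have d: "d \<noteq> 0" using False by (simp add: d_def)
    have "cmod (cnj d / complex_of_real (cmod d)) = 1" using d by (simp add: norm_divide)
    from main[OF this] have "Re (cnj d / complex_of_real (cmod d) * d) \<le> k * (weight_sq M \<sigma> u / 2 + t * H)"
      unfolding d_def[symmetric] .
    moreover have "cnj d / complex_of_real (cmod d) * d = complex_of_real (cmod d)"
      using d complex_norm_square[of d] by (simp add: divide_eq_eq power2_eq_square mult.commute)
    ultimately have "cmod d \<le> k * (weight_sq M \<sigma> u / 2 + t * H)" by (simp only: Re_complex_of_real)
    then show ?thesis unfolding d_def .
  qed
  then show "cmod ?d \<le> k * (weight_sq M \<sigma> u / 2 + t * (c * (exp (2 * c * t) * weight_sq M \<sigma> u) + w))"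
    unfolding H_def .
qed

text \<open>Both sides are continuous in L2 for the fixed bounded weight, so the estimate extends
  from the generator domain by density.\<close>

lemma weighted_estimate:
  assumes u: "u \<in> L2 M" and t: "0 \<le> t"
    and dense: "\<And>n::nat. (un n, gn n) \<in> semigroup_generator M S" "l2_tendsto M un u sequentially"
  shows "weight_sq M \<sigma> (S t u) \<le> exp (2 * c * t) * weight_sq M \<sigma> u"
    and "cmod (l2_inner M (S t u) \<phi> - l2_inner M u \<phi>)
      \<le> k * (weight_sq M \<sigma> u / 2 + t * (c * (exp (2 * c * t) * weight_sq M \<sigma> u) + w))"
proof -
  have un: "un n \<in> L2 M" for n using dense(1)[of n] by (auto simp: semigroup_generator_def)
  note Su = S_tendsto_sequence[OF t dense(2) un u]
  have 1: "(\<lambda>n. weight_sq M \<sigma> (un n)) \<longlonglongrightarrow> weight_sq M \<sigma> u"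
    by (rule weight_sq_tendsto[OF \<sigma> dense(2) un u])
  have 2: "(\<lambda>n. weight_sq M \<sigma> (S t (un n))) \<longlonglongrightarrow> weight_sq M \<sigma> (S t u)"
    by (rule weight_sq_tendsto[OF \<sigma> Su S_L2[OF t un] S_L2[OF t u]])
  show "weight_sq M \<sigma> (S t u) \<le> exp (2 * c * t) * weight_sq M \<sigma> u"
    by (rule LIMSEQ_le[OF 2 tendsto_mult[OF tendsto_const 1]])
       (use weighted_estimate_generator(1)[OF dense(1) t] in auto)
  have 3: "(\<lambda>n. cmod (l2_inner M (S t (un n)) \<phi> - l2_inner M (un n) \<phi>)) \<longlonglongrightarrow> cmod (l2_inner M (S t u) \<phi> - l2_inner M u \<phi>)"
    by (intro tendsto_intros l2_tendsto_inner(2)[OF Su S_L2[OF t un] S_L2[OF t u] phi] l2_tendsto_inner(2)[OF dense(2) un u phi])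
  have 4: "(\<lambda>n. k * (weight_sq M \<sigma> (un n) / 2 + t * (c * (exp (2 * c * t) * weight_sq M \<sigma> (un n)) + w)))
      \<longlonglongrightarrow> k * (weight_sq M \<sigma> u / 2 + t * (c * (exp (2 * c * t) * weight_sq M \<sigma> u) + w))"
    by (intro tendsto_intros 1) simp
  show "cmod (l2_inner M (S t u) \<phi> - l2_inner M u \<phi>)
      \<le> k * (weight_sq M \<sigma> u / 2 + t * (c * (exp (2 * c * t) * weight_sq M \<sigma> u) + w))"
    by (rule LIMSEQ_le[OF 3 4]) (use weighted_estimate_generator(2)[OF dense(1) t] in auto)
qed

end

end

subsection \<open>Density of the domain of the associated operator\<close>

context l2_form
begin

lemma form_operator_comb:
  assumes "(x, f) \<in> form_operator M D a" "(x', f') \<in> form_operator M D a"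
  shows "((\<lambda>y. \<alpha> * x y + \<beta> * x' y), (\<lambda>y. \<alpha> * f y + \<beta> * f' y)) \<in> form_operator M D a"
proof -
  obtain U where x: "x \<in> L2 M" "f \<in> L2 M" and U: "\<And>n. U n \<in> D" "bounded (range (\<lambda>n. p (U n)))" "l2_tendsto M U x sequentially"
    "\<And>v. v \<in> D \<Longrightarrow> (\<lambda>n. a (U n) v) \<longlonglongrightarrow> l2_inner M f v"
    using assms(1) unfolding form_operator_def by auto
  obtain V where x': "x' \<in> L2 M" "f' \<in> L2 M" and V: "\<And>n. V n \<in> D" "bounded (range (\<lambda>n. p (V n)))" "l2_tendsto M V x' sequentially"
    "\<And>v. v \<in> D \<Longrightarrow> (\<lambda>n. a (V n) v) \<longlonglongrightarrow> l2_inner M f' v"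
    using assms(2) unfolding form_operator_def by auto
  obtain BU where BU: "\<And>n. p (U n) \<le> BU" using U(2) unfolding bounded_iff by (auto dest: abs_le_D1)
  obtain BV where BV: "\<And>n. p (V n) \<le> BV" using V(2) unfolding bounded_iff by (auto dest: abs_le_D1)
  let ?W = "\<lambda>n y. \<alpha> * U n y + \<beta> * V n y"
  have pb: "p (?W n) \<le> 2 * ((cmod \<alpha>)\<^sup>2 * BU) + 2 * ((cmod \<beta>)\<^sup>2 * BV)" for n
  proof -
    have "p (?W n) \<le> 2 * p (\<lambda>y. \<alpha> * U n y) + 2 * p (\<lambda>y. \<beta> * V n y)"
      by (rule p_add_le[OF scale_mem[OF U(1)] scale_mem[OF V(1)]])
    also have "\<dots> \<le> 2 * ((cmod \<alpha>)\<^sup>2 * BU) + 2 * ((cmod \<beta>)\<^sup>2 * BV)"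
      unfolding p_scale[OF U(1)] p_scale[OF V(1)] by (intro add_mono mult_left_mono BU BV) auto
    finally show ?thesis .
  qed
  show ?thesis unfolding form_operator_def
  proof (intro CollectI case_prodI conjI exI[of _ ?W] allI ballI)
    show W: "?W n \<in> D" for n by (intro comb_mem U V)
    show "bounded (range (\<lambda>n. p (?W n)))"
      using pb p_nonneg[OF W] by (intro boundedI[of _ "2 * ((cmod \<alpha>)\<^sup>2 * BU) + 2 * ((cmod \<beta>)\<^sup>2 * BV)"]) auto
    show "l2_tendsto M ?W (\<lambda>y. \<alpha> * x y + \<beta> * x' y) sequentially"
      by (rule l2_tendsto_comb[OF U(3) memL2[OF U(1)] x(1) V(3) memL2[OF V(1)] x'(1)])
    fix v assume v: "v \<in> D"
    show "(\<lambda>n. a (?W n) v) \<longlonglongrightarrow> l2_inner M (\<lambda>y. \<alpha> * f y + \<beta> * f' y) v"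
      unfolding comb_left[OF U(1) V(1) v] l2_inner_comb_left[OF x(2) x'(2) memL2[OF v]]
      by (intro tendsto_intros U(4) V(4) v)
  qed (intro L2_comb x x')+
qed

lemma form_operator_zero: "((\<lambda>y. 0), (\<lambda>y. 0)) \<in> form_operator M D a"
  unfolding form_operator_def
  by (intro CollectI case_prodI conjI exI[of _ "\<lambda>n y. 0"] allI ballI L2_zero zero_mem)
     (auto simp: l2_tendsto_def zero_left l2_inner_def)

text \<open>Let z be the part of u orthogonal to the domain and let y solve (1 + A) y = z. Then y is
  orthogonal to z, which forces y = 0; the generator maps the zero class to the zero class, so z = 0
  as well.\<close>

lemma generator_domain_dense:
  assumes assoc: "associated_semigroup M D a S" and u: "u \<in> L2 M"
  obtains un gn where "\<And>n::nat. (un n, gn n) \<in> semigroup_generator M S" "l2_tendsto M un u sequentially"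
proof -
  interpret S: l2_semigroup M S using assoc by unfold_locales (simp add: associated_semigroup_def)
  have gen: "semigroup_generator M S = {(x, \<lambda>\<omega>. - f \<omega>) |x f. (x, f) \<in> form_operator M D a}"
    using assoc by (simp add: associated_semigroup_def)
  define D0 where "D0 = {x. \<exists>f. (x, f) \<in> form_operator M D a}"
  have D0: "D0 \<subseteq> L2 M" "(\<lambda>x. 0) \<in> D0"
  proof -
    show "D0 \<subseteq> L2 M" unfolding D0_def form_operator_def by blast
    show "(\<lambda>x. 0) \<in> D0" unfolding D0_def using form_operator_zero by blast
  qed
  have D0_comb: "(\<lambda>z. \<alpha> * x z + \<beta> * y z) \<in> D0" if xy: "x \<in> D0" "y \<in> D0" for x y \<alpha> \<beta>
  proof -
    obtain f f' where "(x, f) \<in> form_operator M D a" "(y, f') \<in> form_operator M D a"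
      using xy unfolding D0_def by blast
    from form_operator_comb[OF this, of \<alpha> \<beta>] show ?thesis unfolding D0_def by blast
  qed
  \<comment> \<open>For the zero form with shift 1 the approximate Lax-Milgram theorem produces the
    orthogonal projection of u onto the closure of \<open>D0\<close>.\<close>
  interpret Z: l2_form D0 "\<lambda>u v. 0" 0 M
    by unfold_locales (use D0 D0_comb in auto)
  have "\<forall>n. \<exists>U. Z.approximates 1 u (1 / real (Suc n)) U"
    using Z.approximates_exists[OF u, of 1] by (metis of_nat_0_less_iff zero_less_Suc zero_less_divide_1_iff zero_less_one)
  from choice[OF this] obtain U where U: "\<And>n. Z.approximates 1 u (1 / real (Suc n)) (U n)" by blast
  note UD = Z.approximates_mem[OF U]
  obtain x where x: "x \<in> L2 M" "l2_tendsto M U x sequentially" using Z.approximates_limit[OF U _ u] by auto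
  define z where "z y = u y - x y" for y
  have z: "z \<in> L2 M" unfolding z_def by (intro L2_diff u x)
  have orth: "l2_inner M z w = 0" if w: "w \<in> D0" for w
  proof -
    have wL: "w \<in> L2 M" using w D0(1) by blast
    have "(\<lambda>n. Z.shift 1 (U n) w) \<longlonglongrightarrow> l2_inner M u w"
      by (rule Z.approximates_tendsto(1)[OF U _ u x, of "\<lambda>n. w" 0 w]) (use w wL in \<open>auto simp: l2_tendsto_def\<close>)
    then have "(\<lambda>n. l2_inner M (U n) w) \<longlonglongrightarrow> l2_inner M u w" by (simp add: Z.shift_def)
    moreover have "(\<lambda>n. l2_inner M (U n) w) \<longlonglongrightarrow> l2_inner M x w"
      by (rule l2_tendsto_inner(2)[OF x(2) Z.memL2[OF UD] x(1) wL])
    ultimately have "l2_inner M u w = l2_inner M x w" using LIMSEQ_unique by blast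
    then show ?thesis unfolding z_def[abs_def] by (simp add: l2_inner_diff_left u x wL)
  qed
  have "\<forall>n. \<exists>U. approximates 1 z (1 / real (Suc n)) U"
    using approximates_exists[OF z, of 1] by (metis of_nat_0_less_iff zero_less_Suc zero_less_divide_1_iff zero_less_one)
  from choice[OF this] obtain V where V: "\<And>n. approximates 1 z (1 / real (Suc n)) (V n)" by blast
  note VD = approximates_mem[OF V]
  obtain y where y: "y \<in> L2 M" "l2_tendsto M V y sequentially" using approximates_limit[OF V _ z] by auto
  have yA: "(y, \<lambda>\<omega>. z \<omega> - complex_of_real 1 * y \<omega>) \<in> form_operator M D a"
    by (rule approximates_form_operator[OF V _ z y]) simp
  \<comment> \<open>This pairing is the limit of the shifted energies of V n, which dominate the
    squared norms of V n and hence that of y.\<close>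
  then have "l2_inner M z y = 0" by (intro orth) (auto simp: D0_def)
  moreover have "(\<lambda>n. shift 1 (V n) (V n)) \<longlonglongrightarrow> l2_inner M z y"
    by (rule approximates_tendsto(1)[OF V _ z y VD approximates_p_bounded[OF V _ z] y]) auto
  ultimately have "(\<lambda>n. Re (shift 1 (V n) (V n))) \<longlonglongrightarrow> Re 0" by (intro tendsto_Re) simp
  moreover have "(\<lambda>n. (l2_norm M (V n))\<^sup>2) \<longlonglongrightarrow> (l2_norm M y)\<^sup>2"
    by (intro tendsto_power l2_tendsto_norm[OF y(2) memL2[OF VD] y(1)])
  ultimately have "(l2_norm M y)\<^sup>2 \<le> Re 0"
    by (intro LIMSEQ_le) (use p_nonneg[OF VD] in \<open>auto simp: Re_shift\<close>)
  then have y0: "l2_norm M y = 0" by simp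
  let ?G = "\<lambda>\<omega>. - (z \<omega> - complex_of_real 1 * y \<omega>)"
  have "(y, ?G) \<in> semigroup_generator M S" unfolding gen
    by (intro CollectI exI[of _ y] exI[of _ "\<lambda>\<omega>. z \<omega> - complex_of_real 1 * y \<omega>"] conjI refl yA)
  then have GL: "?G \<in> L2 M" and Glim: "((\<lambda>h. l2_norm M (\<lambda>x. (S h y x - y x) / complex_of_real h - ?G x)) \<longlongrightarrow> 0) (at_right 0)"
    by (auto simp: semigroup_generator_def l2_tendsto_def)
  \<comment> \<open>y and S h y are both null, so the difference quotient is null for every h > 0
    and the distance to ?G does not depend on h; convergence to ?G then forces ?G to be
    null.\<close>
  have "l2_norm M (\<lambda>x. (S h y x - y x) / complex_of_real h - ?G x) = l2_norm M ?G" if h: "0 < h" for h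
  proof -
    obtain C where C: "\<forall>u\<in>L2 M. l2_norm M (S h u) \<le> C * l2_norm M u" using S.S_bounded[of h] h by auto
    have "l2_norm M (S h y) \<le> C * l2_norm M y" by (rule bspec[OF C y(1)])
    then have "l2_norm M (S h y) \<le> 0" using y0 by simp
    then have "l2_norm M (S h y) = 0" using l2_norm_nonneg[of M "S h y"] by linarith
    then have "AE x in M. S h y x = 0" using l2_norm_eq_0_iff[OF S.S_L2[OF less_imp_le[OF h] y(1)]] by simp
    moreover have "AE x in M. y x = 0" using l2_norm_eq_0_iff[OF y(1)] y0 by simp
    ultimately have ae: "AE x in M. (S h y x - y x) / complex_of_real h - ?G x = - ?G x" by eventually_elim simp
    have "(\<lambda>x. (1 / complex_of_real h) * (S h y x - y x) - ?G x) \<in> L2 M"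
      using h by (intro L2_diff[OF L2_cmult[OF L2_diff[OF S.S_L2 y(1)]] GL] y) auto
    then have "(\<lambda>x. (S h y x - y x) / complex_of_real h - ?G x) \<in> L2 M" by simp
    then have "l2_norm M (\<lambda>x. (S h y x - y x) / complex_of_real h - ?G x) = l2_norm M (\<lambda>x. (-1) * ?G x)"
      using ae by (intro l2_norm_cong_AE L2_measurable L2_cmult GL) auto
    also have "\<dots> = l2_norm M ?G" unfolding l2_norm_cmult by simp
    finally show ?thesis .
  qed
  then have "\<forall>\<^sub>F h in at_right 0. l2_norm M (\<lambda>x. (S h y x - y x) / complex_of_real h - ?G x) = l2_norm M ?G"
    using eventually_at_right_less[of 0] by (auto elim: eventually_mono)
  then have "((\<lambda>h. l2_norm M (\<lambda>x. (S h y x - y x) / complex_of_real h - ?G x)) \<longlongrightarrow> l2_norm M ?G) (at_right 0)"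
    by (rule tendsto_eventually)
  then have "l2_norm M ?G = 0" using Glim by (intro tendsto_unique[of "at_right (0::real)"]) auto
  then have "AE \<omega> in M. ?G \<omega> = 0" using l2_norm_eq_0_iff[OF GL] by simp
  moreover have "AE \<omega> in M. y \<omega> = 0" using l2_norm_eq_0_iff[OF y(1)] y0 by simp
  ultimately have "AE \<omega> in M. x \<omega> = u \<omega>" by eventually_elim (simp add: z_def)
  then have lim: "l2_tendsto M U u sequentially"
    by (rule l2_tendsto_cong_AE[OF x(2) Z.memL2[OF UD] x(1) u])
  have "\<forall>n. \<exists>f. (U n, f) \<in> form_operator M D a" using UD by (auto simp: D0_def)
  from choice[OF this] obtain f where f: "\<And>n. (U n, f n) \<in> form_operator M D a" by blast
  show ?thesis
  proof (rule that[of U "\<lambda>n \<omega>. - f n \<omega>", OF _ lim])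
    show "(U n, \<lambda>\<omega>. - f n \<omega>) \<in> semigroup_generator M S" for n
      unfolding gen by (intro CollectI exI[of _ "U n"] exI[of _ "f n"] conjI refl f)
  qed
qed

end

section \<open>Polynomial weights and conservation of mass\<close>

text \<open>Bounded logarithmic gradient. Products add the constants, powers multiply them, and
  reciprocals keep them, so weights built from the bracket are handled without computing
  derivatives.\<close>

definition log_bounded :: "(real^'d::finite \<Rightarrow> complex) \<Rightarrow> real \<Rightarrow> bool" where
  "log_bounded f C \<longleftrightarrow> smooth f \<and> (\<forall>i x. cmod (partial_deriv i f x) \<le> C * cmod (f x))"

lemma log_bounded_mult:
  assumes "log_bounded f C" "log_bounded g C'"
  shows "log_bounded (\<lambda>x. f x * g x) (C + C')"
  unfolding log_bounded_def
proof (intro conjI allI)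
  have s: "smooth f" "smooth g" using assms by (auto simp: log_bounded_def)
  show "smooth (\<lambda>x. f x * g x)" by (rule smooth_mult[OF s])
  fix i x
  have "cmod (partial_deriv i (\<lambda>x. f x * g x) x) \<le> cmod (partial_deriv i f x) * cmod (g x) + cmod (f x) * cmod (partial_deriv i g x)"
    unfolding partial_deriv_mult[OF smooth_differentiable[OF s(1)] smooth_differentiable[OF s(2)]]
    by (rule order_trans[OF norm_triangle_ineq]) (simp add: norm_mult)
  also have "\<dots> \<le> (C * cmod (f x)) * cmod (g x) + cmod (f x) * (C' * cmod (g x))"
    by (rule add_mono; (rule mult_right_mono | rule mult_left_mono)) (use assms in \<open>auto simp: log_bounded_def\<close>)
  also have "\<dots> = (C + C') * cmod (f x * g x)" by (simp add: norm_mult algebra_simps)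
  finally show "cmod (partial_deriv i (\<lambda>x. f x * g x) x) \<le> (C + C') * cmod (f x * g x)" .
qed

lemma log_bounded_power: "log_bounded f C \<Longrightarrow> log_bounded (\<lambda>x. f x ^ n) (real n * C)"
proof (induction n)
  case 0
  then show ?case by (simp add: log_bounded_def smooth_const partial_deriv_const)
next
  case (Suc n)
  show ?case using log_bounded_mult[OF Suc.prems Suc.IH[OF Suc.prems]] by (simp add: algebra_simps)
qed

lemma log_bounded_inverse:
  assumes "log_bounded f C" "\<And>x. f x \<noteq> 0"
  shows "log_bounded (\<lambda>x. inverse (f x)) C"
  unfolding log_bounded_def
proof (intro conjI allI)
  have s: "smooth f" using assms by (auto simp: log_bounded_def)
  show "smooth (\<lambda>x. inverse (f x))" by (rule smooth_inverse[OF s assms(2)])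
  fix i x
  have "cmod (partial_deriv i (\<lambda>x. inverse (f x)) x) = cmod (inverse (f x)) * cmod (partial_deriv i f x) * cmod (inverse (f x))"
    unfolding partial_deriv_inverse[OF smooth_differentiable[OF s] assms(2)] by (simp add: norm_mult)
  also have "\<dots> \<le> cmod (inverse (f x)) * (C * cmod (f x)) * cmod (inverse (f x))"
    by (intro mult_right_mono mult_left_mono) (use assms in \<open>auto simp: log_bounded_def\<close>)
  also have "\<dots> = C * cmod (inverse (f x))" using assms(2)[of x] by (simp add: norm_inverse norm_divide field_simps)
  finally show "cmod (partial_deriv i (\<lambda>x. inverse (f x)) x) \<le> C * cmod (inverse (f x))" .
qed

definition bracket :: "real \<Rightarrow> real^'d::finite \<Rightarrow> real" where
  "bracket \<delta> x = 1 + \<delta>\<^sup>2 * (norm x)\<^sup>2"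

lemma bracket_ge_1: "1 \<le> bracket \<delta> x"
  by (simp add: bracket_def)

lemma bracket_pos: "0 < bracket \<delta> x"
  using bracket_ge_1[of \<delta> x] by linarith

lemma bracket_neq_0 [simp]: "bracket \<delta> x \<noteq> 0"
  using bracket_pos[of \<delta> x] by simp

text \<open>With t = \<delta> |x| this is 2 t \<le> 1 + t^2; the surviving factor \<delta> is the
  source of the small constant in part (b).\<close>

lemma log_bounded_bracket:
  assumes "0 \<le> \<delta>"
  shows "log_bounded (\<lambda>x :: real^'d::finite. complex_of_real (bracket \<delta> x)) \<delta>"
  unfolding log_bounded_def
proof (intro conjI allI)
  have "smooth (\<lambda>x :: real^'d. 1 + complex_of_real (\<delta>\<^sup>2) * complex_of_real ((norm (x - 0))\<^sup>2))"
    by (intro smooth_add smooth_mult smooth_const smooth_dist_sq)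
  then show "smooth (\<lambda>x :: real^'d. complex_of_real (bracket \<delta> x))" by (simp add: bracket_def)
  fix i and x :: "real^'d"
  have "((\<lambda>x :: real^'d. 1 + \<delta>\<^sup>2 * (x \<bullet> x)) has_derivative (\<lambda>h. 0 + \<delta>\<^sup>2 * (x \<bullet> h + h \<bullet> x))) (at x)"
    by (intro has_derivative_add has_derivative_const has_derivative_mult_right has_derivative_inner has_derivative_ident)
  then have "((\<lambda>x :: real^'d. complex_of_real (bracket \<delta> x)) has_derivative (\<lambda>h. complex_of_real (0 + \<delta>\<^sup>2 * (x \<bullet> h + h \<bullet> x)))) (at x)"
    unfolding bracket_def power2_norm_eq_inner by (rule has_derivative_of_real)
  from partial_deriv_eqI[OF this]
  have "partial_deriv i (\<lambda>x :: real^'d. complex_of_real (bracket \<delta> x)) x = complex_of_real (2 * \<delta>\<^sup>2 * x $ i)"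
    by (simp add: inner_axis inner_commute[of _ x])
  then have "cmod (partial_deriv i (\<lambda>x :: real^'d. complex_of_real (bracket \<delta> x)) x) = 2 * \<delta>\<^sup>2 * \<bar>x $ i\<bar>"
    by (simp only: norm_of_real abs_mult) simp
  also have "\<dots> \<le> 2 * \<delta>\<^sup>2 * norm x" by (intro mult_left_mono component_le_norm_cart) simp
  also have "\<dots> = \<delta> * (2 * 1 * (\<delta> * norm x))" by (simp add: power2_eq_square)
  also have "\<dots> \<le> \<delta> * (1\<^sup>2 + (\<delta> * norm x)\<^sup>2)" by (intro mult_left_mono sum_squares_bound assms)
  also have "\<dots> = \<delta> * cmod (complex_of_real (bracket \<delta> x))"
    unfolding norm_of_real using bracket_pos[of \<delta> x] by (simp add: bracket_def power_mult_distrib)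
  finally show "cmod (partial_deriv i (\<lambda>x :: real^'d. complex_of_real (bracket \<delta> x)) x) \<le> \<delta> * cmod (complex_of_real (bracket \<delta> x))" .
qed

text \<open>A point with n \<le> |x| < n + 1 lies in the ball of radius n + 1, where the value of
  the function at the point is at most c n. Summing c n times the ball volumes replaces polar
  coordinates.\<close>

lemma integrable_bracket_power:
  "integrable lebesgue (\<lambda>x :: real^'d::finite. inverse (bracket 1 x) ^ (2 * CARD('d)))"
proof -
  define m where "m = CARD('d)"
  have m: "1 \<le> m" unfolding m_def by (simp add: Suc_leI)
  let ?f = "\<lambda>x :: real^'d. inverse (bracket 1 x) ^ (2 * m)"
  define c where "c n = inverse (1 + (real n)\<^sup>2) ^ (2 * m)" for n :: nat
  define V where "V = unit_ball_vol (real m)"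
  have V: "0 \<le> V" by (simp add: V_def)
  have fpos: "0 \<le> ?f x" for x using bracket_pos[of 1 x] by simp
  have cont: "continuous_on UNIV ?f"
    by (intro continuous_intros) (auto simp: bracket_def add_nonneg_eq_0_iff intro!: continuous_intros)
  then have meas: "?f \<in> borel_measurable borel" by (rule borel_measurable_continuous_onI)
  have le: "ennreal (?f x) \<le> (\<Sum>n. ennreal (c n) * indicator (cball 0 (real n + 1)) x)" for x :: "real^'d"
  proof -
    define n where "n = nat \<lfloor>norm x\<rfloor>"
    have n: "real n \<le> norm x" "norm x \<le> real n + 1" unfolding n_def using norm_ge_zero[of x] by linarith+
    have "inverse (bracket 1 x) \<le> inverse (1 + (real n)\<^sup>2)"
      using n(1) by (intro le_imp_inverse_le) (auto simp: bracket_def add_pos_nonneg intro: power_mono)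
    then have "?f x \<le> c n" unfolding c_def using bracket_pos[of 1 x] by (intro power_mono) auto
    then have "ennreal (?f x) \<le> ennreal (c n) * indicator (cball 0 (real n + 1)) x"
      using n(2) by (simp add: ennreal_leI)
    also have "\<dots> \<le> (\<Sum>n. ennreal (c n) * indicator (cball 0 (real n + 1)) x)"
      by (rule ennreal_term_le_suminf[of "\<lambda>n. ennreal (c n) * indicator (cball 0 (real n + 1)) x" n])
    finally show ?thesis .
  qed
  have "(\<integral>\<^sup>+x. ennreal (?f x) \<partial>lborel) \<le> (\<integral>\<^sup>+x. (\<Sum>n. ennreal (c n) * indicator (cball 0 (real n + 1)) (x :: real^'d)) \<partial>lborel)"
    by (intro nn_integral_mono le)
  also have "\<dots> = (\<Sum>n. \<integral>\<^sup>+x. ennreal (c n) * indicator (cball 0 (real n + 1)) (x :: real^'d) \<partial>lborel)"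
    by (rule nn_integral_suminf) (intro borel_measurable_times_ennreal borel_measurable_const borel_measurable_indicator, simp)
  also have "\<dots> = (\<Sum>n. ennreal (c n * (V * (real n + 1) ^ m)))"
  proof (rule arg_cong[where f=suminf], rule ext)
    fix n
    have "(\<integral>\<^sup>+x. ennreal (c n) * indicator (cball 0 (real n + 1)) (x :: real^'d) \<partial>lborel) = ennreal (c n) * emeasure lborel (cball (0::real^'d) (real n + 1))"
      by (rule nn_integral_cmult_indicator) simp
    also have "emeasure lborel (cball (0::real^'d) (real n + 1)) = ennreal (V * (real n + 1) ^ m)"
      by (subst emeasure_cball) (simp_all add: V_def m_def)
    also have "ennreal (c n) * ennreal (V * (real n + 1) ^ m) = ennreal (c n * (V * (real n + 1) ^ m))"
      using V by (intro ennreal_mult[symmetric]) (auto simp: c_def)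
    finally show "(\<integral>\<^sup>+x. ennreal (c n) * indicator (cball 0 (real n + 1)) (x :: real^'d) \<partial>lborel) = ennreal (c n * (V * (real n + 1) ^ m))" .
  qed
  also have "\<dots> \<le> (\<Sum>n. ennreal (2 * V * inverse ((real (Suc n))\<^sup>2)))"
  proof (rule suminf_le)
    fix n :: nat
    \<comment> \<open>n + 1 \<le> 1 + n^2 lets m of the 2m inverse factors absorb the volume growth;
      the m that remain are at least one, enough for comparison with 1/(n+1)^2.\<close>
    define r where "r = 1 + (real n)\<^sup>2"
    have r: "1 \<le> r" by (simp add: r_def)
    have nr: "real n + 1 \<le> r" unfolding r_def by (cases n) (auto simp: power2_eq_square)
    have "c n * (V * (real n + 1) ^ m) \<le> inverse r ^ (2 * m) * (V * r ^ m)"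
      unfolding c_def r_def[symmetric] using r nr V by (intro mult_left_mono power_mono) auto
    also have "\<dots> = V * inverse r ^ m"
      using r by (simp add: mult_2 power_add power_inverse)
    also have "\<dots> \<le> V * inverse r ^ 1"
      using r V m by (intro mult_left_mono power_decreasing) (auto simp: inverse_le_1_iff)
    also have "\<dots> \<le> V * (2 * inverse ((real (Suc n))\<^sup>2))"
    proof (rule mult_left_mono[OF _ V])
      have "(real (Suc n))\<^sup>2 \<le> 2 * r" unfolding r_def using sum_squares_bound[of "real n" 1] by (simp add: power2_sum)
      then show "inverse r ^ 1 \<le> 2 * inverse ((real (Suc n))\<^sup>2)" using r by (simp add: field_simps)
    qed
    finally show "ennreal (c n * (V * (real n + 1) ^ m)) \<le> ennreal (2 * V * inverse ((real (Suc n))\<^sup>2))"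
      by (intro ennreal_leI) (simp add: mult_ac)
  qed auto
  also have "\<dots> < \<infinity>"
  proof -
    have "summable (\<lambda>n. inverse ((real n)\<^sup>2))" by (rule inverse_power_summable) simp
    then have "summable (\<lambda>n. inverse ((real (Suc n))\<^sup>2))" by (subst summable_Suc_iff)
    then have "summable (\<lambda>n. 2 * V * inverse ((real (Suc n))\<^sup>2))" by (rule summable_mult)
    then show ?thesis using V by (subst suminf_ennreal2) auto
  qed
  finally have "(\<integral>\<^sup>+x. ennreal (?f x) \<partial>lborel) < \<infinity>" .
  then have "integrable lborel ?f"
    using meas fpos by (intro integrableI_bounded) auto
  then show ?thesis using meas unfolding m_def by (simp add: integrable_completion)
qed

section \<open>The two weights and the weighted energy estimate\<close>

context elliptic
begin

definition test_weight :: "real \<Rightarrow> real^'d \<Rightarrow> real" where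
  "test_weight \<delta> x = inverse (bracket \<delta> x) ^ CARD('d)"

text \<open>Increases to (1 + |x|^2)^(2d) as \<delta> tends to 0, yet is bounded for each \<delta> >
  0; the truncation at infinity is by a quotient so that the logarithmic gradient stays bounded
  uniformly.\<close>

definition growth_weight :: "real \<Rightarrow> real^'d \<Rightarrow> real" where
  "growth_weight \<delta> x = (bracket 1 x * inverse (bracket \<delta> x)) ^ (2 * CARD('d))"

lemma test_weight_bounds: "0 < test_weight \<delta> x" "test_weight \<delta> x \<le> 1"
  using bracket_ge_1[of \<delta> x] by (auto simp: test_weight_def power_le_one inverse_le_1_iff bracket_pos)

lemma growth_weight_nonneg: "0 \<le> growth_weight \<delta> x"
  by (simp add: growth_weight_def)

lemma sqrt_growth_weight: "sqrt (growth_weight \<delta> x) = (bracket 1 x * inverse (bracket \<delta> x)) ^ CARD('d)"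
proof -
  have "growth_weight \<delta> x = ((bracket 1 x * inverse (bracket \<delta> x)) ^ CARD('d))\<^sup>2"
    by (simp only: growth_weight_def power_mult[symmetric] mult.commute[of 2])
  then show ?thesis using bracket_pos[of 1 x] bracket_pos[of \<delta> x] by simp
qed

text \<open>The weights are tuned so that \<open>\<bar>\<nabla>\<phi>\<bar> \<le> m \<delta> \<phi> = m \<delta> \<sigma>\<^sup>1\<^sup>/\<^sup>2 \<omega>\<close> with a square integrable
  \<open>\<omega>\<close> independent of \<open>\<delta>\<close>.\<close>

lemma test_weight_eq: "test_weight \<delta> x = sqrt (growth_weight \<delta> x) * test_weight 1 x"
proof -
  have "(bracket 1 x * inverse (bracket \<delta> x)) * inverse (bracket 1 x) = inverse (bracket \<delta> x)"
    using bracket_pos[of 1 x] by simp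
  then show ?thesis unfolding sqrt_growth_weight test_weight_def by (simp only: power_mult_distrib[symmetric])
qed

lemma log_bounded_test_weight:
  assumes "0 \<le> \<delta>"
  shows "log_bounded (\<lambda>x. complex_of_real (test_weight \<delta> x)) (real CARD('d) * \<delta>)"
proof -
  have "log_bounded (\<lambda>x. inverse (complex_of_real (bracket \<delta> x)) ^ CARD('d)) (real CARD('d) * \<delta>)"
    by (intro log_bounded_power log_bounded_inverse log_bounded_bracket assms)
       simp
  then show ?thesis by (simp add: test_weight_def)
qed

text \<open>The quotient has logarithmic constant 1 + \<delta> \<le> 2 and is raised to the power
  2d, which gives 4d for all admissible \<delta>.\<close>

lemma log_bounded_growth_weight:
  assumes "0 \<le> \<delta>" "\<delta> \<le> 1"
  shows "smooth (\<lambda>x. complex_of_real (growth_weight \<delta> x))"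
    and "cmod (partial_deriv i (\<lambda>x. complex_of_real (growth_weight \<delta> x)) x) \<le> 4 * real CARD('d) * growth_weight \<delta> x"
proof -
  have "log_bounded (\<lambda>x. (complex_of_real (bracket 1 x) * inverse (complex_of_real (bracket \<delta> x))) ^ (2 * CARD('d))) (real (2 * CARD('d)) * (1 + \<delta>))"
    by (intro log_bounded_power log_bounded_mult log_bounded_inverse log_bounded_bracket assms)
       simp_all
  then have lb: "log_bounded (\<lambda>x. complex_of_real (growth_weight \<delta> x)) (real (2 * CARD('d)) * (1 + \<delta>))"
    by (simp add: growth_weight_def)
  then show "smooth (\<lambda>x. complex_of_real (growth_weight \<delta> x))" by (simp add: log_bounded_def)
  have "cmod (partial_deriv i (\<lambda>x. complex_of_real (growth_weight \<delta> x)) x) \<le> (real (2 * CARD('d)) * (1 + \<delta>)) * cmod (complex_of_real (growth_weight \<delta> x))"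
    using lb unfolding log_bounded_def by blast
  also have "\<dots> = (real (2 * CARD('d)) * (1 + \<delta>)) * growth_weight \<delta> x"
    using growth_weight_nonneg by simp
  also have "\<dots> \<le> (real (2 * CARD('d)) * 2) * growth_weight \<delta> x"
    using assms growth_weight_nonneg by (intro mult_right_mono mult_left_mono) auto
  finally show "cmod (partial_deriv i (\<lambda>x. complex_of_real (growth_weight \<delta> x)) x) \<le> 4 * real CARD('d) * growth_weight \<delta> x" by simp
qed

lemma growth_weight_bound:
  assumes "0 < \<delta>" "\<delta> \<le> 1"
  shows "growth_weight \<delta> x \<le> inverse (\<delta>\<^sup>2) ^ (2 * CARD('d))"
proof -
  have d1: "\<delta>\<^sup>2 \<le> 1" using assms by (simp add: power_le_one)
  have "\<delta>\<^sup>2 * bracket 1 x \<le> bracket \<delta> x" using d1 by (simp add: bracket_def algebra_simps)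
  then have "bracket 1 x * inverse (bracket \<delta> x) \<le> inverse (\<delta>\<^sup>2)"
    using bracket_pos[of \<delta> x] assms by (simp add: field_simps)
  then show ?thesis unfolding growth_weight_def
    using bracket_pos[of 1 x] bracket_pos[of \<delta> x] by (intro power_mono) auto
qed

lemma test_weight_L2_1: "(\<lambda>x. complex_of_real (test_weight 1 x)) \<in> L2 M"
proof -
  have sq: "(cmod (complex_of_real (test_weight 1 x)))\<^sup>2 = inverse (bracket 1 x) ^ (2 * CARD('d))" for x
    using test_weight_bounds(1)[of 1 x] using bracket_pos[of 1 x] by (simp add: test_weight_def norm_power norm_inverse power_mult[symmetric] mult.commute)
  have "integrable M (\<lambda>x. inverse (bracket 1 x) ^ (2 * CARD('d)))"
    using integrable_mult_indicator[OF dom_sets integrable_bracket_power] dom_sets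
    by (subst integrable_restrict_space) auto
  moreover have "(\<lambda>x. complex_of_real (test_weight 1 x)) \<in> borel_measurable M"
    using log_bounded_test_weight[of 1] unfolding log_bounded_def
    by (intro continuous_measurable_lebesgue_on smooth_continuous dom_sets) simp
  ultimately show ?thesis unfolding L2_def by (simp only: sq mem_Collect_eq)
qed

definition mass_const :: real where
  "mass_const = (LINT x|M. (test_weight 1 x)\<^sup>2)"

lemma mass_integrable: "integrable M (\<lambda>x. (test_weight 1 x)\<^sup>2)"
proof -
  have eq: "(\<lambda>x. (cmod (complex_of_real (test_weight 1 x)))\<^sup>2) = (\<lambda>x. (test_weight 1 x)\<^sup>2)" by simp
  show ?thesis using L2_square_integrable[OF test_weight_L2_1] unfolding eq .
qed

lemma mass_const_nonneg: "0 \<le> mass_const"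
  unfolding mass_const_def by (intro integral_nonneg_AE) simp

lemma test_weight_H1:
  assumes \<delta>: "0 < \<delta>" "\<delta> \<le> 1"
  shows "(\<lambda>x. complex_of_real (test_weight \<delta> x)) \<in> H1 \<Omega>"
    and "AE x in M. grad (\<lambda>x. complex_of_real (test_weight \<delta> x)) x = (\<lambda>i. partial_deriv i (\<lambda>x. complex_of_real (test_weight \<delta> x)) x)"
proof -
  let ?\<phi> = "\<lambda>x. complex_of_real (test_weight \<delta> x)"
  have lb: "log_bounded ?\<phi> (real CARD('d) * \<delta>)" by (rule log_bounded_test_weight) (use \<delta> in simp)
  then have sm: "smooth ?\<phi>" by (simp add: log_bounded_def)
  \<comment> \<open>Finite because \<delta> > 0; it dominates the test weight and its derivatives by
    the square integrable weight at \<delta> = 1. No uniformity in \<delta> is claimed here.\<close>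
  define C where "C = sqrt (inverse (\<delta>\<^sup>2) ^ (2 * CARD('d)))"
  have dom: "test_weight \<delta> x \<le> C * test_weight 1 x" for x
    unfolding test_weight_eq[of \<delta> x] C_def
    by (intro mult_right_mono real_sqrt_le_mono growth_weight_bound \<delta> less_imp_le[OF test_weight_bounds(1)])
  have C0: "0 \<le> C" by (simp add: C_def)
  have L2I: "f \<in> L2 M" if f: "smooth f" "\<And>x. cmod (f x) \<le> K * test_weight 1 x" for f K
  proof -
    have "f x = (f x / complex_of_real (test_weight 1 x)) * complex_of_real (test_weight 1 x)" for x
      using test_weight_bounds(1)[of 1 x] by simp
    moreover have "(\<lambda>x. (f x / complex_of_real (test_weight 1 x)) * complex_of_real (test_weight 1 x)) \<in> L2 M"
    proof (rule L2_mult_bounded[OF test_weight_L2_1])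
      show "(\<lambda>x. f x / complex_of_real (test_weight 1 x)) \<in> borel_measurable M"
        using L2_measurable[OF test_weight_L2_1] continuous_measurable_lebesgue_on[OF smooth_continuous[OF f(1)] dom_sets]
        by (intro borel_measurable_divide)
      show "AE x in M. cmod (f x / complex_of_real (test_weight 1 x)) \<le> K"
      proof (rule AE_I2)
        fix x
        show "cmod (f x / complex_of_real (test_weight 1 x)) \<le> K"
          using f(2)[of x] test_weight_bounds(1)[of 1 x] by (simp add: norm_divide pos_divide_le_eq)
      qed
    qed
    ultimately show ?thesis by simp
  qed
  have L2a: "?\<phi> \<in> L2 M" by (rule L2I[OF sm, of C]) (use dom test_weight_bounds(1) in \<open>simp add: less_imp_le\<close>)
  have L2b: "partial_deriv i ?\<phi> \<in> L2 M" for i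
  proof (rule L2I[OF smooth_partial_deriv[OF sm]])
    fix x
    have "cmod (partial_deriv i ?\<phi> x) \<le> real CARD('d) * \<delta> * cmod (?\<phi> x)" using lb by (simp add: log_bounded_def)
    also have "\<dots> = real CARD('d) * \<delta> * test_weight \<delta> x" using test_weight_bounds(1)[of \<delta> x] by simp
    also have "\<dots> \<le> real CARD('d) * \<delta> * (C * test_weight 1 x)" by (intro mult_left_mono dom) (use \<delta> in simp)
    finally show "cmod (partial_deriv i ?\<phi> x) \<le> (real CARD('d) * \<delta> * C) * test_weight 1 x" by simp
  qed
  show "?\<phi> \<in> H1 \<Omega>" by (rule H1_smooth(1)[OF sm L2a L2b])
  have "AE x in M. \<forall>i. weak_partial \<Omega> i ?\<phi> x = partial_deriv i ?\<phi> x"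
    by (intro AE_all_index H1_smooth(2)[OF sm L2a L2b])
  then show "AE x in M. grad ?\<phi> x = (\<lambda>i. partial_deriv i ?\<phi> x)" by eventually_elim (auto simp: grad_def)
qed

text \<open>The gradient of the test weight is at most d \<delta> times the weight; splitting the
  weight as in \<open>test_weight_eq\<close> pairs its growing factor with the energy and leaves a
  fixed square integrable one. The prefactor is linear in \<delta>.\<close>

lemma form_test_weight_bound:
  assumes \<delta>: "0 < \<delta>" "\<delta> \<le> 1" and u: "u \<in> H1 \<Omega>" and int: "integrable M (\<lambda>x. growth_weight \<delta> x * energy u x)"
  shows "cmod (elliptic_form \<Omega> a u (\<lambda>x. complex_of_real (test_weight \<delta> x)))
    \<le> (\<kappa> * sqrt N * (real CARD('d) * \<delta>)) / 2 * ((LINT x|M. growth_weight \<delta> x * energy u x) + mass_const)"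
proof -
  let ?\<phi> = "\<lambda>x. complex_of_real (test_weight \<delta> x)"
  let ?k = "\<kappa> * sqrt N * (real CARD('d) * \<delta>)"
  have phi: "?\<phi> \<in> H1 \<Omega>" by (rule test_weight_H1(1)[OF \<delta>])
  have k0: "0 \<le> ?k" using kappa_nonneg N_nonneg \<delta> by simp
  have lb: "log_bounded ?\<phi> (real CARD('d) * \<delta>)" by (rule log_bounded_test_weight) (use \<delta> in simp)
  have "cmod (elliptic_form \<Omega> a u ?\<phi>) \<le> (LINT x|M. cmod (Q x (grad u x) (grad ?\<phi> x)))"
    unfolding elliptic_form_eq[OF u phi] by (rule integral_norm_bound)
  also have "\<dots> \<le> (LINT x|M. ?k / 2 * (growth_weight \<delta> x * energy u x + (test_weight 1 x)\<^sup>2))"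
  proof (rule integral_mono_AE)
    show "integrable M (\<lambda>x. cmod (Q x (grad u x) (grad ?\<phi> x)))"
      by (intro integrable_norm Q_integrable grad_L2 u phi)
    show "integrable M (\<lambda>x. ?k / 2 * (growth_weight \<delta> x * energy u x + (test_weight 1 x)\<^sup>2))"
      by (intro integrable_mult_right Bochner_Integration.integrable_add int mass_integrable)
    show "AE x in M. cmod (Q x (grad u x) (grad ?\<phi> x)) \<le> ?k / 2 * (growth_weight \<delta> x * energy u x + (test_weight 1 x)\<^sup>2)"
      using test_weight_H1(2)[OF \<delta>] AE_good
    proof eventually_elim
      fix x assume g: "grad ?\<phi> x = (\<lambda>i. partial_deriv i ?\<phi> x)" and good: "good x"
      let ?h = "\<lambda>i. partial_deriv i ?\<phi> x"
      define e where "e = energy u x"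
      define \<sigma> where "\<sigma> = growth_weight \<delta> x"
      define \<omega> where "\<omega> = test_weight 1 x"
      have e: "0 \<le> e" "0 \<le> \<sigma>" "0 \<le> \<omega>"
        unfolding e_def \<sigma>_def \<omega>_def using energy_nonneg[OF good] growth_weight_nonneg test_weight_bounds(1)[of 1 x] by auto
      have "cmod (?h i) \<le> (real CARD('d) * \<delta>) * test_weight \<delta> x" for i
      proof -
        have "cmod (?h i) \<le> (real CARD('d) * \<delta>) * cmod (?\<phi> x)" using lb by (simp add: log_bounded_def)
        then show ?thesis using test_weight_bounds(1)[of \<delta> x] by simp
      qed
      then have "Re (Q x ?h ?h) \<le> N * ((real CARD('d) * \<delta>) * test_weight \<delta> x)\<^sup>2" by (rule Q_le[OF good])
      then have "sqrt (Re (Q x ?h ?h)) \<le> sqrt (N * ((real CARD('d) * \<delta>) * test_weight \<delta> x)\<^sup>2)" by (rule real_sqrt_le_mono)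
      also have "\<dots> = sqrt N * ((real CARD('d) * \<delta>) * test_weight \<delta> x)"
        using \<delta> test_weight_bounds(1)[of \<delta> x] by (simp add: real_sqrt_mult)
      finally have h: "sqrt (Re (Q x ?h ?h)) \<le> sqrt N * ((real CARD('d) * \<delta>) * test_weight \<delta> x)" .
      have "cmod (Q x (grad u x) ?h) \<le> \<kappa> * (sqrt e * sqrt (Re (Q x ?h ?h)))"
        unfolding e_def energy_def by (rule Q_bound[OF good])
      also have "\<dots> \<le> \<kappa> * (sqrt e * (sqrt N * ((real CARD('d) * \<delta>) * test_weight \<delta> x)))"
        using e kappa_nonneg by (intro mult_left_mono h) auto
      also have "\<dots> = ?k / 2 * (2 * (sqrt \<sigma> * sqrt e) * \<omega>)"
        unfolding test_weight_eq[of \<delta> x] \<sigma>_def[symmetric] \<omega>_def[symmetric] by simp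
      also have "\<dots> \<le> ?k / 2 * ((sqrt \<sigma> * sqrt e)\<^sup>2 + \<omega>\<^sup>2)"
        using k0 by (intro mult_left_mono sum_squares_bound) simp
      also have "(sqrt \<sigma> * sqrt e)\<^sup>2 = \<sigma> * e" using e by (simp add: power_mult_distrib)
      finally show "cmod (Q x (grad u x) (grad ?\<phi> x)) \<le> ?k / 2 * (growth_weight \<delta> x * energy u x + (test_weight 1 x)\<^sup>2)"
        unfolding g e_def \<sigma>_def \<omega>_def .
    qed
  qed
  also have "\<dots> = ?k / 2 * ((LINT x|M. growth_weight \<delta> x * energy u x) + mass_const)"
    unfolding mass_const_def using int mass_integrable by simp
  finally show ?thesis .
qed

text \<open>Half of the Caccioppoli factor \<kappa>^2 N times (4d)^2, the latter from the choice s =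
  4 d sqrt \<sigma>; the half comes from the factor 2 in front of the form.\<close>

definition decay_const :: real where
  "decay_const = \<kappa>\<^sup>2 * N * (4 * real CARD('d))\<^sup>2 / 2"

lemma decay_const_nonneg: "0 \<le> decay_const"
  unfolding decay_const_def using N_nonneg by simp

text \<open>x itself has no gradient, so the Caccioppoli estimate and the bound against the test
  weight are applied to approximate solutions. The energies themselves need not converge; only their
  upper bounds do.\<close>

lemma form_operator_weighted:
  assumes \<delta>: "0 < \<delta>" "\<delta> \<le> 1" and xf: "(x, f) \<in> form_operator M (H1 \<Omega>) (elliptic_form \<Omega> a)"
  defines "R \<equiv> Re (l2_inner M f (\<lambda>y. complex_of_real (growth_weight \<delta> y) * x y))"
  shows "0 \<le> R + decay_const * weight_sq M (growth_weight \<delta>) x"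
    and "cmod (l2_inner M f (\<lambda>y. complex_of_real (test_weight \<delta> y)))
      \<le> \<kappa> * sqrt N * (real CARD('d) * \<delta>) * (R + decay_const * weight_sq M (growth_weight \<delta>) x + mass_const / 2)"
proof -
  let ?\<sigma> = "growth_weight \<delta>"
  let ?c\<sigma> = "\<lambda>y. complex_of_real (growth_weight \<delta> y)"
  let ?\<phi> = "\<lambda>x. complex_of_real (test_weight \<delta> x)"
  let ?k = "\<kappa> * sqrt N * (real CARD('d) * \<delta>)"
  \<comment> \<open>Forced by |D_i \<sigma>| \<le> 4 d \<sigma> = sqrt \<sigma> * s.\<close>
  define s where "s y = 4 * real CARD('d) * sqrt (?\<sigma> y)" for y
  \<comment> \<open>One bound for both the weight and its derivatives; it depends on \<delta> but
    disappears in the limit.\<close>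
  define B where "B = (1 + 4 * real CARD('d)) * inverse (\<delta>\<^sup>2) ^ (2 * CARD('d))"
  have xL: "x \<in> L2 M" and fL: "f \<in> L2 M" using xf by (auto simp: form_operator_def)
  let ?g = "\<lambda>y. f y + complex_of_real 1 * x y"
  have gL: "?g \<in> L2 M" by (intro L2_add L2_cmult fL xL)
  obtain U where U: "\<And>n. F.approximates 1 ?g (1 / real (Suc n)) (U n)" "l2_tendsto M U x sequentially"
    using F.form_operator_approximable[OF xf, of 1] by auto
  note UH = F.approximates_mem[OF U(1)]
  have Up: "F.p (U n) \<le> (1 + l2_norm M ?g / sqrt 1)\<^sup>2" for n by (rule F.approximates_p_bounded[OF U(1) _ gL]) simp
  have sm: "smooth ?c\<sigma>" by (rule log_bounded_growth_weight(1)) (use \<delta> in auto)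
  have dsig: "cmod (partial_deriv i ?c\<sigma> y) \<le> 4 * real CARD('d) * ?\<sigma> y" for i y
    by (rule log_bounded_growth_weight(2)) (use \<delta> in auto)
  have b0: "?\<sigma> y \<le> inverse (\<delta>\<^sup>2) ^ (2 * CARD('d))" for y by (rule growth_weight_bound[OF \<delta>])
  have Bb: "cmod (?c\<sigma> y) \<le> B" "cmod (partial_deriv i ?c\<sigma> y) \<le> B" for i y
  proof -
    have p: "0 \<le> inverse (\<delta>\<^sup>2) ^ (2 * CARD('d))" by simp
    have "1 * inverse (\<delta>\<^sup>2) ^ (2 * CARD('d)) \<le> B" unfolding B_def by (intro mult_right_mono p) simp
    then show "cmod (?c\<sigma> y) \<le> B" using b0[of y] growth_weight_nonneg[of \<delta> y] by simp
    have "4 * real CARD('d) * ?\<sigma> y \<le> 4 * real CARD('d) * inverse (\<delta>\<^sup>2) ^ (2 * CARD('d))" by (intro mult_left_mono b0) simp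
    also have "\<dots> \<le> B" unfolding B_def by (intro mult_right_mono p) simp
    finally show "cmod (partial_deriv i ?c\<sigma> y) \<le> B" using dsig[of i y] by linarith
  qed
  have sigm: "?\<sigma> \<in> borel_measurable M" by (rule of_real_smooth_measurable[OF sm])
  have smeas: "s \<in> borel_measurable M" unfolding s_def
    by (intro borel_measurable_times borel_measurable_const measurable_compose[OF sigm borel_measurable_sqrt])
  have s0: "0 \<le> s y" for y by (simp add: s_def growth_weight_nonneg)
  have sB: "s y \<le> 4 * real CARD('d) * sqrt (inverse (\<delta>\<^sup>2) ^ (2 * CARD('d)))" for y
    unfolding s_def by (intro mult_left_mono real_sqrt_le_mono b0) simp
  have ds: "cmod (partial_deriv i ?c\<sigma> y) \<le> sqrt (?\<sigma> y) * s y" for i y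
  proof -
    have "sqrt (?\<sigma> y) * s y = 4 * real CARD('d) * ?\<sigma> y"
      using growth_weight_nonneg[of \<delta> y] by (simp add: s_def)
    then show ?thesis using dsig[of i y] by simp
  qed
  note WE = weighted_energy[OF UH sm growth_weight_nonneg Bb smeas s0 sB ds]
  have csm: "(\<lambda>y. complex_of_real (s y)) \<in> borel_measurable M"
    by (rule measurable_compose[OF smeas borel_measurable_of_real])
  have sAE: "AE y in M. cmod (complex_of_real (s y)) \<le> 4 * real CARD('d) * sqrt (inverse (\<delta>\<^sup>2) ^ (2 * CARD('d)))"
    using s0 sB by (intro AE_I2) simp
  have c\<sigma>m: "?c\<sigma> \<in> borel_measurable M" by (rule continuous_measurable_lebesgue_on[OF smooth_continuous[OF sm] dom_sets])
  have c\<sigma>AE: "AE y in M. cmod (?c\<sigma> y) \<le> B" using Bb(1) by (intro AE_I2) simp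
  have snorm: "(l2_norm M (\<lambda>y. complex_of_real (s y) * x y))\<^sup>2 = (4 * real CARD('d))\<^sup>2 * weight_sq M ?\<sigma> x"
  proof -
    have "(cmod (complex_of_real (s y) * x y))\<^sup>2 = (4 * real CARD('d))\<^sup>2 * (?\<sigma> y * (cmod (x y))\<^sup>2)" for y
      using growth_weight_nonneg[of \<delta> y] s0[of y] by (simp add: norm_mult s_def power_mult_distrib)
    then show ?thesis unfolding l2_norm_sq weight_sq_eq by simp
  qed
  define E where "E n = (LINT y|M. ?\<sigma> y * energy (U n) y)" for n
  have Epos: "0 \<le> E n" for n
  proof -
    have "AE y in M. 0 \<le> ?\<sigma> y * energy (U n) y"
      using AE_good by eventually_elim (simp add: growth_weight_nonneg energy_nonneg)
    then show ?thesis unfolding E_def by (rule integral_nonneg_AE)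
  qed
  have f_eq: "(\<lambda>y. ?g y - complex_of_real 1 * x y) = f" by simp
  have "(\<lambda>n. l2_norm M (U n)) \<longlonglongrightarrow> l2_norm M x" by (rule l2_tendsto_norm[OF U(2) H1_L2[OF UH] xL])
  from convergent_imp_Bseq[OF convergentI[OF this]] obtain N0 where N0: "\<And>n. l2_norm M (U n) \<le> N0"
    unfolding Bseq_def by auto
  have lim1: "(\<lambda>n. elliptic_form \<Omega> a (U n) (\<lambda>y. ?c\<sigma> y * U n y)) \<longlonglongrightarrow> l2_inner M f (\<lambda>y. ?c\<sigma> y * x y)"
  proof -
    have "(\<lambda>n. elliptic_form \<Omega> a (U n) (\<lambda>y. ?c\<sigma> y * U n y)) \<longlonglongrightarrow> l2_inner M (\<lambda>y. ?g y - complex_of_real 1 * x y) (\<lambda>y. ?c\<sigma> y * x y)"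
    proof (rule F.approximates_tendsto(2)[OF U(1) _ gL xL U(2)])
      show "(\<lambda>y. ?c\<sigma> y * U n y) \<in> H1 \<Omega>" for n by (rule H1_mult(1)[OF UH sm Bb])
      show "F.p (\<lambda>y. ?c\<sigma> y * U n y) \<le> 2 * B\<^sup>2 * (1 + l2_norm M ?g / sqrt 1)\<^sup>2 + 2 * (N * B\<^sup>2) * N0\<^sup>2" for n
      proof -
        have "F.p (\<lambda>y. ?c\<sigma> y * U n y) \<le> 2 * B\<^sup>2 * F.p (U n) + 2 * (N * B\<^sup>2) * (l2_norm M (U n))\<^sup>2"
          by (rule mult_energy_bound[OF UH sm Bb])
        also have "\<dots> \<le> 2 * B\<^sup>2 * (1 + l2_norm M ?g / sqrt 1)\<^sup>2 + 2 * (N * B\<^sup>2) * N0\<^sup>2"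
          by (rule add_mono; rule mult_left_mono) (use Up N0 N_nonneg in \<open>auto intro: power_mono\<close>)
        finally show ?thesis .
      qed
      show "(\<lambda>y. ?c\<sigma> y * x y) \<in> L2 M" by (rule L2_mult_bounded[OF xL c\<sigma>m c\<sigma>AE])
      show "l2_tendsto M (\<lambda>n y. ?c\<sigma> y * U n y) (\<lambda>y. ?c\<sigma> y * x y) sequentially"
        by (rule l2_tendsto_mult_bounded[OF U(2) H1_L2[OF UH] xL c\<sigma>m c\<sigma>AE])
    qed simp
    then show ?thesis unfolding f_eq .
  qed
  have phiH: "?\<phi> \<in> H1 \<Omega>" by (rule test_weight_H1(1)[OF \<delta>])
  have lim2: "(\<lambda>n. elliptic_form \<Omega> a (U n) ?\<phi>) \<longlonglongrightarrow> l2_inner M f ?\<phi>"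
  proof -
    have "(\<lambda>n. elliptic_form \<Omega> a (U n) ?\<phi>) \<longlonglongrightarrow> l2_inner M (\<lambda>y. ?g y - complex_of_real 1 * x y) ?\<phi>"
      by (rule F.approximates_tendsto(2)[OF U(1) _ gL xL U(2), of "\<lambda>n. ?\<phi>" "F.p ?\<phi>" ?\<phi>])
         (use phiH H1_L2 in \<open>auto simp: l2_tendsto_def\<close>)
    then show ?thesis unfolding f_eq .
  qed
  have lim3: "(\<lambda>n. l2_norm M (\<lambda>y. complex_of_real (s y) * U n y)) \<longlonglongrightarrow> l2_norm M (\<lambda>y. complex_of_real (s y) * x y)"
    by (rule l2_tendsto_norm[OF l2_tendsto_mult_bounded[OF U(2) H1_L2[OF UH] xL csm sAE]
          L2_mult_bounded[OF H1_L2[OF UH] csm sAE] L2_mult_bounded[OF xL csm sAE]])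
  let ?E' = "\<lambda>n. 2 * Re (elliptic_form \<Omega> a (U n) (\<lambda>y. ?c\<sigma> y * U n y))
      + \<kappa>\<^sup>2 * N * (l2_norm M (\<lambda>y. complex_of_real (s y) * U n y))\<^sup>2"
  \<comment> \<open>The upper bounds for the weighted energies converge to an expression in x and f
    alone. Nonnegativity of the energies gives the first claim, the factor \<delta> in front the
    second.\<close>
  have E'lim: "?E' \<longlonglongrightarrow> 2 * (R + decay_const * weight_sq M ?\<sigma> x)"
  proof -
    have "?E' \<longlonglongrightarrow> 2 * Re (l2_inner M f (\<lambda>y. ?c\<sigma> y * x y)) + \<kappa>\<^sup>2 * N * (l2_norm M (\<lambda>y. complex_of_real (s y) * x y))\<^sup>2"
      by (intro tendsto_intros lim1 lim3)
    then show ?thesis unfolding snorm R_def decay_const_def by (simp add: algebra_simps)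
  qed
  have EE': "E n \<le> ?E' n" for n unfolding E_def by (rule WE(2))
  have "0 \<le> 2 * (R + decay_const * weight_sq M ?\<sigma> x)"
    by (rule LIMSEQ_le_const[OF E'lim]) (use Epos EE' order_trans in blast)
  then show "0 \<le> R + decay_const * weight_sq M ?\<sigma> x" by simp
  have k0: "0 \<le> ?k" using kappa_nonneg N_nonneg \<delta> by simp
  have "cmod (l2_inner M f ?\<phi>) \<le> ?k / 2 * (2 * (R + decay_const * weight_sq M ?\<sigma> x) + mass_const)"
  proof (rule LIMSEQ_le[OF tendsto_norm[OF lim2] tendsto_mult[OF tendsto_const tendsto_add[OF E'lim tendsto_const]]], intro exI allI impI)
    fix n
    have "cmod (elliptic_form \<Omega> a (U n) ?\<phi>) \<le> ?k / 2 * (E n + mass_const)"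
      unfolding E_def by (rule form_test_weight_bound[OF \<delta> UH WE(1)])
    also have "\<dots> \<le> ?k / 2 * (?E' n + mass_const)" using EE'[of n] k0 by (intro mult_left_mono) auto
    finally show "cmod (elliptic_form \<Omega> a (U n) ?\<phi>) \<le> ?k / 2 * (?E' n + mass_const)" .
  qed
  then show "cmod (l2_inner M f ?\<phi>) \<le> ?k * (R + decay_const * weight_sq M ?\<sigma> x + mass_const / 2)"
    by (simp add: algebra_simps)
qed

end

section \<open>Passage to the limit in the weights\<close>

context elliptic
begin

abbreviation scale :: "nat \<Rightarrow> real" where "scale n \<equiv> inverse (real (Suc n))"

lemma scale_bounds: "0 < scale n" "scale n \<le> 1"
  by (auto simp: inverse_le_1_iff)

lemma scale_tendsto: "scale \<longlonglongrightarrow> 0"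
  by (rule LIMSEQ_inverse_real_of_nat)

lemma test_weight_tendsto: "(\<lambda>n. test_weight (scale n) x) \<longlonglongrightarrow> 1"
proof -
  have "(\<lambda>n. inverse (1 + (scale n)\<^sup>2 * (norm x)\<^sup>2) ^ CARD('d)) \<longlonglongrightarrow> inverse (1 + 0\<^sup>2 * (norm x)\<^sup>2) ^ CARD('d)"
    by (intro tendsto_intros scale_tendsto) simp
  then show ?thesis by (simp only: test_weight_def bracket_def) simp
qed

lemma weights_measurable:
  assumes "0 < \<delta>" "\<delta> \<le> 1"
  shows "test_weight \<delta> \<in> borel_measurable M" "growth_weight \<delta> \<in> borel_measurable M"
  using log_bounded_test_weight[of \<delta>] log_bounded_growth_weight(1)[of \<delta>] assms
  by (auto simp: log_bounded_def intro!: of_real_smooth_measurable)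

lemma growth_integrable:
  assumes "0 < \<delta>" "\<delta> \<le> 1" "v \<in> L2 M"
  shows "integrable M (\<lambda>x. growth_weight \<delta> x * (cmod (v x))\<^sup>2)"
proof (rule Bochner_Integration.integrable_bound)
  show "integrable M (\<lambda>x. inverse (\<delta>\<^sup>2) ^ (2 * CARD('d)) * (cmod (v x))\<^sup>2)"
    by (intro integrable_mult_right L2_square_integrable assms)
  show "(\<lambda>x. growth_weight \<delta> x * (cmod (v x))\<^sup>2) \<in> borel_measurable M"
    by (intro borel_measurable_times weights_measurable borel_measurable_integrable L2_square_integrable assms)
  show "AE x in M. norm (growth_weight \<delta> x * (cmod (v x))\<^sup>2) \<le> norm (inverse (\<delta>\<^sup>2) ^ (2 * CARD('d)) * (cmod (v x))\<^sup>2)"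
  proof (rule AE_I2)
    fix x
    show "norm (growth_weight \<delta> x * (cmod (v x))\<^sup>2) \<le> norm (inverse (\<delta>\<^sup>2) ^ (2 * CARD('d)) * (cmod (v x))\<^sup>2)"
      using growth_weight_nonneg[of \<delta> x] growth_weight_bound[OF assms(1,2), of x]
      by (simp add: abs_mult mult_right_mono)
  qed
qed

text \<open>The test weight times |v| is at most half of \<sigma> |v|^2 + \<omega>^2, with a bound
  on the integral independent of the scale; Fatou's lemma removes the weight.\<close>

lemma integrable_of_growth_bound:
  assumes v: "v \<in> L2 M" and W: "\<And>n. weight_sq M (growth_weight (scale n)) v \<le> W"
  shows "integrable M v"
proof (rule integrableI_bounded)
  show vm: "v \<in> borel_measurable M" by (rule L2_measurable[OF v])
  define C where "C = (W + mass_const) / 2"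
  have fin: "(\<integral>\<^sup>+x. ennreal (test_weight (scale n) x * cmod (v x)) \<partial>M) \<le> ennreal C" for n
  proof -
    let ?h = "\<lambda>x. (growth_weight (scale n) x * (cmod (v x))\<^sup>2 + (test_weight 1 x)\<^sup>2) / 2"
    have h: "integrable M ?h"
      by (intro integrable_divide Bochner_Integration.integrable_add growth_integrable scale_bounds v mass_integrable)
    have "(\<integral>\<^sup>+x. ennreal (test_weight (scale n) x * cmod (v x)) \<partial>M) \<le> (\<integral>\<^sup>+x. ennreal (?h x) \<partial>M)"
    proof (intro nn_integral_mono ennreal_leI)
      fix x
      define s where "s = sqrt (growth_weight (scale n) x) * cmod (v x)"
      have "test_weight (scale n) x * cmod (v x) = s * test_weight 1 x"
        unfolding test_weight_eq[of "scale n" x] s_def by simp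
      moreover have "s\<^sup>2 = growth_weight (scale n) x * (cmod (v x))\<^sup>2"
        using growth_weight_nonneg[of "scale n" x] by (simp add: s_def power_mult_distrib)
      moreover have "2 * s * test_weight 1 x \<le> s\<^sup>2 + (test_weight 1 x)\<^sup>2" by (rule sum_squares_bound)
      ultimately show "test_weight (scale n) x * cmod (v x) \<le> ?h x" by argo
    qed
    also have "\<dots> = ennreal (LINT x|M. ?h x)"
      by (rule nn_integral_eq_integral[OF h]) (simp add: growth_weight_nonneg)
    also have "(LINT x|M. ?h x) = (weight_sq M (growth_weight (scale n)) v + mass_const) / 2"
      unfolding weight_sq_eq mass_const_def
      by (subst integral_divide_zero, subst Bochner_Integration.integral_add[OF growth_integrable[OF scale_bounds v] mass_integrable]) simp
    also have "ennreal \<dots> \<le> ennreal C" unfolding C_def using W[of n] by (intro ennreal_leI) simp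
    finally show ?thesis .
  qed
  have "(\<integral>\<^sup>+x. ennreal (cmod (v x)) \<partial>M) = (\<integral>\<^sup>+x. liminf (\<lambda>n. ennreal (test_weight (scale n) x * cmod (v x))) \<partial>M)"
  proof (rule nn_integral_cong)
    fix x
    have "(\<lambda>n. test_weight (scale n) x * cmod (v x)) \<longlonglongrightarrow> 1 * cmod (v x)"
      by (intro tendsto_intros test_weight_tendsto)
    then have "(\<lambda>n. ennreal (test_weight (scale n) x * cmod (v x))) \<longlonglongrightarrow> ennreal (cmod (v x))"
      by (intro tendsto_ennrealI) simp
    from lim_imp_Liminf[OF _ this]
    show "ennreal (cmod (v x)) = liminf (\<lambda>n. ennreal (test_weight (scale n) x * cmod (v x)))" by simp
  qed
  also have "\<dots> \<le> liminf (\<lambda>n. \<integral>\<^sup>+x. ennreal (test_weight (scale n) x * cmod (v x)) \<partial>M)"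
    by (rule nn_integral_liminf)
       (intro measurable_compose[OF _ measurable_ennreal] borel_measurable_times weights_measurable scale_bounds
         measurable_compose[OF vm borel_measurable_norm])
  also have "\<dots> \<le> ennreal C" by (rule Liminf_le) (use fin in auto)
  also have "\<dots> < \<infinity>" by simp
  finally show "(\<integral>\<^sup>+x. ennreal (norm (v x)) \<partial>M) < \<infinity>" .
qed

text \<open>The test weights are at most 1 and tend to 1, so |v| dominates.\<close>

lemma test_weight_inner_tendsto:
  assumes v: "v \<in> L2 M" "integrable M v"
  shows "(\<lambda>n. l2_inner M v (\<lambda>x. complex_of_real (test_weight (scale n) x))) \<longlonglongrightarrow> l2_inner M v (\<lambda>x. 1)"
  unfolding l2_inner_def
proof (rule integral_dominated_convergence[where w="\<lambda>x. cmod (v x)"])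
  show "(\<lambda>x. v x * cnj 1) \<in> borel_measurable M" using L2_measurable[OF v(1)] by simp
  show "(\<lambda>x. v x * cnj (complex_of_real (test_weight (scale n) x))) \<in> borel_measurable M" for n
    unfolding complex_cnj_complex_of_real
    by (intro borel_measurable_times L2_measurable[OF v(1)] measurable_compose[OF _ borel_measurable_of_real] weights_measurable scale_bounds)
  show "integrable M (\<lambda>x. cmod (v x))" by (rule integrable_norm[OF v(2)])
  show "AE x in M. (\<lambda>n. v x * cnj (complex_of_real (test_weight (scale n) x))) \<longlonglongrightarrow> v x * cnj 1"
  proof (rule AE_I2)
    fix x
    have "(\<lambda>n. v x * complex_of_real (test_weight (scale n) x)) \<longlonglongrightarrow> v x * complex_of_real 1"
      by (intro tendsto_intros test_weight_tendsto)
    then show "(\<lambda>n. v x * cnj (complex_of_real (test_weight (scale n) x))) \<longlonglongrightarrow> v x * cnj 1" by simp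
  qed
  show "AE x in M. norm (v x * cnj (complex_of_real (test_weight (scale n) x))) \<le> cmod (v x)" for n
  proof (rule AE_I2)
    fix x
    show "norm (v x * cnj (complex_of_real (test_weight (scale n) x))) \<le> cmod (v x)"
      using test_weight_bounds[where \<delta>="scale n" and x=x] mult_left_mono[of "test_weight (scale n) x" 1 "cmod (v x)"]
      by (simp add: norm_mult del: of_nat_Suc)
  qed
qed

theorem semigroup_conserves_mass:
  assumes assoc: "associated_semigroup M (H1 \<Omega>) (elliptic_form \<Omega> a) S"
    and t: "0 < t" and u: "u \<in> L2c \<Omega>"
  shows "integrable M (S t u)"
    and "l2_inner M (S t u) (\<lambda>x. 1) = l2_inner M u (\<lambda>x. 1)"
proof -
  interpret S: l2_semigroup M S using assoc by unfold_locales (simp add: associated_semigroup_def)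
  have gen: "semigroup_generator M S = {(x, \<lambda>\<omega>. - f \<omega>) |x f. (x, f) \<in> form_operator M (H1 \<Omega>) (elliptic_form \<Omega> a)}"
    using assoc by (simp add: associated_semigroup_def)
  have uL: "u \<in> L2 M" and K: "compact (ess_support \<Omega> u)" using u by (auto simp: L2c_def)
  have SuL: "S t u \<in> L2 M" using t by (intro S.S_L2 uL) simp
  obtain R where R: "0 < R" "ess_support \<Omega> u \<subseteq> cball 0 R"
    using bounded_subset_ballD[OF compact_imp_bounded[OF K], of 0] ball_subset_cball by (metis subset_trans)
  have u0: "AE x in M. x \<notin> cball 0 R \<longrightarrow> u x = 0"
    using AE_zero_outside_ess_support[of u] by eventually_elim (use R(2) in blast)
  \<comment> \<open>The compact support enters here: on the ball of radius R the growth weights are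
    at most (1 + R^2)^(2d), whatever the scale.\<close>
  define W0 where "W0 = (1 + R\<^sup>2) ^ (2 * CARD('d)) * (l2_norm M u)\<^sup>2"
  have W0: "weight_sq M (growth_weight (scale n)) u \<le> W0" for n
  proof -
    have "weight_sq M (growth_weight (scale n)) u \<le> (LINT x|M. (1 + R\<^sup>2) ^ (2 * CARD('d)) * (cmod (u x))\<^sup>2)"
      unfolding weight_sq_eq
    proof (rule integral_mono_AE[OF growth_integrable[OF scale_bounds uL]])
      show "integrable M (\<lambda>x. (1 + R\<^sup>2) ^ (2 * CARD('d)) * (cmod (u x))\<^sup>2)"
        by (intro integrable_mult_right L2_square_integrable uL)
      show "AE x in M. growth_weight (scale n) x * (cmod (u x))\<^sup>2 \<le> (1 + R\<^sup>2) ^ (2 * CARD('d)) * (cmod (u x))\<^sup>2"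
        using u0
      proof eventually_elim
        fix x assume x: "x \<notin> cball 0 R \<longrightarrow> u x = 0"
        show "growth_weight (scale n) x * (cmod (u x))\<^sup>2 \<le> (1 + R\<^sup>2) ^ (2 * CARD('d)) * (cmod (u x))\<^sup>2"
        proof (cases "x \<in> cball 0 R")
          case True
          then have "(norm x)\<^sup>2 \<le> R\<^sup>2" by (intro power_mono) auto
          then have b1: "bracket 1 x \<le> 1 + R\<^sup>2" by (simp add: bracket_def)
          have "bracket 1 x * inverse (bracket (scale n) x) \<le> bracket 1 x * 1"
            using bracket_ge_1[of "scale n" x] bracket_pos[of 1 x]
            by (intro mult_left_mono) (auto simp: inverse_le_1_iff)
          then have "bracket 1 x * inverse (bracket (scale n) x) \<le> 1 + R\<^sup>2" using b1 by linarith
          then have "growth_weight (scale n) x \<le> (1 + R\<^sup>2) ^ (2 * CARD('d))"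
            unfolding growth_weight_def using bracket_pos[of 1 x] bracket_pos[of "scale n" x]
            by (intro power_mono) (auto intro!: mult_nonneg_nonneg simp del: of_nat_Suc)
          then show ?thesis by (intro mult_right_mono) auto
        next
          case False
          then show ?thesis using x by simp
        qed
      qed
    qed
    then show ?thesis unfolding W0_def l2_norm_sq by simp
  qed
  obtain un gn where dense: "\<And>n::nat. (un n, gn n) \<in> semigroup_generator M S" "l2_tendsto M un u sequentially"
    using F.generator_domain_dense[OF assoc uL] by blast
  let ?\<phi> = "\<lambda>n x. complex_of_real (test_weight (scale n) x)"
  \<comment> \<open>The only factor depending on the scale in the final estimate, and it tends to
    0.\<close>
  define k where "k n = \<kappa> * sqrt N * (real CARD('d) * scale n)" for n
  define E where "E = exp (2 * decay_const * t)"
  have k0: "0 \<le> k n" for n unfolding k_def using kappa_nonneg N_nonneg scale_bounds(1)[of n] by simp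
  have est: "weight_sq M (growth_weight (scale n)) (S t u) \<le> E * weight_sq M (growth_weight (scale n)) u"
    "cmod (l2_inner M (S t u) (?\<phi> n) - l2_inner M u (?\<phi> n))
      \<le> k n * (weight_sq M (growth_weight (scale n)) u / 2
          + t * (decay_const * (E * weight_sq M (growth_weight (scale n)) u) + mass_const / 2))" for n
  proof -
    have sig: "0 \<le> growth_weight (scale n) x \<and> growth_weight (scale n) x \<le> inverse ((scale n)\<^sup>2) ^ (2 * CARD('d))" for x
      using growth_weight_nonneg growth_weight_bound[OF scale_bounds] by blast
    have phi: "?\<phi> n \<in> L2 M" by (rule H1_L2[OF test_weight_H1(1)[OF scale_bounds]])
    have w: "0 \<le> mass_const / 2" using mass_const_nonneg by simp
    \<comment> \<open>The generator is -A, so the estimates for the form operator enter with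
      reversed sign.\<close>
    have minus: "l2_inner M (\<lambda>\<omega>. - f \<omega>) v = - l2_inner M f v" for f v by (simp add: l2_inner_def)
    have dis: "Re (l2_inner M g (\<lambda>y. complex_of_real (growth_weight (scale n) y) * x y)) \<le> decay_const * weight_sq M (growth_weight (scale n)) x"
      and tb: "cmod (l2_inner M g (?\<phi> n)) \<le> k n * (decay_const * weight_sq M (growth_weight (scale n)) x + mass_const / 2
        - Re (l2_inner M g (\<lambda>y. complex_of_real (growth_weight (scale n) y) * x y)))"
      if xg: "(x, g) \<in> semigroup_generator M S" for x g
    proof -
      obtain f where g: "g = (\<lambda>\<omega>. - f \<omega>)" and xf: "(x, f) \<in> form_operator M (H1 \<Omega>) (elliptic_form \<Omega> a)"
        using xg unfolding gen by auto
      note fw = form_operator_weighted[OF scale_bounds[of n] xf]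
      show "Re (l2_inner M g (\<lambda>y. complex_of_real (growth_weight (scale n) y) * x y)) \<le> decay_const * weight_sq M (growth_weight (scale n)) x"
        using fw(1) unfolding g minus by simp
      show "cmod (l2_inner M g (?\<phi> n)) \<le> k n * (decay_const * weight_sq M (growth_weight (scale n)) x + mass_const / 2
        - Re (l2_inner M g (\<lambda>y. complex_of_real (growth_weight (scale n) y) * x y)))"
        using fw(2) unfolding g minus k_def by (simp add: algebra_simps)
    qed
    note we = S.weighted_estimate[OF weights_measurable(2)[OF scale_bounds] sig phi decay_const_nonneg k0 w dis tb uL less_imp_le[OF t] dense]
    show "weight_sq M (growth_weight (scale n)) (S t u) \<le> E * weight_sq M (growth_weight (scale n)) u"
      unfolding E_def by (rule we(1))
    show "cmod (l2_inner M (S t u) (?\<phi> n) - l2_inner M u (?\<phi> n))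
      \<le> k n * (weight_sq M (growth_weight (scale n)) u / 2
          + t * (decay_const * (E * weight_sq M (growth_weight (scale n)) u) + mass_const / 2))"
      unfolding E_def by (rule we(2))
  qed
  have E0: "0 \<le> E" by (simp add: E_def)
  have EW: "E * weight_sq M (growth_weight (scale n)) u \<le> E * W0" for n by (intro mult_left_mono W0 E0)
  show Sint: "integrable M (S t u)"
    by (rule integrable_of_growth_bound[OF SuL order_trans[OF est(1) EW]])
  have uint: "integrable M u"
    by (rule integrable_of_growth_bound[OF uL W0])
  define C where "C = W0 / 2 + t * (decay_const * (E * W0) + mass_const / 2)"
  have bound: "cmod (l2_inner M (S t u) (?\<phi> n) - l2_inner M u (?\<phi> n)) \<le> k n * C" for n
  proof -
    have "decay_const * (E * weight_sq M (growth_weight (scale n)) u) \<le> decay_const * (E * W0)"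
      by (intro mult_left_mono EW decay_const_nonneg)
    then have "t * (decay_const * (E * weight_sq M (growth_weight (scale n)) u) + mass_const / 2) \<le> t * (decay_const * (E * W0) + mass_const / 2)"
      using t by (intro mult_left_mono) auto
    then have "weight_sq M (growth_weight (scale n)) u / 2 + t * (decay_const * (E * weight_sq M (growth_weight (scale n)) u) + mass_const / 2) \<le> C"
      unfolding C_def using W0[of n] by linarith
    then show ?thesis using est(2)[of n] mult_left_mono[OF _ k0[of n]] order_trans by blast
  qed
  have lim: "(\<lambda>n. cmod (l2_inner M (S t u) (?\<phi> n) - l2_inner M u (?\<phi> n))) \<longlonglongrightarrow> cmod (l2_inner M (S t u) (\<lambda>x. 1) - l2_inner M u (\<lambda>x. 1))"
    by (intro tendsto_intros test_weight_inner_tendsto SuL uL Sint uint)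
  have "(\<lambda>n. \<kappa> * sqrt N * (real CARD('d) * scale n) * C) \<longlonglongrightarrow> \<kappa> * sqrt N * (real CARD('d) * 0) * C"
    by (intro tendsto_intros scale_tendsto)
  then have klim: "(\<lambda>n. k n * C) \<longlonglongrightarrow> 0" unfolding k_def by simp
  have "cmod (l2_inner M (S t u) (\<lambda>x. 1) - l2_inner M u (\<lambda>x. 1)) \<le> 0"
    by (rule LIMSEQ_le[OF lim klim]) (use bound in blast)
  then show "l2_inner M (S t u) (\<lambda>x. 1) = l2_inner M u (\<lambda>x. 1)" by simp
qed

end

text \<open>Relaxed form and semigroup enter through their defining properties rather than as
  constructed objects. Integrability of S t u is asserted explicitly, because the integral of a
  non-integrable function is 0 by convention and the equality alone would not mean conservation of
  mass.\<close>

theorem proposition4p8: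
  fixes \<Omega> :: "(real^'d::finite) set"
    and a :: "'d \<Rightarrow> 'd \<Rightarrow> real^'d \<Rightarrow> complex"
    and \<theta> :: real
  assumes "open \<Omega>"
    and "\<And>i j. a i j \<in> L_infty (lebesgue_on \<Omega>)"
    and "0 \<le> \<theta>" and "\<theta> < pi / 2"
    and "\<And>\<xi> :: complex^'d. AE x in lebesgue_on \<Omega>.
           (\<Sum>i\<in>UNIV. \<Sum>j\<in>UNIV. a i j x * \<xi> $ i * cnj (\<xi> $ j)) \<in> sector \<theta>"
  shows
    "(\<forall>Db b. relaxed_form (lebesgue_on \<Omega>) (H1 \<Omega>) (elliptic_form \<Omega> a) Db b \<longrightarrow>
        (\<forall>u\<in>Db. \<forall>v\<in>Db.
           compact (ess_support \<Omega> u) \<and> compact (ess_support \<Omega> v) \<and>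
           constant_near \<Omega> v (ess_support \<Omega> u) \<longrightarrow> b u v = 0)) \<and>
     (\<forall>S. associated_semigroup (lebesgue_on \<Omega>) (H1 \<Omega>) (elliptic_form \<Omega> a) S \<longrightarrow>
        (\<forall>t>0. \<forall>u\<in>L2c \<Omega>.
           integrable (lebesgue_on \<Omega>) (S t u) \<and>
           l2_inner (lebesgue_on \<Omega>) (S t u) (\<lambda>x. 1) = l2_inner (lebesgue_on \<Omega>) u (\<lambda>x. 1)))"
proof -
  interpret elliptic \<Omega> a \<theta>
    by unfold_locales (use assms in auto)
  show ?thesis
    by (intro conjI allI impI ballI; (elim conjE)?; (rule relaxed_form_local semigroup_conserves_mass; assumption))
qed

end
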